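(* Let $(M,\otimes,I)$ be a monoidal model category and let $M^c$ be the coloured category of cofibrant objects of $M$, with the weak equivalences as coloured arrows. Then $M^c$ is naturally a fair monoidal coloured category (i.e. a fair monoid in $\mathbf{CCat}$), with semi-monoid structure given by $\otimes$. The weak units are the weak equivalences $Z\stackrel{\sim}{\to}I$ with $Z$ cofibrant; that is, the coloured category $U$ of weak units has as objects these weak equivalences and as arrows the commutative triangles $Z'\stackrel{\sim}{\to}Z\stackrel{\sim}{\to}I$ over $I$, and the map $U\to M^c$ sends $Z\stackrel{\sim}{\to}I$ to $Z$.
   Context: A monoidal model category (Hovey) is a model category $M$ with a monoidal structure $(\otimes,I)$ that is compatible with the model structure; in particular tensor products of cofibrant objects are cofibrant, and (i) $\otimes$ preserves weak equivalences between cofibrant objects; (ii) for every weak equivalence $Z\stackrel{\sim}{\to}I$ with $Z$ cofibrant and every cofibrant $X$, the composite $Z\otimes X\to I\otimes X\to X$ is a weak equivalence (and symmetrically on the other side). The unit $I$ is not assumed cofibrant. The associativity constraints of $\otimes$ are suppressed, i.e. $\otimes$ is treated as strictly associative. A coloured category is a category $C$ with a subcategory $W$ containing all objects, whose arrows are called coloured; $\mathbf{CCat}$ is the category of coloured categories and colour-preserving functors. $\mathbf{CCat}$ is itself coloured as follows: a colour-preserving functor $F:(C,W)\to(C',W')$ is an equifunctor (coloured arrow) if its Dwyer–Kan simplicial localisation $LF:LC\to LC'$ is an equivalence of simplicial categories, i.e. $\pi_0LF:\pi_0LC\to\pi_0LC'$ is an equivalence of categories and each $LC(x,y)\to LC'(Fx,Fy)$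 is a weak equivalence of simplicial sets. An object of $\mathbf{CCat}$ is contractible if its functor to the terminal coloured category is an equifunctor. A fair monoid in $\mathbf{CCat}$ consists of semi-monoids (strictly associative multiplication, no unit required) $A$ and $U$ in $(\mathbf{CCat},\times)$ and a semi-monoid homomorphism $U\to A$ such that $U$ is contractible and the induced multiplication maps $U\times A\to A\leftarrow A\times U$ are equifunctors. $U$ is called the coloured category of weak units. In the claim, $A=M^c$, all arrows of $U$ are coloured, and the multiplication of $U$ sends $Z\to I$ and $Z'\to I$ to the composite $Z\otimes Z'\to I\otimes I\to I$. *)

theory Defs
  imports "HOL-Analysis.Analysis" "HOL-Homology.Simplices"
begin

section \<open>Categories\<close>

text \<open>Objects and arrows are elements of carrier sets; only the values of the operations on the
  carriers are meaningful. Composition is in the order of functions: \<open>g \<cdot>\<^bsub>C\<^esub> f\<close> is \<open>g\<close> after \<open>f\<close>.\<close>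

record ('o, 'm) cat =
  obs :: "'o set"
  arrs :: "'m set"
  src :: "'m \<Rightarrow> 'o"
  tgt :: "'m \<Rightarrow> 'o"
  idt :: "'o \<Rightarrow> 'm"
  cmp :: "'m \<Rightarrow> 'm \<Rightarrow> 'm"  (infixl "\<cdot>\<index>" 70)

definition homs :: "('o, 'm, 'z) cat_scheme \<Rightarrow> 'o \<Rightarrow> 'o \<Rightarrow> 'm set" where
  "homs C x y = {f \<in> arrs C. src C f = x \<and> tgt C f = y}"

definition category :: "('o, 'm, 'z) cat_scheme \<Rightarrow> bool" where
  "category C \<longleftrightarrow>
     (\<forall>f\<in>arrs C. src C f \<in> obs C \<and> tgt C f \<in> obs C) \<and>
     (\<forall>x\<in>obs C. idt C x \<in> homs C x x) \<and>
     (\<forall>x y z. \<forall>f\<in>homs C x y. \<forall>g\<in>homs C y z. g \<cdot>\<^bsub>C\<^esub> f \<in> homs C x z) \<and>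
     (\<forall>x y. \<forall>f\<in>homs C x y. f \<cdot>\<^bsub>C\<^esub> idt C x = f \<and> idt C y \<cdot>\<^bsub>C\<^esub> f = f) \<and>
     (\<forall>x y z w. \<forall>f\<in>homs C x y. \<forall>g\<in>homs C y z. \<forall>h\<in>homs C z w.
        h \<cdot>\<^bsub>C\<^esub> (g \<cdot>\<^bsub>C\<^esub> f) = (h \<cdot>\<^bsub>C\<^esub> g) \<cdot>\<^bsub>C\<^esub> f)"

definition wide_subcat :: "('o, 'm, 'z) cat_scheme \<Rightarrow> 'm set \<Rightarrow> bool" where
  "wide_subcat C S \<longleftrightarrow> S \<subseteq> arrs C \<and> (\<forall>x\<in>obs C. idt C x \<in> S) \<and>
     (\<forall>f\<in>S. \<forall>g\<in>S. src C g = tgt C f \<longrightarrow> g \<cdot>\<^bsub>C\<^esub> f \<in> S)"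

definition iso_arr :: "('o, 'm, 'z) cat_scheme \<Rightarrow> 'm \<Rightarrow> bool" where
  "iso_arr C f \<longleftrightarrow> f \<in> arrs C \<and>
     (\<exists>g\<in>homs C (tgt C f) (src C f).
        g \<cdot>\<^bsub>C\<^esub> f = idt C (src C f) \<and> f \<cdot>\<^bsub>C\<^esub> g = idt C (tgt C f))"

definition op_cat :: "('o, 'm, 'z) cat_scheme \<Rightarrow> ('o, 'm) cat" where
  "op_cat C = \<lparr>obs = obs C, arrs = arrs C, src = tgt C, tgt = src C, idt = idt C,
               cmp = (\<lambda>g f. f \<cdot>\<^bsub>C\<^esub> g)\<rparr>"

definition prod_cat ::
    "('o, 'm, 'z) cat_scheme \<Rightarrow> ('p, 'n, 'y) cat_scheme \<Rightarrow> ('o \<times> 'p, 'm \<times> 'n) cat" where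
  "prod_cat C D = \<lparr>obs = obs C \<times> obs D, arrs = arrs C \<times> arrs D,
     src = map_prod (src C) (src D), tgt = map_prod (tgt C) (tgt D),
     idt = map_prod (idt C) (idt D),
     cmp = (\<lambda>(g, g') (f, f'). (g \<cdot>\<^bsub>C\<^esub> f, g' \<cdot>\<^bsub>D\<^esub> f'))\<rparr>"

record ('o, 'm, 'p, 'n) fctr =
  onob :: "'o \<Rightarrow> 'p"
  onar :: "'m \<Rightarrow> 'n"

definition is_functor ::
    "('o, 'm, 'z) cat_scheme \<Rightarrow> ('p, 'n, 'y) cat_scheme \<Rightarrow> ('o, 'm, 'p, 'n) fctr \<Rightarrow> bool" where
  "is_functor C D F \<longleftrightarrow>
     (\<forall>x\<in>obs C. onob F x \<in> obs D \<and> onar F (idt C x) = idt D (onob F x)) \<and>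
     (\<forall>x y. \<forall>f\<in>homs C x y. onar F f \<in> homs D (onob F x) (onob F y)) \<and>
     (\<forall>x y z. \<forall>f\<in>homs C x y. \<forall>g\<in>homs C y z. onar F (g \<cdot>\<^bsub>C\<^esub> f) = onar F g \<cdot>\<^bsub>D\<^esub> onar F f)"

definition id_fctr :: "('o, 'm, 'o, 'm) fctr" where
  "id_fctr = \<lparr>onob = (\<lambda>x. x), onar = (\<lambda>f. f)\<rparr>"

definition comp_fctr ::
    "('p, 'n, 'q, 'l) fctr \<Rightarrow> ('o, 'm, 'p, 'n) fctr \<Rightarrow> ('o, 'm, 'q, 'l) fctr" where
  "comp_fctr G F = \<lparr>onob = onob G \<circ> onob F, onar = onar G \<circ> onar F\<rparr>"

definition prod_fctr ::
    "('o, 'm, 'p, 'n) fctr \<Rightarrow> ('o', 'm', 'p', 'n') fctr \<Rightarrow>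
     ('o \<times> 'o', 'm \<times> 'm', 'p \<times> 'p', 'n \<times> 'n') fctr" where
  "prod_fctr F G = \<lparr>onob = map_prod (onob F) (onob G), onar = map_prod (onar F) (onar G)\<rparr>"

definition nat_trans ::
    "('o, 'm, 'z) cat_scheme \<Rightarrow> ('p, 'n, 'y) cat_scheme \<Rightarrow>
     ('o, 'm, 'p, 'n) fctr \<Rightarrow> ('o, 'm, 'p, 'n) fctr \<Rightarrow> ('o \<Rightarrow> 'n) \<Rightarrow> bool" where
  "nat_trans C D F G \<eta> \<longleftrightarrow>
     (\<forall>x\<in>obs C. \<eta> x \<in> homs D (onob F x) (onob G x)) \<and>
     (\<forall>x y. \<forall>f\<in>homs C x y. \<eta> y \<cdot>\<^bsub>D\<^esub> onar F f = onar G f \<cdot>\<^bsub>D\<^esub> \<eta> x)"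

definition nat_iso ::
    "('o, 'm, 'z) cat_scheme \<Rightarrow> ('p, 'n, 'y) cat_scheme \<Rightarrow>
     ('o, 'm, 'p, 'n) fctr \<Rightarrow> ('o, 'm, 'p, 'n) fctr \<Rightarrow> ('o \<Rightarrow> 'n) \<Rightarrow> bool" where
  "nat_iso C D F G \<eta> \<longleftrightarrow> nat_trans C D F G \<eta> \<and> (\<forall>x\<in>obs C. iso_arr D (\<eta> x))"

definition cat_equivalence ::
    "('o, 'm, 'z) cat_scheme \<Rightarrow> ('p, 'n, 'y) cat_scheme \<Rightarrow> ('o, 'm, 'p, 'n) fctr \<Rightarrow> bool" where
  "cat_equivalence C D F \<longleftrightarrow> is_functor C D F \<and>
     (\<exists>G \<eta> \<epsilon>. is_functor D C G \<and>
        nat_iso C C id_fctr (comp_fctr G F) \<eta> \<and> nat_iso D D (comp_fctr F G) id_fctr \<epsilon>)"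


section \<open>Limits and colimits\<close>

definition const_fctr :: "('p, 'n, 'y) cat_scheme \<Rightarrow> 'p \<Rightarrow> ('o, 'm, 'p, 'n) fctr" where
  "const_fctr C x = \<lparr>onob = (\<lambda>_. x), onar = (\<lambda>_. idt C x)\<rparr>"

definition is_cone ::
    "('s, 't, 'z) cat_scheme \<Rightarrow> ('o, 'm, 'y) cat_scheme \<Rightarrow> ('s, 't, 'o, 'm) fctr \<Rightarrow>
     'o \<Rightarrow> ('s \<Rightarrow> 'm) \<Rightarrow> bool" where
  "is_cone J C D x \<pi> \<longleftrightarrow> x \<in> obs C \<and> nat_trans J C (const_fctr C x) D \<pi>"

definition is_limit ::
    "('s, 't, 'z) cat_scheme \<Rightarrow> ('o, 'm, 'y) cat_scheme \<Rightarrow> ('s, 't, 'o, 'm) fctr \<Rightarrow>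
     'o \<Rightarrow> ('s \<Rightarrow> 'm) \<Rightarrow> bool" where
  "is_limit J C D x \<pi> \<longleftrightarrow> is_cone J C D x \<pi> \<and>
     (\<forall>y \<rho>. is_cone J C D y \<rho> \<longrightarrow>
        (\<exists>!h. h \<in> homs C y x \<and> (\<forall>j\<in>obs J. \<pi> j \<cdot>\<^bsub>C\<^esub> h = \<rho> j)))"

text \<open>The type \<open>'s\<close> bounds the size of the index categories and so plays the role of
  the universe of small sets. It is a parameter independent of the types of objects and arrows:
  a category with all limits of the size of its own set of arrows is a preorder.\<close>

definition has_limits :: "'s itself \<Rightarrow> ('o, 'm, 'z) cat_scheme \<Rightarrow> bool" where
  "has_limits _ C \<longleftrightarrow>
     (\<forall>(J :: ('s, 's) cat) D. category J \<and> is_functor J C D \<longrightarrow> (\<exists>x \<pi>. is_limit J C D x \<pi>))"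

text \<open>A functor \<open>J \<rightarrow> C\<close> is the same pair of maps as a functor from the opposite of \<open>J\<close> to the
  opposite of \<open>C\<close>, and a colimit of the former is a limit of the latter.\<close>

definition has_colimits :: "'s itself \<Rightarrow> ('o, 'm, 'z) cat_scheme \<Rightarrow> bool" where
  "has_colimits S C \<longleftrightarrow> has_limits S (op_cat C)"

definition is_initial :: "('o, 'm, 'z) cat_scheme \<Rightarrow> 'o \<Rightarrow> bool" where
  "is_initial C z \<longleftrightarrow> z \<in> obs C \<and> (\<forall>x\<in>obs C. \<exists>!f. f \<in> homs C z x)"

text \<open>\<open>p\<close> with \<open>i : b \<rightarrow> p\<close> and \<open>j : c \<rightarrow> p\<close> is a pushout of \<open>f : a \<rightarrow> b\<close> and \<open>g : a \<rightarrow> c\<close>.\<close>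

definition is_pushout ::
    "('o, 'm, 'z) cat_scheme \<Rightarrow> 'm \<Rightarrow> 'm \<Rightarrow> 'o \<Rightarrow> 'm \<Rightarrow> 'm \<Rightarrow> bool" where
  "is_pushout C f g p i j \<longleftrightarrow>
     f \<in> arrs C \<and> g \<in> arrs C \<and> src C f = src C g \<and>
     i \<in> homs C (tgt C f) p \<and> j \<in> homs C (tgt C g) p \<and> i \<cdot>\<^bsub>C\<^esub> f = j \<cdot>\<^bsub>C\<^esub> g \<and>
     (\<forall>q. \<forall>u\<in>homs C (tgt C f) q. \<forall>v\<in>homs C (tgt C g) q. u \<cdot>\<^bsub>C\<^esub> f = v \<cdot>\<^bsub>C\<^esub> g \<longrightarrow>
        (\<exists>!h. h \<in> homs C p q \<and> h \<cdot>\<^bsub>C\<^esub> i = u \<and> h \<cdot>\<^bsub>C\<^esub> j = v))"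


section \<open>Model categories\<close>

record ('o, 'm) mcat = "('o, 'm) cat" +
  weq :: "'m set"
  cof :: "'m set"
  fib :: "'m set"

definition is_square :: "('o, 'm, 'z) cat_scheme \<Rightarrow> 'm \<Rightarrow> 'm \<Rightarrow> 'm \<Rightarrow> 'm \<Rightarrow> bool" where
  "is_square C f g u v \<longleftrightarrow> f \<in> arrs C \<and> g \<in> arrs C \<and>
     u \<in> homs C (src C f) (src C g) \<and> v \<in> homs C (tgt C f) (tgt C g) \<and>
     g \<cdot>\<^bsub>C\<^esub> u = v \<cdot>\<^bsub>C\<^esub> f"

definition is_retract :: "('o, 'm, 'z) cat_scheme \<Rightarrow> 'm \<Rightarrow> 'm \<Rightarrow> bool" where
  "is_retract C f g \<longleftrightarrow>
     (\<exists>u v r s. is_square C f g u v \<and> is_square C g f r s \<and>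
        r \<cdot>\<^bsub>C\<^esub> u = idt C (src C f) \<and> s \<cdot>\<^bsub>C\<^esub> v = idt C (tgt C f))"

definition has_llp :: "('o, 'm, 'z) cat_scheme \<Rightarrow> 'm \<Rightarrow> 'm \<Rightarrow> bool" where
  "has_llp C i p \<longleftrightarrow>
     (\<forall>u v. is_square C i p u v \<longrightarrow>
        (\<exists>h\<in>homs C (tgt C i) (src C p). h \<cdot>\<^bsub>C\<^esub> i = u \<and> p \<cdot>\<^bsub>C\<^esub> h = v))"

text \<open>A functorial factorisation \<open>f = \<beta> f \<circ> \<alpha> f\<close> with \<open>\<alpha> f \<in> L\<close> and \<open>\<beta> f \<in> R\<close>; a square
  \<open>(u, v) : f \<rightarrow> g\<close> is sent to the arrow \<open>\<theta> f g u v\<close> between the middle objects.\<close>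

definition has_functorial_factorisation ::
    "('o, 'm, 'z) cat_scheme \<Rightarrow> 'm set \<Rightarrow> 'm set \<Rightarrow> bool" where
  "has_functorial_factorisation C L R \<longleftrightarrow>
     (\<exists>\<alpha> \<beta> \<theta>.
        (\<forall>f\<in>arrs C. \<alpha> f \<in> L \<and> \<beta> f \<in> R \<and> src C (\<alpha> f) = src C f \<and> tgt C (\<beta> f) = tgt C f \<and>
           tgt C (\<alpha> f) = src C (\<beta> f) \<and> \<beta> f \<cdot>\<^bsub>C\<^esub> \<alpha> f = f) \<and>
        (\<forall>f g u v. is_square C f g u v \<longrightarrow>
           is_square C (\<alpha> f) (\<alpha> g) u (\<theta> f g u v) \<and> is_square C (\<beta> f) (\<beta> g) (\<theta> f g u v) v) \<and>
        (\<forall>f\<in>arrs C. \<theta> f f (idt C (src C f)) (idt C (tgt C f)) = idt C (tgt C (\<alpha> f))) \<and>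
        (\<forall>f g h u v u' v'. is_square C f g u v \<and> is_square C g h u' v' \<longrightarrow>
           \<theta> f h (u' \<cdot>\<^bsub>C\<^esub> u) (v' \<cdot>\<^bsub>C\<^esub> v) = \<theta> g h u' v' \<cdot>\<^bsub>C\<^esub> \<theta> f g u v))"

text \<open>Model categories in the sense of Hovey, ``Model categories'', Definitions 1.1.3 and 1.1.4.\<close>

definition model_category :: "'s itself \<Rightarrow> ('o, 'm, 'z) mcat_scheme \<Rightarrow> bool" where
  "model_category S M \<longleftrightarrow>
     category M \<and> has_limits S M \<and> has_colimits S M \<and>
     wide_subcat M (weq M) \<and> wide_subcat M (cof M) \<and> wide_subcat M (fib M) \<and>
     (\<forall>f\<in>arrs M. \<forall>g\<in>arrs M. src M g = tgt M f \<longrightarrow>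
        (f \<in> weq M \<and> g \<in> weq M \<longrightarrow> g \<cdot>\<^bsub>M\<^esub> f \<in> weq M) \<and>
        (f \<in> weq M \<and> g \<cdot>\<^bsub>M\<^esub> f \<in> weq M \<longrightarrow> g \<in> weq M) \<and>
        (g \<in> weq M \<and> g \<cdot>\<^bsub>M\<^esub> f \<in> weq M \<longrightarrow> f \<in> weq M)) \<and>
     (\<forall>f g. is_retract M f g \<longrightarrow>
        (g \<in> weq M \<longrightarrow> f \<in> weq M) \<and> (g \<in> cof M \<longrightarrow> f \<in> cof M) \<and> (g \<in> fib M \<longrightarrow> f \<in> fib M)) \<and>
     (\<forall>i\<in>cof M \<inter> weq M. \<forall>p\<in>fib M. has_llp M i p) \<and>
     (\<forall>i\<in>cof M. \<forall>p\<in>fib M \<inter> weq M. has_llp M i p) \<and>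
     has_functorial_factorisation M (cof M) (fib M \<inter> weq M) \<and>
     has_functorial_factorisation M (cof M \<inter> weq M) (fib M)"

definition cofibrant :: "('o, 'm, 'z) mcat_scheme \<Rightarrow> 'o \<Rightarrow> bool" where
  "cofibrant M x \<longleftrightarrow> (\<exists>z. is_initial M z \<and> (\<exists>f\<in>homs M z x. f \<in> cof M))"


section \<open>Monoidal model categories\<close>

text \<open>The tensor product is strictly associative; the unit constraints
  \<open>lun x : I \<otimes> x \<rightarrow> x\<close> and \<open>run x : x \<otimes> I \<rightarrow> x\<close> are natural isomorphisms, not identities.\<close>

record ('o, 'm) mmcat = "('o, 'm) mcat" +
  ten :: "('o \<times> 'o, 'm \<times> 'm, 'o, 'm) fctr"
  unt :: "'o"
  lun :: "'o \<Rightarrow> 'm"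
  run :: "'o \<Rightarrow> 'm"

abbreviation tob :: "('o, 'm, 'z) mmcat_scheme \<Rightarrow> 'o \<Rightarrow> 'o \<Rightarrow> 'o" where
  "tob M x y \<equiv> onob (ten M) (x, y)"

abbreviation tar :: "('o, 'm, 'z) mmcat_scheme \<Rightarrow> 'm \<Rightarrow> 'm \<Rightarrow> 'm" where
  "tar M f g \<equiv> onar (ten M) (f, g)"

definition strictly_associative ::
    "('o, 'm, 'z) cat_scheme \<Rightarrow> ('o \<times> 'o, 'm \<times> 'm, 'o, 'm) fctr \<Rightarrow> bool" where
  "strictly_associative C T \<longleftrightarrow>
     (\<forall>x\<in>obs C. \<forall>y\<in>obs C. \<forall>z\<in>obs C. onob T (onob T (x, y), z) = onob T (x, onob T (y, z))) \<and>
     (\<forall>f\<in>arrs C. \<forall>g\<in>arrs C. \<forall>h\<in>arrs C. onar T (onar T (f, g), h) = onar T (f, onar T (g, h)))"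

definition monoidal_category :: "('o, 'm, 'z) mmcat_scheme \<Rightarrow> bool" where
  "monoidal_category M \<longleftrightarrow>
     category M \<and> is_functor (prod_cat M M) M (ten M) \<and> strictly_associative M (ten M) \<and>
     unt M \<in> obs M \<and>
     nat_iso M M \<lparr>onob = tob M (unt M), onar = tar M (idt M (unt M))\<rparr> id_fctr (lun M) \<and>
     nat_iso M M \<lparr>onob = (\<lambda>x. tob M x (unt M)), onar = (\<lambda>f. tar M f (idt M (unt M)))\<rparr>
       id_fctr (run M) \<and>
     (\<forall>x\<in>obs M. \<forall>y\<in>obs M. tar M (run M x) (idt M y) = tar M (idt M x) (lun M y))"

text \<open>Closedness: tensoring with a fixed object, on either side, has a right adjoint
  (expressed by universal arrows).\<close>

definition closed_monoidal :: "('o, 'm, 'z) mmcat_scheme \<Rightarrow> bool" where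
  "closed_monoidal M \<longleftrightarrow> monoidal_category M \<and>
     (\<forall>x\<in>obs M. \<forall>z\<in>obs M.
        (\<exists>e\<in>obs M. \<exists>ev\<in>homs M (tob M e x) z. \<forall>y\<in>obs M. \<forall>f\<in>homs M (tob M y x) z.
           \<exists>!g. g \<in> homs M y e \<and> ev \<cdot>\<^bsub>M\<^esub> tar M g (idt M x) = f) \<and>
        (\<exists>e\<in>obs M. \<exists>ev\<in>homs M (tob M x e) z. \<forall>y\<in>obs M. \<forall>f\<in>homs M (tob M x y) z.
           \<exists>!g. g \<in> homs M y e \<and> ev \<cdot>\<^bsub>M\<^esub> tar M (idt M x) g = f))"

text \<open>Given \<open>f : a \<rightarrow> b\<close> and \<open>g : c \<rightarrow> d\<close>, an arrow \<open>h\<close> is a pushout product of \<open>f\<close> and \<open>g\<close> if it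
  is the induced arrow from a pushout of \<open>a \<otimes> d \<leftarrow> a \<otimes> c \<rightarrow> b \<otimes> c\<close> to \<open>b \<otimes> d\<close>.\<close>

definition is_pushout_product ::
    "('o, 'm, 'z) mmcat_scheme \<Rightarrow> 'm \<Rightarrow> 'm \<Rightarrow> 'm \<Rightarrow> bool" where
  "is_pushout_product M f g h \<longleftrightarrow>
     (\<exists>p i j. is_pushout M (tar M (idt M (src M f)) g) (tar M f (idt M (src M g))) p i j \<and>
        h \<in> homs M p (tob M (tgt M f) (tgt M g)) \<and>
        h \<cdot>\<^bsub>M\<^esub> i = tar M f (idt M (tgt M g)) \<and>
        h \<cdot>\<^bsub>M\<^esub> j = tar M (idt M (tgt M f)) g)"

text \<open>Hovey, ``Model categories'', Definition 4.2.6, with the unit axiom stated for every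
  cofibrant object weakly equivalent to the unit.\<close>

definition monoidal_model_category :: "'s itself \<Rightarrow> ('o, 'm, 'z) mmcat_scheme \<Rightarrow> bool" where
  "monoidal_model_category S M \<longleftrightarrow>
     model_category S M \<and> closed_monoidal M \<and>
     (\<forall>f\<in>cof M. \<forall>g\<in>cof M. \<forall>h. is_pushout_product M f g h \<longrightarrow>
        h \<in> cof M \<and> (f \<in> weq M \<or> g \<in> weq M \<longrightarrow> h \<in> weq M)) \<and>
     (\<forall>q\<in>weq M. \<forall>x. cofibrant M (src M q) \<and> tgt M q = unt M \<and> cofibrant M x \<longrightarrow>
        lun M x \<cdot>\<^bsub>M\<^esub> tar M q (idt M x) \<in> weq M \<and>
        run M x \<cdot>\<^bsub>M\<^esub> tar M (idt M x) q \<in> weq M)"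


section \<open>Coloured categories\<close>

record ('o, 'm) ccat = "('o, 'm) cat" +
  col :: "'m set"

definition coloured_category :: "('o, 'm, 'z) ccat_scheme \<Rightarrow> bool" where
  "coloured_category C \<longleftrightarrow> category C \<and> wide_subcat C (col C)"

definition coloured_functor ::
    "('o, 'm, 'z) ccat_scheme \<Rightarrow> ('p, 'n, 'y) ccat_scheme \<Rightarrow> ('o, 'm, 'p, 'n) fctr \<Rightarrow> bool" where
  "coloured_functor C D F \<longleftrightarrow> is_functor C D F \<and> (\<forall>f\<in>col C. onar F f \<in> col D)"

definition prod_ccat ::
    "('o, 'm) ccat \<Rightarrow> ('p, 'n) ccat \<Rightarrow> ('o \<times> 'p, 'm \<times> 'n) ccat" where
  "prod_ccat C D = cat.extend (prod_cat C D) (ccat.fields (col C \<times> col D))"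

definition terminal_ccat :: "(unit, unit) ccat" where
  "terminal_ccat = \<lparr>obs = {()}, arrs = {()}, src = (\<lambda>_. ()), tgt = (\<lambda>_. ()), idt = (\<lambda>_. ()),
                    cmp = (\<lambda>_ _. ()), col = {()}\<rparr>"

definition to_terminal :: "('o, 'm, unit, unit) fctr" where
  "to_terminal = \<lparr>onob = (\<lambda>_. ()), onar = (\<lambda>_. ())\<rparr>"


section \<open>Simplicial sets and their geometric realisation\<close>

text \<open>A simplicial set is given by its sets of simplices and, for every monotone
  \<open>\<alpha> : {0..m} \<rightarrow> {0..n}\<close>, the operator \<open>sact m n \<alpha>\<close> from \<open>n\<close>-simplices to \<open>m\<close>-simplices.\<close>

record 'x sset =
  simps :: "nat \<Rightarrow> 'x set"
  sact :: "nat \<Rightarrow> nat \<Rightarrow> (nat \<Rightarrow> nat) \<Rightarrow> 'x \<Rightarrow> 'x"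

definition simplex_op :: "nat \<Rightarrow> nat \<Rightarrow> (nat \<Rightarrow> nat) \<Rightarrow> bool" where
  "simplex_op m n \<alpha> \<longleftrightarrow> mono_on {..m} \<alpha> \<and> \<alpha> ` {..m} \<subseteq> {..n}"

definition simplex_push :: "nat \<Rightarrow> (nat \<Rightarrow> nat) \<Rightarrow> (nat \<Rightarrow> real) \<Rightarrow> nat \<Rightarrow> real" where
  "simplex_push m \<alpha> t = (\<lambda>j. \<Sum>i | i \<le> m \<and> \<alpha> i = j. t i)"

definition quotient_topology :: "'a topology \<Rightarrow> ('a \<Rightarrow> 'b) \<Rightarrow> 'b topology" where
  "quotient_topology X q =
     topology (\<lambda>U. U \<subseteq> q ` topspace X \<and> openin X {x \<in> topspace X. q x \<in> U})"

lemma openin_quotient_topology: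
  "openin (quotient_topology X q) U \<longleftrightarrow>
     U \<subseteq> q ` topspace X \<and> openin X {x \<in> topspace X. q x \<in> U}"
proof -
  have int: "{x \<in> topspace X. q x \<in> S \<inter> T} =
      {x \<in> topspace X. q x \<in> S} \<inter> {x \<in> topspace X. q x \<in> T}" for S T
    by auto
  have un: "{x \<in> topspace X. q x \<in> \<Union>\<K>} = (\<Union>K\<in>\<K>. {x \<in> topspace X. q x \<in> K})" for \<K>
    by auto
  have "istopology (\<lambda>U. U \<subseteq> q ` topspace X \<and> openin X {x \<in> topspace X. q x \<in> U})"
    unfolding istopology_def int un by blast
  then show ?thesis
    by (simp add: quotient_topology_def)
qed

lemma topspace_quotient_topology: "topspace (quotient_topology X q) = q ` topspace X"
proof (rule antisym)
  show "topspace (quotient_topology X q) \<subseteq> q ` topspace X"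
    using openin_quotient_topology openin_topspace by fastforce
  have "{x \<in> topspace X. q x \<in> q ` topspace X} = topspace X"
    by auto
  then have "openin (quotient_topology X q) (q ` topspace X)"
    by (simp add: openin_quotient_topology)
  then show "q ` topspace X \<subseteq> topspace (quotient_topology X q)"
    by (rule openin_subset)
qed

lemma quotient_map_quotient_topology: "quotient_map X (quotient_topology X q) q"
  by (auto simp: quotient_map_def topspace_quotient_topology openin_quotient_topology)

text \<open>The points \<open>((n, x), t)\<close>, where \<open>t\<close> lies in the standard \<open>n\<close>-simplex indexed by the
  \<open>n\<close>-simplex \<open>x\<close>.\<close>

definition pre_realisation :: "'x sset \<Rightarrow> ((nat \<times> 'x) \<times> (nat \<Rightarrow> real)) topology" where
  "pre_realisation X =
     sum_topology (\<lambda>(n, _). subtopology (powertop_real UNIV) (standard_simplex n))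
       (SIGMA n:UNIV. simps X n)"

definition glue_rel ::
    "'x sset \<Rightarrow> ((nat \<times> 'x) \<times> (nat \<Rightarrow> real)) rel" where
  "glue_rel X = {(((m, sact X m n \<alpha> x), t), ((n, x), simplex_push m \<alpha> t)) | m n \<alpha> x t.
     simplex_op m n \<alpha> \<and> x \<in> simps X n \<and> t \<in> standard_simplex m}"

definition real_class ::
    "'x sset \<Rightarrow> (nat \<times> 'x) \<times> (nat \<Rightarrow> real) \<Rightarrow> ((nat \<times> 'x) \<times> (nat \<Rightarrow> real)) set" where
  "real_class X p = ((glue_rel X \<union> (glue_rel X)\<inverse>)\<^sup>*) `` {p}"

definition realisation :: "'x sset \<Rightarrow> ((nat \<times> 'x) \<times> (nat \<Rightarrow> real)) set topology" where
  "realisation X = quotient_topology (pre_realisation X) (real_class X)"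

definition realisation_map ::
    "'y sset \<Rightarrow> (nat \<Rightarrow> 'x \<Rightarrow> 'y) \<Rightarrow>
     ((nat \<times> 'x) \<times> (nat \<Rightarrow> real)) set \<Rightarrow> ((nat \<times> 'y) \<times> (nat \<Rightarrow> real)) set" where
  "realisation_map Y f c = (\<Union>((n, x), t)\<in>c. real_class Y ((n, f n x), t))"

text \<open>A weak equivalence of simplicial sets is a map whose geometric realisation is a homotopy
  equivalence (for CW complexes this is the same as a weak homotopy equivalence).\<close>

definition sset_map :: "'x sset \<Rightarrow> 'y sset \<Rightarrow> (nat \<Rightarrow> 'x \<Rightarrow> 'y) \<Rightarrow> bool" where
  "sset_map X Y f \<longleftrightarrow>
     (\<forall>n. \<forall>x\<in>simps X n. f n x \<in> simps Y n) \<and>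
     (\<forall>m n \<alpha>. simplex_op m n \<alpha> \<longrightarrow>
        (\<forall>x\<in>simps X n. f m (sact X m n \<alpha> x) = sact Y m n \<alpha> (f n x)))"

definition sset_weq :: "'x sset \<Rightarrow> 'y sset \<Rightarrow> (nat \<Rightarrow> 'x \<Rightarrow> 'y) \<Rightarrow> bool" where
  "sset_weq X Y f \<longleftrightarrow> sset_map X Y f \<and>
     continuous_map (realisation X) (realisation Y) (realisation_map Y f) \<and>
     (\<exists>g. continuous_map (realisation Y) (realisation X) g \<and>
        homotopic_with (\<lambda>_. True) (realisation X) (realisation X) (g \<circ> realisation_map Y f) id \<and>
        homotopic_with (\<lambda>_. True) (realisation Y) (realisation Y) (realisation_map Y f \<circ> g) id)"

definition pi0_rel :: "'x sset \<Rightarrow> 'x rel" where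
  "pi0_rel X = {(sact X 0 1 (\<lambda>_. 0) e, sact X 0 1 (\<lambda>_. 1) e) | e. e \<in> simps X 1}"

definition pi0_class :: "'x sset \<Rightarrow> 'x \<Rightarrow> 'x set" where
  "pi0_class X x = ((pi0_rel X \<union> (pi0_rel X)\<inverse>)\<^sup>*) `` {x}"


section \<open>Simplicial categories\<close>

record ('o, 'x) scat =
  sobs :: "'o set"
  smap :: "'o \<Rightarrow> 'o \<Rightarrow> 'x sset"
  sidt :: "'o \<Rightarrow> 'x"                             \<comment> \<open>a 0-simplex of \<open>smap x x\<close>\<close>
  scmp :: "'o \<Rightarrow> 'o \<Rightarrow> 'o \<Rightarrow> nat \<Rightarrow> 'x \<Rightarrow> 'x \<Rightarrow> 'x"  \<comment> \<open>\<open>scmp x y z k g f\<close>, with \<open>f : x \<rightarrow> y\<close>, \<open>g : y \<rightarrow> z\<close>\<close>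

record ('o, 'x, 'p, 'y) sfctr =
  sonob :: "'o \<Rightarrow> 'p"
  sonmap :: "'o \<Rightarrow> 'o \<Rightarrow> nat \<Rightarrow> 'x \<Rightarrow> 'y"

definition pi0_cat :: "('o, 'x) scat \<Rightarrow> ('o, 'o \<times> 'o \<times> 'x set) cat" where
  "pi0_cat S = \<lparr>obs = sobs S,
     arrs = {(x, y, pi0_class (smap S x y) h) | x y h.
               x \<in> sobs S \<and> y \<in> sobs S \<and> h \<in> simps (smap S x y) 0},
     src = (\<lambda>(x, _, _). x), tgt = (\<lambda>(_, y, _). y),
     idt = (\<lambda>x. (x, x, pi0_class (smap S x x) (sidt S x))),
     cmp = (\<lambda>(y, z, d) (x, _, c).
       (x, z, \<Union>g\<in>d. \<Union>f\<in>c. pi0_class (smap S x z) (scmp S x y z 0 g f)))\<rparr>"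

definition pi0_fctr ::
    "('p, 'y) scat \<Rightarrow> ('o, 'x, 'p, 'y) sfctr \<Rightarrow>
     ('o, 'o \<times> 'o \<times> 'x set, 'p, 'p \<times> 'p \<times> 'y set) fctr" where
  "pi0_fctr T F = \<lparr>onob = sonob F,
     onar = (\<lambda>(x, y, c). (sonob F x, sonob F y,
       \<Union>f\<in>c. pi0_class (smap T (sonob F x) (sonob F y)) (sonmap F x y 0 f)))\<rparr>"

definition scat_equivalence ::
    "('o, 'x) scat \<Rightarrow> ('p, 'y) scat \<Rightarrow> ('o, 'x, 'p, 'y) sfctr \<Rightarrow> bool" where
  "scat_equivalence S T F \<longleftrightarrow>
     cat_equivalence (pi0_cat S) (pi0_cat T) (pi0_fctr T F) \<and>
     (\<forall>x\<in>sobs S. \<forall>y\<in>sobs S.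
        sset_weq (smap S x y) (smap T (sonob F x) (sonob F y)) (sonmap F x y))"


section \<open>The Dwyer--Kan simplicial localisation\<close>

text \<open>The localisation is taken in the form of the hammock localisation (Dwyer and Kan,
  ``Calculating simplicial localizations'', 2.1). A \<open>k\<close>-simplex from \<open>x\<close> to \<open>y\<close> is a reduced
  hammock of width \<open>k\<close> and arbitrary length, that is, a reduced zigzag from the constant chain at
  \<open>x\<close> to the constant chain at \<open>y\<close>, in which

  \<^item> the vertices are functors from the ordinal \<open>{0..k}\<close> to the category of coloured arrows: such a
    chain \<open>a\<close> has as value on \<open>i \<le> j\<close> the coloured arrow \<open>a i j\<close>, and \<open>undefined\<close> elsewhere;
  \<^item> the columns are natural transformations of functors to the whole category, pointing either
    to the right, or to the left, and then with coloured components.\<close>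

definition is_chain :: "('o, 'm, 'z) ccat_scheme \<Rightarrow> nat \<Rightarrow> (nat \<Rightarrow> nat \<Rightarrow> 'm) \<Rightarrow> bool" where
  "is_chain C k a \<longleftrightarrow>
     (\<forall>i j. i \<le> j \<and> j \<le> k \<longrightarrow>
        a i j \<in> col C \<and> src C (a i j) = src C (a i i) \<and> tgt C (a i j) = src C (a j j)) \<and>
     (\<forall>i\<le>k. a i i = idt C (src C (a i i))) \<and>
     (\<forall>i j l. i \<le> j \<and> j \<le> l \<and> l \<le> k \<longrightarrow> a i l = a j l \<cdot>\<^bsub>C\<^esub> a i j) \<and>
     (\<forall>i j. \<not> (i \<le> j \<and> j \<le> k) \<longrightarrow> a i j = undefined)"

definition const_chain :: "('o, 'm, 'z) ccat_scheme \<Rightarrow> nat \<Rightarrow> 'o \<Rightarrow> nat \<Rightarrow> nat \<Rightarrow> 'm" where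
  "const_chain C k x = (\<lambda>i j. if i \<le> j \<and> j \<le> k then idt C x else undefined)"

definition is_chain_trans ::
    "('o, 'm, 'z) ccat_scheme \<Rightarrow> nat \<Rightarrow> (nat \<Rightarrow> nat \<Rightarrow> 'm) \<Rightarrow> (nat \<Rightarrow> nat \<Rightarrow> 'm) \<Rightarrow>
     (nat \<Rightarrow> 'm) \<Rightarrow> bool" where
  "is_chain_trans C k a b \<tau> \<longleftrightarrow>
     (\<forall>i\<le>k. \<tau> i \<in> homs C (src C (a i i)) (src C (b i i))) \<and>
     (\<forall>i j. i \<le> j \<and> j \<le> k \<longrightarrow> \<tau> j \<cdot>\<^bsub>C\<^esub> a i j = b i j \<cdot>\<^bsub>C\<^esub> \<tau> i) \<and>
     (\<forall>i>k. \<tau> i = undefined)"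

datatype 'm column =
  Column (rightward: bool) (lchain: "nat \<Rightarrow> nat \<Rightarrow> 'm") (rchain: "nat \<Rightarrow> nat \<Rightarrow> 'm")
    (comps: "nat \<Rightarrow> 'm")

definition is_column :: "('o, 'm, 'z) ccat_scheme \<Rightarrow> nat \<Rightarrow> 'm column \<Rightarrow> bool" where
  "is_column C k c \<longleftrightarrow> is_chain C k (lchain c) \<and> is_chain C k (rchain c) \<and>
     (if rightward c then is_chain_trans C k (lchain c) (rchain c) (comps c)
      else is_chain_trans C k (rchain c) (lchain c) (comps c) \<and> (\<forall>i\<le>k. comps c i \<in> col C))"

fun is_zigzag ::
    "('o, 'm, 'z) ccat_scheme \<Rightarrow> nat \<Rightarrow> (nat \<Rightarrow> nat \<Rightarrow> 'm) \<Rightarrow> 'm column list \<Rightarrow>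
     (nat \<Rightarrow> nat \<Rightarrow> 'm) \<Rightarrow> bool" where
  "is_zigzag C k a [] b \<longleftrightarrow> a = b"
| "is_zigzag C k a (c # h) b \<longleftrightarrow> is_column C k c \<and> lchain c = a \<and> is_zigzag C k (rchain c) h b"

definition is_id_column :: "('o, 'm, 'z) ccat_scheme \<Rightarrow> nat \<Rightarrow> 'm column \<Rightarrow> bool" where
  "is_id_column C k c \<longleftrightarrow> (\<forall>i\<le>k. comps c i = idt C (src C (comps c i)))"

definition is_reduced :: "('o, 'm, 'z) ccat_scheme \<Rightarrow> nat \<Rightarrow> 'm column list \<Rightarrow> bool" where
  "is_reduced C k h \<longleftrightarrow>
     (\<forall>c\<in>set h. \<not> is_id_column C k c) \<and>
     successively (\<lambda>c d. rightward c \<noteq> rightward d) h"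

text \<open>Reduction composes adjacent columns of the same direction and omits identity columns.\<close>

definition merge_columns ::
    "('o, 'm, 'z) ccat_scheme \<Rightarrow> nat \<Rightarrow> 'm column \<Rightarrow> 'm column \<Rightarrow> 'm column" where
  "merge_columns C k c d = Column (rightward c) (lchain c) (rchain d)
     (\<lambda>i. if i \<le> k then (if rightward c then comps d i \<cdot>\<^bsub>C\<^esub> comps c i
                          else comps c i \<cdot>\<^bsub>C\<^esub> comps d i)
          else undefined)"

fun add_column ::
    "('o, 'm, 'z) ccat_scheme \<Rightarrow> nat \<Rightarrow> 'm column \<Rightarrow> 'm column list \<Rightarrow> 'm column list" where
  "add_column C k c [] = (if is_id_column C k c then [] else [c])"
| "add_column C k c (d # h) =
     (if is_id_column C k c then d # h
      else if rightward c = rightward d then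
        (if is_id_column C k (merge_columns C k c d) then h else merge_columns C k c d # h)
      else c # d # h)"

definition reduce_zigzag ::
    "('o, 'm, 'z) ccat_scheme \<Rightarrow> nat \<Rightarrow> 'm column list \<Rightarrow> 'm column list" where
  "reduce_zigzag C k h = foldr (add_column C k) h []"

definition restrict_column :: "nat \<Rightarrow> (nat \<Rightarrow> nat) \<Rightarrow> 'm column \<Rightarrow> 'm column" where
  "restrict_column m \<alpha> c = Column (rightward c)
     (\<lambda>i j. if i \<le> j \<and> j \<le> m then lchain c (\<alpha> i) (\<alpha> j) else undefined)
     (\<lambda>i j. if i \<le> j \<and> j \<le> m then rchain c (\<alpha> i) (\<alpha> j) else undefined)
     (\<lambda>i. if i \<le> m then comps c (\<alpha> i) else undefined)"

definition hammocks ::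
    "('o, 'm, 'z) ccat_scheme \<Rightarrow> 'o \<Rightarrow> 'o \<Rightarrow> 'm column list sset" where
  "hammocks C x y = \<lparr>
     simps = (\<lambda>k. {h. is_zigzag C k (const_chain C k x) h (const_chain C k y) \<and> is_reduced C k h}),
     sact = (\<lambda>m n \<alpha> h. reduce_zigzag C m (map (restrict_column m \<alpha>) h))\<rparr>"

definition localisation :: "('o, 'm, 'z) ccat_scheme \<Rightarrow> ('o, 'm column list) scat" where
  "localisation C = \<lparr>sobs = obs C, smap = hammocks C, sidt = (\<lambda>_. []),
     scmp = (\<lambda>_ _ _ k g f. reduce_zigzag C k (f @ g))\<rparr>"

definition map_column_fctr ::
    "('o, 'm, 'p, 'n) fctr \<Rightarrow> nat \<Rightarrow> 'm column \<Rightarrow> 'n column" where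
  "map_column_fctr F k c = Column (rightward c)
     (\<lambda>i j. if i \<le> j \<and> j \<le> k then onar F (lchain c i j) else undefined)
     (\<lambda>i j. if i \<le> j \<and> j \<le> k then onar F (rchain c i j) else undefined)
     (\<lambda>i. if i \<le> k then onar F (comps c i) else undefined)"

definition localisation_fctr ::
    "('p, 'n, 'z) ccat_scheme \<Rightarrow> ('o, 'm, 'p, 'n) fctr \<Rightarrow>
     ('o, 'm column list, 'p, 'n column list) sfctr" where
  "localisation_fctr D F = \<lparr>sonob = onob F,
     sonmap = (\<lambda>_ _ k h. reduce_zigzag D k (map (map_column_fctr F k) h))\<rparr>"


section \<open>Equifunctors and fair monoids\<close>

definition equifunctor ::
    "('o, 'm) ccat \<Rightarrow> ('p, 'n) ccat \<Rightarrow> ('o, 'm, 'p, 'n) fctr \<Rightarrow> bool" where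
  "equifunctor C D F \<longleftrightarrow> coloured_functor C D F \<and>
     scat_equivalence (localisation C) (localisation D) (localisation_fctr D F)"

definition contractible_ccat :: "('o, 'm) ccat \<Rightarrow> bool" where
  "contractible_ccat C \<longleftrightarrow> equifunctor C terminal_ccat to_terminal"

definition semimonoid_ccat ::
    "('o, 'm) ccat \<Rightarrow> ('o \<times> 'o, 'm \<times> 'm, 'o, 'm) fctr \<Rightarrow> bool" where
  "semimonoid_ccat A \<mu> \<longleftrightarrow> coloured_category A \<and>
     coloured_functor (prod_ccat A A) A \<mu> \<and> strictly_associative A \<mu>"

definition semimonoid_hom ::
    "('o, 'm) ccat \<Rightarrow> ('o \<times> 'o, 'm \<times> 'm, 'o, 'm) fctr \<Rightarrow>
     ('p, 'n) ccat \<Rightarrow> ('p \<times> 'p, 'n \<times> 'n, 'p, 'n) fctr \<Rightarrow> ('o, 'm, 'p, 'n) fctr \<Rightarrow> bool" where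
  "semimonoid_hom U \<nu> A \<mu> F \<longleftrightarrow> coloured_functor U A F \<and>
     (\<forall>x\<in>obs U. \<forall>y\<in>obs U. onob F (onob \<nu> (x, y)) = onob \<mu> (onob F x, onob F y)) \<and>
     (\<forall>f\<in>arrs U. \<forall>g\<in>arrs U. onar F (onar \<nu> (f, g)) = onar \<mu> (onar F f, onar F g))"

definition fair_monoid ::
    "('o, 'm) ccat \<Rightarrow> ('o \<times> 'o, 'm \<times> 'm, 'o, 'm) fctr \<Rightarrow>
     ('p, 'n) ccat \<Rightarrow> ('p \<times> 'p, 'n \<times> 'n, 'p, 'n) fctr \<Rightarrow> ('p, 'n, 'o, 'm) fctr \<Rightarrow> bool" where
  "fair_monoid A \<mu> U \<nu> F \<longleftrightarrow>
     semimonoid_ccat A \<mu> \<and> semimonoid_ccat U \<nu> \<and> semimonoid_hom U \<nu> A \<mu> F \<and>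
     contractible_ccat U \<and>
     equifunctor (prod_ccat U A) A (comp_fctr \<mu> (prod_fctr F id_fctr)) \<and>
     equifunctor (prod_ccat A U) A (comp_fctr \<mu> (prod_fctr id_fctr F))"


section \<open>Cofibrant objects and weak units\<close>

definition cofibrant_ccat :: "('o, 'm, 'z) mcat_scheme \<Rightarrow> ('o, 'm) ccat" where
  "cofibrant_ccat M = \<lparr>obs = {x \<in> obs M. cofibrant M x},
     arrs = {f \<in> arrs M. cofibrant M (src M f) \<and> cofibrant M (tgt M f)},
     src = src M, tgt = tgt M, idt = idt M, cmp = cmp M,
     col = {f \<in> weq M. cofibrant M (src M f) \<and> cofibrant M (tgt M f)}\<rparr>"

text \<open>An arrow \<open>(p', w, p)\<close> of the category of weak units is the commutative triangle
  \<open>p' = p \<circ> w\<close> of weak equivalences.\<close>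

definition weak_units :: "('o, 'm, 'z) mmcat_scheme \<Rightarrow> ('m, 'm \<times> 'm \<times> 'm) ccat" where
  "weak_units M =
    (let Ob = {p \<in> weq M. cofibrant M (src M p) \<and> tgt M p = unt M};
         Ar = {(p', w, p) | p' w p. p' \<in> Ob \<and> p \<in> Ob \<and> w \<in> weq M \<and>
                 w \<in> homs M (src M p') (src M p) \<and> p \<cdot>\<^bsub>M\<^esub> w = p'}
     in \<lparr>obs = Ob, arrs = Ar,
         src = (\<lambda>(p', _, _). p'), tgt = (\<lambda>(_, _, p). p),
         idt = (\<lambda>p. (p, idt M (src M p), p)),
         cmp = (\<lambda>(_, v, p) (p'', w, _). (p'', v \<cdot>\<^bsub>M\<^esub> w, p)),
         col = Ar\<rparr>)"

definition weak_unit_tensor :: "('o, 'm, 'z) mmcat_scheme \<Rightarrow> 'm \<Rightarrow> 'm \<Rightarrow> 'm" where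
  "weak_unit_tensor M p q = lun M (unt M) \<cdot>\<^bsub>M\<^esub> tar M p q"

definition weak_units_mult ::
    "('o, 'm, 'z) mmcat_scheme \<Rightarrow>
     ('m \<times> 'm, ('m \<times> 'm \<times> 'm) \<times> ('m \<times> 'm \<times> 'm), 'm, 'm \<times> 'm \<times> 'm) fctr" where
  "weak_units_mult M = \<lparr>onob = (\<lambda>(p, q). weak_unit_tensor M p q),
     onar = (\<lambda>((p', w, p), (q', v, q)).
       (weak_unit_tensor M p' q', tar M w v, weak_unit_tensor M p q))\<rparr>"

definition weak_units_forget ::
    "('o, 'm, 'z) mmcat_scheme \<Rightarrow> ('m, 'm \<times> 'm \<times> 'm, 'o, 'm) fctr" where
  "weak_units_forget M = \<lparr>onob = src M, onar = (\<lambda>(_, w, _). w)\<rparr>"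

end

theory Submission
  imports Defs
begin

text \<open>A coloured natural transformation \<open>\<eta> : P \<Rightarrow> Q\<close> makes the simplicial functors \<open>LP\<close> and \<open>LQ\<close>
  homotopic: a hammock is replaced by a hammock whose rows are its images, first under \<open>P\<close> and then
  under \<open>Q\<close>, and the components of \<open>\<eta>\<close> are invertible in \<open>\<pi>\<^sub>0\<close> of the localisation. Hence a functor
  with an inverse up to zigzags of coloured natural transformations is an equifunctor.

  For weak units, let \<open>q : Z \<rightarrow> I\<close> be a cofibrant replacement of the unit. Functorial factorisation of
  a weak unit \<open>p\<close> as a cofibration followed by a trivial fibration \<open>P p\<close> gives a zigzag
  \<open>p \<rightarrow> P p \<leftarrow> q\<close>, natural in \<open>p\<close>; so the category \<open>U\<close> of weak units is contractible, and \<open>x \<mapsto> (q, x)\<close>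
  is inverse to the projection \<open>U \<times> A \<rightarrow> A\<close>. By the unit axiom the multiplication \<open>U \<times> A \<rightarrow> A\<close> is
  connected to the projection by a coloured natural transformation. Ken Brown's lemma makes the
  tensor product of cofibrant objects preserve weak equivalences, and associativity of the
  multiplication of \<open>U\<close> rests on the identity \<open>lun I \<otimes> 1 = 1 \<otimes> lun I\<close>.\<close>

section \<open>Simplicial sets and simplicial homotopies\<close>

text \<open>Three obstacles shape the proof. Weak equivalences are tested on geometric realisations,
  while the available homotopies are simplicial; they are realised by cutting each product of a
  simplex with [0,1] into prisms. Since components are defined by edges, every homotopy is recorded
  twice: topologically and on vertices. Next, \<open>LP\<close> and \<open>LQ\<close> lead to
  mapping spaces between different objects, so a transformation from \<open>P\<close> to
  \<open>Q\<close> gives no homotopy of two maps with one target, only squares that commute up to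
  homotopy. Such squares can be pasted and inverted, and a two-out-of-six argument turns them into
  weak equivalences of mapping spaces. Finally, restriction to rows or application of a functor may
  create identity columns and so destroy reducedness. Everything done to hammocks rests on one fact:
  reducing beforehand does not change the final reduction. For weak units, an arrow from
  \<open>q\<close> to \<open>p\<close> obtained by lifting would depend on choices. Factoring the
  arrow from the initial object to \<open>I\<close> by the same functorial factorisation gives an
  arrow from \<open>q\<close> to \<open>P p\<close> whose naturality follows from uniqueness of
  arrows out of the initial object.\<close>

definition sset :: "'x sset \<Rightarrow> bool" where
  "sset X \<longleftrightarrow>
     (\<forall>m n \<alpha>. simplex_op m n \<alpha> \<longrightarrow> (\<forall>x\<in>simps X n. sact X m n \<alpha> x \<in> simps X m)) \<and>
     (\<forall>l m n \<alpha> \<beta>. simplex_op l m \<beta> \<and> simplex_op m n \<alpha> \<longrightarrow>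
        (\<forall>x\<in>simps X n. sact X l m \<beta> (sact X m n \<alpha> x) = sact X l n (\<alpha> \<circ> \<beta>) x)) \<and>
     (\<forall>n. \<forall>x\<in>simps X n. sact X n n (\<lambda>i. i) x = x) \<and>
     (\<forall>m n \<alpha> \<beta>. simplex_op m n \<alpha> \<and> (\<forall>i\<le>m. \<alpha> i = \<beta> i) \<longrightarrow>
        (\<forall>x\<in>simps X n. sact X m n \<alpha> x = sact X m n \<beta> x))"

lemma sset_closed: "\<lbrakk>sset X; simplex_op m n \<alpha>; x \<in> simps X n\<rbrakk> \<Longrightarrow> sact X m n \<alpha> x \<in> simps X m"
  by (drule sset_def[THEN iffD1, THEN conjunct1]) blast

lemma sset_comp:
  "\<lbrakk>sset X; simplex_op l m \<beta>; simplex_op m n \<alpha>; x \<in> simps X n\<rbrakk> \<Longrightarrow>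
     sact X l m \<beta> (sact X m n \<alpha> x) = sact X l n (\<alpha> \<circ> \<beta>) x"
  by (drule sset_def[THEN iffD1, THEN conjunct2, THEN conjunct1]) blast

lemma sset_ident: "\<lbrakk>sset X; x \<in> simps X n\<rbrakk> \<Longrightarrow> sact X n n (\<lambda>i. i) x = x"
  by (drule sset_def[THEN iffD1, THEN conjunct2, THEN conjunct2, THEN conjunct1]) blast

lemma sset_cong:
  "\<lbrakk>sset X; simplex_op m n \<alpha>; \<And>i. i \<le> m \<Longrightarrow> \<alpha> i = \<beta> i; x \<in> simps X n\<rbrakk> \<Longrightarrow>
     sact X m n \<alpha> x = sact X m n \<beta> x"
  by (drule sset_def[THEN iffD1, THEN conjunct2, THEN conjunct2, THEN conjunct2]) meson

lemma simplex_opI: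
  "\<lbrakk>\<And>i j. i \<le> j \<Longrightarrow> j \<le> m \<Longrightarrow> \<alpha> i \<le> \<alpha> j; \<And>i. i \<le> m \<Longrightarrow> \<alpha> i \<le> n\<rbrakk> \<Longrightarrow> simplex_op m n \<alpha>"
  unfolding simplex_op_def by (auto intro!: mono_onI)

lemma simplex_op_mono: "\<lbrakk>simplex_op m n \<alpha>; i \<le> j; j \<le> m\<rbrakk> \<Longrightarrow> \<alpha> i \<le> \<alpha> j"
  unfolding simplex_op_def by (auto intro: mono_onD[of "{..m}" \<alpha>])

lemma simplex_op_le: "\<lbrakk>simplex_op m n \<alpha>; i \<le> m\<rbrakk> \<Longrightarrow> \<alpha> i \<le> n"
  unfolding simplex_op_def by auto

lemma simplex_op_comp: "\<lbrakk>simplex_op l m \<beta>; simplex_op m n \<alpha>\<rbrakk> \<Longrightarrow> simplex_op l n (\<alpha> \<circ> \<beta>)"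
  by (rule simplex_opI) (simp_all add: simplex_op_mono[of m n \<alpha>] simplex_op_mono[of l m \<beta>]
      simplex_op_le[of m n \<alpha>] simplex_op_le[of l m \<beta>])

text \<open>A homotopy \<open>X \<times> \<Delta>\<^sup>1 \<rightarrow> Y\<close>; the \<open>n\<close>-simplices of \<open>\<Delta>\<^sup>1\<close> are the monotone maps
  \<open>s : {0..n} \<rightarrow> {0,1}\<close>.\<close>

definition simplicial_homotopy ::
    "'x sset \<Rightarrow> 'y sset \<Rightarrow> (nat \<Rightarrow> (nat \<Rightarrow> nat) \<Rightarrow> 'x \<Rightarrow> 'y) \<Rightarrow> bool" where
  "simplicial_homotopy X Y H \<longleftrightarrow>
     (\<forall>n s. simplex_op n 1 s \<longrightarrow> (\<forall>x\<in>simps X n. H n s x \<in> simps Y n)) \<and>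
     (\<forall>m n \<alpha> s. simplex_op m n \<alpha> \<and> simplex_op n 1 s \<longrightarrow>
        (\<forall>x\<in>simps X n. H m (s \<circ> \<alpha>) (sact X m n \<alpha> x) = sact Y m n \<alpha> (H n s x))) \<and>
     (\<forall>n s s'. simplex_op n 1 s \<and> (\<forall>i\<le>n. s i = s' i) \<longrightarrow>
        (\<forall>x\<in>simps X n. H n s x = H n s' x))"

lemma simplicial_homotopy_closed:
  "\<lbrakk>simplicial_homotopy X Y H; simplex_op n 1 s; x \<in> simps X n\<rbrakk> \<Longrightarrow> H n s x \<in> simps Y n"
  by (drule simplicial_homotopy_def[THEN iffD1, THEN conjunct1]) blast

lemma simplicial_homotopy_natural:
  "\<lbrakk>simplicial_homotopy X Y H; simplex_op m n \<alpha>; simplex_op n 1 s; x \<in> simps X n\<rbrakk> \<Longrightarrow>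
     H m (s \<circ> \<alpha>) (sact X m n \<alpha> x) = sact Y m n \<alpha> (H n s x)"
  by (drule simplicial_homotopy_def[THEN iffD1, THEN conjunct2, THEN conjunct1]) blast

lemma simplicial_homotopy_cong:
  "\<lbrakk>simplicial_homotopy X Y H; simplex_op n 1 s; \<And>i. i \<le> n \<Longrightarrow> s i = s' i; x \<in> simps X n\<rbrakk> \<Longrightarrow>
     H n s x = H n s' x"
  by (drule simplicial_homotopy_def[THEN iffD1, THEN conjunct2, THEN conjunct2]) meson

section \<open>Geometric realisation\<close>

lemma simplex_push_comp:
  assumes "simplex_op l m \<beta>" 
  shows "simplex_push m \<alpha> (simplex_push l \<beta> t) = simplex_push l (\<alpha> \<circ> \<beta>) t"
proof
  fix k
  have "(\<Sum>j | j \<le> m \<and> \<alpha> j = k. \<Sum>i | i \<le> l \<and> \<beta> i = j. t i) =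
      (\<Sum>j\<in>{j. j \<le> m \<and> \<alpha> j = k}. \<Sum>i | i \<in> {i. i \<le> l \<and> \<alpha> (\<beta> i) = k} \<and> \<beta> i = j. t i)"
    by (intro sum.cong refl) auto
  also have "\<dots> = (\<Sum>i | i \<le> l \<and> \<alpha> (\<beta> i) = k. t i)"
    using simplex_op_le[OF assms] by (subst sum.group) (auto intro: finite_subset[of _ "{..l}"])
  finally show "simplex_push m \<alpha> (simplex_push l \<beta> t) k = simplex_push l (\<alpha> \<circ> \<beta>) t k"
    by (simp add: simplex_push_def)
qed

lemma sum_simplex_push:
  assumes "finite A" 
  shows "sum (simplex_push m \<alpha> t) A = (\<Sum>i | i \<le> m \<and> \<alpha> i \<in> A. t i)"
proof -
  have "sum (simplex_push m \<alpha> t) A = (\<Sum>j\<in>A. \<Sum>i | i \<in> {i. i \<le> m \<and> \<alpha> i \<in> A} \<and> \<alpha> i = j. t i)"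
    unfolding simplex_push_def by (intro sum.cong refl) auto
  also have "\<dots> = (\<Sum>i | i \<le> m \<and> \<alpha> i \<in> A. t i)"
    using assms by (subst sum.group) (auto intro: finite_subset[of _ "{..m}"])
  finally show ?thesis .
qed

text \<open>The bound by 1 in the library definition is automatic: a coordinate is one of several
  nonnegative summands with total 1.\<close>

lemma standard_simplexI:
  assumes "\<And>i. 0 \<le> t i" "\<And>i. i > n \<Longrightarrow> t i = 0" "sum t {..n} = 1"
  shows "t \<in> standard_simplex n"
proof -
  have "t i \<le> 1" for i
  proof (cases "i \<le> n")
    case True
    then have "t i \<le> sum t {..n}"
      using assms(1) by (intro member_le_sum) auto
    then show ?thesis using assms(3) by simp
  qed (use assms in auto)
  then show ?thesis
    using assms by (auto simp: standard_simplex_def)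
qed

lemma standard_simplexD:
  assumes "t \<in> standard_simplex n"
  shows "0 \<le> t i" "i > n \<Longrightarrow> t i = 0" "sum t {..n} = 1"
  using assms by (auto simp: standard_simplex_def)

lemma simplex_push_standard_simplex:
  assumes "simplex_op m n \<alpha>" "t \<in> standard_simplex m"
  shows "simplex_push m \<alpha> t \<in> standard_simplex n"
proof (rule standard_simplexI)
  show "0 \<le> simplex_push m \<alpha> t i" for i
    unfolding simplex_push_def using standard_simplexD[OF assms(2)] by (auto intro: sum_nonneg)
  show "simplex_push m \<alpha> t i = 0" if "i > n" for i
  proof -
    have "{j. j \<le> m \<and> \<alpha> j = i} = {}"
      using that simplex_op_le[OF assms(1)] by fastforce
    then show ?thesis by (simp only: simplex_push_def) simp
  qed
  have "{i. i \<le> m \<and> \<alpha> i \<in> {..n}} = {..m}"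
    using simplex_op_le[OF assms(1)] by auto
  then show "sum (simplex_push m \<alpha> t) {..n} = 1"
    using standard_simplexD[OF assms(2)] by (simp add: sum_simplex_push)
qed

lemma real_class_refl: "a \<in> real_class X a"
  by (simp add: real_class_def)

lemma real_class_eq_iff:
  "real_class X a = real_class X b \<longleftrightarrow> (a, b) \<in> (glue_rel X \<union> (glue_rel X)\<inverse>)\<^sup>*"
    (is "_ \<longleftrightarrow> _ \<in> ?R")
proof
  assume "real_class X a = real_class X b"
  then have "b \<in> real_class X a"
    by (simp add: real_class_refl)
  then show "(a, b) \<in> ?R"
    by (simp add: real_class_def)
next
  have "sym ?R"
    by (intro sym_rtrancl sym_Un_converse)
  moreover assume "(a, b) \<in> ?R"
  ultimately show "real_class X a = real_class X b"
    unfolding real_class_def by (auto dest: symD intro: rtrancl_trans)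
qed

lemma real_class_glue:
  "\<lbrakk>simplex_op m n \<alpha>; x \<in> simps X n; t \<in> standard_simplex m\<rbrakk> \<Longrightarrow>
     real_class X ((m, sact X m n \<alpha> x), t) = real_class X ((n, x), simplex_push m \<alpha> t)"
  unfolding real_class_eq_iff by (rule r_into_rtrancl) (auto simp: glue_rel_def)

text \<open>Points of the realisation are classes of the generated equivalence relation. A function
  is constant on them as soon as it respects the generating gluings, by induction along a zigzag of
  gluings.\<close>

lemma glue_invariant:
  assumes "real_class X a = real_class X b"
    and inv: "\<And>m n \<alpha> x t. \<lbrakk>simplex_op m n \<alpha>; x \<in> simps X n; t \<in> standard_simplex m\<rbrakk> \<Longrightarrow>
       f ((m, sact X m n \<alpha> x), t) = f ((n, x), simplex_push m \<alpha> t)"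
  shows "f a = f b"
proof -
  have "(a, b) \<in> (glue_rel X \<union> (glue_rel X)\<inverse>)\<^sup>*"
    using assms(1) by (simp add: real_class_eq_iff)
  then show ?thesis
  proof induction
    case (step y z)
    then have "f y = f z"
      using inv by (auto simp: glue_rel_def)
    then show ?case using step by simp
  qed simp
qed

lemma topspace_pre_realisation:
  "topspace (pre_realisation X) = {((n, x), t). x \<in> simps X n \<and> t \<in> standard_simplex n}"
  by (auto simp: pre_realisation_def)

lemma quotient_real_class: "quotient_map (pre_realisation X) (realisation X) (real_class X)"
  by (simp add: realisation_def quotient_map_quotient_topology)

lemma realisation_cases:
  assumes "c \<in> topspace (realisation X)"
  obtains n x t where "x \<in> simps X n" "t \<in> standard_simplex n" "c = real_class X ((n, x), t)"
  using assms by (auto simp: realisation_def topspace_quotient_topology topspace_pre_realisation)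

lemma continuous_map_simplex_inclusion:
  assumes "x \<in> simps X n"
  shows "continuous_map (subtopology (powertop_real UNIV) (standard_simplex n)) (realisation X)
     (\<lambda>t. real_class X ((n, x), t))"
proof -
  have "continuous_map (subtopology (powertop_real UNIV) (standard_simplex n)) (pre_realisation X)
      (\<lambda>t. ((n, x), t))"
    unfolding pre_realisation_def continuous_map_def
  proof (intro conjI allI impI)
    show "(\<lambda>t. ((n, x), t)) \<in> topspace (subtopology (powertop_real UNIV) (standard_simplex n)) \<rightarrow>
        topspace (sum_topology (\<lambda>(n, _). subtopology (powertop_real UNIV) (standard_simplex n))
          (SIGMA n:UNIV. simps X n))"
      using assms by auto
    fix U :: "((nat \<times> 'a) \<times> (nat \<Rightarrow> real)) set"
    assume "openin (sum_topology (\<lambda>(n, _). subtopology (powertop_real UNIV) (standard_simplex n))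
          (SIGMA n:UNIV. simps X n)) U"
    then have "openin (subtopology (powertop_real UNIV) (standard_simplex n)) {t. ((n, x), t) \<in> U}"
      using assms by (auto simp: openin_sum_topology)
    moreover from openin_subset[OF this] have "{t \<in> topspace (subtopology (powertop_real UNIV) (standard_simplex n)).
        ((n, x), t) \<in> U} = {t. ((n, x), t) \<in> U}"
      by auto
    ultimately show "openin (subtopology (powertop_real UNIV) (standard_simplex n))
        {t \<in> topspace (subtopology (powertop_real UNIV) (standard_simplex n)). ((n, x), t) \<in> U}"
      by simp
  qed
  then show ?thesis
    using continuous_map_compose quotient_imp_continuous_map[OF quotient_real_class]
    by (fastforce simp: o_def)
qed

text \<open>Each summand is open in the sum, so a box inside one summand is a box in the whole
  product. Continuity can therefore be checked one simplex at a time.\<close>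

lemma continuous_map_prod_sum_topology:
  assumes "\<And>i. i \<in> I \<Longrightarrow> continuous_map (prod_topology Z (X i)) Y (\<lambda>(z, x). f (z, (i, x)))"
  shows "continuous_map (prod_topology Z (sum_topology X I)) Y f"
  unfolding continuous_map_def
proof (intro conjI allI impI)
  show "f \<in> topspace (prod_topology Z (sum_topology X I)) \<rightarrow> topspace Y"
  proof
    fix a assume "a \<in> topspace (prod_topology Z (sum_topology X I))"
    then obtain z i x where a: "a = (z, (i, x))" "i \<in> I" "z \<in> topspace Z" "x \<in> topspace (X i)"
      by (cases a) auto
    then show "f a \<in> topspace Y"
      using continuous_map_funspace[OF assms[of i]] by (auto simp: Pi_iff)
  qed
  fix V assume V: "openin Y V"
  show "openin (prod_topology Z (sum_topology X I))
      {a \<in> topspace (prod_topology Z (sum_topology X I)). f a \<in> V}" (is "openin _ ?P")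
    unfolding openin_prod_topology_alt
  proof (intro allI impI)
    fix z c assume "(z, c) \<in> ?P"
    then obtain i x where c: "c = (i, x)" "i \<in> I" "z \<in> topspace Z" "x \<in> topspace (X i)" "f (z, (i, x)) \<in> V"
      by (cases c) auto
    have "openin (prod_topology Z (X i)) {a \<in> topspace (prod_topology Z (X i)). (\<lambda>(z, x). f (z, (i, x))) a \<in> V}"
      using assms[OF c(2)] V by (rule openin_continuous_map_preimage)
    then obtain A B where AB: "openin Z A" "openin (X i) B" "z \<in> A" "x \<in> B"
        "A \<times> B \<subseteq> {a \<in> topspace (prod_topology Z (X i)). (\<lambda>(z, x). f (z, (i, x))) a \<in> V}"
      unfolding openin_prod_topology_alt using c by (auto elim!: allE[of _ z] allE[of _ x])
    have "openin (sum_topology X I) ({i} \<times> B)"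
      using AB(2) openin_subset[OF AB(2)] c(2) unfolding openin_sum_topology
      by (auto, rename_tac k, case_tac "k = i", auto)
    moreover have "A \<times> ({i} \<times> B) \<subseteq> ?P"
      using AB(5) c(2) openin_subset[OF AB(2)] openin_subset[OF AB(1)] by auto
    ultimately show "\<exists>U W. openin Z U \<and> openin (sum_topology X I) W \<and> z \<in> U \<and> c \<in> W \<and> U \<times> W \<subseteq> ?P"
      using AB c by blast
  qed
qed

section \<open>Maps induced on realisations\<close>

lemma sset_map_closed: "\<lbrakk>sset_map X Y f; x \<in> simps X n\<rbrakk> \<Longrightarrow> f n x \<in> simps Y n"
  by (drule sset_map_def[THEN iffD1, THEN conjunct1]) blast

lemma sset_map_natural:
  "\<lbrakk>sset_map X Y f; simplex_op m n \<alpha>; x \<in> simps X n\<rbrakk> \<Longrightarrow> f m (sact X m n \<alpha> x) = sact Y m n \<alpha> (f n x)"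
  by (drule sset_map_def[THEN iffD1, THEN conjunct2]) blast

text \<open>\<open>realisation_map\<close> is a union over all representatives of a point.
  Compatibility of \<open>f\<close> with the operators makes all contributing classes equal, so the
  union collapses to one class.\<close>

lemma realisation_map_class:
  assumes "sset_map X Y f" "sset X" "sset Y" "x \<in> simps X n" "t \<in> standard_simplex n"
  shows "realisation_map Y f (real_class X ((n, x), t)) = real_class Y ((n, f n x), t)"
proof -
  define g where "g = (\<lambda>((n, x), t). real_class Y ((n, f n x), t))"
  have "g b = g ((n, x), t)" if "real_class X b = real_class X ((n, x), t)" for b
    using that
  proof (rule glue_invariant)
    fix m n \<alpha> x and t :: "nat \<Rightarrow> real"
    assume a: "simplex_op m n \<alpha>" "x \<in> simps X n" "t \<in> standard_simplex m"
    then have "f m (sact X m n \<alpha> x) = sact Y m n \<alpha> (f n x)" "f n x \<in> simps Y n"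
      using assms(1) by (auto simp: sset_map_def)
    then show "g ((m, sact X m n \<alpha> x), t) = g ((n, x), simplex_push m \<alpha> t)"
      using a by (simp add: g_def real_class_glue)
  qed
  then have "g b = g ((n, x), t)" if "b \<in> real_class X ((n, x), t)" for b
    using that by (metis Image_singleton_iff real_class_def real_class_eq_iff)
  then have "realisation_map Y f (real_class X ((n, x), t)) = (\<Union>b\<in>real_class X ((n, x), t). g ((n, x), t))"
    unfolding realisation_map_def by (intro SUP_cong refl) (auto simp: g_def)
  moreover have "real_class X ((n, x), t) \<noteq> {}"
    using real_class_refl by blast
  ultimately show ?thesis
    by (simp add: g_def)
qed

section \<open>The realisation of a simplicial homotopy\<close>

text \<open>A point \<open>(t, r)\<close> of \<open>\<Delta>\<^sup>n \<times> [0,1]\<close> lies in the \<open>p\<close>-th of the \<open>n + 1\<close> simplices of the prism,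
  with vertices \<open>(0,0), \<dots>, (p,0), (p,1), \<dots>, (n,1)\<close>, if \<open>in_prism n p t r\<close> holds; its barycentric
  coordinates there are \<open>prism_coords n p t r\<close>.\<close>

definition prism_proj :: "nat \<Rightarrow> nat \<Rightarrow> nat" where
  "prism_proj p j = (if j \<le> p then j else j - 1)"

definition prism_step :: "nat \<Rightarrow> nat \<Rightarrow> nat" where
  "prism_step p j = (if j \<le> p then 0 else 1)"

definition in_prism :: "nat \<Rightarrow> nat \<Rightarrow> (nat \<Rightarrow> real) \<Rightarrow> real \<Rightarrow> bool" where
  "in_prism n p t r \<longleftrightarrow> p \<le> n \<and> sum t {..<p} \<le> 1 - r \<and> sum t {p<..n} \<le> r"

text \<open>The two middle coordinates split the mass \<open>t p\<close> between the vertices (p,0)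
  and (p,1), in such a way that level 1 carries total mass \<open>r\<close> and level 0 carries
  \<open>1 - r\<close>. The inequalities in \<open>in_prism\<close> say that both parts are
  nonnegative.\<close>

definition prism_coords :: "nat \<Rightarrow> nat \<Rightarrow> (nat \<Rightarrow> real) \<Rightarrow> real \<Rightarrow> nat \<Rightarrow> real" where
  "prism_coords n p t r j =
     (if j < p then t j else if j = p then 1 - r - sum t {..<p}
      else if j = Suc p then r - sum t {p<..n} else t (j - 1))"

lemma simplex_op_prism_proj: "p \<le> n \<Longrightarrow> simplex_op (Suc n) n (prism_proj p)"
  by (rule simplex_opI) (auto simp: prism_proj_def)

lemma simplex_op_prism_step: "simplex_op n 1 (prism_step p)"
  by (rule simplex_opI) (auto simp: prism_step_def)

lemma simplex_push_prism_proj: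
  assumes "p \<le> n" "v \<in> standard_simplex (Suc n)"
  shows "simplex_push (Suc n) (prism_proj p) v i =
     (if i < p then v i else if i = p then v p + v (Suc p) else v (Suc i))"
proof -
  consider "i < p" | "i = p" | "i > p" "i \<le> n" | "i > n" by linarith
  then show ?thesis
  proof cases
    case 1
    then have "{j. j \<le> Suc n \<and> prism_proj p j = i} = {i}"
      using assms by (auto simp: prism_proj_def split: if_splits)
    then show ?thesis using 1 by (simp add: simplex_push_def)
  next
    case 2
    then have "{j. j \<le> Suc n \<and> prism_proj p j = i} = {p, Suc p}"
      using assms by (auto simp: prism_proj_def split: if_splits)
    then show ?thesis using 2 by (simp add: simplex_push_def)
  next
    case 3
    then have "{j. j \<le> Suc n \<and> prism_proj p j = i} = {Suc i}"
      using assms by (auto simp: prism_proj_def split: if_splits)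
    then show ?thesis using 3 by (simp add: simplex_push_def)
  next
    case 4
    then have "{j. j \<le> Suc n \<and> prism_proj p j = i} = {}"
      using assms by (auto simp: prism_proj_def split: if_splits)
    then have "simplex_push (Suc n) (prism_proj p) v i = 0"
      by (simp only: simplex_push_def sum.empty)
    then show ?thesis using 4 assms standard_simplexD(2)[OF assms(2), of "Suc i"] by simp
  qed
qed

lemma sum_atMost_split: "p \<le> n \<Longrightarrow> sum t {..n} = sum t {..<p} + t p + sum t {p<..n}" for t :: "nat \<Rightarrow> real"
proof -
  assume p: "p \<le> n"
  have "{..n} = insert p ({..<p} \<union> {p<..n})" using p by auto
  moreover have "{..<p} \<inter> {p<..n} = {}" by auto
  ultimately show ?thesis by (simp add: sum.union_disjoint)
qed

lemma sum_shift_greaterThanAtMost: "(\<Sum>j\<in>{Suc p<..Suc n}. t (j - 1)) = sum t {p<..n}" for t :: "nat \<Rightarrow> real"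
  by (rule sum.reindex_bij_witness[of _ Suc "\<lambda>j. j - 1"]) auto

lemma sum_prism_coords_upper:
  assumes "p \<le> n" shows "sum (prism_coords n p t r) {p<..Suc n} = r"
proof -
  have "{p<..Suc n} = insert (Suc p) {Suc p<..Suc n}" using assms by auto
  moreover have "sum (prism_coords n p t r) {Suc p<..Suc n} = (\<Sum>j\<in>{Suc p<..Suc n}. t (j - 1))"
    by (rule sum.cong) (auto simp: prism_coords_def)
  ultimately show ?thesis
    unfolding sum_shift_greaterThanAtMost by (simp add: prism_coords_def)
qed

lemma prism_coords_standard_simplex:
  assumes "t \<in> standard_simplex n" "in_prism n p t r"
  shows "prism_coords n p t r \<in> standard_simplex (Suc n)"
proof (rule standard_simplexI)
  have p: "p \<le> n" using assms by (simp add: in_prism_def)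
  show "0 \<le> prism_coords n p t r i" for i
    using assms standard_simplexD[OF assms(1)] by (auto simp: prism_coords_def in_prism_def)
  show "prism_coords n p t r i = 0" if "i > Suc n" for i
    using that p standard_simplexD[OF assms(1)] by (auto simp: prism_coords_def)
  have "sum (prism_coords n p t r) {..<p} = sum t {..<p}"
    by (rule sum.cong) (auto simp: prism_coords_def)
  then show "sum (prism_coords n p t r) {..Suc n} = 1"
    using p by (simp only: sum_atMost_split[of p "Suc n"] sum_prism_coords_upper) (simp add: prism_coords_def)
qed

lemma simplex_push_prism_coords:
  assumes "t \<in> standard_simplex n" "in_prism n p t r"
  shows "simplex_push (Suc n) (prism_proj p) (prism_coords n p t r) = t"
proof
  fix i
  have p: "p \<le> n" using assms by (simp add: in_prism_def)
  show "simplex_push (Suc n) (prism_proj p) (prism_coords n p t r) i = t i"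
    using sum_atMost_split[OF p, of t] standard_simplexD(3)[OF assms(1)]
    by (simp add: simplex_push_prism_proj[OF p prism_coords_standard_simplex[OF assms]])
      (auto simp: prism_coords_def)
qed

text \<open>A point of a prism is determined by its image in the base simplex and by the mass of its
  upper vertices. This is how the image of prism coordinates under an operator is recognised as
  prism coordinates again.\<close>

lemma prism_coords_unique:
  assumes "p \<le> n" "v \<in> standard_simplex (Suc n)"
    and t: "t = simplex_push (Suc n) (prism_proj p) v" and r: "r = sum v {p<..Suc n}"
  shows "in_prism n p t r" "v = prism_coords n p t r"
proof -
  have ti: "t i = (if i < p then v i else if i = p then v p + v (Suc p) else v (Suc i))" for i
    unfolding t by (rule simplex_push_prism_proj[OF assms(1,2)])
  have 1: "sum t {..<p} = sum v {..<p}"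
    by (rule sum.cong) (auto simp: ti)
  have "sum t {p<..n} = (\<Sum>j\<in>{Suc p<..Suc n}. t (j - 1))"
    by (simp only: sum_shift_greaterThanAtMost)
  also have "\<dots> = sum v {Suc p<..Suc n}"
    by (rule sum.cong) (auto simp: ti)
  finally have 2: "sum t {p<..n} = sum v {Suc p<..Suc n}" .
  have "{p<..Suc n} = insert (Suc p) {Suc p<..Suc n}" using assms by auto
  then have 3: "r = v (Suc p) + sum v {Suc p<..Suc n}"
    by (simp add: r)
  have 4: "1 = sum v {..<p} + v p + r"
    using sum_atMost_split[of p "Suc n" v] assms standard_simplexD(3)[OF assms(2)] by simp
  show "in_prism n p t r"
    using 1 2 3 4 assms(1) standard_simplexD(1)[OF assms(2), of p] standard_simplexD(1)[OF assms(2), of "Suc p"]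
    unfolding in_prism_def by linarith
  show "v = prism_coords n p t r"
    using 1 2 3 4 by (auto simp: prism_coords_def ti fun_eq_iff)
qed

lemma in_prism_ex:
  assumes "t \<in> standard_simplex n" "0 \<le> r" "r \<le> 1"
  obtains p where "in_prism n p t r"
proof -
  \<comment> \<open>Level 0 is filled greedily. As \<open>Suc p\<close> fails, the mass up to and
    including \<open>p\<close> exceeds \<open>1 - r\<close>, hence less than \<open>r\<close>
    remains beyond \<open>p\<close>.\<close>
  define p where "p = (GREATEST p. p \<le> n \<and> sum t {..<p} \<le> 1 - r)"
  have p: "p \<le> n \<and> sum t {..<p} \<le> 1 - r"
    unfolding p_def by (rule GreatestI_nat[of _ 0 n]) (use assms in auto)
  have "sum t {p<..n} \<le> r"
  proof (cases "p = n")
    case True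
    then show ?thesis using assms by simp
  next
    case False
    then have Sp: "Suc p \<le> n" using p by simp
    have "\<not> sum t {..<Suc p} \<le> 1 - r"
    proof
      assume "sum t {..<Suc p} \<le> 1 - r"
      then have "Suc p \<le> p"
        unfolding p_def using Sp by (intro Greatest_le_nat[of _ _ n]) (simp_all only: p_def simp_thms)
      then show False by simp
    qed
    then show ?thesis
      using p sum_atMost_split[of p n t] standard_simplexD(3)[OF assms(1)] by simp
  qed
  then show thesis using that[of p] p by (simp add: in_prism_def)
qed


section \<open>Gluing the prisms into a homotopy on the realisation\<close>

definition prism_point ::
    "'y sset \<Rightarrow> 'x sset \<Rightarrow> (nat \<Rightarrow> (nat \<Rightarrow> nat) \<Rightarrow> 'x \<Rightarrow> 'y) \<Rightarrow> nat \<Rightarrow> 'x \<Rightarrow> nat \<Rightarrow> (nat \<Rightarrow> real) \<Rightarrow>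
     ((nat \<times> 'y) \<times> (nat \<Rightarrow> real)) set" where
  "prism_point Y X H n x p v =
     real_class Y ((Suc n, H (Suc n) (prism_step p) (sact X (Suc n) n (prism_proj p) x)), v)"

context
  fixes X :: "'x sset" and Y :: "'y sset" and H :: "nat \<Rightarrow> (nat \<Rightarrow> nat) \<Rightarrow> 'x \<Rightarrow> 'y"
  assumes X: "sset X" and Y: "sset Y" and H: "simplicial_homotopy X Y H"
begin

lemma prism_simplex:
  "\<lbrakk>x \<in> simps X n; p \<le> n\<rbrakk> \<Longrightarrow>
     H (Suc n) (prism_step p) (sact X (Suc n) n (prism_proj p) x) \<in> simps Y (Suc n)"
  by (intro simplicial_homotopy_closed[OF H] simplex_op_prism_step sset_closed[OF X]
      simplex_op_prism_proj)

text \<open>A section \<open>\<delta>\<close> of \<open>prism_proj p\<close> singles out a copy of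
  the base simplex inside the prism, on which the homotopy parameter runs through \<open>s\<close>.
  Naturality of \<open>H\<close> then leaves \<open>H n s x\<close>. The common face of adjacent
  prisms, the bottom and the top are all of this form.\<close>

lemma prism_face:
  assumes "x \<in> simps X n" "p \<le> n" and \<delta>: "simplex_op n (Suc n) \<delta>"
    and sec: "\<And>i. i \<le> n \<Longrightarrow> prism_proj p (\<delta> i) = i"
    and s: "simplex_op n 1 s" "\<And>i. i \<le> n \<Longrightarrow> prism_step p (\<delta> i) = s i"
  shows "sact Y n (Suc n) \<delta> (H (Suc n) (prism_step p) (sact X (Suc n) n (prism_proj p) x)) = H n s x"
proof -
  have op: "simplex_op (Suc n) n (prism_proj p)"
    by (rule simplex_op_prism_proj[OF assms(2)])
  have sx: "sact X (Suc n) n (prism_proj p) x \<in> simps X (Suc n)"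
    by (rule sset_closed[OF X op assms(1)])
  have 1: "sact X n (Suc n) \<delta> (sact X (Suc n) n (prism_proj p) x) = sact X n n (prism_proj p \<circ> \<delta>) x"
    by (rule sset_comp[OF X \<delta> op assms(1)])
  have 2: "sact X n n (prism_proj p \<circ> \<delta>) x = sact X n n (\<lambda>i. i) x"
    by (rule sset_cong[OF X simplex_op_comp[OF \<delta> op] _ assms(1)]) (simp add: sec)
  have *: "sact X n (Suc n) \<delta> (sact X (Suc n) n (prism_proj p) x) = x"
    by (rule trans[OF 1 trans[OF 2 sset_ident[OF X assms(1)]]])
  have 3: "H n (prism_step p \<circ> \<delta>) x = H n s x"
    by (rule simplicial_homotopy_cong[OF H s(1) _ assms(1), symmetric]) (simp add: s(2))
  show ?thesis
    using simplicial_homotopy_natural[OF H \<delta> simplex_op_prism_step sx, of p]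
    unfolding * by (rule trans[OF sym 3])
qed

lemma prism_point_face:
  assumes "x \<in> simps X n" "p \<le> n" "simplex_op n (Suc n) \<delta>" "t \<in> standard_simplex n"
    and "\<And>i. i \<le> n \<Longrightarrow> prism_proj p (\<delta> i) = i"
    and "simplex_op n 1 s" "\<And>i. i \<le> n \<Longrightarrow> prism_step p (\<delta> i) = s i"
  shows "prism_point Y X H n x p (simplex_push n \<delta> t) = real_class Y ((n, H n s x), t)"
  using prism_face[OF assms(1,2,3,5,6,7)]
    real_class_glue[OF assms(3) prism_simplex[OF assms(1,2)] assms(4)]
  by (simp add: prism_point_def)

text \<open>Adjacent prisms share the face with vertices (0,0), ..., (p,0), (p+1,1), ..., (n,1);
  \<open>\<delta>\<close> skips the index \<open>Suc p\<close>, which is (p,1) in one prism and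
  (p+1,0) in the other. A point in both prisms has coordinate 0 there, so it lies on this
  face.\<close>

lemma prism_point_Suc:
  assumes x: "x \<in> simps X n" and t: "t \<in> standard_simplex n"
    and p: "in_prism n p t r" and Sp: "in_prism n (Suc p) t r"
  shows "prism_point Y X H n x p (prism_coords n p t r) =
     prism_point Y X H n x (Suc p) (prism_coords n (Suc p) t r)"
proof -
  define \<delta> where "\<delta> i = (if i \<le> p then i else Suc i)" for i
  have \<delta>: "simplex_op n (Suc n) \<delta>"
    by (rule simplex_opI) (auto simp: \<delta>_def)
  have le: "p \<le> n" "Suc p \<le> n"
    using p Sp by (auto simp: in_prism_def)
  have 1: "sum t {..<p} + t p \<le> 1 - r" "sum t {p<..n} \<le> r" "1 = sum t {..<p} + t p + sum t {p<..n}"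
    using p Sp sum_atMost_split[OF le(1), of t] standard_simplexD(3)[OF t] by (auto simp: in_prism_def)
  have "{p<..n} = insert (Suc p) {Suc p<..n}"
    using le by auto
  then have 2: "sum t {p<..n} = t (Suc p) + sum t {Suc p<..n}"
    by simp
  have push: "simplex_push n \<delta> t i = (if i \<le> p then t i else if i = Suc p then 0 else t (i - 1))" for i
  proof -
    consider "i \<le> p" | "i = Suc p" | "Suc p < i" "i \<le> Suc n" | "Suc n < i" by linarith
    then show ?thesis
    proof cases
      case 1
      then have "{j. j \<le> n \<and> \<delta> j = i} = {i}" using le by (auto simp: \<delta>_def)
      then show ?thesis using 1 by (simp add: simplex_push_def)
    next
      case 2
      then have "{j. j \<le> n \<and> \<delta> j = i} = {}" by (auto simp: \<delta>_def)
      then have "simplex_push n \<delta> t i = 0" by (simp only: simplex_push_def sum.empty)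
      then show ?thesis using 2 by simp
    next
      case 3
      then have "{j. j \<le> n \<and> \<delta> j = i} = {i - 1}" by (auto simp: \<delta>_def)
      then show ?thesis using 3 by (simp add: simplex_push_def)
    next
      case 4
      then have "{j. j \<le> n \<and> \<delta> j = i} = {}" by (auto simp: \<delta>_def)
      then have "simplex_push n \<delta> t i = 0" by (simp only: simplex_push_def sum.empty)
      then show ?thesis using 4 standard_simplexD(2)[OF t, of "i - 1"] le by simp
    qed
  qed
  have c: "prism_coords n p t r = simplex_push n \<delta> t" "prism_coords n (Suc p) t r = simplex_push n \<delta> t"
    using 1 2 by (auto simp: fun_eq_iff push prism_coords_def)
  have "prism_point Y X H n x p (simplex_push n \<delta> t) = real_class Y ((n, H n (prism_step p) x), t)"
    by (rule prism_point_face[OF x le(1) \<delta> t])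
      (use simplex_op_prism_step in \<open>auto simp: \<delta>_def prism_proj_def prism_step_def\<close>)
  moreover have "prism_point Y X H n x (Suc p) (simplex_push n \<delta> t) = real_class Y ((n, H n (prism_step p) x), t)"
    by (rule prism_point_face[OF x le(2) \<delta> t])
      (use simplex_op_prism_step in \<open>auto simp: \<delta>_def prism_proj_def prism_step_def\<close>)
  ultimately show ?thesis by (simp add: c)
qed

text \<open>The prisms that contain a given point form an interval of indices, because the partial
  sums in \<open>in_prism\<close> are monotone in \<open>p\<close>. So one can walk from
  \<open>p\<close> to \<open>q\<close> through adjacent prisms.\<close>

lemma prism_point_unique:
  assumes x: "x \<in> simps X n" and t: "t \<in> standard_simplex n"
    and "in_prism n p t r" "in_prism n q t r"
  shows "prism_point Y X H n x p (prism_coords n p t r) = prism_point Y X H n x q (prism_coords n q t r)"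
proof -
  have up: "prism_point Y X H n x p (prism_coords n p t r) = prism_point Y X H n x q (prism_coords n q t r)"
    if "p \<le> q" "in_prism n p t r" "in_prism n q t r" for p q
    using that
  proof (induction p rule: inc_induct)
    case (step p)
    have "sum t {..<Suc p} \<le> sum t {..<q}" "sum t {Suc p<..n} \<le> sum t {p<..n}"
      using step.hyps standard_simplexD(1)[OF t] by (auto intro!: sum_mono2 simp del: sum.lessThan_Suc)
    then have Sp: "in_prism n (Suc p) t r"
      using step.hyps step.prems unfolding in_prism_def by linarith
    show ?case
      by (rule trans[OF prism_point_Suc[OF x t step.prems(1) Sp] step.IH[OF Sp step.prems(2)]])
  qed simp
  show ?thesis
  proof (cases "p \<le> q")
    case True
    then show ?thesis by (rule up[OF _ assms(3,4)])
  next
    case False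
    then have "q \<le> p" by simp
    then show ?thesis by (rule up[OF _ assms(4,3), symmetric])
  qed
qed

lemma prism_point_natural:
  assumes y: "y \<in> simps X n" and t: "t \<in> standard_simplex m" and \<beta>: "simplex_op m n \<beta>"
    and p: "in_prism m p t r"
  shows "in_prism n (\<beta> p) (simplex_push m \<beta> t) r"
    and "prism_point Y X H m (sact X m n \<beta> y) p (prism_coords m p t r) =
      prism_point Y X H n y (\<beta> p) (prism_coords n (\<beta> p) (simplex_push m \<beta> t) r)"
proof -
  define v where "v = prism_coords m p t r"
  \<comment> \<open>The map of vertices induced by \<open>\<beta>\<close>: level is kept and the
    base vertex moves by \<open>\<beta>\<close>. In the list of vertices of the prism with index
    \<open>\<beta> p\<close>, a vertex (i,0) has position i and a vertex (i,1) has position i + 1,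
    hence the sum.\<close>
  define e where "e j = \<beta> (prism_proj p j) + prism_step p j" for j
  have pm: "p \<le> m" using p by (simp add: in_prism_def)
  have qn: "\<beta> p \<le> n" using simplex_op_le[OF \<beta> pm] .
  have v: "v \<in> standard_simplex (Suc m)"
    unfolding v_def by (rule prism_coords_standard_simplex[OF t p])
  have op: "simplex_op (Suc m) m (prism_proj p)" "simplex_op (Suc n) n (prism_proj (\<beta> p))"
    using pm qn by (simp_all add: simplex_op_prism_proj)
  have e: "simplex_op (Suc m) (Suc n) e"
  proof (rule simplex_opI)
    fix i j assume ij: "i \<le> j" "j \<le> Suc m"
    then have "prism_proj p i \<le> prism_proj p j" "prism_proj p j \<le> m" "prism_step p i \<le> prism_step p j"
      using pm by (auto simp: prism_proj_def prism_step_def)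
    then show "e i \<le> e j"
      unfolding e_def by (intro add_mono simplex_op_mono[OF \<beta>])
  next
    fix i assume "i \<le> Suc m"
    then have "prism_proj p i \<le> m" "prism_step p i \<le> 1"
      using pm by (auto simp: prism_proj_def prism_step_def)
    then show "e i \<le> Suc n"
      using simplex_op_le[OF \<beta>, of "prism_proj p i"] by (simp add: e_def)
  qed
  have pe: "prism_proj (\<beta> p) (e j) = \<beta> (prism_proj p j)" and se: "prism_step (\<beta> p) (e j) = prism_step p j"
    if "j \<le> Suc m" for j
  proof -
    have "prism_proj (\<beta> p) (e j) = \<beta> (prism_proj p j) \<and> prism_step (\<beta> p) (e j) = prism_step p j"
    proof (cases "j \<le> p")
      case True
      then show ?thesis
        using simplex_op_mono[OF \<beta> True pm] by (simp add: e_def prism_proj_def prism_step_def)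
    next
      case False
      then have "\<beta> p \<le> \<beta> (j - 1)"
        using that by (intro simplex_op_mono[OF \<beta>]) auto
      then show ?thesis
        using False by (simp add: e_def prism_proj_def prism_step_def)
    qed
    then show "prism_proj (\<beta> p) (e j) = \<beta> (prism_proj p j)" "prism_step (\<beta> p) (e j) = prism_step p j"
      by auto
  qed
  have cong: "simplex_push (Suc m) (prism_proj (\<beta> p) \<circ> e) v = simplex_push (Suc m) (\<beta> \<circ> prism_proj p) v"
    unfolding simplex_push_def using pe by (intro ext sum.cong) auto
  have w: "simplex_push (Suc m) e v \<in> standard_simplex (Suc n)"
    by (rule simplex_push_standard_simplex[OF e v])
  have eqt: "simplex_push m \<beta> t = simplex_push (Suc n) (prism_proj (\<beta> p)) (simplex_push (Suc m) e v)"
    unfolding simplex_push_comp[OF e] cong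
    using simplex_push_comp[OF op(1), of \<beta> v] simplex_push_prism_coords[OF t p] by (simp add: v_def)
  have eqr: "r = sum (simplex_push (Suc m) e v) {\<beta> p<..Suc n}"
  proof -
    have "{i. i \<le> Suc m \<and> e i \<in> {\<beta> p<..Suc n}} = {p<..Suc m}"
    proof (rule Set.set_eqI, rule iffI)
      fix i assume i: "i \<in> {i. i \<le> Suc m \<and> e i \<in> {\<beta> p<..Suc n}}"
      then have "prism_step p i = 1"
        using se[of i] by (simp add: prism_step_def)
      then show "i \<in> {p<..Suc m}"
        using i by (simp add: prism_step_def split: if_splits)
    next
      fix i assume i: "i \<in> {p<..Suc m}"
      then have "prism_step (\<beta> p) (e i) = 1"
        using se[of i] by (simp add: prism_step_def)
      then show "i \<in> {i. i \<le> Suc m \<and> e i \<in> {\<beta> p<..Suc n}}"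
        using i simplex_op_le[OF e, of i] by (simp add: prism_step_def split: if_splits)
    qed
    then show ?thesis
      by (simp add: sum_simplex_push v_def sum_prism_coords_upper[OF pm])
  qed
  note u = prism_coords_unique[OF qn w eqt eqr]
  show "in_prism n (\<beta> p) (simplex_push m \<beta> t) r"
    by (rule u(1))
  have 1: "sact X (Suc m) m (prism_proj p) (sact X m n \<beta> y) = sact X (Suc m) n (\<beta> \<circ> prism_proj p) y"
    by (rule sset_comp[OF X op(1) \<beta> y])
  have 2: "sact X (Suc m) n (\<beta> \<circ> prism_proj p) y = sact X (Suc m) n (prism_proj (\<beta> p) \<circ> e) y"
    by (rule sset_cong[OF X simplex_op_comp[OF op(1) \<beta>] _ y]) (simp add: pe)
  have *: "sact X (Suc m) m (prism_proj p) (sact X m n \<beta> y) =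
      sact X (Suc m) (Suc n) e (sact X (Suc n) n (prism_proj (\<beta> p)) y)"
    by (rule trans[OF 1 trans[OF 2 sset_comp[OF X e op(2) y, symmetric]]])
  have yy: "sact X (Suc n) n (prism_proj (\<beta> p)) y \<in> simps X (Suc n)"
    by (rule sset_closed[OF X op(2) y])
  have 3: "H (Suc m) (prism_step p) (sact X (Suc m) (Suc n) e (sact X (Suc n) n (prism_proj (\<beta> p)) y)) =
      H (Suc m) (prism_step (\<beta> p) \<circ> e) (sact X (Suc m) (Suc n) e (sact X (Suc n) n (prism_proj (\<beta> p)) y))"
    by (rule simplicial_homotopy_cong[OF H simplex_op_prism_step _ sset_closed[OF X e yy]]) (simp add: se)
  have 4: "H (Suc m) (prism_step p) (sact X (Suc m) m (prism_proj p) (sact X m n \<beta> y)) =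
      sact Y (Suc m) (Suc n) e (H (Suc n) (prism_step (\<beta> p)) (sact X (Suc n) n (prism_proj (\<beta> p)) y))"
    unfolding * by (rule trans[OF 3 simplicial_homotopy_natural[OF H e simplex_op_prism_step yy]])
  show "prism_point Y X H m (sact X m n \<beta> y) p (prism_coords m p t r) =
      prism_point Y X H n y (\<beta> p) (prism_coords n (\<beta> p) (simplex_push m \<beta> t) r)"
    unfolding prism_point_def 4 u(2)[symmetric] v_def[symmetric]
    by (rule real_class_glue[OF e prism_simplex[OF y qn] v])
qed

text \<open>A point may lie in several prisms; by \<open>prism_point_unique\<close> the choice does
  not affect the value.\<close>

definition homotopy_point where
  "homotopy_point = (\<lambda>(r, ((n, x), t)).
     let p = SOME p. in_prism n p t r in prism_point Y X H n x p (prism_coords n p t r))"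

lemma homotopy_point_eq:
  assumes "x \<in> simps X n" "t \<in> standard_simplex n" "in_prism n p t r"
  shows "homotopy_point (r, ((n, x), t)) = prism_point Y X H n x p (prism_coords n p t r)"
  unfolding homotopy_point_def Let_def prod.case
  by (rule prism_point_unique[OF assms(1,2) someI[of "\<lambda>p. in_prism n p t r", OF assms(3)] assms(3)])

lemma homotopy_point_glue:
  assumes "real_class X a = real_class X b" "0 \<le> r" "r \<le> 1"
  shows "homotopy_point (r, a) = homotopy_point (r, b)"
  using assms(1)
proof (rule glue_invariant)
  fix m n \<alpha> x and t :: "nat \<Rightarrow> real"
  assume a: "simplex_op m n \<alpha>" "x \<in> simps X n" "t \<in> standard_simplex m"
  then obtain p where p: "in_prism m p t r"
    using in_prism_ex assms by blast
  show "homotopy_point (r, ((m, sact X m n \<alpha> x), t)) = homotopy_point (r, ((n, x), simplex_push m \<alpha> t))"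
    using prism_point_natural[OF a(2,3,1) p] homotopy_point_eq[OF _ a(3) p] sset_closed[OF X a(1,2)]
      homotopy_point_eq[OF a(2) simplex_push_standard_simplex[OF a(1,3)]]
    by metis
qed

lemma continuous_map_coordinate: "continuous_map (subtopology (powertop_real UNIV) S) euclideanreal (\<lambda>t. t i)"
  by (intro continuous_map_from_subtopology continuous_map_product_projection) simp

text \<open>Over a single simplex, the prisms are finitely many closed sets covering its product
  with [0,1]; on each the map is continuous because the prism coordinates are, and the pieces agree
  on overlaps.\<close>

lemma continuous_map_homotopy_point:
  "continuous_map (prod_topology (subtopology euclideanreal {0..1}) (pre_realisation X))
     (realisation Y) homotopy_point"
  unfolding pre_realisation_def
proof (rule continuous_map_prod_sum_topology)
  fix i assume "i \<in> (SIGMA n:UNIV. simps X n)"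
  then obtain n x where i: "i = (n, x)" and x: "x \<in> simps X n"
    by auto
  let ?S = "subtopology (powertop_real UNIV) (standard_simplex n)"
  let ?P = "prod_topology (subtopology euclideanreal {0..1}) ?S"
  let ?T = "\<lambda>p. {(r, t) \<in> topspace ?P. in_prism n p t r}"
  let ?f = "\<lambda>p (r, t). prism_point Y X H n x p (prism_coords n p t r)"
  have r: "continuous_map ?P euclideanreal fst"
    using continuous_map_fst continuous_map_into_fulltopology by blast
  have t: "continuous_map ?P euclideanreal (\<lambda>a. snd a i)" for i
    using continuous_map_compose[OF continuous_map_snd continuous_map_coordinate] by (simp add: o_def)
  have "continuous_map ?P (realisation Y) (\<lambda>(r, t). homotopy_point (r, ((n, x), t)))"
  proof (rule pasting_lemma_closed[where I = "{..n}" and T = ?T and f = ?f])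
    show "closedin ?P (?T p)" if "p \<in> {..n}" for p
    proof -
      have "?T p = {a \<in> topspace ?P. sum (snd a) {..<p} + fst a \<in> {..1}} \<inter>
          {a \<in> topspace ?P. sum (snd a) {p<..n} - fst a \<in> {..0}}"
        using that by (auto simp: in_prism_def)
      moreover have "closedin ?P \<dots>"
        by (intro closedin_Int closedin_continuous_map_preimage[where Y = euclideanreal]
            continuous_map_add continuous_map_diff continuous_map_sum r t) auto
      ultimately show ?thesis by simp
    qed
    show "continuous_map (subtopology ?P (?T p)) (realisation Y) (?f p)" if "p \<in> {..n}" for p
    proof -
      have "continuous_map (subtopology ?P (?T p)) euclideanreal (\<lambda>a. prism_coords n p (snd a) (fst a) j)" for j
        unfolding prism_coords_def
        by (cases "j < p"; cases "j = p"; cases "j = Suc p")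
          (simp_all, (intro continuous_map_from_subtopology continuous_map_diff continuous_map_sum r t
            continuous_map_const[THEN iffD2]; simp)+)
      then have "continuous_map (subtopology ?P (?T p))
          (subtopology (powertop_real UNIV) (standard_simplex (Suc n)))
          (\<lambda>(r, t). prism_coords n p t r)"
        by (auto simp: continuous_map_in_subtopology continuous_map_componentwise_UNIV case_prod_beta
            intro: prism_coords_standard_simplex)
      from continuous_map_compose[OF this continuous_map_simplex_inclusion[OF prism_simplex[OF x, of p]]] that
      show ?thesis
        unfolding prism_point_def o_def case_prod_beta by simp
    qed
    show "?f p a = ?f q a" if "a \<in> topspace ?P \<inter> ?T p \<inter> ?T q" for p q a
    proof -
      obtain r t where "a = (r, t)" by (cases a)
      then show ?thesis
        using that prism_point_unique[OF x, of t p r q] by simp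
    qed
    show "\<exists>p. p \<in> {..n} \<and> a \<in> ?T p \<and> (\<lambda>(r, t). homotopy_point (r, ((n, x), t))) a = ?f p a"
      if a: "a \<in> topspace ?P" for a
    proof -
      obtain r t where rt: "a = (r, t)" "0 \<le> r" "r \<le> 1" "t \<in> standard_simplex n"
        using a by (cases a) auto
      then obtain p where "in_prism n p t r"
        using in_prism_ex by blast
      then show ?thesis
        using a rt homotopy_point_eq[OF x] by (intro exI[of _ p]) (auto simp: in_prism_def)
    qed
  qed auto
  then show "continuous_map (prod_topology (subtopology euclideanreal {0..1})
        (case i of (n, _) \<Rightarrow> subtopology (powertop_real UNIV) (standard_simplex n)))
      (realisation Y) (\<lambda>(r, t). homotopy_point (r, (i, t)))"
    by (simp add: i)
qed

text \<open>At level 0 the point lies in the last prism, whose first \<open>n + 1\<close> vertices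
  are the whole bottom. The remaining coordinate, at (n,1), vanishes, so the prism coordinates are
  \<open>t\<close> itself.\<close>

lemma homotopy_point_0:
  assumes "x \<in> simps X n" "t \<in> standard_simplex n"
  shows "homotopy_point (0, ((n, x), t)) = real_class Y ((n, H n (\<lambda>_. 0) x), t)"
proof -
  have s: "sum t {..n} = sum t {..<n} + t n"
    by (metis lessThan_Suc_atMost sum.lessThan_Suc)
  have p: "in_prism n n t 0"
    using standard_simplexD(1)[OF assms(2), of n] standard_simplexD(3)[OF assms(2)] s
    unfolding in_prism_def by simp
  have "simplex_push n (\<lambda>i. i) t = t"
  proof
    fix i
    show "simplex_push n (\<lambda>i. i) t i = t i"
    proof (cases "i \<le> n")
      case True
      then have "{j. j \<le> n \<and> j = i} = {i}" by auto
      then show ?thesis by (simp add: simplex_push_def)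
    next
      case False
      then have "{j. j \<le> n \<and> j = i} = {}" by auto
      then have "simplex_push n (\<lambda>i. i) t i = 0" by (simp only: simplex_push_def sum.empty)
      then show ?thesis using False standard_simplexD(2)[OF assms(2)] by simp
    qed
  qed
  moreover have "prism_coords n n t 0 = t"
    using standard_simplexD[OF assms(2)] s by (auto simp: fun_eq_iff prism_coords_def)
  ultimately have "homotopy_point (0, ((n, x), t)) = prism_point Y X H n x n (simplex_push n (\<lambda>i. i) t)"
    using homotopy_point_eq[OF assms p] by simp
  also have "\<dots> = real_class Y ((n, H n (\<lambda>_. 0) x), t)"
    by (rule prism_point_face[OF assms(1) _ _ assms(2)])
      (auto intro: simplex_opI simp: prism_proj_def prism_step_def)
  finally show ?thesis .
qed

text \<open>At level 1 the point lies in the first prism, with vertices (0,0), (0,1), ..., (n,1).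
  The top is the face that omits index 0, that is, the image of \<open>Suc\<close>.\<close>

lemma homotopy_point_1:
  assumes "x \<in> simps X n" "t \<in> standard_simplex n"
  shows "homotopy_point (1, ((n, x), t)) = real_class Y ((n, H n (\<lambda>_. 1) x), t)"
proof -
  have s: "1 = t 0 + sum t {0<..n}"
    using sum_atMost_split[of 0 n t] standard_simplexD(3)[OF assms(2)] by simp
  have p: "in_prism n 0 t 1"
    using standard_simplexD(1)[OF assms(2), of 0] s by (simp add: in_prism_def)
  have "prism_coords n 0 t 1 = simplex_push n Suc t"
  proof
    fix i
    consider "i = 0" | j where "i = Suc j" "j \<le> n" | j where "i = Suc j" "j > n"
      by (metis not_less not0_implies_Suc)
    then show "prism_coords n 0 t 1 i = simplex_push n Suc t i"
    proof cases
      case 1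
      then show ?thesis by (simp add: simplex_push_def prism_coords_def)
    next
      case 2
      then have "{j. j \<le> n \<and> Suc j = i} = {j}" by auto
      then show ?thesis using 2 s by (simp add: simplex_push_def prism_coords_def)
    next
      case 3
      then have "{j. j \<le> n \<and> Suc j = i} = {}" by auto
      then have "simplex_push n Suc t i = 0" by (simp only: simplex_push_def sum.empty)
      then show ?thesis using 3 standard_simplexD(2)[OF assms(2)] by (simp add: prism_coords_def)
    qed
  qed
  then have "homotopy_point (1, ((n, x), t)) = prism_point Y X H n x 0 (simplex_push n Suc t)"
    using homotopy_point_eq[OF assms p] by simp
  also have "\<dots> = real_class Y ((n, H n (\<lambda>_. 1) x), t)"
    by (rule prism_point_face[OF assms(1) _ _ assms(2)])
      (auto intro: simplex_opI simp: prism_proj_def prism_step_def)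
  finally show ?thesis .
qed

lemma homotopic_realisation_map:
  assumes f: "sset_map X Y f" and g: "sset_map X Y g"
    and f0: "\<And>n x. x \<in> simps X n \<Longrightarrow> H n (\<lambda>_. 0) x = f n x"
    and g1: "\<And>n x. x \<in> simps X n \<Longrightarrow> H n (\<lambda>_. 1) x = g n x"
  shows "homotopic_with (\<lambda>_. True) (realisation X) (realisation Y) (realisation_map Y f) (realisation_map Y g)"
proof -
  let ?I = "subtopology euclideanreal {0..1}"
  let ?q = "\<lambda>(r::real, a). (r, real_class X a)"
  \<comment> \<open>The product of a quotient map with a locally compact Hausdorff space is again a
    quotient map. For [0,1] this makes the homotopy on \<open>pre_realisation\<close> descend to the
    realisation, once it respects the gluings.\<close>
  have lc: "locally_compact_space ?I"
    by (intro compact_imp_locally_compact_space compact_space_subtopology)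
      (simp add: compactin_euclidean_iff)
  have q: "quotient_map (prod_topology ?I (pre_realisation X)) (prod_topology ?I (realisation X)) ?q"
    by (rule quotient_map_prod_right[OF lc _ quotient_real_class]) (simp add: Hausdorff_space_subtopology)
  have eq: "homotopy_point a = homotopy_point b"
    if "a \<in> topspace (prod_topology ?I (pre_realisation X))"
       "b \<in> topspace (prod_topology ?I (pre_realisation X))" "?q a = ?q b" for a b
  proof -
    have "fst a = fst b" "real_class X (snd a) = real_class X (snd b)" "0 \<le> fst a" "fst a \<le> 1"
      using that by (auto simp del: topspace_prod_topology simp: case_prod_beta topspace_prod_topology)
    then show ?thesis
      using homotopy_point_glue[of "snd a" "snd b" "fst a"] by (metis prod.collapse)
  qed
  obtain h where h: "continuous_map (prod_topology ?I (realisation X)) (realisation Y) h"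
    and hq: "\<And>a. a \<in> topspace (prod_topology ?I (pre_realisation X)) \<Longrightarrow> h (?q a) = homotopy_point a"
  proof (rule quotient_map_lift_exists[OF q continuous_map_homotopy_point])
    fix a b assume "a \<in> topspace (prod_topology ?I (pre_realisation X))"
       "b \<in> topspace (prod_topology ?I (pre_realisation X))" "?q a = ?q b"
    then show "homotopy_point a = homotopy_point b"
      by (rule eq)
  next
    fix h assume "continuous_map (prod_topology ?I (realisation X)) (realisation Y) h"
      "\<And>a. a \<in> topspace (prod_topology ?I (pre_realisation X)) \<Longrightarrow> h (?q a) = homotopy_point a"
    then show thesis by (rule that)
  qed
  show ?thesis
  proof (subst homotopic_with, simp, intro exI[of _ h] conjI ballI TrueI)
    show "continuous_map (prod_topology ?I (realisation X)) (realisation Y) h"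
      by (rule h)
  next
    fix c assume "c \<in> topspace (realisation X)"
    then obtain n x t where c: "x \<in> simps X n" "t \<in> standard_simplex n" "c = real_class X ((n, x), t)"
      by (rule realisation_cases)
    show "h (0, c) = realisation_map Y f c"
      using hq[of "(0, ((n, x), t))"] c homotopy_point_0[OF c(1,2)] f0[OF c(1)]
      by (simp add: topspace_pre_realisation realisation_map_class[OF f X Y])
    show "h (1, c) = realisation_map Y g c"
      using hq[of "(1, ((n, x), t))"] c homotopy_point_1[OF c(1,2)] g1[OF c(1)]
      by (simp add: topspace_pre_realisation realisation_map_class[OF g X Y])
  qed
qed

end

text \<open>A map is homotopic to itself by the constant simplicial homotopy, and
  \<open>homotopic_with\<close> includes continuity of its ends.\<close>

lemma continuous_map_realisation_map:
  assumes f: "sset_map X Y f" and X: "sset X" and Y: "sset Y"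
  shows "continuous_map (realisation X) (realisation Y) (realisation_map Y f)"
proof -
  have "simplicial_homotopy X Y (\<lambda>n s. f n)"
    unfolding simplicial_homotopy_def
  proof (intro conjI allI impI ballI)
    fix m n \<alpha> s x assume "simplex_op m n \<alpha> \<and> simplex_op n 1 s" "x \<in> simps X n"
    then show "f m (sact X m n \<alpha> x) = sact Y m n \<alpha> (f n x)"
      by (intro sset_map_natural[OF f]) simp_all
  next
    fix n s x assume "x \<in> simps X n"
    then show "f n x \<in> simps Y n"
      by (rule sset_map_closed[OF f])
  qed (rule refl)
  from homotopic_realisation_map[OF X Y this f f refl refl]
  show ?thesis
    by (rule homotopic_with_imp_continuous_maps[THEN conjunct1])
qed

section \<open>Homotopic maps of simplicial sets\<close>

definition edge_eq :: "'x sset \<Rightarrow> 'x rel" where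
  "edge_eq X = (pi0_rel X \<union> (pi0_rel X)\<inverse>)\<^sup>*"

lemma edge_eq_refl [simp]: "(a, a) \<in> edge_eq X"
  by (simp add: edge_eq_def)

lemma edge_eq_sym: "(a, b) \<in> edge_eq X \<Longrightarrow> (b, a) \<in> edge_eq X"
  unfolding edge_eq_def using sym_rtrancl[OF sym_Un_converse] by (metis symD)

lemma edge_eq_trans: "\<lbrakk>(a, b) \<in> edge_eq X; (b, c) \<in> edge_eq X\<rbrakk> \<Longrightarrow> (a, c) \<in> edge_eq X"
  unfolding edge_eq_def by (rule rtrancl_trans)

lemma edge_eq_edge:
  "e \<in> simps X 1 \<Longrightarrow> (sact X 0 1 (\<lambda>_. 0) e, sact X 0 1 (\<lambda>_. 1) e) \<in> edge_eq X"
  unfolding edge_eq_def pi0_rel_def by (rule r_into_rtrancl) auto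

lemma edge_eq_induct [consumes 1, case_names edge refl sym trans]:
  assumes "(a, b) \<in> edge_eq X"
    and "\<And>e. e \<in> simps X 1 \<Longrightarrow> P (sact X 0 1 (\<lambda>_. 0) e) (sact X 0 1 (\<lambda>_. 1) e)"
    and "P a a" "\<And>a b. P a b \<Longrightarrow> P b a" "\<And>a b c. P a b \<Longrightarrow> P b c \<Longrightarrow> P a c"
  shows "P a b"
  using assms(1) unfolding edge_eq_def
proof induction
  case base
  show ?case by fact
next
  case (step b c)
  then have "P b c"
    using assms(2,4) by (auto simp: pi0_rel_def)
  then show ?case
    using step assms(5) by blast
qed

lemma pi0_class_eq_iff: "pi0_class X a = pi0_class X b \<longleftrightarrow> (a, b) \<in> edge_eq X"
proof
  assume "pi0_class X a = pi0_class X b"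
  moreover have "b \<in> pi0_class X b"
    unfolding pi0_class_def by simp
  ultimately show "(a, b) \<in> edge_eq X"
    by (auto simp: pi0_class_def edge_eq_def)
next
  assume "(a, b) \<in> edge_eq X"
  then show "pi0_class X a = pi0_class X b"
    unfolding pi0_class_def edge_eq_def[symmetric]
    by (auto intro: edge_eq_trans edge_eq_sym)
qed

lemma mem_pi0_class: "b \<in> pi0_class X a \<longleftrightarrow> (a, b) \<in> edge_eq X"
  by (simp add: pi0_class_def edge_eq_def)

lemma pi0_class_nonempty: "pi0_class X a \<noteq> {}"
  using mem_pi0_class[of a X a] by auto

lemma simplex_op_const: "c \<le> n \<Longrightarrow> simplex_op m n (\<lambda>_. c)"
  by (rule simplex_opI) auto

lemma edge_eq_simps:
  assumes "sset X" "(a, b) \<in> edge_eq X" "a \<in> simps X 0"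
  shows "b \<in> simps X 0"
  using assms(2) unfolding edge_eq_def
proof induction
  case (step b c)
  then obtain e where "e \<in> simps X 1" "c = sact X 0 1 (\<lambda>_. 0) e \<or> c = sact X 0 1 (\<lambda>_. 1) e"
    by (auto simp: pi0_rel_def)
  then show ?case
    using sset_closed[OF assms(1) simplex_op_const[of 0 1 0]] sset_closed[OF assms(1) simplex_op_const[of 1 1 0]]
    by auto
qed (fact assms(3))

lemma edge_eq_map:
  assumes "sset_map X Y f" "(a, b) \<in> edge_eq X"
  shows "(f 0 a, f 0 b) \<in> edge_eq Y"
  using assms(2)
proof (induction rule: edge_eq_induct)
  case (edge e)
  show ?case
    using edge_eq_edge[OF sset_map_closed[OF assms(1) edge]]
      sset_map_natural[OF assms(1) simplex_op_const[of 0 1 0] edge]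
      sset_map_natural[OF assms(1) simplex_op_const[of 1 1 0] edge]
    by simp
qed (auto intro: edge_eq_sym edge_eq_trans)

lemma sset_map_comp:
  "\<lbrakk>sset_map X Y f; sset_map Y Z g\<rbrakk> \<Longrightarrow> sset_map X Z (\<lambda>n x. g n (f n x))"
  unfolding sset_map_def by simp

lemma sset_map_id: "sset_map X X (\<lambda>n x. x)"
  by (simp add: sset_map_def)

text \<open>The last clause records the effect on components: \<open>\<pi>\<^sub>0\<close> of a
  simplicial category is defined by edges of the mapping spaces, not by paths in their realisations,
  so it is carried along instead of being extracted from the topological homotopy.\<close>

definition homotopic_maps ::
    "'x sset \<Rightarrow> 'y sset \<Rightarrow> (nat \<Rightarrow> 'x \<Rightarrow> 'y) \<Rightarrow> (nat \<Rightarrow> 'x \<Rightarrow> 'y) \<Rightarrow> bool" where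
  "homotopic_maps X Y f g \<longleftrightarrow> sset X \<and> sset Y \<and> sset_map X Y f \<and> sset_map X Y g \<and>
     homotopic_with (\<lambda>_. True) (realisation X) (realisation Y) (realisation_map Y f) (realisation_map Y g) \<and>
     (\<forall>v\<in>simps X 0. (f 0 v, g 0 v) \<in> edge_eq Y)"

lemma homotopic_maps_simplicial:
  assumes X: "sset X" and Y: "sset Y" and H: "simplicial_homotopy X Y H"
    and f: "sset_map X Y f" and g: "sset_map X Y g"
    and H0: "\<And>n x. x \<in> simps X n \<Longrightarrow> H n (\<lambda>_. 0) x = f n x"
    and H1: "\<And>n x. x \<in> simps X n \<Longrightarrow> H n (\<lambda>_. 1) x = g n x"
  shows "homotopic_maps X Y f g"
proof -
  have "(f 0 v, g 0 v) \<in> edge_eq Y" if v: "v \<in> simps X 0" for v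
  proof -
    \<comment> \<open>The nondegenerate edge of the interval. Applying \<open>H\<close> to it and to
      the degenerate edge at \<open>v\<close> gives an edge from \<open>f 0 v\<close> to
      \<open>g 0 v\<close>.\<close>
    let ?i = "\<lambda>i::nat. if i = 0 then 0 else (1::nat)"
    define d where "d = sact X 1 0 (\<lambda>_. 0) v"
    define e where "e = H 1 ?i d"
    have i: "simplex_op 1 1 ?i"
      by (rule simplex_opI) auto
    have d: "d \<in> simps X 1"
      unfolding d_def by (rule sset_closed[OF X simplex_op_const v]) simp
    have e: "e \<in> simps Y 1"
      unfolding e_def by (rule simplicial_homotopy_closed[OF H i d])
    have v': "sact X 0 1 (\<lambda>_. c) d = v" if "c \<le> 1" for c
      using sset_comp[OF X simplex_op_const[OF that, of 0] simplex_op_const[of 0 0 1] v]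
        sset_cong[OF X simplex_op_const[of 0 0 0] _ v, of "\<lambda>i. i"] sset_ident[OF X v]
      by (simp add: d_def o_def)
    have "sact Y 0 1 (\<lambda>_. c) e = H 0 (\<lambda>_. ?i c) v" if "c \<le> 1" for c
      using simplicial_homotopy_natural[OF H simplex_op_const[OF that, of 0] i d]
      by (simp add: e_def v'[OF that] o_def del: One_nat_def)
    from this[of 0] this[of 1] have "sact Y 0 1 (\<lambda>_. 0) e = f 0 v" "sact Y 0 1 (\<lambda>_. 1) e = g 0 v"
      using H0[OF v] H1[OF v] by simp_all
    then show ?thesis
      using edge_eq_edge[OF e] by simp
  qed
  then show ?thesis
    unfolding homotopic_maps_def using assms homotopic_realisation_map[OF X Y H f g H0 H1] by blast
qed

text \<open>Two functions may describe the same map of simplicial sets and still differ off the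
  simplices. This lemma allows equational rewriting inside a chain of homotopies.\<close>

lemma homotopic_maps_eq:
  assumes X: "sset X" and Y: "sset Y" and f: "sset_map X Y f" 
    and fg: "\<And>n x. x \<in> simps X n \<Longrightarrow> f n x = g n x"
  shows "homotopic_maps X Y f g"
proof (rule homotopic_maps_simplicial[OF X Y _ f])
  show "sset_map X Y g"
    unfolding sset_map_def
  proof (intro conjI allI ballI impI)
    fix n x assume x: "x \<in> simps X n"
    then show "g n x \<in> simps Y n"
      using sset_map_closed[OF f x] fg[OF x] by simp
    fix m \<alpha> assume "simplex_op m n \<alpha>"
    then show "g m (sact X m n \<alpha> x) = sact Y m n \<alpha> (g n x)"
      using sset_map_natural[OF f _ x] fg[OF x] fg[OF sset_closed[OF X _ x]] by metis
  qed
  show "simplicial_homotopy X Y (\<lambda>n s. f n)"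
    unfolding simplicial_homotopy_def
    by (auto intro: sset_map_closed[OF f] sset_map_natural[OF f])
qed (auto simp: fg)

lemma homotopic_maps_refl: "\<lbrakk>sset X; sset Y; sset_map X Y f\<rbrakk> \<Longrightarrow> homotopic_maps X Y f f"
  by (rule homotopic_maps_eq) auto

lemma homotopic_maps_sym: "homotopic_maps X Y f g \<Longrightarrow> homotopic_maps X Y g f"
  unfolding homotopic_maps_def by (auto simp: homotopic_with_sym intro: edge_eq_sym)

lemma homotopic_maps_trans [trans]:
  "\<lbrakk>homotopic_maps X Y f g; homotopic_maps X Y g h\<rbrakk> \<Longrightarrow> homotopic_maps X Y f h"
  unfolding homotopic_maps_def by (meson homotopic_with_trans edge_eq_trans)

lemma realisation_map_comp:
  assumes "sset X" "sset Y" "sset Z" "sset_map X Y f" "sset_map Y Z g" "c \<in> topspace (realisation X)"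
  shows "realisation_map Z (\<lambda>n x. g n (f n x)) c = realisation_map Z g (realisation_map Y f c)"
proof -
  obtain n x t where c: "x \<in> simps X n" "t \<in> standard_simplex n" "c = real_class X ((n, x), t)"
    using assms(6) by (rule realisation_cases)
  show ?thesis
    unfolding c(3) realisation_map_class[OF assms(4,1,2) c(1,2)]
      realisation_map_class[OF assms(5,2,3) sset_map_closed[OF assms(4) c(1)] c(2)]
      realisation_map_class[OF sset_map_comp[OF assms(4,5)] assms(1,3) c(1,2)]
    by (rule refl)
qed

lemma realisation_map_id:
  assumes "sset X" "c \<in> topspace (realisation X)"
  shows "realisation_map X (\<lambda>n x. x) c = c"
proof -
  obtain n x t where c: "x \<in> simps X n" "t \<in> standard_simplex n" "c = real_class X ((n, x), t)"
    using assms(2) by (rule realisation_cases)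
  show ?thesis
    unfolding c(3) realisation_map_class[OF sset_map_id assms(1,1) c(1,2)] by (rule refl)
qed

lemma homotopic_maps_post:
  assumes "homotopic_maps X Y f g" "sset_map Y Z h" "sset Z"
  shows "homotopic_maps X Z (\<lambda>n x. h n (f n x)) (\<lambda>n x. h n (g n x))"
proof -
  have a: "sset X" "sset Y" "sset_map X Y f" "sset_map X Y g"
    using assms(1) by (auto simp: homotopic_maps_def)
  have "homotopic_with (\<lambda>_. True) (realisation X) (realisation Z)
      (realisation_map Z h \<circ> realisation_map Y f) (realisation_map Z h \<circ> realisation_map Y g)"
    by (rule homotopic_with_compose_continuous_map_left[where p = "\<lambda>_. True", OF _ continuous_map_realisation_map[OF assms(2) a(2) assms(3)]])
      (use assms(1) in \<open>simp_all add: homotopic_maps_def\<close>)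
  then have "homotopic_with (\<lambda>_. True) (realisation X) (realisation Z)
      (realisation_map Z (\<lambda>n x. h n (f n x))) (realisation_map Z (\<lambda>n x. h n (g n x)))"
    by (rule homotopic_with_eq)
      (simp_all add: realisation_map_comp[OF a(1,2) assms(3) a(3) assms(2)]
         realisation_map_comp[OF a(1,2) assms(3) a(4) assms(2)])
  then show ?thesis
    using assms a sset_map_comp[OF a(3) assms(2)] sset_map_comp[OF a(4) assms(2)]
    unfolding homotopic_maps_def by (auto intro: edge_eq_map)
qed

lemma homotopic_maps_pre:
  assumes "homotopic_maps X Y f g" "sset_map W X h" "sset W"
  shows "homotopic_maps W Y (\<lambda>n x. f n (h n x)) (\<lambda>n x. g n (h n x))"
proof -
  have a: "sset X" "sset Y" "sset_map X Y f" "sset_map X Y g"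
    using assms(1) by (auto simp: homotopic_maps_def)
  have "homotopic_with (\<lambda>_. True) (realisation W) (realisation Y)
      (realisation_map Y f \<circ> realisation_map X h) (realisation_map Y g \<circ> realisation_map X h)"
    by (rule homotopic_with_compose_continuous_map_right[where p = "\<lambda>_. True", OF _ continuous_map_realisation_map[OF assms(2,3) a(1)]])
      (use assms(1) in \<open>simp_all add: homotopic_maps_def\<close>)
  then have "homotopic_with (\<lambda>_. True) (realisation W) (realisation Y)
      (realisation_map Y (\<lambda>n x. f n (h n x))) (realisation_map Y (\<lambda>n x. g n (h n x)))"
    by (rule homotopic_with_eq)
      (simp_all add: realisation_map_comp[OF assms(3) a(1,2) assms(2) a(3)]
         realisation_map_comp[OF assms(3) a(1,2) assms(2) a(4)])
  then show ?thesis
    using assms a sset_map_comp[OF assms(2) a(3)] sset_map_comp[OF assms(2) a(4)]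
      sset_map_closed[OF assms(2)]
    unfolding homotopic_maps_def by auto
qed

lemma sset_weqI:
  assumes f: "sset_map X Y f" and g: "sset_map Y X g"
    and gf: "homotopic_maps X X (\<lambda>n x. g n (f n x)) (\<lambda>n x. x)"
    and fg: "homotopic_maps Y Y (\<lambda>n x. f n (g n x)) (\<lambda>n x. x)"
  shows "sset_weq X Y f"
proof -
  have X: "sset X" and Y: "sset Y"
    using gf fg by (auto simp: homotopic_maps_def)
  have 1: "homotopic_with (\<lambda>_. True) (realisation X) (realisation X) (realisation_map X g \<circ> realisation_map Y f) id"
    by (rule homotopic_with_eq[of "\<lambda>_. True" _ _ "realisation_map X (\<lambda>n x. g n (f n x))" "realisation_map X (\<lambda>n x. x)"])
      (use gf in \<open>simp_all add: homotopic_maps_def realisation_map_comp[OF X Y X f g] realisation_map_id[OF X]\<close>)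
  have 2: "homotopic_with (\<lambda>_. True) (realisation Y) (realisation Y) (realisation_map Y f \<circ> realisation_map X g) id"
    by (rule homotopic_with_eq[of "\<lambda>_. True" _ _ "realisation_map Y (\<lambda>n x. f n (g n x))" "realisation_map Y (\<lambda>n x. x)"])
      (use fg in \<open>simp_all add: homotopic_maps_def realisation_map_comp[OF Y X Y g f] realisation_map_id[OF Y]\<close>)
  show ?thesis
    unfolding sset_weq_def
    using f continuous_map_realisation_map[OF f X Y] continuous_map_realisation_map[OF g Y X] 1 2 by blast
qed

text \<open>The inverse of \<open>f\<close> is \<open>a g\<close>. One composite is the hypothesis
  \<open>agf\<close>; for the other, insert the left inverse \<open>c\<close> of \<open>g\<close>:
  \<open>f a g\<close> is homotopic to \<open>c g f a g\<close>, hence by \<open>gfa\<close> to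
  \<open>c g\<close>, hence to the identity.\<close>

lemma sset_weq_two_of_six:
  assumes f: "sset_map X Y f" and g: "sset_map Y Z g" and a: "sset_map Z X a" and c: "sset_map Z Y c"
    and agf: "homotopic_maps X X (\<lambda>n x. a n (g n (f n x))) (\<lambda>n x. x)"
    and gfa: "homotopic_maps Z Z (\<lambda>n x. g n (f n (a n x))) (\<lambda>n x. x)"
    and cg: "homotopic_maps Y Y (\<lambda>n x. c n (g n x)) (\<lambda>n x. x)"
  shows "sset_weq X Y f"
proof (rule sset_weqI[OF f sset_map_comp[OF g a] agf])
  have Y: "sset Y" using cg by (simp add: homotopic_maps_def)
  have "homotopic_maps Y Y (\<lambda>n x. f n (a n (g n x))) (\<lambda>n x. c n (g n (f n (a n (g n x)))))"
    by (rule homotopic_maps_sym, rule homotopic_maps_pre[OF cg _ Y])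
      (intro sset_map_comp[OF g] sset_map_comp[OF a f])
  also have "homotopic_maps Y Y (\<lambda>n x. c n (g n (f n (a n (g n x))))) (\<lambda>n x. c n (g n x))"
    using homotopic_maps_post[OF homotopic_maps_pre[OF gfa g Y] c Y] .
  also note cg
  finally show "homotopic_maps Y Y (\<lambda>n x. f n (a n (g n x))) (\<lambda>n x. x)" .
qed


section \<open>Simplicial categories\<close>

definition degen :: "('o, 'x) scat \<Rightarrow> 'o \<Rightarrow> 'o \<Rightarrow> nat \<Rightarrow> 'x \<Rightarrow> 'x" where
  "degen S x y k z = sact (smap S x y) k 0 (\<lambda>_. 0) z"

text \<open>The record \<open>scat\<close> has no axioms; these are the laws of a category enriched
  in simplicial sets. The identity is stored as a vertex and enters in dimension \<open>k\<close>
  through its degeneracy.\<close>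

locale simplicial_category =
  fixes S :: "('o, 'x) scat"
  assumes hom_sset: "\<lbrakk>x \<in> sobs S; y \<in> sobs S\<rbrakk> \<Longrightarrow> sset (smap S x y)"
    and sidt_in: "x \<in> sobs S \<Longrightarrow> sidt S x \<in> simps (smap S x x) 0"
    and scmp_in: "\<lbrakk>x \<in> sobs S; y \<in> sobs S; z \<in> sobs S; f \<in> simps (smap S x y) k; g \<in> simps (smap S y z) k\<rbrakk> \<Longrightarrow>
       scmp S x y z k g f \<in> simps (smap S x z) k"
    and sact_scmp: "\<lbrakk>x \<in> sobs S; y \<in> sobs S; z \<in> sobs S; simplex_op m n \<alpha>;
       f \<in> simps (smap S x y) n; g \<in> simps (smap S y z) n\<rbrakk> \<Longrightarrow>
       sact (smap S x z) m n \<alpha> (scmp S x y z n g f) =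
       scmp S x y z m (sact (smap S y z) m n \<alpha> g) (sact (smap S x y) m n \<alpha> f)"
    and scmp_assoc: "\<lbrakk>x \<in> sobs S; y \<in> sobs S; z \<in> sobs S; w \<in> sobs S; f \<in> simps (smap S x y) k;
       g \<in> simps (smap S y z) k; h \<in> simps (smap S z w) k\<rbrakk> \<Longrightarrow>
       scmp S x z w k h (scmp S x y z k g f) = scmp S x y w k (scmp S y z w k h g) f"
    and scmp_ident_right: "\<lbrakk>x \<in> sobs S; y \<in> sobs S; f \<in> simps (smap S x y) k\<rbrakk> \<Longrightarrow>
       scmp S x x y k f (degen S x x k (sidt S x)) = f"
    and scmp_ident_left: "\<lbrakk>x \<in> sobs S; y \<in> sobs S; f \<in> simps (smap S x y) k\<rbrakk> \<Longrightarrow>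
       scmp S x y y k (degen S y y k (sidt S y)) f = f"
begin

abbreviation "hs x y \<equiv> simps (smap S x y)"
abbreviation "hv x y \<equiv> simps (smap S x y) 0"

lemma degen_in: "\<lbrakk>x \<in> sobs S; y \<in> sobs S; z \<in> hv x y\<rbrakk> \<Longrightarrow> degen S x y k z \<in> hs x y k"
  unfolding degen_def by (rule sset_closed[OF hom_sset simplex_op_const]) auto

lemma sact_degen:
  "\<lbrakk>x \<in> sobs S; y \<in> sobs S; z \<in> hv x y; simplex_op m n \<alpha>\<rbrakk> \<Longrightarrow>
     sact (smap S x y) m n \<alpha> (degen S x y n z) = degen S x y m z"
  unfolding degen_def
  by (subst sset_comp[OF hom_sset _ simplex_op_const]) (auto simp: o_def)

lemma degen_0: "\<lbrakk>x \<in> sobs S; y \<in> sobs S; z \<in> hv x y\<rbrakk> \<Longrightarrow> degen S x y 0 z = z"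
  unfolding degen_def
  using sset_cong[OF hom_sset simplex_op_const[of 0 0 0], of x y "\<lambda>i. i" z] sset_ident[OF hom_sset, of x y z 0]
  by simp

lemma degen_scmp:
  "\<lbrakk>x \<in> sobs S; y \<in> sobs S; w \<in> sobs S; a \<in> hv x y; b \<in> hv y w\<rbrakk> \<Longrightarrow>
     degen S x w k (scmp S x y w 0 b a) = scmp S x y w k (degen S y w k b) (degen S x y k a)"
  unfolding degen_def by (rule sact_scmp) (auto intro: simplex_op_const)

lemma sset_map_post:
  assumes "x \<in> sobs S" "y \<in> sobs S" "w \<in> sobs S" "z \<in> hv y w"
  shows "sset_map (smap S x y) (smap S x w) (\<lambda>k h. scmp S x y w k (degen S y w k z) h)"
  unfolding sset_map_def
  using scmp_in[OF assms(1-3) _ degen_in[OF assms(2-4)]]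
    sact_scmp[OF assms(1-3) _ _ degen_in[OF assms(2-4)]] sact_degen[OF assms(2-4)]
  by simp

text \<open>Composition with a vertex depends, up to homotopy, only on its component. Along one edge
  this is a simplicial homotopy; the general case follows along the path of edges.\<close>

lemma homotopic_post_edge:
  assumes o: "x \<in> sobs S" "y \<in> sobs S" "w \<in> sobs S" and z: "z \<in> hv y w" and zz: "(z, z') \<in> edge_eq (smap S y w)"
  shows "homotopic_maps (smap S x y) (smap S x w)
    (\<lambda>k h. scmp S x y w k (degen S y w k z) h) (\<lambda>k h. scmp S x y w k (degen S y w k z') h)"
proof -
  have "z \<in> hv y w \<longrightarrow> z' \<in> hv y w \<longrightarrow> homotopic_maps (smap S x y) (smap S x w)
    (\<lambda>k h. scmp S x y w k (degen S y w k z) h) (\<lambda>k h. scmp S x y w k (degen S y w k z') h)"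
    using zz unfolding edge_eq_def
  proof induction
    case base
    show ?case
      using o by (auto intro!: homotopic_maps_refl hom_sset sset_map_post)
  next
    case (step b c)
    have bv: "z \<in> hv y w \<Longrightarrow> b \<in> hv y w"
      using edge_eq_simps[OF hom_sset[OF o(2,3)]] step(1) by (auto simp: edge_eq_def)
    have edge: "homotopic_maps (smap S x y) (smap S x w)
       (\<lambda>k h. scmp S x y w k (degen S y w k (sact (smap S y w) 0 1 (\<lambda>_. 0) e)) h)
       (\<lambda>k h. scmp S x y w k (degen S y w k (sact (smap S y w) 0 1 (\<lambda>_. 1) e)) h)"
      if e: "e \<in> hs y w 1" for e
    \<comment> \<open>The interval parameter \<open>s\<close> pulls the edge \<open>e\<close> back
      to a \<open>k\<close>-simplex; composing \<open>h\<close> with it moves from one end of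
      \<open>e\<close> to the other.\<close>
    proof (rule homotopic_maps_simplicial[where H = "\<lambda>k s h. scmp S x y w k (sact (smap S y w) k 1 s e) h"])
      have se: "sact (smap S y w) k 1 s e \<in> hs y w k" if "simplex_op k 1 s" for k s
        by (rule sset_closed[OF hom_sset[OF o(2,3)] that e])
      show "simplicial_homotopy (smap S x y) (smap S x w) (\<lambda>k s h. scmp S x y w k (sact (smap S y w) k 1 s e) h)"
        unfolding simplicial_homotopy_def
      proof (intro conjI allI impI ballI)
        fix n s h assume "simplex_op n 1 s" "h \<in> hs x y n"
        then show "scmp S x y w n (sact (smap S y w) n 1 s e) h \<in> hs x w n"
          by (intro scmp_in o se)
      next
        fix m n \<alpha> s h assume "simplex_op m n \<alpha> \<and> simplex_op n 1 s" "h \<in> hs x y n"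
        then show "scmp S x y w m (sact (smap S y w) m 1 (s \<circ> \<alpha>) e) (sact (smap S x y) m n \<alpha> h) =
            sact (smap S x w) m n \<alpha> (scmp S x y w n (sact (smap S y w) n 1 s e) h)"
          using sact_scmp[OF o, of m n \<alpha> h "sact (smap S y w) n 1 s e"] se[of n s]
            sset_comp[OF hom_sset[OF o(2,3)], of m n \<alpha> 1 s e] e by simp
      next
        fix n s s' h assume "simplex_op n 1 s \<and> (\<forall>i\<le>n. s i = s' i)" "h \<in> hs x y n"
        then show "scmp S x y w n (sact (smap S y w) n 1 s e) h = scmp S x y w n (sact (smap S y w) n 1 s' e) h"
          using sset_cong[OF hom_sset[OF o(2,3)], of n 1 s s' e] e by simp
      qed
      have d: "sact (smap S y w) k 1 (\<lambda>_. c) e = degen S y w k (sact (smap S y w) 0 1 (\<lambda>_. c) e)" if "c \<le> 1" for k c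
        unfolding degen_def
        using sset_comp[OF hom_sset[OF o(2,3)] simplex_op_const[of 0 0 k] simplex_op_const[OF that] e]
        by (simp add: o_def)
      show "scmp S x y w k (sact (smap S y w) k 1 (\<lambda>_. 0) e) h =
          scmp S x y w k (degen S y w k (sact (smap S y w) 0 1 (\<lambda>_. 0) e)) h" for k h
        using d[of 0 k] by simp
      show "scmp S x y w k (sact (smap S y w) k 1 (\<lambda>_. 1) e) h =
          scmp S x y w k (degen S y w k (sact (smap S y w) 0 1 (\<lambda>_. 1) e)) h" for k h
        using d[of 1 k] by simp
    qed (use e in \<open>auto intro!: hom_sset o sset_map_post sset_closed[OF hom_sset simplex_op_const]\<close>)
    show ?case
    proof (intro impI)
      assume zc: "z \<in> hv y w" "c \<in> hv y w"
      have "homotopic_maps (smap S x y) (smap S x w)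
        (\<lambda>k h. scmp S x y w k (degen S y w k b) h) (\<lambda>k h. scmp S x y w k (degen S y w k c) h)"
        using step(2) edge by (auto simp: pi0_rel_def intro: homotopic_maps_sym)
      with step.IH zc bv show "homotopic_maps (smap S x y) (smap S x w)
        (\<lambda>k h. scmp S x y w k (degen S y w k z) h) (\<lambda>k h. scmp S x y w k (degen S y w k c) h)"
        using homotopic_maps_trans by blast
    qed
  qed
  then show ?thesis
    using z edge_eq_simps[OF hom_sset[OF o(2,3)] zz z] by blast
qed


text \<open>Passing to the opposite turns statements about postcomposition into statements about
  precomposition, so only the former are proved directly.\<close>

definition op_scat where
  "op_scat = \<lparr>sobs = sobs S, smap = (\<lambda>x y. smap S y x), sidt = sidt S,
     scmp = (\<lambda>x y z k g f. scmp S z y x k f g)\<rparr>"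

lemma op_scat_simps: "sobs op_scat = sobs S" "smap op_scat x y = smap S y x" "sidt op_scat = sidt S"
    "scmp op_scat x y z k g f = scmp S z y x k f g"
  by (simp_all add: op_scat_def)

lemma degen_op: "degen op_scat x y = degen S y x"
  by (simp add: degen_def op_scat_simps fun_eq_iff)

lemma simplicial_category_op: "simplicial_category op_scat"
  by unfold_locales
    (auto simp: op_scat_simps degen_op intro: hom_sset sidt_in scmp_in sact_scmp scmp_assoc[symmetric]
      scmp_ident_left scmp_ident_right)

lemma sset_map_pre:
  "\<lbrakk>x \<in> sobs S; y \<in> sobs S; w \<in> sobs S; z \<in> hv x y\<rbrakk> \<Longrightarrow>
     sset_map (smap S y w) (smap S x w) (\<lambda>k h. scmp S x y w k h (degen S x y k z))"
  using simplicial_category.sset_map_post[OF simplicial_category_op, of w y x z]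
  by (simp add: op_scat_simps degen_op)

lemma homotopic_post:
  "\<lbrakk>homotopic_maps X (smap S x y) f g; x \<in> sobs S; y \<in> sobs S; w \<in> sobs S; z \<in> hv y w\<rbrakk> \<Longrightarrow>
     homotopic_maps X (smap S x w) (\<lambda>k h. scmp S x y w k (degen S y w k z) (f k h))
       (\<lambda>k h. scmp S x y w k (degen S y w k z) (g k h))"
  by (rule homotopic_maps_post[OF _ sset_map_post hom_sset])

lemma homotopic_pre:
  "\<lbrakk>homotopic_maps X (smap S y w) f g; x \<in> sobs S; y \<in> sobs S; w \<in> sobs S; z \<in> hv x y\<rbrakk> \<Longrightarrow>
     homotopic_maps X (smap S x w) (\<lambda>k h. scmp S x y w k (f k h) (degen S x y k z))
       (\<lambda>k h. scmp S x y w k (g k h) (degen S x y k z))"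
  by (rule homotopic_maps_post[OF _ sset_map_pre hom_sset])

lemma edge_eq_post:
  "\<lbrakk>(f, g) \<in> edge_eq (smap S x y); x \<in> sobs S; y \<in> sobs S; w \<in> sobs S; z \<in> hv y w\<rbrakk> \<Longrightarrow>
     (scmp S x y w 0 z f, scmp S x y w 0 z g) \<in> edge_eq (smap S x w)"
  using edge_eq_map[OF sset_map_post] degen_0[of y w z] by fastforce

lemma edge_eq_pre:
  "\<lbrakk>(f, g) \<in> edge_eq (smap S y w); x \<in> sobs S; y \<in> sobs S; w \<in> sobs S; z \<in> hv x y\<rbrakk> \<Longrightarrow>
     (scmp S x y w 0 f z, scmp S x y w 0 g z) \<in> edge_eq (smap S x w)"
  using edge_eq_map[OF sset_map_pre] degen_0[of x y z] by fastforce

text \<open>Only the class of \<open>z' z\<close> in \<open>\<pi>\<^sub>0\<close> is known to be the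
  identity; by \<open>homotopic_post_edge\<close> that suffices to cancel the pair up to homotopy of
  maps.\<close>

lemma homotopic_post_cancel:
  assumes f: "sset_map X (smap S x y) f" and X: "sset X" and o: "x \<in> sobs S" "y \<in> sobs S" "w \<in> sobs S"
    and z: "z \<in> hv y w" "z' \<in> hv w y" and e: "(scmp S y w y 0 z' z, sidt S y) \<in> edge_eq (smap S y y)"
  shows "homotopic_maps X (smap S x y)
    (\<lambda>k h. scmp S x w y k (degen S w y k z') (scmp S x y w k (degen S y w k z) (f k h))) f"
proof -
  have "homotopic_maps X (smap S x y)
      (\<lambda>k h. scmp S x w y k (degen S w y k z') (scmp S x y w k (degen S y w k z) (f k h)))
      (\<lambda>k h. scmp S x y y k (degen S y y k (scmp S y w y 0 z' z)) (f k h))"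
    by (rule homotopic_maps_eq[OF X hom_sset[OF o(1,2)]
        sset_map_comp[OF sset_map_comp[OF f sset_map_post[OF o z(1)]] sset_map_post[OF o(1,3,2) z(2)]]])
      (simp add: degen_scmp o z scmp_assoc degen_in sset_map_closed[OF f])
  also have "homotopic_maps X (smap S x y) \<dots> (\<lambda>k h. scmp S x y y k (degen S y y k (sidt S y)) (f k h))"
    by (rule homotopic_maps_pre[OF homotopic_post_edge[OF o(1,2,2) _ e] f X])
      (intro scmp_in[OF o(2,3,2)] z)
  also have "homotopic_maps X (smap S x y) \<dots> f"
    by (rule homotopic_maps_eq[OF X hom_sset[OF o(1,2)]
        sset_map_comp[OF f sset_map_post[OF o(1,2,2) sidt_in[OF o(2)]]]])
      (simp add: o scmp_ident_left sset_map_closed[OF f])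
  finally show ?thesis .
qed

lemma homotopic_pre_cancel:
  "\<lbrakk>sset_map X (smap S y x) f; sset X; x \<in> sobs S; y \<in> sobs S; w \<in> sobs S;
    z \<in> hv w y; z' \<in> hv y w; (scmp S y w y 0 z z', sidt S y) \<in> edge_eq (smap S y y)\<rbrakk> \<Longrightarrow>
    homotopic_maps X (smap S y x)
      (\<lambda>k h. scmp S y w x k (scmp S w y x k (f k h) (degen S w y k z)) (degen S y w k z')) f"
  using simplicial_category.homotopic_post_cancel[OF simplicial_category_op, of X x y f w z z']
  by (simp add: op_scat_simps degen_op)

end

section \<open>Homotopic simplicial functors\<close>

text \<open>The maps of \<open>P\<close> and \<open>Q\<close> on the space from \<open>x\<close> to
  \<open>y\<close> have different targets. Composition with \<open>z\<close> brings both into the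
  space from \<open>P x\<close> to \<open>Q y\<close>, where they are compared. The homotopies are
  given for each pair of objects separately, with no coherence among them.\<close>

definition natural_up_to_homotopy ::
    "('o, 'x) scat \<Rightarrow> ('p, 'y) scat \<Rightarrow> ('o, 'x, 'p, 'y) sfctr \<Rightarrow> ('o, 'x, 'p, 'y) sfctr \<Rightarrow>
     ('o \<Rightarrow> 'y) \<Rightarrow> bool" where
  "natural_up_to_homotopy S T P Q z \<longleftrightarrow>
     (\<forall>x\<in>sobs S. z x \<in> simps (smap T (sonob P x) (sonob Q x)) 0) \<and>
     (\<forall>x\<in>sobs S. \<forall>y\<in>sobs S. homotopic_maps (smap S x y) (smap T (sonob P x) (sonob Q y))
        (\<lambda>k h. scmp T (sonob P x) (sonob P y) (sonob Q y) k (degen T (sonob P y) (sonob Q y) k (z y)) (sonmap P x y k h))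
        (\<lambda>k h. scmp T (sonob P x) (sonob Q x) (sonob Q y) k (sonmap Q x y k h) (degen T (sonob P x) (sonob Q x) k (z x))))"

definition inverse_up_to_homotopy ::
    "('o, 'x) scat \<Rightarrow> ('p, 'y) scat \<Rightarrow> ('o, 'x, 'p, 'y) sfctr \<Rightarrow> ('o, 'x, 'p, 'y) sfctr \<Rightarrow>
     ('o \<Rightarrow> 'y) \<Rightarrow> ('o \<Rightarrow> 'y) \<Rightarrow> bool" where
  "inverse_up_to_homotopy S T P Q z z' \<longleftrightarrow>
     (\<forall>x\<in>sobs S. (scmp T (sonob P x) (sonob Q x) (sonob P x) 0 (z' x) (z x), sidt T (sonob P x))
        \<in> edge_eq (smap T (sonob P x) (sonob P x)))"

definition premap :: "('o, 'x) scat \<Rightarrow> ('p, 'y) scat \<Rightarrow> ('o, 'x, 'p, 'y) sfctr \<Rightarrow> bool" where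
  "premap S T P \<longleftrightarrow> (\<forall>x\<in>sobs S. sonob P x \<in> sobs T) \<and>
     (\<forall>x\<in>sobs S. \<forall>y\<in>sobs S. sset_map (smap S x y) (smap T (sonob P x) (sonob P y)) (sonmap P x y))"

text \<open>Naturality is demanded of \<open>z\<close> alone; for its inverse \<open>z'\<close> it
  is derived, which makes the relation symmetric. Invertibility is meant in
  \<open>\<pi>\<^sub>0\<close>.\<close>

definition homotopic_sfctrs ::
    "('o, 'x) scat \<Rightarrow> ('p, 'y) scat \<Rightarrow> ('o, 'x, 'p, 'y) sfctr \<Rightarrow> ('o, 'x, 'p, 'y) sfctr \<Rightarrow> bool" where
  "homotopic_sfctrs S T P Q \<longleftrightarrow> premap S T P \<and> premap S T Q \<and>
     (\<exists>z z'. natural_up_to_homotopy S T P Q z \<and>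
        (\<forall>x\<in>sobs S. z' x \<in> simps (smap T (sonob Q x) (sonob P x)) 0) \<and>
        inverse_up_to_homotopy S T P Q z z' \<and> inverse_up_to_homotopy S T Q P z' z)"

context
  fixes S :: "('o, 'x) scat" and T :: "('p, 'y) scat"
  assumes S: "simplicial_category S" and T: "simplicial_category T"
begin

interpretation S: simplicial_category S by (rule S)
interpretation T: simplicial_category T by (rule T)

text \<open>The usual conjugation, up to homotopy: \<open>z' Q\<close> becomes
  \<open>z' Q z z'\<close>, then \<open>z' z P z'\<close> by naturality of \<open>z\<close>, then
  \<open>P z'\<close>.\<close>

lemma natural_up_to_homotopy_inverse:
  assumes N: "natural_up_to_homotopy S T P Q z" and P: "premap S T P" and Q: "premap S T Q"
    and z': "\<And>x. x \<in> sobs S \<Longrightarrow> z' x \<in> simps (smap T (sonob Q x) (sonob P x)) 0"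
    and e1: "inverse_up_to_homotopy S T P Q z z'" and e2: "inverse_up_to_homotopy S T Q P z' z"
  shows "natural_up_to_homotopy S T Q P z'"
  unfolding natural_up_to_homotopy_def
proof (intro conjI ballI z')
  fix x y assume xy: "x \<in> sobs S" "y \<in> sobs S"
  define Px Py Qx Qy where o_def: "Px = sonob P x" "Py = sonob P y" "Qx = sonob Q x" "Qy = sonob Q y"
  have o: "Px \<in> sobs T" "Py \<in> sobs T" "Qx \<in> sobs T" "Qy \<in> sobs T"
    using P Q xy by (auto simp: premap_def o_def)
  have zx: "z x \<in> T.hv Px Qx" and zy: "z y \<in> T.hv Py Qy"
    using N xy by (auto simp: natural_up_to_homotopy_def o_def)
  have zx': "z' x \<in> T.hv Qx Px" and zy': "z' y \<in> T.hv Qy Py"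
    using z' xy by (auto simp: o_def)
  have X: "sset (smap S x y)"
    by (rule S.hom_sset[OF xy])
  have p: "sset_map (smap S x y) (smap T Px Py) (sonmap P x y)" and q: "sset_map (smap S x y) (smap T Qx Qy) (sonmap Q x y)"
    using P Q xy by (auto simp: premap_def o_def)
  have N': "homotopic_maps (smap S x y) (smap T Px Qy)
      (\<lambda>k h. scmp T Px Py Qy k (degen T Py Qy k (z y)) (sonmap P x y k h))
      (\<lambda>k h. scmp T Px Qx Qy k (sonmap Q x y k h) (degen T Px Qx k (z x)))"
    using N xy by (auto simp: natural_up_to_homotopy_def o_def)
  have zq: "sset_map (smap S x y) (smap T Qx Py) (\<lambda>k h. scmp T Qx Qy Py k (degen T Qy Py k (z' y)) (sonmap Q x y k h))"
    by (rule sset_map_comp[OF q T.sset_map_post[OF o(3,4,2) zy']])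
  have "homotopic_maps (smap S x y) (smap T Qx Py)
     (\<lambda>k h. scmp T Qx Qy Py k (degen T Qy Py k (z' y)) (sonmap Q x y k h))
     (\<lambda>k h. scmp T Qx Px Py k (scmp T Px Qx Py k (scmp T Qx Qy Py k (degen T Qy Py k (z' y)) (sonmap Q x y k h))
        (degen T Px Qx k (z x))) (degen T Qx Px k (z' x)))"
    using e2 xy by (intro homotopic_maps_sym[OF T.homotopic_pre_cancel[OF zq X o(2,3,1) zx zx']])
      (simp add: inverse_up_to_homotopy_def o_def)
  also have "homotopic_maps (smap S x y) (smap T Qx Py) \<dots>
     (\<lambda>k h. scmp T Qx Px Py k (scmp T Px Qy Py k (degen T Qy Py k (z' y)) (scmp T Px Qx Qy k (sonmap Q x y k h)
        (degen T Px Qx k (z x)))) (degen T Qx Px k (z' x)))"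
    by (rule homotopic_maps_eq[OF X T.hom_sset[OF o(3,2)]
        sset_map_comp[OF sset_map_comp[OF zq T.sset_map_pre[OF o(1,3,2) zx]] T.sset_map_pre[OF o(3,1,2) zx']]])
      (simp add: T.scmp_assoc o zx zy' T.degen_in sset_map_closed[OF q])
  also have "homotopic_maps (smap S x y) (smap T Qx Py) \<dots>
     (\<lambda>k h. scmp T Qx Px Py k (scmp T Px Qy Py k (degen T Qy Py k (z' y))
        (scmp T Px Py Qy k (degen T Py Qy k (z y)) (sonmap P x y k h))) (degen T Qx Px k (z' x)))"
    by (rule T.homotopic_pre[OF T.homotopic_post[OF homotopic_maps_sym[OF N'] o(1,4,2) zy'] o(3,1,2) zx'])
  also have "homotopic_maps (smap S x y) (smap T Qx Py) \<dots>
     (\<lambda>k h. scmp T Qx Px Py k (sonmap P x y k h) (degen T Qx Px k (z' x)))"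
    using e1 xy by (intro T.homotopic_pre[OF T.homotopic_post_cancel[OF p X o(1,2,4) zy zy'] o(3,1,2) zx'])
      (simp add: inverse_up_to_homotopy_def o_def)
  finally show "homotopic_maps (smap S x y) (smap T (sonob Q x) (sonob P y))
     (\<lambda>k h. scmp T (sonob Q x) (sonob Q y) (sonob P y) k (degen T (sonob Q y) (sonob P y) k (z' y)) (sonmap Q x y k h))
     (\<lambda>k h. scmp T (sonob Q x) (sonob P x) (sonob P y) k (sonmap P x y k h) (degen T (sonob Q x) (sonob P x) k (z' x)))"
    by (simp only: o_def)
qed

lemma homotopic_sfctrs_sym: "homotopic_sfctrs S T P Q \<Longrightarrow> homotopic_sfctrs S T Q P"
proof -
  assume "homotopic_sfctrs S T P Q"
  then obtain z z' where z: "natural_up_to_homotopy S T P Q z" "premap S T P" "premap S T Q"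
      "\<And>x. x \<in> sobs S \<Longrightarrow> z' x \<in> T.hv (sonob Q x) (sonob P x)"
      "inverse_up_to_homotopy S T P Q z z'" "inverse_up_to_homotopy S T Q P z' z"
    by (auto simp: homotopic_sfctrs_def)
  have "\<forall>x\<in>sobs S. z x \<in> T.hv (sonob P x) (sonob Q x)"
    using z(1) by (simp add: natural_up_to_homotopy_def)
  with natural_up_to_homotopy_inverse[OF z] z show ?thesis
    unfolding homotopic_sfctrs_def by blast
qed

lemma natural_up_to_homotopy_trans:
  assumes N: "natural_up_to_homotopy S T P Q u" "natural_up_to_homotopy S T Q R v"
    and P: "premap S T P" and Q: "premap S T Q" and R: "premap S T R"
  shows "natural_up_to_homotopy S T P R (\<lambda>x. scmp T (sonob P x) (sonob Q x) (sonob R x) 0 (v x) (u x))"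
  unfolding natural_up_to_homotopy_def
proof (intro conjI ballI)
  have o: "x \<in> sobs S \<Longrightarrow> sonob P x \<in> sobs T" "x \<in> sobs S \<Longrightarrow> sonob Q x \<in> sobs T"
     "x \<in> sobs S \<Longrightarrow> sonob R x \<in> sobs T" for x
    using P Q R by (auto simp: premap_def)
  have u: "x \<in> sobs S \<Longrightarrow> u x \<in> T.hv (sonob P x) (sonob Q x)" and v: "x \<in> sobs S \<Longrightarrow> v x \<in> T.hv (sonob Q x) (sonob R x)" for x
    using N by (auto simp: natural_up_to_homotopy_def)
  show "scmp T (sonob P x) (sonob Q x) (sonob R x) 0 (v x) (u x) \<in> T.hv (sonob P x) (sonob R x)" if "x \<in> sobs S" for x
    using that by (intro T.scmp_in o u v)
  fix x y assume xy: "x \<in> sobs S" "y \<in> sobs S"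
  define Px Py Qx Qy Rx Ry where n: "Px = sonob P x" "Py = sonob P y" "Qx = sonob Q x" "Qy = sonob Q y"
    "Rx = sonob R x" "Ry = sonob R y"
  note o' = o[OF xy(1), folded n] o[OF xy(2), folded n]
  note uv = u[OF xy(1), folded n] u[OF xy(2), folded n] v[OF xy(1), folded n] v[OF xy(2), folded n]
  have X: "sset (smap S x y)"
    by (rule S.hom_sset[OF xy])
  have p: "sset_map (smap S x y) (smap T Px Py) (sonmap P x y)" and q: "sset_map (smap S x y) (smap T Qx Qy) (sonmap Q x y)"
    and r: "sset_map (smap S x y) (smap T Rx Ry) (sonmap R x y)"
    using P Q R xy by (auto simp: premap_def n)
  have N1: "homotopic_maps (smap S x y) (smap T Px Qy)
      (\<lambda>k h. scmp T Px Py Qy k (degen T Py Qy k (u y)) (sonmap P x y k h))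
      (\<lambda>k h. scmp T Px Qx Qy k (sonmap Q x y k h) (degen T Px Qx k (u x)))"
    using N(1) xy by (auto simp: natural_up_to_homotopy_def n)
  have N2: "homotopic_maps (smap S x y) (smap T Qx Ry)
      (\<lambda>k h. scmp T Qx Qy Ry k (degen T Qy Ry k (v y)) (sonmap Q x y k h))
      (\<lambda>k h. scmp T Qx Rx Ry k (sonmap R x y k h) (degen T Qx Rx k (v x)))"
    using N(2) xy by (auto simp: natural_up_to_homotopy_def n)
  have "homotopic_maps (smap S x y) (smap T Px Ry)
     (\<lambda>k h. scmp T Px Py Ry k (degen T Py Ry k (scmp T Py Qy Ry 0 (v y) (u y))) (sonmap P x y k h))
     (\<lambda>k h. scmp T Px Qy Ry k (degen T Qy Ry k (v y)) (scmp T Px Py Qy k (degen T Py Qy k (u y)) (sonmap P x y k h)))"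
    by (rule homotopic_maps_eq[OF X T.hom_sset sset_map_comp[OF p T.sset_map_post]])
      (simp_all add: o' uv T.scmp_in T.degen_scmp T.scmp_assoc T.degen_in sset_map_closed[OF p])
  also have "homotopic_maps (smap S x y) (smap T Px Ry) \<dots>
     (\<lambda>k h. scmp T Px Qy Ry k (degen T Qy Ry k (v y)) (scmp T Px Qx Qy k (sonmap Q x y k h) (degen T Px Qx k (u x))))"
    by (rule T.homotopic_post[OF N1]) (simp_all add: o' uv)
  also have "homotopic_maps (smap S x y) (smap T Px Ry) \<dots>
     (\<lambda>k h. scmp T Px Qx Ry k (scmp T Qx Qy Ry k (degen T Qy Ry k (v y)) (sonmap Q x y k h)) (degen T Px Qx k (u x)))"
    by (rule homotopic_maps_eq[OF X T.hom_sset sset_map_comp[OF sset_map_comp[OF q T.sset_map_pre] T.sset_map_post]])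
      (simp_all add: o' uv T.scmp_assoc T.degen_in sset_map_closed[OF q])
  also have "homotopic_maps (smap S x y) (smap T Px Ry) \<dots>
     (\<lambda>k h. scmp T Px Qx Ry k (scmp T Qx Rx Ry k (sonmap R x y k h) (degen T Qx Rx k (v x))) (degen T Px Qx k (u x)))"
    by (rule T.homotopic_pre[OF N2]) (simp_all add: o' uv)
  also have "homotopic_maps (smap S x y) (smap T Px Ry) \<dots>
     (\<lambda>k h. scmp T Px Rx Ry k (sonmap R x y k h) (degen T Px Rx k (scmp T Px Qx Rx 0 (v x) (u x))))"
    by (rule homotopic_maps_eq[OF X T.hom_sset sset_map_comp[OF sset_map_comp[OF r T.sset_map_pre] T.sset_map_pre]])
      (simp_all add: o' uv T.degen_scmp T.scmp_assoc T.degen_in sset_map_closed[OF r])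
  finally show "homotopic_maps (smap S x y) (smap T (sonob P x) (sonob R y))
     (\<lambda>k h. scmp T (sonob P x) (sonob P y) (sonob R y) k
        (degen T (sonob P y) (sonob R y) k (scmp T (sonob P y) (sonob Q y) (sonob R y) 0 (v y) (u y))) (sonmap P x y k h))
     (\<lambda>k h. scmp T (sonob P x) (sonob R x) (sonob R y) k (sonmap R x y k h)
        (degen T (sonob P x) (sonob R x) k (scmp T (sonob P x) (sonob Q x) (sonob R x) 0 (v x) (u x))))"
    by (simp only: n)
qed

lemma inverse_up_to_homotopy_trans:
  assumes "inverse_up_to_homotopy S T P Q u u'" "inverse_up_to_homotopy S T Q R v v'"
    and u: "\<And>x. x \<in> sobs S \<Longrightarrow> u x \<in> T.hv (sonob P x) (sonob Q x)"
    and u': "\<And>x. x \<in> sobs S \<Longrightarrow> u' x \<in> T.hv (sonob Q x) (sonob P x)"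
    and v: "\<And>x. x \<in> sobs S \<Longrightarrow> v x \<in> T.hv (sonob Q x) (sonob R x)"
    and v': "\<And>x. x \<in> sobs S \<Longrightarrow> v' x \<in> T.hv (sonob R x) (sonob Q x)"
    and P: "premap S T P" and Q: "premap S T Q" and R: "premap S T R"
  shows "inverse_up_to_homotopy S T P R
     (\<lambda>x. scmp T (sonob P x) (sonob Q x) (sonob R x) 0 (v x) (u x))
     (\<lambda>x. scmp T (sonob R x) (sonob Q x) (sonob P x) 0 (u' x) (v' x))"
  unfolding inverse_up_to_homotopy_def
proof
  fix x assume x: "x \<in> sobs S"
  define p q r where n: "p = sonob P x" "q = sonob Q x" "r = sonob R x"
  have o: "p \<in> sobs T" "q \<in> sobs T" "r \<in> sobs T"
    using P Q R x by (auto simp: premap_def n)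
  note h = u[OF x, folded n] u'[OF x, folded n] v[OF x, folded n] v'[OF x, folded n]
  have 1: "(scmp T p q p 0 (u' x) (u x), sidt T p) \<in> edge_eq (smap T p p)"
    and 2: "(scmp T q r q 0 (v' x) (v x), sidt T q) \<in> edge_eq (smap T q q)"
    using assms(1,2) x by (auto simp: inverse_up_to_homotopy_def n)
  have "scmp T p r p 0 (scmp T r q p 0 (u' x) (v' x)) (scmp T p q r 0 (v x) (u x)) =
     scmp T p q p 0 (u' x) (scmp T p q q 0 (scmp T q r q 0 (v' x) (v x)) (u x))"
    using o h by (simp add: T.scmp_assoc[symmetric] T.scmp_in)
  moreover have "(scmp T p q p 0 (u' x) (scmp T p q q 0 (scmp T q r q 0 (v' x) (v x)) (u x)),
       scmp T p q p 0 (u' x) (scmp T p q q 0 (sidt T q) (u x))) \<in> edge_eq (smap T p p)"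
    by (intro T.edge_eq_post T.edge_eq_pre 2 o h)
  moreover have "scmp T p q q 0 (sidt T q) (u x) = u x"
    using T.scmp_ident_left[OF o(1,2) h(1)] T.degen_0[OF o(2,2) T.sidt_in[OF o(2)]] by simp
  ultimately show "(scmp T (sonob P x) (sonob R x) (sonob P x) 0
       (scmp T (sonob R x) (sonob Q x) (sonob P x) 0 (u' x) (v' x))
       (scmp T (sonob P x) (sonob Q x) (sonob R x) 0 (v x) (u x)), sidt T (sonob P x)) \<in> edge_eq (smap T (sonob P x) (sonob P x))"
    using 1 by (simp add: n edge_eq_trans)
qed

lemma homotopic_sfctrs_trans:
  assumes "homotopic_sfctrs S T P Q" "homotopic_sfctrs S T Q R"
  shows "homotopic_sfctrs S T P R"
proof -
  obtain u u' where u: "natural_up_to_homotopy S T P Q u"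
      "\<And>x. x \<in> sobs S \<Longrightarrow> u' x \<in> T.hv (sonob Q x) (sonob P x)"
      "inverse_up_to_homotopy S T P Q u u'" "inverse_up_to_homotopy S T Q P u' u"
    using assms(1) by (auto simp: homotopic_sfctrs_def)
  obtain v v' where v: "natural_up_to_homotopy S T Q R v"
      "\<And>x. x \<in> sobs S \<Longrightarrow> v' x \<in> T.hv (sonob R x) (sonob Q x)"
      "inverse_up_to_homotopy S T Q R v v'" "inverse_up_to_homotopy S T R Q v' v"
    using assms(2) by (auto simp: homotopic_sfctrs_def)
  have m: "premap S T P" "premap S T Q" "premap S T R"
    using assms by (auto simp: homotopic_sfctrs_def)
  have uv: "\<And>x. x \<in> sobs S \<Longrightarrow> u x \<in> T.hv (sonob P x) (sonob Q x)"
      "\<And>x. x \<in> sobs S \<Longrightarrow> v x \<in> T.hv (sonob Q x) (sonob R x)"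
    using u(1) v(1) by (auto simp: natural_up_to_homotopy_def)
  have "\<forall>x\<in>sobs S. scmp T (sonob R x) (sonob Q x) (sonob P x) 0 (u' x) (v' x) \<in> T.hv (sonob R x) (sonob P x)"
    using m u(2) v(2) by (auto simp: premap_def intro!: T.scmp_in)
  moreover note natural_up_to_homotopy_trans[OF u(1) v(1) m]
  moreover have "inverse_up_to_homotopy S T P R (\<lambda>x. scmp T (sonob P x) (sonob Q x) (sonob R x) 0 (v x) (u x))
      (\<lambda>x. scmp T (sonob R x) (sonob Q x) (sonob P x) 0 (u' x) (v' x))"
    by (rule inverse_up_to_homotopy_trans[OF u(3) v(3) uv(1) u(2) uv(2) v(2) m])
  moreover have "inverse_up_to_homotopy S T R P (\<lambda>x. scmp T (sonob R x) (sonob Q x) (sonob P x) 0 (u' x) (v' x))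
      (\<lambda>x. scmp T (sonob P x) (sonob Q x) (sonob R x) 0 (v x) (u x))"
    by (rule inverse_up_to_homotopy_trans[OF v(4) u(4) v(2) uv(2) u(2) uv(1) m(3,2,1)])
  ultimately show ?thesis
    unfolding homotopic_sfctrs_def using m by (intro conjI exI) assumption+
qed

end

section \<open>Equivalences of simplicial categories\<close>

definition id_sfctr :: "('o, 'x, 'o, 'x) sfctr" where
  "id_sfctr = \<lparr>sonob = (\<lambda>x. x), sonmap = (\<lambda>_ _ _ h. h)\<rparr>"

definition comp_sfctr :: "('p, 'y, 'q, 'w) sfctr \<Rightarrow> ('o, 'x, 'p, 'y) sfctr \<Rightarrow> ('o, 'x, 'q, 'w) sfctr" where
  "comp_sfctr G F = \<lparr>sonob = (\<lambda>x. sonob G (sonob F x)),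
     sonmap = (\<lambda>x y k h. sonmap G (sonob F x) (sonob F y) k (sonmap F x y k h))\<rparr>"

definition simplicial_functor :: "('o, 'x) scat \<Rightarrow> ('p, 'y) scat \<Rightarrow> ('o, 'x, 'p, 'y) sfctr \<Rightarrow> bool" where
  "simplicial_functor S T F \<longleftrightarrow> premap S T F \<and>
     (\<forall>x\<in>sobs S. sonmap F x x 0 (sidt S x) = sidt T (sonob F x)) \<and>
     (\<forall>x\<in>sobs S. \<forall>y\<in>sobs S. \<forall>z\<in>sobs S. \<forall>k. \<forall>f\<in>simps (smap S x y) k. \<forall>g\<in>simps (smap S y z) k.
        sonmap F x z k (scmp S x y z k g f) =
        scmp T (sonob F x) (sonob F y) (sonob F z) k (sonmap F y z k g) (sonmap F x y k f))"

lemma homs_pi0_cat: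
  "homs (pi0_cat S) x y = {(x, y, pi0_class (smap S x y) h) | h. x \<in> sobs S \<and> y \<in> sobs S \<and> h \<in> simps (smap S x y) 0}"
  by (auto simp: homs_def pi0_cat_def)

text \<open>Composition in \<open>pi0_cat\<close> is a union over representatives. Edge-equivalent
  factors have edge-equivalent composites, so the union is a single class.\<close>

lemma pi0_cat_cmp:
  assumes S: "simplicial_category S" and o: "x \<in> sobs S" "y \<in> sobs S" "z \<in> sobs S"
    and f: "f \<in> simps (smap S x y) 0" and g: "g \<in> simps (smap S y z) 0"
  shows "(y, z, pi0_class (smap S y z) g) \<cdot>\<^bsub>pi0_cat S\<^esub> (x, y, pi0_class (smap S x y) f) =
    (x, z, pi0_class (smap S x z) (scmp S x y z 0 g f))"
proof -
  interpret S: simplicial_category S by (rule S)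
  have "pi0_class (smap S x z) (scmp S x y z 0 g' f') = pi0_class (smap S x z) (scmp S x y z 0 g f)"
    if g': "g' \<in> pi0_class (smap S y z) g" and f': "f' \<in> pi0_class (smap S x y) f" for g' f'
  proof -
    have e: "(g, g') \<in> edge_eq (smap S y z)" "(f, f') \<in> edge_eq (smap S x y)"
      using that by (simp_all add: mem_pi0_class)
    have "f' \<in> S.hv x y"
      by (rule edge_eq_simps[OF S.hom_sset[OF o(1,2)] e(2) f])
    then have "(scmp S x y z 0 g f', scmp S x y z 0 g' f') \<in> edge_eq (smap S x z)"
      by (rule S.edge_eq_pre[OF e(1) o])
    then show ?thesis
      unfolding pi0_class_eq_iff by (rule edge_eq_sym[OF edge_eq_trans[OF S.edge_eq_post[OF e(2) o g]]])
  qed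
  then have "(\<Union>g'\<in>pi0_class (smap S y z) g. \<Union>f'\<in>pi0_class (smap S x y) f. pi0_class (smap S x z) (scmp S x y z 0 g' f')) =
    (\<Union>g'\<in>pi0_class (smap S y z) g. \<Union>f'\<in>pi0_class (smap S x y) f. pi0_class (smap S x z) (scmp S x y z 0 g f))"
    by (intro SUP_cong refl) blast
  then show ?thesis
    using pi0_class_nonempty[of "smap S y z" g] pi0_class_nonempty[of "smap S x y" f]
    by (simp add: pi0_cat_def)
qed

lemma pi0_cat_idt: "idt (pi0_cat S) x = (x, x, pi0_class (smap S x x) (sidt S x))"
  by (simp add: pi0_cat_def)

lemma pi0_fctr_class:
  assumes "sset_map (smap S x y) (smap T (sonob F x) (sonob F y)) (sonmap F x y)"
  shows "onar (pi0_fctr T F) (x, y, pi0_class (smap S x y) h) =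
    (sonob F x, sonob F y, pi0_class (smap T (sonob F x) (sonob F y)) (sonmap F x y 0 h))"
proof -
  have "pi0_class (smap T (sonob F x) (sonob F y)) (sonmap F x y 0 h') =
      pi0_class (smap T (sonob F x) (sonob F y)) (sonmap F x y 0 h)" if "h' \<in> pi0_class (smap S x y) h" for h'
    unfolding pi0_class_eq_iff using that edge_eq_map[OF assms]
    by (auto simp: mem_pi0_class intro: edge_eq_sym)
  then show ?thesis
    using pi0_class_nonempty[of "smap S x y" h] by (simp add: pi0_fctr_def)
qed

lemma is_functor_pi0_fctr:
  assumes S: "simplicial_category S" and T: "simplicial_category T" and F: "simplicial_functor S T F"
  shows "is_functor (pi0_cat S) (pi0_cat T) (pi0_fctr T F)"
proof -
  interpret S: simplicial_category S by (rule S)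
  interpret T: simplicial_category T by (rule T)
  have o: "x \<in> sobs S \<Longrightarrow> sonob F x \<in> sobs T" and m: "\<lbrakk>x \<in> sobs S; y \<in> sobs S\<rbrakk> \<Longrightarrow>
      sset_map (smap S x y) (smap T (sonob F x) (sonob F y)) (sonmap F x y)" for x y
    using F by (auto simp: simplicial_functor_def premap_def)
  have ob: "onob (pi0_fctr T F) = sonob F" "obs (pi0_cat S) = sobs S" "obs (pi0_cat T) = sobs T"
    by (simp_all add: pi0_fctr_def pi0_cat_def)
  show ?thesis
    unfolding is_functor_def ob
  proof (intro conjI ballI allI)
    fix x assume x: "x \<in> sobs S"
    show "sonob F x \<in> sobs T" by (rule o[OF x])
    show "onar (pi0_fctr T F) (idt (pi0_cat S) x) = idt (pi0_cat T) (sonob F x)"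
      using F x by (simp add: pi0_cat_idt pi0_fctr_class[where S = S, OF m[OF x x]] simplicial_functor_def)
  next
    fix x y f assume "f \<in> homs (pi0_cat S) x y"
    then obtain h where h: "x \<in> sobs S" "y \<in> sobs S" "h \<in> S.hv x y" "f = (x, y, pi0_class (smap S x y) h)"
      by (auto simp: homs_pi0_cat)
    show "onar (pi0_fctr T F) f \<in> homs (pi0_cat T) (sonob F x) (sonob F y)"
      unfolding h(4) pi0_fctr_class[where S = S, OF m[OF h(1,2)]] homs_pi0_cat
      using o h sset_map_closed[OF m[OF h(1,2)] h(3)] by blast
    fix z g assume "g \<in> homs (pi0_cat S) y z"
    then obtain k where k: "z \<in> sobs S" "k \<in> S.hv y z" "g = (y, z, pi0_class (smap S y z) k)"
      by (auto simp: homs_pi0_cat)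
    show "onar (pi0_fctr T F) (g \<cdot>\<^bsub>pi0_cat S\<^esub> f) = onar (pi0_fctr T F) g \<cdot>\<^bsub>pi0_cat T\<^esub> onar (pi0_fctr T F) f"
      unfolding h(4) k(3) pi0_cat_cmp[OF S h(1,2) k(1) h(3) k(2)] pi0_fctr_class[where S = S, OF m[OF h(1,2)]]
        pi0_fctr_class[where S = S, OF m[OF h(2) k(1)]] pi0_fctr_class[where S = S, OF m[OF h(1) k(1)]]
        pi0_cat_cmp[OF T o[OF h(1)] o[OF h(2)] o[OF k(1)] sset_map_closed[OF m[OF h(1,2)] h(3)]
          sset_map_closed[OF m[OF h(2) k(1)] k(2)]]
      using F h k by (simp add: simplicial_functor_def)
  qed
qed

text \<open>The components are the classes of \<open>z x\<close>, with inverses the classes of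
  \<open>z' x\<close>. \<open>F\<close> and \<open>G\<close> are described by their values because
  the lemma is applied to \<open>id_fctr\<close> and to composites, which are not literally of the
  form \<open>pi0_fctr\<close>.\<close>

lemma nat_iso_pi0:
  assumes S: "simplicial_category S" and T: "simplicial_category T" and h: "homotopic_sfctrs S T P Q"
    and FG: "onob F = sonob P" "onob G = sonob Q"
    and F: "\<And>x y h. \<lbrakk>x \<in> sobs S; y \<in> sobs S; h \<in> simps (smap S x y) 0\<rbrakk> \<Longrightarrow>
       onar F (x, y, pi0_class (smap S x y) h) =
       (sonob P x, sonob P y, pi0_class (smap T (sonob P x) (sonob P y)) (sonmap P x y 0 h))"
    and G: "\<And>x y h. \<lbrakk>x \<in> sobs S; y \<in> sobs S; h \<in> simps (smap S x y) 0\<rbrakk> \<Longrightarrow>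
       onar G (x, y, pi0_class (smap S x y) h) =
       (sonob Q x, sonob Q y, pi0_class (smap T (sonob Q x) (sonob Q y)) (sonmap Q x y 0 h))"
  shows "\<exists>\<eta>. nat_iso (pi0_cat S) (pi0_cat T) F G \<eta>"
proof -
  interpret S: simplicial_category S by (rule S)
  interpret T: simplicial_category T by (rule T)
  obtain z z' where z: "natural_up_to_homotopy S T P Q z"
      "\<And>x. x \<in> sobs S \<Longrightarrow> z' x \<in> T.hv (sonob Q x) (sonob P x)"
      "inverse_up_to_homotopy S T P Q z z'" "inverse_up_to_homotopy S T Q P z' z"
    using h by (auto simp: homotopic_sfctrs_def)
  have o: "x \<in> sobs S \<Longrightarrow> sonob P x \<in> sobs T" "x \<in> sobs S \<Longrightarrow> sonob Q x \<in> sobs T"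
    and m: "\<lbrakk>x \<in> sobs S; y \<in> sobs S\<rbrakk> \<Longrightarrow> sset_map (smap S x y) (smap T (sonob P x) (sonob P y)) (sonmap P x y)"
       "\<lbrakk>x \<in> sobs S; y \<in> sobs S\<rbrakk> \<Longrightarrow> sset_map (smap S x y) (smap T (sonob Q x) (sonob Q y)) (sonmap Q x y)" for x y
    using h by (auto simp: homotopic_sfctrs_def premap_def)
  have zi: "x \<in> sobs S \<Longrightarrow> z x \<in> T.hv (sonob P x) (sonob Q x)" for x
    using z(1) by (simp add: natural_up_to_homotopy_def)
  define \<eta> where "\<eta> x = (sonob P x, sonob Q x, pi0_class (smap T (sonob P x) (sonob Q x)) (z x))" for x
  define \<eta>' where "\<eta>' x = (sonob Q x, sonob P x, pi0_class (smap T (sonob Q x) (sonob P x)) (z' x))" for x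
  have \<eta>: "\<eta> x \<in> homs (pi0_cat T) (sonob P x) (sonob Q x)"
    and \<eta>': "\<eta>' x \<in> homs (pi0_cat T) (sonob Q x) (sonob P x)" if "x \<in> sobs S" for x
    unfolding homs_pi0_cat \<eta>_def \<eta>'_def using that o zi z(2) by blast+
  have "nat_trans (pi0_cat S) (pi0_cat T) F G \<eta>"
    unfolding nat_trans_def FG
  proof (intro conjI ballI allI)
    fix x assume "x \<in> obs (pi0_cat S)"
    then show "\<eta> x \<in> homs (pi0_cat T) (sonob P x) (sonob Q x)"
      by (intro \<eta>) (simp add: pi0_cat_def)
  next
    fix x y f assume "f \<in> homs (pi0_cat S) x y"
    then obtain h where h: "x \<in> sobs S" "y \<in> sobs S" "h \<in> S.hv x y" "f = (x, y, pi0_class (smap S x y) h)"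
      by (auto simp: homs_pi0_cat)
    have "(scmp T (sonob P x) (sonob P y) (sonob Q y) 0 (degen T (sonob P y) (sonob Q y) 0 (z y)) (sonmap P x y 0 h),
        scmp T (sonob P x) (sonob Q x) (sonob Q y) 0 (sonmap Q x y 0 h) (degen T (sonob P x) (sonob Q x) 0 (z x)))
        \<in> edge_eq (smap T (sonob P x) (sonob Q y))"
      using z(1) h unfolding natural_up_to_homotopy_def homotopic_maps_def by blast
    then have *: "(scmp T (sonob P x) (sonob P y) (sonob Q y) 0 (z y) (sonmap P x y 0 h),
        scmp T (sonob P x) (sonob Q x) (sonob Q y) 0 (sonmap Q x y 0 h) (z x)) \<in> edge_eq (smap T (sonob P x) (sonob Q y))"
      by (simp add: T.degen_0 o zi h)
    show "\<eta> y \<cdot>\<^bsub>pi0_cat T\<^esub> onar F f = onar G f \<cdot>\<^bsub>pi0_cat T\<^esub> \<eta> x"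
      unfolding h(4) F[OF h(1-3)] G[OF h(1-3)] \<eta>_def
        pi0_cat_cmp[OF T o(1)[OF h(1)] o(1)[OF h(2)] o(2)[OF h(2)] sset_map_closed[OF m(1)[OF h(1,2)] h(3)] zi[OF h(2)]]
        pi0_cat_cmp[OF T o(1)[OF h(1)] o(2)[OF h(1)] o(2)[OF h(2)] zi[OF h(1)] sset_map_closed[OF m(2)[OF h(1,2)] h(3)]]
      using * by (simp add: pi0_class_eq_iff)
  qed
  moreover have "iso_arr (pi0_cat T) (\<eta> x)" if "x \<in> obs (pi0_cat S)" for x
  proof -
    have x: "x \<in> sobs S" using that by (simp add: pi0_cat_def)
    have st: "\<eta> x \<in> arrs (pi0_cat T)" "src (pi0_cat T) (\<eta> x) = sonob P x" "tgt (pi0_cat T) (\<eta> x) = sonob Q x"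
      using \<eta>[OF x] by (auto simp: homs_def)
    have "\<eta>' x \<cdot>\<^bsub>pi0_cat T\<^esub> \<eta> x = idt (pi0_cat T) (sonob P x)" "\<eta> x \<cdot>\<^bsub>pi0_cat T\<^esub> \<eta>' x = idt (pi0_cat T) (sonob Q x)"
      unfolding \<eta>_def \<eta>'_def pi0_cat_idt
        pi0_cat_cmp[OF T o(1)[OF x] o(2)[OF x] o(1)[OF x] zi[OF x] z(2)[OF x]]
        pi0_cat_cmp[OF T o(2)[OF x] o(1)[OF x] o(2)[OF x] z(2)[OF x] zi[OF x]]
      using z(3,4) x by (simp_all add: pi0_class_eq_iff inverse_up_to_homotopy_def)
    then show ?thesis
      unfolding iso_arr_def st(2,3) using st(1) \<eta>'[OF x] by blast
  qed
  ultimately show ?thesis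
    unfolding nat_iso_def by blast
qed

text \<open>If \<open>E\<close> is connected to the identity by components that are invertible up to
  homotopy, then it is bijective on mapping spaces up to homotopy, for the same reason that a
  functor isomorphic to the identity is fully faithful.\<close>

lemma homotopic_id_inverse:
  assumes S: "simplicial_category S" and h: "homotopic_sfctrs S S E id_sfctr" and xy: "x \<in> sobs S" "y \<in> sobs S"
  shows "\<exists>a. sset_map (smap S (sonob E x) (sonob E y)) (smap S x y) a \<and>
     homotopic_maps (smap S x y) (smap S x y) (\<lambda>k h. a k (sonmap E x y k h)) (\<lambda>k h. h) \<and>
     homotopic_maps (smap S (sonob E x) (sonob E y)) (smap S (sonob E x) (sonob E y)) (\<lambda>k h. sonmap E x y k (a k h)) (\<lambda>k h. h)"
proof -
  interpret S: simplicial_category S by (rule S)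
  obtain z z' where z: "natural_up_to_homotopy S S E id_sfctr z"
      "\<And>x. x \<in> sobs S \<Longrightarrow> z' x \<in> S.hv x (sonob E x)"
      "inverse_up_to_homotopy S S E id_sfctr z z'" "inverse_up_to_homotopy S S id_sfctr E z' z"
    using h by (auto simp: homotopic_sfctrs_def id_sfctr_def)
  define u v where uv: "u = sonob E x" "v = sonob E y"
  have o: "u \<in> sobs S" "v \<in> sobs S" and e: "sset_map (smap S x y) (smap S u v) (sonmap E x y)"
    using h xy by (auto simp: homotopic_sfctrs_def premap_def uv)
  have zx: "z x \<in> S.hv u x" and zy: "z y \<in> S.hv v y"
    using z(1) xy by (auto simp: natural_up_to_homotopy_def id_sfctr_def uv)
  have zx': "z' x \<in> S.hv x u" and zy': "z' y \<in> S.hv y v"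
    using z(2) xy by (auto simp: uv)
  have c: "(scmp S x u x 0 (z x) (z' x), sidt S x) \<in> edge_eq (smap S x x)"
      "(scmp S u x u 0 (z' x) (z x), sidt S u) \<in> edge_eq (smap S u u)"
      "(scmp S v y v 0 (z' y) (z y), sidt S v) \<in> edge_eq (smap S v v)"
    using z(3,4) xy by (auto simp: inverse_up_to_homotopy_def id_sfctr_def uv)
  have N: "homotopic_maps (smap S x y) (smap S u y)
     (\<lambda>k h. scmp S u v y k (degen S v y k (z y)) (sonmap E x y k h))
     (\<lambda>k h. scmp S u x y k h (degen S u x k (z x)))"
    using z(1) xy by (auto simp: natural_up_to_homotopy_def id_sfctr_def uv)
  \<comment> \<open>Conjugation by the components, \<open>h\<close> to \<open>z y\<close> after
    \<open>h\<close> after \<open>z' x\<close>. Naturality shows that it undoes \<open>E\<close> on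
    one side; for the other side the pair \<open>z' y\<close>, \<open>z y\<close> is first inserted
    in front of \<open>E\<close>.\<close>
  define a where "a k h = scmp S x u y k (scmp S u v y k (degen S v y k (z y)) h) (degen S x u k (z' x))" for k h
  have a: "sset_map (smap S u v) (smap S x y) a"
    unfolding a_def by (intro sset_map_comp[OF S.sset_map_post[OF o(1,2) xy(2) zy] S.sset_map_pre[OF xy(1) o(1) xy(2) zx']])
  have "homotopic_maps (smap S x y) (smap S x y) (\<lambda>k h. a k (sonmap E x y k h))
      (\<lambda>k h. scmp S x u y k (scmp S u x y k h (degen S u x k (z x))) (degen S x u k (z' x)))"
    unfolding a_def by (rule S.homotopic_pre[OF N xy(1) o(1) xy(2) zx'])
  also have "homotopic_maps (smap S x y) (smap S x y) \<dots> (\<lambda>k h. h)"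
    by (rule S.homotopic_pre_cancel[OF sset_map_id S.hom_sset[OF xy] xy(2,1) o(1) zx zx' c(1)])
  finally have 1: "homotopic_maps (smap S x y) (smap S x y) (\<lambda>k h. a k (sonmap E x y k h)) (\<lambda>k h. h)" .
  have uvs: "sset (smap S u v)" by (rule S.hom_sset[OF o])
  have ea: "sset_map (smap S u v) (smap S u v) (\<lambda>k h. sonmap E x y k (a k h))"
    by (rule sset_map_comp[OF a e])
  have "homotopic_maps (smap S u v) (smap S u v) (\<lambda>k h. sonmap E x y k (a k h))
      (\<lambda>k h. scmp S u y v k (degen S y v k (z' y)) (scmp S u v y k (degen S v y k (z y)) (sonmap E x y k (a k h))))"
    by (rule homotopic_maps_sym[OF S.homotopic_post_cancel[OF ea uvs o xy(2) zy zy' c(3)]])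
  also have "homotopic_maps (smap S u v) (smap S u v) \<dots>
      (\<lambda>k h. scmp S u y v k (degen S y v k (z' y)) (scmp S u x y k (a k h) (degen S u x k (z x))))"
    by (rule S.homotopic_post[OF homotopic_maps_pre[OF N a uvs] o(1) xy(2) o(2) zy'])
  also have "homotopic_maps (smap S u v) (smap S u v) \<dots>
      (\<lambda>k h. scmp S u y v k (degen S y v k (z' y)) (scmp S u v y k (degen S v y k (z y)) h))"
    unfolding a_def
    by (rule S.homotopic_post[OF S.homotopic_pre_cancel[OF S.sset_map_post[OF o xy(2) zy] uvs xy(2) o(1) xy(1) zx' zx c(2)]
          o(1) xy(2) o(2) zy'])
  also have "homotopic_maps (smap S u v) (smap S u v) \<dots> (\<lambda>k h. h)"
    by (rule S.homotopic_post_cancel[OF sset_map_id uvs o xy(2) zy zy' c(3)])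
  finally show ?thesis
    using a 1 unfolding uv[symmetric] by blast
qed

text \<open>On \<open>\<pi>\<^sub>0\<close> the homotopies become natural isomorphisms. On mapping
  spaces neither \<open>F\<close> nor \<open>G\<close> has an evident inverse; only the composites
  \<open>G F\<close> and \<open>F G\<close> do, which is the situation of
  \<open>sset_weq_two_of_six\<close>.\<close>

theorem scat_equivalenceI:
  assumes S: "simplicial_category S" and T: "simplicial_category T"
    and F: "simplicial_functor S T F" and G: "simplicial_functor T S G"
    and GF: "homotopic_sfctrs S S (comp_sfctr G F) id_sfctr"
    and FG: "homotopic_sfctrs T T (comp_sfctr F G) id_sfctr"
  shows "scat_equivalence S T F"
proof -
  interpret S: simplicial_category S by (rule S)
  interpret T: simplicial_category T by (rule T)
  have fo: "x \<in> sobs S \<Longrightarrow> sonob F x \<in> sobs T" and fm: "\<lbrakk>x \<in> sobs S; y \<in> sobs S\<rbrakk> \<Longrightarrow>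
      sset_map (smap S x y) (smap T (sonob F x) (sonob F y)) (sonmap F x y)" for x y
    using F by (auto simp: simplicial_functor_def premap_def)
  have go: "x \<in> sobs T \<Longrightarrow> sonob G x \<in> sobs S" and gm: "\<lbrakk>x \<in> sobs T; y \<in> sobs T\<rbrakk> \<Longrightarrow>
      sset_map (smap T x y) (smap S (sonob G x) (sonob G y)) (sonmap G x y)" for x y
    using G by (auto simp: simplicial_functor_def premap_def)
  have "\<exists>\<eta>. nat_iso (pi0_cat S) (pi0_cat S) id_fctr (comp_fctr (pi0_fctr S G) (pi0_fctr T F)) \<eta>"
    by (rule nat_iso_pi0[OF S S homotopic_sfctrs_sym[OF S S GF]])
      (simp_all add: id_fctr_def comp_fctr_def id_sfctr_def comp_sfctr_def o_def
        pi0_fctr_class[where S = S, OF fm] pi0_fctr_class[where S = T, OF gm] fo,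
        simp_all add: pi0_fctr_def)
  moreover have "\<exists>\<epsilon>. nat_iso (pi0_cat T) (pi0_cat T) (comp_fctr (pi0_fctr T F) (pi0_fctr S G)) id_fctr \<epsilon>"
    by (rule nat_iso_pi0[OF T T FG])
      (simp_all add: id_fctr_def comp_fctr_def id_sfctr_def comp_sfctr_def o_def
        pi0_fctr_class[where S = S, OF fm] pi0_fctr_class[where S = T, OF gm] go,
        simp_all add: pi0_fctr_def)
  ultimately have 1: "cat_equivalence (pi0_cat S) (pi0_cat T) (pi0_fctr T F)"
    unfolding cat_equivalence_def using is_functor_pi0_fctr[OF S T F] is_functor_pi0_fctr[OF T S G] by blast
  have "sset_weq (smap S x y) (smap T (sonob F x) (sonob F y)) (sonmap F x y)" if xy: "x \<in> sobs S" "y \<in> sobs S" for x y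
  proof -
    define u v where uv: "u = sonob F x" "v = sonob F y"
    have o: "u \<in> sobs T" "v \<in> sobs T" using fo xy by (auto simp: uv)
    obtain a where a: "sset_map (smap S (sonob G u) (sonob G v)) (smap S x y) a"
        "homotopic_maps (smap S x y) (smap S x y) (\<lambda>k h. a k (sonmap G u v k (sonmap F x y k h))) (\<lambda>k h. h)"
        "homotopic_maps (smap S (sonob G u) (sonob G v)) (smap S (sonob G u) (sonob G v))
           (\<lambda>k h. sonmap G u v k (sonmap F x y k (a k h))) (\<lambda>k h. h)"
      using homotopic_id_inverse[OF S GF xy] by (auto simp: comp_sfctr_def uv)
    obtain c where c: "sset_map (smap T (sonob F (sonob G u)) (sonob F (sonob G v))) (smap T u v) c"
        "homotopic_maps (smap T u v) (smap T u v)
           (\<lambda>k h. c k (sonmap F (sonob G u) (sonob G v) k (sonmap G u v k h))) (\<lambda>k h. h)"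
      using homotopic_id_inverse[OF T FG o] by (auto simp: comp_sfctr_def)
    \<comment> \<open>Applied to \<open>F\<close>, then \<open>G\<close>: \<open>a\<close> inverts
      the composite \<open>G F\<close> on both sides, and \<open>c\<close> after the next
      \<open>F\<close> is a left inverse of \<open>G\<close> on the space from \<open>u\<close> to
      \<open>v\<close>.\<close>
    show ?thesis
      unfolding uv[symmetric]
      by (rule sset_weq_two_of_six[OF fm[OF xy, folded uv] gm[OF o] a(1)
            sset_map_comp[OF fm[OF go[OF o(1)] go[OF o(2)]] c(1)] a(2,3) c(2)])
  qed
  with 1 show ?thesis
    unfolding scat_equivalence_def by blast
qed

section \<open>Coloured categories\<close>

lemma homsI: "\<lbrakk>f \<in> arrs C; src C f = x; tgt C f = y\<rbrakk> \<Longrightarrow> f \<in> homs C x y"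
  by (simp add: homs_def)

lemma homsD: "f \<in> homs C x y \<Longrightarrow> f \<in> arrs C \<and> src C f = x \<and> tgt C f = y"
  by (simp add: homs_def)

lemma category_obs:
  "\<lbrakk>category C; f \<in> homs C x y\<rbrakk> \<Longrightarrow> x \<in> obs C" "\<lbrakk>category C; f \<in> homs C x y\<rbrakk> \<Longrightarrow> y \<in> obs C"
  by (auto simp: category_def homs_def)

lemma category_idt: "\<lbrakk>category C; x \<in> obs C\<rbrakk> \<Longrightarrow> idt C x \<in> homs C x x"
  by (drule category_def[THEN iffD1, THEN conjunct2, THEN conjunct1]) blast

lemma category_cmp: "\<lbrakk>category C; f \<in> homs C x y; g \<in> homs C y z\<rbrakk> \<Longrightarrow> g \<cdot>\<^bsub>C\<^esub> f \<in> homs C x z"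
  by (drule category_def[THEN iffD1, THEN conjunct2, THEN conjunct2, THEN conjunct1]) blast

lemma category_idt_right: "\<lbrakk>category C; f \<in> homs C x y\<rbrakk> \<Longrightarrow> f \<cdot>\<^bsub>C\<^esub> idt C x = f"
  by (drule category_def[THEN iffD1, THEN conjunct2, THEN conjunct2, THEN conjunct2, THEN conjunct1]) blast

lemma category_idt_left: "\<lbrakk>category C; f \<in> homs C x y\<rbrakk> \<Longrightarrow> idt C y \<cdot>\<^bsub>C\<^esub> f = f"
  by (drule category_def[THEN iffD1, THEN conjunct2, THEN conjunct2, THEN conjunct2, THEN conjunct1]) blast

lemma category_assoc:
  "\<lbrakk>category C; f \<in> homs C x y; g \<in> homs C y z; h \<in> homs C z w\<rbrakk> \<Longrightarrow>
     h \<cdot>\<^bsub>C\<^esub> (g \<cdot>\<^bsub>C\<^esub> f) = (h \<cdot>\<^bsub>C\<^esub> g) \<cdot>\<^bsub>C\<^esub> f"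
  by (drule category_def[THEN iffD1, THEN conjunct2, THEN conjunct2, THEN conjunct2, THEN conjunct2]) blast

lemma coloured_categoryD: "coloured_category C \<Longrightarrow> category C"
  by (simp add: coloured_category_def)

lemma col_arrs: "\<lbrakk>coloured_category C; f \<in> col C\<rbrakk> \<Longrightarrow> f \<in> arrs C"
  by (auto simp: coloured_category_def wide_subcat_def)

lemma col_idt: "\<lbrakk>coloured_category C; x \<in> obs C\<rbrakk> \<Longrightarrow> idt C x \<in> col C"
  by (simp add: coloured_category_def wide_subcat_def)

lemma col_cmp:
  "\<lbrakk>coloured_category C; f \<in> col C; g \<in> col C; f \<in> homs C x y; g \<in> homs C y z\<rbrakk> \<Longrightarrow> g \<cdot>\<^bsub>C\<^esub> f \<in> col C"
  by (auto simp: coloured_category_def wide_subcat_def homs_def)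

lemma functor_ob: "\<lbrakk>is_functor C D F; x \<in> obs C\<rbrakk> \<Longrightarrow> onob F x \<in> obs D"
  by (drule is_functor_def[THEN iffD1, THEN conjunct1]) blast

lemma functor_idt: "\<lbrakk>is_functor C D F; x \<in> obs C\<rbrakk> \<Longrightarrow> onar F (idt C x) = idt D (onob F x)"
  by (drule is_functor_def[THEN iffD1, THEN conjunct1]) blast

lemma functor_homs: "\<lbrakk>is_functor C D F; f \<in> homs C x y\<rbrakk> \<Longrightarrow> onar F f \<in> homs D (onob F x) (onob F y)"
  by (drule is_functor_def[THEN iffD1, THEN conjunct2, THEN conjunct1, rule_format])

lemma functor_cmp:
  "\<lbrakk>is_functor C D F; f \<in> homs C x y; g \<in> homs C y z\<rbrakk> \<Longrightarrow> onar F (g \<cdot>\<^bsub>C\<^esub> f) = onar F g \<cdot>\<^bsub>D\<^esub> onar F f"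
  by (drule is_functor_def[THEN iffD1, THEN conjunct2, THEN conjunct2, rule_format])

section \<open>Reduction of zigzags\<close>

text \<open>A chain stores arrows only; its object in position \<open>i\<close> is recovered from
  the identity \<open>a i i\<close>.\<close>

abbreviation vtx where "vtx C a i \<equiv> src C (a i i)"

lemma is_chainD:
  "\<lbrakk>is_chain C k a; i \<le> j; j \<le> k\<rbrakk> \<Longrightarrow> a i j \<in> col C \<and> src C (a i j) = vtx C a i \<and> tgt C (a i j) = vtx C a j"
  by (drule is_chain_def[THEN iffD1, THEN conjunct1, rule_format, OF _ conjI])

lemma is_chain_col: "\<lbrakk>is_chain C k a; i \<le> j; j \<le> k\<rbrakk> \<Longrightarrow> a i j \<in> col C"
  by (drule (2) is_chainD) (rule conjunct1)

lemma is_chain_homs: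
  assumes C: "coloured_category C" and a: "is_chain C k a" "i \<le> j" "j \<le> k"
  shows "a i j \<in> homs C (vtx C a i) (vtx C a j)"
proof (rule homsI)
  note 1 = is_chainD[OF a]
  show "a i j \<in> arrs C" by (rule col_arrs[OF C conjunct1[OF 1]])
  show "src C (a i j) = vtx C a i" "tgt C (a i j) = vtx C a j"
    by (rule conjunct1[OF conjunct2[OF 1]], rule conjunct2[OF conjunct2[OF 1]])
qed

lemma is_chain_idt: "\<lbrakk>is_chain C k a; i \<le> k\<rbrakk> \<Longrightarrow> a i i = idt C (vtx C a i)"
  by (simp only: is_chain_def)

lemma is_chain_cmp: "\<lbrakk>is_chain C k a; i \<le> j; j \<le> l; l \<le> k\<rbrakk> \<Longrightarrow> a i l = a j l \<cdot>\<^bsub>C\<^esub> a i j"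
  by (drule is_chain_def[THEN iffD1, THEN conjunct2, THEN conjunct2, THEN conjunct1]) blast

lemma is_chain_undefined: "\<lbrakk>is_chain C k a; \<not> (i \<le> j \<and> j \<le> k)\<rbrakk> \<Longrightarrow> a i j = undefined"
  by (drule is_chain_def[THEN iffD1, THEN conjunct2, THEN conjunct2, THEN conjunct2]) blast

lemma is_chain_obs: "\<lbrakk>coloured_category C; is_chain C k a; i \<le> k\<rbrakk> \<Longrightarrow> vtx C a i \<in> obs C"
  using is_chain_homs[of C k a i i] by (auto intro: category_obs coloured_categoryD)

lemma is_chainI:
  assumes "\<And>i j. \<lbrakk>i \<le> j; j \<le> k\<rbrakk> \<Longrightarrow> a i j \<in> homs C (v i) (v j) \<and> a i j \<in> col C"
    and "\<And>i. i \<le> k \<Longrightarrow> a i i = idt C (v i)"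
    and "\<And>i j l. \<lbrakk>i \<le> j; j \<le> l; l \<le> k\<rbrakk> \<Longrightarrow> a i l = a j l \<cdot>\<^bsub>C\<^esub> a i j"
    and "\<And>i j. \<not> (i \<le> j \<and> j \<le> k) \<Longrightarrow> a i j = undefined"
  shows "is_chain C k a" "\<And>i. i \<le> k \<Longrightarrow> vtx C a i = v i"
proof -
  show v: "\<And>i. i \<le> k \<Longrightarrow> vtx C a i = v i"
    using assms(1) by (simp add: homs_def)
  show "is_chain C k a"
    unfolding is_chain_def
  proof (intro conjI allI impI)
    fix i j assume ij: "i \<le> j \<and> j \<le> k"
    then show "a i j \<in> col C" "src C (a i j) = vtx C a i" "tgt C (a i j) = vtx C a j"
      using assms(1)[of i j] v[of i] v[of j] by (auto simp: homs_def)
  next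
    fix i assume "i \<le> k"
    then show "a i i = idt C (vtx C a i)"
      using assms(2)[of i] v[of i] by simp
  next
    fix i j l assume "i \<le> j \<and> j \<le> l \<and> l \<le> k"
    then show "a i l = a j l \<cdot>\<^bsub>C\<^esub> a i j"
      by (intro assms(3)) auto
  next
    fix i j assume "\<not> (i \<le> j \<and> j \<le> k)"
    then show "a i j = undefined" by (rule assms(4))
  qed
qed

lemma is_chain_trans_homs: "\<lbrakk>is_chain_trans C k a b \<tau>; i \<le> k\<rbrakk> \<Longrightarrow> \<tau> i \<in> homs C (vtx C a i) (vtx C b i)"
  by (simp add: is_chain_trans_def)

lemma is_chain_trans_natural:
  "\<lbrakk>is_chain_trans C k a b \<tau>; i \<le> j; j \<le> k\<rbrakk> \<Longrightarrow> \<tau> j \<cdot>\<^bsub>C\<^esub> a i j = b i j \<cdot>\<^bsub>C\<^esub> \<tau> i"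
  by (drule is_chain_trans_def[THEN iffD1, THEN conjunct2, THEN conjunct1]) blast

lemma is_chain_trans_undefined: "\<lbrakk>is_chain_trans C k a b \<tau>; \<not> i \<le> k\<rbrakk> \<Longrightarrow> \<tau> i = undefined"
  by (simp add: is_chain_trans_def)

lemma is_chain_transI:
  assumes "\<And>i. i \<le> k \<Longrightarrow> \<tau> i \<in> homs C (vtx C a i) (vtx C b i)"
    and "\<And>i j. \<lbrakk>i \<le> j; j \<le> k\<rbrakk> \<Longrightarrow> \<tau> j \<cdot>\<^bsub>C\<^esub> a i j = b i j \<cdot>\<^bsub>C\<^esub> \<tau> i"
    and "\<And>i. \<not> i \<le> k \<Longrightarrow> \<tau> i = undefined"
  shows "is_chain_trans C k a b \<tau>"
  unfolding is_chain_trans_def using assms by simp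

text \<open>The value beyond \<open>k\<close> is fixed so that equality of columns is plain equality
  of functions.\<close>

definition vcomp :: "('o, 'm, 'z) cat_scheme \<Rightarrow> nat \<Rightarrow> (nat \<Rightarrow> 'm) \<Rightarrow> (nat \<Rightarrow> 'm) \<Rightarrow> nat \<Rightarrow> 'm" where
  "vcomp C k \<tau> \<sigma> i = (if i \<le> k then \<tau> i \<cdot>\<^bsub>C\<^esub> \<sigma> i else undefined)"

lemma is_chain_trans_vcomp:
  assumes C: "coloured_category C" and a: "is_chain C k a" and b: "is_chain C k b" and c: "is_chain C k c"
    and \<sigma>: "is_chain_trans C k a b \<sigma>" and \<tau>: "is_chain_trans C k b c \<tau>"
  shows "is_chain_trans C k a c (vcomp C k \<tau> \<sigma>)"
proof (rule is_chain_transI)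
  note cat = coloured_categoryD[OF C]
  fix i j assume ij: "i \<le> j" "j \<le> k"
  then have i: "i \<le> k" by simp
  note s = is_chain_trans_homs[OF \<sigma>] and t = is_chain_trans_homs[OF \<tau>]
  have "(\<tau> j \<cdot>\<^bsub>C\<^esub> \<sigma> j) \<cdot>\<^bsub>C\<^esub> a i j = \<tau> j \<cdot>\<^bsub>C\<^esub> (b i j \<cdot>\<^bsub>C\<^esub> \<sigma> i)"
    using category_assoc[OF cat is_chain_homs[OF C a ij] s[OF ij(2)] t[OF ij(2)]]
      is_chain_trans_natural[OF \<sigma> ij] by simp
  also have "\<dots> = (c i j \<cdot>\<^bsub>C\<^esub> \<tau> i) \<cdot>\<^bsub>C\<^esub> \<sigma> i"
    using category_assoc[OF cat s[OF i] is_chain_homs[OF C b ij] t[OF ij(2)]]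
      is_chain_trans_natural[OF \<tau> ij] by simp
  also have "\<dots> = c i j \<cdot>\<^bsub>C\<^esub> (\<tau> i \<cdot>\<^bsub>C\<^esub> \<sigma> i)"
    using category_assoc[OF cat s[OF i] t[OF i] is_chain_homs[OF C c ij]] by simp
  finally show "vcomp C k \<tau> \<sigma> j \<cdot>\<^bsub>C\<^esub> a i j = c i j \<cdot>\<^bsub>C\<^esub> vcomp C k \<tau> \<sigma> i"
    using ij by (simp add: vcomp_def)
next
  fix i assume "i \<le> k"
  then show "vcomp C k \<tau> \<sigma> i \<in> homs C (vtx C a i) (vtx C c i)"
    using category_cmp[OF coloured_categoryD[OF C] is_chain_trans_homs[OF \<sigma>] is_chain_trans_homs[OF \<tau>]]
    by (simp add: vcomp_def)
qed (simp add: vcomp_def)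

lemma vcomp_assoc:
  assumes "coloured_category C" "is_chain_trans C k a b \<sigma>" "is_chain_trans C k b c \<tau>" "is_chain_trans C k c d \<upsilon>"
  shows "vcomp C k \<upsilon> (vcomp C k \<tau> \<sigma>) = vcomp C k (vcomp C k \<upsilon> \<tau>) \<sigma>"
  using category_assoc[OF coloured_categoryD[OF assms(1)] is_chain_trans_homs[OF assms(2)]
      is_chain_trans_homs[OF assms(3)] is_chain_trans_homs[OF assms(4)]]
  by (auto simp: vcomp_def fun_eq_iff)

lemma vcomp_id_right:
  assumes C: "coloured_category C" and \<tau>: "is_chain_trans C k b c \<tau>" and \<sigma>: "is_chain_trans C k a b \<sigma>"
    and id: "\<forall>i\<le>k. \<sigma> i = idt C (src C (\<sigma> i))"
  shows "vcomp C k \<tau> \<sigma> = \<tau>"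
proof
  note cat = coloured_categoryD[OF C]
  fix i
  show "vcomp C k \<tau> \<sigma> i = \<tau> i"
  proof (cases "i \<le> k")
    case True
    note h = is_chain_trans_homs[OF \<sigma> True]
    have "\<sigma> i = idt C (vtx C a i)" using id True homsD[OF h] by metis
    moreover then have "vtx C a i = vtx C b i"
      using homsD[OF h] homsD[OF category_idt[OF cat category_obs(1)[OF cat h]]] by simp
    ultimately show ?thesis
      using True category_idt_right[OF cat is_chain_trans_homs[OF \<tau> True]] by (simp add: vcomp_def)
  qed (use is_chain_trans_undefined[OF \<tau>] in \<open>simp add: vcomp_def\<close>)
qed

lemma vcomp_id_left:
  assumes C: "coloured_category C" and \<sigma>: "is_chain_trans C k a b \<sigma>" and \<tau>: "is_chain_trans C k b c \<tau>"
    and id: "\<forall>i\<le>k. \<tau> i = idt C (src C (\<tau> i))"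
  shows "vcomp C k \<tau> \<sigma> = \<sigma>"
proof
  note cat = coloured_categoryD[OF C]
  fix i
  show "vcomp C k \<tau> \<sigma> i = \<sigma> i"
  proof (cases "i \<le> k")
    case True
    have "\<tau> i = idt C (vtx C b i)" using id True homsD[OF is_chain_trans_homs[OF \<tau> True]] by metis
    then show ?thesis
      using True category_idt_left[OF cat is_chain_trans_homs[OF \<sigma> True]] by (simp add: vcomp_def)
  qed (use is_chain_trans_undefined[OF \<sigma>] in \<open>simp add: vcomp_def\<close>)
qed

text \<open>Naturality against identities leaves the same arrows in range, and out of range both
  chains are \<open>undefined\<close>. This is why deleting an identity column leaves a
  zigzag.\<close>

lemma is_chain_trans_id_eq:
  assumes C: "coloured_category C" and a: "is_chain C k a" and b: "is_chain C k b"
    and \<tau>: "is_chain_trans C k a b \<tau>" and id: "\<forall>i\<le>k. \<tau> i = idt C (src C (\<tau> i))"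
  shows "a = b"
proof (intro ext)
  note cat = coloured_categoryD[OF C]
  fix i j
  show "a i j = b i j"
  proof (cases "i \<le> j \<and> j \<le> k")
    case True
    have t: "\<tau> i = idt C (vtx C a i)" "vtx C a i = vtx C b i" if "i \<le> k" for i
    proof -
      note h = is_chain_trans_homs[OF \<tau> that]
      show "\<tau> i = idt C (vtx C a i)" using id that homsD[OF h] by metis
      then show "vtx C a i = vtx C b i"
        using homsD[OF h] homsD[OF category_idt[OF cat category_obs(1)[OF cat h]]] by simp
    qed
    have ik: "i \<le> k" "j \<le> k" using True by auto
    have "a i j = \<tau> j \<cdot>\<^bsub>C\<^esub> a i j"
      unfolding t(1)[OF ik(2)] using True by (simp add: category_idt_left[OF cat is_chain_homs[OF C a]])
    also have "\<dots> = b i j \<cdot>\<^bsub>C\<^esub> \<tau> i"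
      using True by (simp add: is_chain_trans_natural[OF \<tau>])
    also have "\<dots> = b i j"
      unfolding t(1)[OF ik(1)] t(2)[OF ik(1)] using True by (simp add: category_idt_right[OF cat is_chain_homs[OF C b]])
    finally show ?thesis .
  qed (simp add: is_chain_undefined[OF a] is_chain_undefined[OF b])
qed

section \<open>Merging columns and the normal form of a zigzag\<close>

lemma is_column_iff:
  "is_column C k c \<longleftrightarrow> is_chain C k (lchain c) \<and> is_chain C k (rchain c) \<and>
     (rightward c \<longrightarrow> is_chain_trans C k (lchain c) (rchain c) (comps c)) \<and>
     (\<not> rightward c \<longrightarrow> is_chain_trans C k (rchain c) (lchain c) (comps c) \<and> (\<forall>i\<le>k. comps c i \<in> col C))"
  by (auto simp: is_column_def)

lemma merge_columns_alt:
  "merge_columns C k c d = Column (rightward c) (lchain c) (rchain d)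
     (if rightward c then vcomp C k (comps d) (comps c) else vcomp C k (comps c) (comps d))"
  by (auto simp: merge_columns_def vcomp_def fun_eq_iff)

definition composable :: "('o, 'm, 'z) ccat_scheme \<Rightarrow> nat \<Rightarrow> 'm column \<Rightarrow> 'm column \<Rightarrow> bool" where
  "composable C k c d \<longleftrightarrow> is_column C k c \<and> is_column C k d \<and> rchain c = lchain d \<and> rightward c = rightward d"

lemma is_column_merge:
  assumes C: "coloured_category C" and cd: "composable C k c d"
  shows "is_column C k (merge_columns C k c d)"
proof -
  have ch: "is_chain C k (lchain c)" "is_chain C k (rchain c)" "is_chain C k (rchain d)"
    using cd by (auto simp: composable_def is_column_iff)
  show ?thesis
  proof (cases "rightward c")
    case True
    then have "is_chain_trans C k (lchain c) (rchain c) (comps c)" "is_chain_trans C k (rchain c) (rchain d) (comps d)"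
      using cd by (auto simp: composable_def is_column_iff)
    then show ?thesis
      using True ch is_chain_trans_vcomp[OF C ch]
      unfolding is_column_iff merge_columns_alt by simp
  next
    case False
    then have t: "is_chain_trans C k (rchain c) (lchain c) (comps c)" "is_chain_trans C k (rchain d) (rchain c) (comps d)"
      and "\<forall>i\<le>k. comps c i \<in> col C" "\<forall>i\<le>k. comps d i \<in> col C"
      using cd by (auto simp: composable_def is_column_iff)
    then have "\<forall>i\<le>k. vcomp C k (comps c) (comps d) i \<in> col C"
      using col_cmp[OF C _ _ is_chain_trans_homs[OF t(2)] is_chain_trans_homs[OF t(1)]] by (simp add: vcomp_def)
    then show ?thesis
      using False cd ch is_chain_trans_vcomp[OF C ch(3,2,1) t(2,1)]
      unfolding composable_def is_column_iff merge_columns_alt by simp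
  qed
qed

lemma merge_simps [simp]:
  "rightward (merge_columns C k c d) = rightward c" "lchain (merge_columns C k c d) = lchain c"
  "rchain (merge_columns C k c d) = rchain d"
  by (simp_all add: merge_columns_def)

lemma merge_assoc:
  assumes C: "coloured_category C" and cd: "composable C k c d" and de: "composable C k d e"
  shows "merge_columns C k c (merge_columns C k d e) = merge_columns C k (merge_columns C k c d) e"
proof (cases "rightward c")
  case True
  then have "is_chain_trans C k (lchain c) (rchain c) (comps c)" "is_chain_trans C k (rchain c) (rchain d) (comps d)"
    "is_chain_trans C k (rchain d) (rchain e) (comps e)" "rightward d"
    using cd de by (auto simp: composable_def is_column_iff)
  then show ?thesis
    using True by (simp add: merge_columns_alt vcomp_assoc[OF C])
next
  case False
  then have "is_chain_trans C k (rchain c) (lchain c) (comps c)" "is_chain_trans C k (rchain d) (rchain c) (comps d)"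
    "is_chain_trans C k (rchain e) (rchain d) (comps e)" "\<not> rightward d"
    using cd de by (auto simp: composable_def is_column_iff)
  then show ?thesis
    using False by (simp add: merge_columns_alt vcomp_assoc[OF C])
qed

lemma id_column_chains:
  assumes C: "coloured_category C" and c: "is_column C k c" "is_id_column C k c"
  shows "lchain c = rchain c"
proof (cases "rightward c")
  case True
  then show ?thesis
    using is_chain_trans_id_eq[OF C, of k "lchain c" "rchain c" "comps c"] c by (auto simp: is_column_iff is_id_column_def)
next
  case False
  then show ?thesis
    using is_chain_trans_id_eq[OF C, of k "rchain c" "lchain c" "comps c"] c by (auto simp: is_column_iff is_id_column_def)
qed

lemma merge_id_left:
  assumes C: "coloured_category C" and cd: "composable C k c d" and id: "is_id_column C k c"
  shows "merge_columns C k c d = d"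
proof -
  have l: "lchain c = rchain c"
    using id_column_chains[OF C _ id] cd by (simp add: composable_def)
  show ?thesis
  proof (cases "rightward c")
    case True
    then have "vcomp C k (comps d) (comps c) = comps d"
      using cd id by (intro vcomp_id_right[OF C]) (auto simp: composable_def is_column_iff is_id_column_def)
    then show ?thesis
      using True cd l by (simp add: merge_columns_alt composable_def column.expand)
  next
    case False
    then have "vcomp C k (comps c) (comps d) = comps d"
      using cd id by (intro vcomp_id_left[OF C]) (auto simp: composable_def is_column_iff is_id_column_def)
    then show ?thesis
      using False cd l by (simp add: merge_columns_alt composable_def column.expand)
  qed
qed

lemma merge_id_right:
  assumes C: "coloured_category C" and cd: "composable C k c d" and id: "is_id_column C k d"
  shows "merge_columns C k c d = c"
proof -
  have l: "lchain d = rchain d"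
    using id_column_chains[OF C _ id] cd by (simp add: composable_def)
  show ?thesis
  proof (cases "rightward c")
    case True
    then have "vcomp C k (comps d) (comps c) = comps c"
      using cd id by (intro vcomp_id_left[OF C]) (auto simp: composable_def is_column_iff is_id_column_def)
    then show ?thesis
      using True cd l by (simp add: merge_columns_alt composable_def column.expand)
  next
    case False
    then have "vcomp C k (comps c) (comps d) = comps c"
      using cd id by (intro vcomp_id_right[OF C]) (auto simp: composable_def is_column_iff is_id_column_def)
    then show ?thesis
      using False cd l by (simp add: merge_columns_alt composable_def column.expand)
  qed
qed

lemma is_zigzag_append:
  "is_zigzag C k a (f @ g) b \<longleftrightarrow> (\<exists>c. is_zigzag C k a f c \<and> is_zigzag C k c g b)"
  by (induction f arbitrary: a) auto

lemma is_zigzag_columns: "\<lbrakk>is_zigzag C k a h b; c \<in> set h\<rbrakk> \<Longrightarrow> is_column C k c"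
  by (induction h arbitrary: a) auto

lemma is_reduced_Nil [simp]: "is_reduced C k []"
  by (simp add: is_reduced_def)

lemma is_reduced_Cons:
  "is_reduced C k (c # h) \<longleftrightarrow> \<not> is_id_column C k c \<and> is_reduced C k h \<and> (h \<noteq> [] \<longrightarrow> rightward c \<noteq> rightward (hd h))"
  by (cases h) (auto simp: is_reduced_def)

lemma add_column_zigzag:
  assumes C: "coloured_category C" and z: "is_zigzag C k a (c # h) b"
  shows "is_zigzag C k a (add_column C k c h) b"
proof (cases h)
  case Nil
  then show ?thesis
    using z id_column_chains[OF C] by auto
next
  case (Cons d h')
  then have cd: "rightward c = rightward d \<Longrightarrow> composable C k c d"
    using z by (simp add: composable_def)
  show ?thesis
    using z Cons id_column_chains[OF C, of k c] is_column_merge[OF C cd]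
      id_column_chains[OF C is_column_merge[OF C cd]] by auto
qed

lemma add_column_reduced:
  "is_reduced C k h \<Longrightarrow> is_reduced C k (add_column C k c h)"
  by (cases h) (auto simp: is_reduced_Cons)

lemma add_column_id: "is_id_column C k c \<Longrightarrow> add_column C k c h = h"
  by (cases h) auto

text \<open>The confluence of reduction: two columns of one direction may be added in turn or merged
  first. The delicate cases are cancellations, where a merge becomes an identity; they are settled
  by associativity of merging and by reducedness of \<open>h\<close>.\<close>

lemma add_column_merge:
  assumes C: "coloured_category C" and z: "is_zigzag C k a (c # d # h) b" and cd: "rightward c = rightward d"
    and h: "is_reduced C k h"
  shows "add_column C k c (add_column C k d h) = add_column C k (merge_columns C k c d) h"
proof -
  have ccd: "composable C k c d"
    using z cd by (simp add: composable_def)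
  consider "is_id_column C k c" | "is_id_column C k d" "\<not> is_id_column C k c"
    | "\<not> is_id_column C k c" "\<not> is_id_column C k d" by blast
  then show ?thesis
  proof cases
    case 1
    then show ?thesis by (simp add: add_column_id merge_id_left[OF C ccd])
  next
    case 2
    then show ?thesis by (simp add: add_column_id merge_id_right[OF C ccd])
  next
    case 3
    show ?thesis
    proof (cases h)
      case Nil
      then show ?thesis using 3 cd by simp
    next
      case (Cons e h')
      show ?thesis
      proof (cases "rightward d = rightward e")
        case False
        then show ?thesis using 3 cd Cons by simp
      next
        case True
        then have de: "composable C k d e"
          using z Cons by (simp add: composable_def)
        have cde: "composable C k c (merge_columns C k d e)"
          using ccd de is_column_merge[OF C de] by (simp add: composable_def)
        have cde': "composable C k (merge_columns C k c d) e"
          using ccd de is_column_merge[OF C ccd] by (simp add: composable_def)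
        note a = merge_assoc[OF C ccd de]
        have red: "\<not> is_id_column C k e" "h' \<noteq> [] \<Longrightarrow> rightward e \<noteq> rightward (hd h')"
          using h Cons by (auto simp: is_reduced_Cons)
        show ?thesis
        proof (cases "is_id_column C k (merge_columns C k d e)")
          case id: True
          \<comment> \<open>Here \<open>d\<close> cancels \<open>e\<close>. What follows
            \<open>e\<close> points the other way, so on the left \<open>c\<close> is simply put in
            front of the remaining columns.\<close>
          then have c: "merge_columns C k (merge_columns C k c d) e = c"
            using merge_id_right[OF C cde] a by simp
          have lhs: "add_column C k c (add_column C k d h) = c # h'"
            using 3 Cons True id red cd by (cases h') auto
          show ?thesis
          proof (cases "is_id_column C k (merge_columns C k c d)")
            case True
            \<comment> \<open>If \<open>c\<close> also cancels \<open>d\<close>, the triple merge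
              equals \<open>e\<close> by one bracketing and \<open>c\<close> by the other.\<close>
            then have "c = e" using merge_id_left[OF C cde'] c by simp
            then show ?thesis using lhs True Cons by simp
          next
            case False
            then show ?thesis using lhs c 3 Cons True cd by simp
          qed
        next
          case False
          show ?thesis
          proof (cases "is_id_column C k (merge_columns C k c d)")
            case id: True
            \<comment> \<open>Now \<open>c\<close> cancels \<open>d\<close>, and the triple merge is
              \<open>e\<close>, which is no identity since \<open>h\<close> is reduced; both sides
              give \<open>h\<close> back.\<close>
            then have "merge_columns C k c (merge_columns C k d e) = e"
              using merge_id_left[OF C cde'] a by simp
            then show ?thesis using 3 Cons True False id red cd by simp
          next
            case id: False
            then show ?thesis using 3 Cons True False a cd by simp
          qed
        qed
      qed
    qed
  qed
qed

lemma foldr_add_column: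
  assumes C: "coloured_category C" and z: "is_reduced C k z"
  shows "is_zigzag C k a (h @ z) b \<Longrightarrow>
     is_zigzag C k a (foldr (add_column C k) h z) b \<and> is_reduced C k (foldr (add_column C k) h z)"
proof (induction h arbitrary: a)
  case Nil
  then show ?case using z by simp
next
  case (Cons c h)
  then have 1: "is_zigzag C k (rchain c) (foldr (add_column C k) h z) b" "is_reduced C k (foldr (add_column C k) h z)"
    using Cons.IH[of "rchain c"] by auto
  have "is_zigzag C k a (c # foldr (add_column C k) h z) b"
    using 1 Cons.prems by simp
  from add_column_zigzag[OF C this] show ?case
    using 1(2) by (simp add: add_column_reduced)
qed

lemma reduce_zigzag_in:
  assumes "coloured_category C" "is_zigzag C k a h b"
  shows "is_zigzag C k a (reduce_zigzag C k h) b" "is_reduced C k (reduce_zigzag C k h)"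
  using foldr_add_column[OF assms(1) is_reduced_Nil, of k a h b] assms(2) by (simp_all add: reduce_zigzag_def)

lemma reduce_zigzag_reduced: "is_reduced C k h \<Longrightarrow> reduce_zigzag C k h = h"
  unfolding reduce_zigzag_def
proof (induction h)
  case (Cons c h)
  then show ?case by (cases h) (auto simp: is_reduced_Cons)
qed simp

section \<open>Columnwise operations and reduction\<close>

text \<open>Common properties of the operations applied to the columns of a hammock: restriction
  along a simplicial operator, application of a coloured functor, and the prism of a transformation.
  They preserve the shape of zigzags, identity columns and merges, which is what reduction
  sees.\<close>

definition column_morphism ::
    "('o, 'm, 'z) ccat_scheme \<Rightarrow> nat \<Rightarrow> ('p, 'n, 'y) ccat_scheme \<Rightarrow> nat \<Rightarrow>
     ((nat \<Rightarrow> nat \<Rightarrow> 'm) \<Rightarrow> (nat \<Rightarrow> nat \<Rightarrow> 'n)) \<Rightarrow> ('m column \<Rightarrow> 'n column) \<Rightarrow> bool" where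
  "column_morphism C k D l \<psi> \<phi> \<longleftrightarrow>
     (\<forall>c. is_column C k c \<longrightarrow> is_column D l (\<phi> c) \<and> rightward (\<phi> c) = rightward c \<and>
        lchain (\<phi> c) = \<psi> (lchain c) \<and> rchain (\<phi> c) = \<psi> (rchain c) \<and>
        (is_id_column C k c \<longrightarrow> is_id_column D l (\<phi> c))) \<and>
     (\<forall>c d. composable C k c d \<longrightarrow> \<phi> (merge_columns C k c d) = merge_columns D l (\<phi> c) (\<phi> d))"

lemma column_morphismD:
  assumes "column_morphism C k D l \<psi> \<phi>"
  shows "is_column C k c \<Longrightarrow> is_column D l (\<phi> c)" "is_column C k c \<Longrightarrow> rightward (\<phi> c) = rightward c"
    "is_column C k c \<Longrightarrow> lchain (\<phi> c) = \<psi> (lchain c)" "is_column C k c \<Longrightarrow> rchain (\<phi> c) = \<psi> (rchain c)"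
    "is_column C k c \<Longrightarrow> is_id_column C k c \<Longrightarrow> is_id_column D l (\<phi> c)"
    "composable C k c d \<Longrightarrow> \<phi> (merge_columns C k c d) = merge_columns D l (\<phi> c) (\<phi> d)"
  using assms unfolding column_morphism_def by blast+

lemma is_zigzag_map:
  assumes "column_morphism C k D l \<psi> \<phi>"
  shows "is_zigzag C k a h b \<Longrightarrow> is_zigzag D l (\<psi> a) (map \<phi> h) (\<psi> b)"
proof (induction h arbitrary: a)
  case (Cons c h)
  then show ?case
    using column_morphismD[OF assms] by auto
qed simp

text \<open>The image of a nonidentity column may be an identity, so \<open>\<phi>\<close> does not
  preserve reduced zigzags; the two sides agree only after the outer reduction. When columns are
  merged, \<open>add_column_merge\<close> in the target splits the image again.\<close>

lemma foldr_map_add_column: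
  assumes C: "coloured_category C" and D: "coloured_category D" and \<phi>: "column_morphism C k D l \<psi> \<phi>"
    and h: "is_zigzag C k a (c # h) b" and z: "is_zigzag D l (\<psi> b) z e" "is_reduced D l z"
  shows "foldr (add_column D l) (map \<phi> (add_column C k c h)) z =
     add_column D l (\<phi> c) (foldr (add_column D l) (map \<phi> h) z)"
proof -
  have c: "is_column C k c" using h by simp
  show ?thesis
  proof (cases h)
    case Nil
    then show ?thesis
      using column_morphismD(5)[OF \<phi> c] by (simp add: add_column_id)
  next
    case (Cons d h')
    then have d: "is_column C k d" using h by simp
    have "is_zigzag D l (\<psi> a) (map \<phi> (c # d # h') @ z) e"
      using is_zigzag_map[OF \<phi> h] z Cons unfolding is_zigzag_append by blast
    then have zz: "is_zigzag D l (\<psi> a) ([\<phi> c, \<phi> d] @ foldr (add_column D l) (map \<phi> h') z) e"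
        "is_reduced D l (foldr (add_column D l) (map \<phi> h') z)"
      using foldr_add_column[OF D z(2), of _ "map \<phi> h'"] by auto
    show ?thesis
    proof (cases "is_id_column C k c")
      case True
      then show ?thesis
        using Cons column_morphismD(5)[OF \<phi> c] by (simp add: add_column_id)
    next
      case False
      show ?thesis
      proof (cases "rightward c = rightward d")
        case True
        then have cd: "composable C k c d" using h Cons by (simp add: composable_def)
        have "add_column D l (\<phi> c) (foldr (add_column D l) (map \<phi> h) z) =
            add_column D l (\<phi> (merge_columns C k c d)) (foldr (add_column D l) (map \<phi> h') z)"
          using add_column_merge[OF D, of l "\<psi> a" "\<phi> c" "\<phi> d" _ e] zz True Cons
            column_morphismD(2)[OF \<phi> c] column_morphismD(2)[OF \<phi> d] column_morphismD(6)[OF \<phi> cd] by simp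
        then show ?thesis
          using Cons False True column_morphismD(5)[OF \<phi> is_column_merge[OF C cd]] by (simp add: add_column_id)
      next
        case dir: False
        then show ?thesis using Cons False by simp
      qed
    qed
  qed
qed

text \<open>The tail \<open>z\<close> lets one statement serve twice: with empty tail it says that
  reducing before \<open>\<phi>\<close> makes no difference, and with \<open>\<phi>\<close> the
  identity it handles concatenation.\<close>

lemma foldr_map_reduce:
  assumes C: "coloured_category C" and D: "coloured_category D" and \<phi>: "column_morphism C k D l \<psi> \<phi>"
    and z: "is_zigzag D l (\<psi> b) z e" "is_reduced D l z"
  shows "is_zigzag C k a h b \<Longrightarrow> foldr (add_column D l) (map \<phi> (reduce_zigzag C k h)) z =
     foldr (add_column D l) (map \<phi> h) z"
proof (induction h arbitrary: a)
  case Nil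
  then show ?case by (simp add: reduce_zigzag_def)
next
  case (Cons c h)
  then have "is_zigzag C k (rchain c) (reduce_zigzag C k h) b"
    using reduce_zigzag_in(1)[OF C] by simp
  then have "is_zigzag C k a (c # reduce_zigzag C k h) b"
    using Cons.prems by simp
  have "foldr (add_column D l) (map \<phi> (add_column C k c (reduce_zigzag C k h))) z =
      add_column D l (\<phi> c) (foldr (add_column D l) (map \<phi> (reduce_zigzag C k h)) z)"
    by (rule foldr_map_add_column[where \<psi> = \<psi> and \<phi> = \<phi> and b = b, OF C D \<phi> \<open>is_zigzag C k a (c # reduce_zigzag C k h) b\<close> z])
  moreover have "reduce_zigzag C k (c # h) = add_column C k c (reduce_zigzag C k h)"
    by (simp add: reduce_zigzag_def)
  ultimately show ?case
    using Cons.IH[of "rchain c"] Cons.prems by simp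
qed

lemma reduce_map_reduce:
  assumes "coloured_category C" "coloured_category D" "column_morphism C k D l \<psi> \<phi>" "is_zigzag C k a h b"
  shows "reduce_zigzag D l (map \<phi> (reduce_zigzag C k h)) = reduce_zigzag D l (map \<phi> h)"
  using foldr_map_reduce[where \<psi> = \<psi> and \<phi> = \<phi> and b = b and e = "\<psi> b", OF assms(1-3) _ is_reduced_Nil assms(4)] by (simp add: reduce_zigzag_def)

lemma column_morphism_id: "column_morphism C k C k (\<lambda>a. a) (\<lambda>c. c)"
  by (simp add: column_morphism_def)

lemma reduce_append_left:
  assumes C: "coloured_category C" and f: "is_zigzag C k a f b" and g: "is_zigzag C k b g c"
  shows "reduce_zigzag C k (reduce_zigzag C k f @ g) = reduce_zigzag C k (f @ g)"
  using foldr_map_reduce[where \<psi> = "\<lambda>a. a" and \<phi> = "\<lambda>c. c", OF C C column_morphism_id reduce_zigzag_in[OF C g] f]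
  by (simp add: reduce_zigzag_def)

text \<open>Reduction works from the right, so the right factor is reduced first in any case; only
  the fact that a reduced zigzag is its own reduction remains.\<close>

lemma reduce_append_right:
  assumes C: "coloured_category C" and g: "is_zigzag C k b g c"
  shows "reduce_zigzag C k (f @ reduce_zigzag C k g) = reduce_zigzag C k (f @ g)"
  using reduce_zigzag_reduced[OF reduce_zigzag_in(2)[OF C g]] by (simp add: reduce_zigzag_def)

lemma reduce_append_both:
  assumes C: "coloured_category C" and f: "is_zigzag C k a f b" and g: "is_zigzag C k b g c"
  shows "reduce_zigzag C k (reduce_zigzag C k f @ reduce_zigzag C k g) = reduce_zigzag C k (f @ g)"
  unfolding reduce_append_right[OF C g] by (rule reduce_append_left[OF C f g])


section \<open>The hammock localisation as a simplicial category\<close>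

definition restrict_chain :: "nat \<Rightarrow> (nat \<Rightarrow> nat) \<Rightarrow> (nat \<Rightarrow> nat \<Rightarrow> 'm) \<Rightarrow> nat \<Rightarrow> nat \<Rightarrow> 'm" where
  "restrict_chain m \<alpha> a = (\<lambda>i j. if i \<le> j \<and> j \<le> m then a (\<alpha> i) (\<alpha> j) else undefined)"

lemma restrict_column_alt:
  "restrict_column m \<alpha> c = Column (rightward c) (restrict_chain m \<alpha> (lchain c)) (restrict_chain m \<alpha> (rchain c))
     (\<lambda>i. if i \<le> m then comps c (\<alpha> i) else undefined)"
  by (simp add: restrict_column_def restrict_chain_def)

lemma is_chain_restrict:
  assumes C: "coloured_category C" and \<alpha>: "simplex_op m n \<alpha>" and a: "is_chain C n a"
  shows "is_chain C m (restrict_chain m \<alpha> a)" "\<And>i. i \<le> m \<Longrightarrow> vtx C (restrict_chain m \<alpha> a) i = vtx C a (\<alpha> i)"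
proof -
  have op: "i \<le> j \<Longrightarrow> j \<le> m \<Longrightarrow> \<alpha> i \<le> \<alpha> j" "j \<le> m \<Longrightarrow> \<alpha> j \<le> n" for i j
    using simplex_op_mono[OF \<alpha>] simplex_op_le[OF \<alpha>] by auto
  show "is_chain C m (restrict_chain m \<alpha> a)"
  proof (rule is_chainI(1)[where v = "\<lambda>i. vtx C a (\<alpha> i)"])
    fix i j assume ij: "i \<le> j" "j \<le> m"
    then show "restrict_chain m \<alpha> a i j \<in> homs C (vtx C a (\<alpha> i)) (vtx C a (\<alpha> j)) \<and> restrict_chain m \<alpha> a i j \<in> col C"
      using is_chain_homs[OF C a op(1)[OF ij] op(2)[OF ij(2)]] is_chain_col[OF a op(1)[OF ij] op(2)[OF ij(2)]]
      by (simp add: restrict_chain_def)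
  next
    fix i assume i: "i \<le> m"
    then show "restrict_chain m \<alpha> a i i = idt C (vtx C a (\<alpha> i))"
      unfolding is_chain_idt[OF a op(2)[OF i], symmetric] by (simp add: restrict_chain_def)
  next
    fix i j l assume ijl: "i \<le> j" "j \<le> l" "l \<le> m"
    then show "restrict_chain m \<alpha> a i l = restrict_chain m \<alpha> a j l \<cdot>\<^bsub>C\<^esub> restrict_chain m \<alpha> a i j"
      using is_chain_cmp[OF a op(1)[OF ijl(1)] op(1)[OF ijl(2,3)] op(2)[OF ijl(3)]] by (simp add: restrict_chain_def)
  qed (auto simp: restrict_chain_def)
  show "\<And>i. i \<le> m \<Longrightarrow> vtx C (restrict_chain m \<alpha> a) i = vtx C a (\<alpha> i)"
    by (simp add: restrict_chain_def)
qed

lemma is_chain_trans_restrict: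
  assumes \<alpha>: "simplex_op m n \<alpha>" and \<tau>: "is_chain_trans C n a b \<tau>"
  shows "is_chain_trans C m (restrict_chain m \<alpha> a) (restrict_chain m \<alpha> b) (\<lambda>i. if i \<le> m then \<tau> (\<alpha> i) else undefined)"
proof (rule is_chain_transI)
  fix i assume "i \<le> m"
  then show "(if i \<le> m then \<tau> (\<alpha> i) else undefined) \<in> homs C (vtx C (restrict_chain m \<alpha> a) i) (vtx C (restrict_chain m \<alpha> b) i)"
    using is_chain_trans_homs[OF \<tau> simplex_op_le[OF \<alpha>]] by (simp add: restrict_chain_def)
next
  fix i j assume "i \<le> j" "j \<le> m"
  then show "(if j \<le> m then \<tau> (\<alpha> j) else undefined) \<cdot>\<^bsub>C\<^esub> restrict_chain m \<alpha> a i j =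
      restrict_chain m \<alpha> b i j \<cdot>\<^bsub>C\<^esub> (if i \<le> m then \<tau> (\<alpha> i) else undefined)"
    using is_chain_trans_natural[OF \<tau> simplex_op_mono[OF \<alpha>] simplex_op_le[OF \<alpha>]] by (simp add: restrict_chain_def)
qed simp

lemma column_morphism_restrict:
  assumes C: "coloured_category C" and \<alpha>: "simplex_op m n \<alpha>"
  shows "column_morphism C n C m (restrict_chain m \<alpha>) (restrict_column m \<alpha>)"
  unfolding column_morphism_def
proof (intro conjI allI impI)
  fix c assume c: "is_column C n c"
  show "is_column C m (restrict_column m \<alpha> c)"
    using c is_chain_restrict(1)[OF C \<alpha>] is_chain_trans_restrict[OF \<alpha>] simplex_op_le[OF \<alpha>]
    unfolding is_column_iff restrict_column_alt by auto
  show "rightward (restrict_column m \<alpha> c) = rightward c" "lchain (restrict_column m \<alpha> c) = restrict_chain m \<alpha> (lchain c)"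
    "rchain (restrict_column m \<alpha> c) = restrict_chain m \<alpha> (rchain c)"
    by (simp_all add: restrict_column_alt)
  assume "is_id_column C n c"
  then have "comps c (\<alpha> i) = idt C (src C (comps c (\<alpha> i)))" if "i \<le> m" for i
    using simplex_op_le[OF \<alpha> that] unfolding is_id_column_def by blast
  then show "is_id_column C m (restrict_column m \<alpha> c)"
    unfolding is_id_column_def restrict_column_alt by simp
next
  fix c d :: "'b column"
  show "restrict_column m \<alpha> (merge_columns C n c d) = merge_columns C m (restrict_column m \<alpha> c) (restrict_column m \<alpha> d)"
    using simplex_op_le[OF \<alpha>] by (simp add: restrict_column_alt merge_columns_def fun_eq_iff)
qed

lemma const_chain_idt: "\<lbrakk>i \<le> j; j \<le> k\<rbrakk> \<Longrightarrow> const_chain C k x i j = idt C x"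
  by (simp add: const_chain_def)

lemma vtx_const_chain: "\<lbrakk>coloured_category C; x \<in> obs C; i \<le> k\<rbrakk> \<Longrightarrow> vtx C (const_chain C k x) i = x"
  by (simp add: const_chain_def homsD[OF category_idt[OF coloured_categoryD]])

lemma is_chain_const:
  assumes "coloured_category C" "x \<in> obs C" shows "is_chain C k (const_chain C k x)"
  by (rule is_chainI(1)[where v = "\<lambda>_. x"])
    (use category_idt[OF coloured_categoryD[OF assms(1)] assms(2)] category_idt_left[OF coloured_categoryD[OF assms(1)]] assms
      in \<open>auto simp: const_chain_def col_idt\<close>)

lemma restrict_const_chain: "simplex_op m n \<alpha> \<Longrightarrow> restrict_chain m \<alpha> (const_chain C n x) = const_chain C m x"
  by (auto simp: restrict_chain_def const_chain_def fun_eq_iff dest: simplex_op_mono simplex_op_le)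

lemma simps_hammocks:
  "h \<in> simps (hammocks C x y) k \<longleftrightarrow> is_zigzag C k (const_chain C k x) h (const_chain C k y) \<and> is_reduced C k h"
  by (simp add: hammocks_def)

lemma sact_hammocks: "sact (hammocks C x y) m n \<alpha> h = reduce_zigzag C m (map (restrict_column m \<alpha>) h)"
  by (simp add: hammocks_def)

lemma restrict_zigzag:
  assumes "coloured_category C" "simplex_op m n \<alpha>" "is_zigzag C n (const_chain C n x) h (const_chain C n y)"
  shows "is_zigzag C m (const_chain C m x) (map (restrict_column m \<alpha>) h) (const_chain C m y)"
  using is_zigzag_map[OF column_morphism_restrict[OF assms(1,2)] assms(3)]
  by (simp add: restrict_const_chain[OF assms(2)])

lemma restrict_restrict_column:
  assumes "simplex_op l m \<beta>" shows "restrict_column l \<beta> (restrict_column m \<alpha> c) = restrict_column l (\<alpha> \<circ> \<beta>) c"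
  using simplex_op_mono[OF assms] simplex_op_le[OF assms] by (auto simp: restrict_column_def fun_eq_iff)

text \<open>Restriction sets everything out of range to \<open>undefined\<close>. In a genuine
  column it has that value already.\<close>

lemma restrict_column_ident:
  assumes "is_column C n c" shows "restrict_column n (\<lambda>i. i) c = c"
proof -
  have l: "is_chain C n (lchain c)" and r: "is_chain C n (rchain c)"
    and t: "is_chain_trans C n (lchain c) (rchain c) (comps c) \<or> is_chain_trans C n (rchain c) (lchain c) (comps c)"
    using assms unfolding is_column_iff by blast+
  have "(\<lambda>i j. if i \<le> j \<and> j \<le> n then lchain c i j else undefined) = lchain c"
    by (intro ext) (simp add: is_chain_undefined[OF l])
  moreover have "(\<lambda>i j. if i \<le> j \<and> j \<le> n then rchain c i j else undefined) = rchain c"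
    by (intro ext) (simp add: is_chain_undefined[OF r])
  moreover have "comps c i = undefined" if "\<not> i \<le> n" for i
    using t is_chain_trans_undefined[OF _ that] by metis
  then have "(\<lambda>i. if i \<le> n then comps c i else undefined) = comps c"
    by (intro ext) simp
  ultimately show ?thesis
    unfolding restrict_column_def by simp
qed

lemma restrict_column_cong: "(\<And>i. i \<le> m \<Longrightarrow> \<alpha> i = \<beta> i) \<Longrightarrow> restrict_column m \<alpha> c = restrict_column m \<beta> c"
  by (auto simp: restrict_column_def fun_eq_iff)

text \<open>The simplicial identities hold strictly, although each operator reduces its result: by
  \<open>reduce_map_reduce\<close> an intermediate reduction can be omitted.\<close>

lemma sset_hammocks:
  assumes C: "coloured_category C"
  shows "sset (hammocks C x y)"
  unfolding sset_def
proof (intro conjI allI impI ballI)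
  fix m n \<alpha> h assume "simplex_op m n \<alpha>" "h \<in> simps (hammocks C x y) n"
  then show "sact (hammocks C x y) m n \<alpha> h \<in> simps (hammocks C x y) m"
    using reduce_zigzag_in[OF C restrict_zigzag[OF C, of m n \<alpha> x h y]] by (simp add: simps_hammocks sact_hammocks)
next
  fix l m n \<alpha> \<beta> h assume a: "simplex_op l m \<beta> \<and> simplex_op m n \<alpha>" "h \<in> simps (hammocks C x y) n"
  then have b: "simplex_op l m \<beta>" "simplex_op m n \<alpha>"
    and z: "is_zigzag C n (const_chain C n x) h (const_chain C n y)"
    by (auto simp: simps_hammocks)
  show "sact (hammocks C x y) l m \<beta> (sact (hammocks C x y) m n \<alpha> h) = sact (hammocks C x y) l n (\<alpha> \<circ> \<beta>) h"
    unfolding sact_hammocks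
      reduce_map_reduce[OF C C column_morphism_restrict[OF C b(1)] restrict_zigzag[OF C b(2) z]]
    by (simp add: restrict_restrict_column[OF b(1)] o_def)
next
  fix n h assume h: "h \<in> simps (hammocks C x y) n"
  then have "map (restrict_column n (\<lambda>i. i)) h = h"
    by (intro map_idI restrict_column_ident[where C = C]) (auto simp: simps_hammocks dest: is_zigzag_columns)
  then show "sact (hammocks C x y) n n (\<lambda>i. i) h = h"
    using h by (simp add: sact_hammocks simps_hammocks reduce_zigzag_reduced)
next
  fix m n \<alpha> \<beta> h assume "simplex_op m n \<alpha> \<and> (\<forall>i\<le>m. \<alpha> i = \<beta> i)" "h \<in> simps (hammocks C x y) n"
  then have "map (restrict_column m \<alpha>) h = map (restrict_column m \<beta>) h"
    by (intro map_cong refl restrict_column_cong) simp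
  then show "sact (hammocks C x y) m n \<alpha> h = sact (hammocks C x y) m n \<beta> h"
    by (simp only: sact_hammocks)
qed

lemma localisation_simps:
  "sobs (localisation C) = obs C" "smap (localisation C) = hammocks C" "sidt (localisation C) x = []"
  "scmp (localisation C) x y z k g f = reduce_zigzag C k (f @ g)"
  by (simp_all add: localisation_def)

lemma degen_localisation:
  "degen (localisation C) x y k h = reduce_zigzag C k (map (restrict_column k (\<lambda>_. 0)) h)"
  by (simp add: degen_def localisation_simps sact_hammocks)

text \<open>Every iterated composite is the reduction of one concatenation, so associativity and
  compatibility with the operators come from those of lists.\<close>

lemma simplicial_category_localisation:
  assumes C: "coloured_category C"
  shows "simplicial_category (localisation C)"
proof (unfold_locales, unfold localisation_simps degen_localisation sact_hammocks simps_hammocks)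
  show "sset (hammocks C x y)" for x y
    by (rule sset_hammocks[OF C])
  fix x y z k f g
  assume a: "is_zigzag C k (const_chain C k x) f (const_chain C k y) \<and> is_reduced C k f"
    "is_zigzag C k (const_chain C k y) g (const_chain C k z) \<and> is_reduced C k g"
  then have fg: "is_zigzag C k (const_chain C k x) (f @ g) (const_chain C k z)"
    unfolding is_zigzag_append by blast
  show "is_zigzag C k (const_chain C k x) (reduce_zigzag C k (f @ g)) (const_chain C k z) \<and>
      is_reduced C k (reduce_zigzag C k (f @ g))"
    using reduce_zigzag_in[OF C fg] by blast
  show "reduce_zigzag C m (map (restrict_column m \<alpha>) (reduce_zigzag C k (f @ g))) =
      reduce_zigzag C m (reduce_zigzag C m (map (restrict_column m \<alpha>) f) @ reduce_zigzag C m (map (restrict_column m \<alpha>) g))"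
    if \<alpha>: "simplex_op m k \<alpha>" for m \<alpha>
    unfolding reduce_map_reduce[OF C C column_morphism_restrict[OF C \<alpha>] fg]
      reduce_append_both[OF C restrict_zigzag[OF C \<alpha> conjunct1[OF a(1)]] restrict_zigzag[OF C \<alpha> conjunct1[OF a(2)]]]
    by simp
  show "reduce_zigzag C k (reduce_zigzag C k (f @ g) @ h) = reduce_zigzag C k (f @ reduce_zigzag C k (g @ h))"
    if h: "is_zigzag C k (const_chain C k z) h (const_chain C k w) \<and> is_reduced C k h" for h w
  proof -
    have gh: "is_zigzag C k (const_chain C k y) (g @ h) (const_chain C k w)"
      using a h unfolding is_zigzag_append by blast
    show ?thesis
      unfolding reduce_append_left[OF C fg conjunct1[OF h]] reduce_append_right[OF C gh] by simp
  qed
qed (auto simp: const_chain_def reduce_zigzag_reduced) 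

lemma coloured_functorD:
  "coloured_functor C D F \<Longrightarrow> is_functor C D F" "\<lbrakk>coloured_functor C D F; f \<in> col C\<rbrakk> \<Longrightarrow> onar F f \<in> col D"
  by (simp_all add: coloured_functor_def)

section \<open>Coloured natural transformations\<close>

locale coloured_nat_trans =
  fixes C :: "('o, 'm) ccat" and D :: "('p, 'n) ccat" and P Q :: "('o, 'm, 'p, 'n) fctr" and \<eta> :: "'o \<Rightarrow> 'n"
  assumes C: "coloured_category C" and D: "coloured_category D"
    and P: "coloured_functor C D P" and Q: "coloured_functor C D Q"
    and nat: "nat_trans C D P Q \<eta>" and col: "x \<in> obs C \<Longrightarrow> \<eta> x \<in> col D"
begin

lemmas catD = coloured_categoryD[OF D]
lemmas fP = coloured_functorD(1)[OF P] and fQ = coloured_functorD(1)[OF Q]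

lemma nat_homs: "x \<in> obs C \<Longrightarrow> \<eta> x \<in> homs D (onob P x) (onob Q x)"
  by (rule nat[unfolded nat_trans_def, THEN conjunct1, rule_format])

lemma nat_square: "f \<in> homs C x y \<Longrightarrow> \<eta> y \<cdot>\<^bsub>D\<^esub> onar P f = onar Q f \<cdot>\<^bsub>D\<^esub> \<eta> x"
  by (rule nat[unfolded nat_trans_def, THEN conjunct2, rule_format])

text \<open>The rows of a hammock on which \<open>s\<close> vanishes are mapped by \<open>P\<close>, the others by \<open>Q\<close>.\<close>

definition prism_chain :: "nat \<Rightarrow> (nat \<Rightarrow> nat) \<Rightarrow> (nat \<Rightarrow> nat \<Rightarrow> 'm) \<Rightarrow> nat \<Rightarrow> nat \<Rightarrow> 'n" where
  "prism_chain k s a = (\<lambda>i j. if i \<le> j \<and> j \<le> k then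
       (if s j = 0 then onar P (a i j) else if s i = 0 then \<eta> (vtx C a j) \<cdot>\<^bsub>D\<^esub> onar P (a i j) else onar Q (a i j))
     else undefined)"

definition prism_vtx :: "(nat \<Rightarrow> nat) \<Rightarrow> (nat \<Rightarrow> nat \<Rightarrow> 'm) \<Rightarrow> nat \<Rightarrow> 'p" where
  "prism_vtx s a i = (if s i = 0 then onob P (vtx C a i) else onob Q (vtx C a i))"

definition prism_column :: "nat \<Rightarrow> (nat \<Rightarrow> nat) \<Rightarrow> 'm column \<Rightarrow> 'n column" where
  "prism_column k s c = Column (rightward c) (prism_chain k s (lchain c)) (prism_chain k s (rchain c))
     (\<lambda>i. if i \<le> k then (if s i = 0 then onar P (comps c i) else onar Q (comps c i)) else undefined)"

lemma step_mono: "\<lbrakk>simplex_op k 1 s; i \<le> j; j \<le> k; s j = 0\<rbrakk> \<Longrightarrow> s i = 0"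
  using simplex_op_mono by fastforce

text \<open>The chain is the image of \<open>a\<close> under \<open>P\<close> up to the step of
  \<open>s\<close> and under \<open>Q\<close> beyond it, with a component of \<open>\<eta>\<close>
  in between. The components must be coloured because the arrows of a chain are.\<close>

lemma prism_chain_is_chain:
  assumes s: "simplex_op k 1 s" and a: "is_chain C k a"
  shows "is_chain D k (prism_chain k s a)" "\<And>i. i \<le> k \<Longrightarrow> vtx D (prism_chain k s a) i = prism_vtx s a i"
proof -
  note ah = is_chain_homs[OF C a] and ao = is_chain_obs[OF C a]
  have 1: "prism_chain k s a i j \<in> homs D (prism_vtx s a i) (prism_vtx s a j) \<and> prism_chain k s a i j \<in> col D"
    if ij: "i \<le> j" "j \<le> k" for i j
  proof -
    have p: "onar P (a i j) \<in> homs D (onob P (vtx C a i)) (onob P (vtx C a j))" "onar P (a i j) \<in> col D"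
      and q: "onar Q (a i j) \<in> homs D (onob Q (vtx C a i)) (onob Q (vtx C a j))" "onar Q (a i j) \<in> col D"
      using functor_homs[OF fP ah[OF ij]] functor_homs[OF fQ ah[OF ij]]
        coloured_functorD(2)[OF P is_chain_col[OF a ij]] coloured_functorD(2)[OF Q is_chain_col[OF a ij]] by auto
    note e = nat_homs[OF ao[OF ij(2)]] col[OF ao[OF ij(2)]]
    show ?thesis
      using p q step_mono[OF s ij] category_cmp[OF catD p(1) e(1)] col_cmp[OF D p(2) e(2) p(1) e(1)] ij
      by (auto simp: prism_chain_def prism_vtx_def)
  qed
  have 2: "prism_chain k s a i i = idt D (prism_vtx s a i)" if i: "i \<le> k" for i
    using i functor_idt[OF fP ao[OF i]] functor_idt[OF fQ ao[OF i]] is_chain_idt[OF a i]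
    by (simp add: prism_chain_def prism_vtx_def)
  have 3: "prism_chain k s a i l = prism_chain k s a j l \<cdot>\<^bsub>D\<^esub> prism_chain k s a i j"
    if ij: "i \<le> j" and jl: "j \<le> l" and l: "l \<le> k" for i j l
  proof -
    have j: "j \<le> k" and il: "i \<le> l" using that by auto
    note h1 = ah[OF ij j] and h2 = ah[OF jl l]
    have p: "onar P (a i l) = onar P (a j l) \<cdot>\<^bsub>D\<^esub> onar P (a i j)" "onar Q (a i l) = onar Q (a j l) \<cdot>\<^bsub>D\<^esub> onar Q (a i j)"
      using functor_cmp[OF fP h1 h2] functor_cmp[OF fQ h1 h2] is_chain_cmp[OF a ij jl l] by simp_all
    \<comment> \<open>The mixed cases of the composition law. If the step from \<open>P\<close> to
      \<open>Q\<close> lies between \<open>j\<close> and \<open>l\<close>, associativity is enough;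
      if it lies between \<open>i\<close> and \<open>j\<close>, naturality of \<open>\<eta>\<close>
      at \<open>a j l\<close> is used as well.\<close>
    have q: "\<eta> (vtx C a l) \<cdot>\<^bsub>D\<^esub> (onar P (a j l) \<cdot>\<^bsub>D\<^esub> onar P (a i j)) = (\<eta> (vtx C a l) \<cdot>\<^bsub>D\<^esub> onar P (a j l)) \<cdot>\<^bsub>D\<^esub> onar P (a i j)"
      by (rule category_assoc[OF catD functor_homs[OF fP h1] functor_homs[OF fP h2] nat_homs[OF ao[OF l]]])
    have r: "(\<eta> (vtx C a l) \<cdot>\<^bsub>D\<^esub> onar P (a j l)) \<cdot>\<^bsub>D\<^esub> onar P (a i j) = onar Q (a j l) \<cdot>\<^bsub>D\<^esub> (\<eta> (vtx C a j) \<cdot>\<^bsub>D\<^esub> onar P (a i j))"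
      unfolding nat_square[OF h2]
      by (rule category_assoc[OF catD functor_homs[OF fP h1] nat_homs[OF ao[OF j]] functor_homs[OF fQ h2], symmetric])
    show ?thesis
      using step_mono[OF s ij j] step_mono[OF s jl l] that j il p q r
      by (auto simp: prism_chain_def)
  qed
  have 4: "prism_chain k s a i j = undefined" if "\<not> (i \<le> j \<and> j \<le> k)" for i j
    unfolding prism_chain_def if_not_P[OF that] by (rule refl)
  show "is_chain D k (prism_chain k s a)"
    using 1 2 3 4 by (rule is_chainI(1)[where v = "prism_vtx s a"])
  show "\<And>i. i \<le> k \<Longrightarrow> vtx D (prism_chain k s a) i = prism_vtx s a i"
    using 1 by (simp add: homs_def)
qed

lemma prism_trans:
  assumes s: "simplex_op k 1 s" and a: "is_chain C k a" and b: "is_chain C k b" and \<tau>: "is_chain_trans C k a b \<tau>"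
  shows "is_chain_trans D k (prism_chain k s a) (prism_chain k s b)
     (\<lambda>i. if i \<le> k then (if s i = 0 then onar P (\<tau> i) else onar Q (\<tau> i)) else undefined)" (is "is_chain_trans D k _ _ ?t")
proof (rule is_chain_transI)
  fix i assume i: "i \<le> k"
  show "?t i \<in> homs D (vtx D (prism_chain k s a) i) (vtx D (prism_chain k s b) i)"
    unfolding prism_chain_is_chain(2)[OF s a i] prism_chain_is_chain(2)[OF s b i]
    using i functor_homs[OF fP is_chain_trans_homs[OF \<tau> i]] functor_homs[OF fQ is_chain_trans_homs[OF \<tau> i]]
    by (simp add: prism_vtx_def)
next
  fix i j assume ij: "i \<le> j" "j \<le> k"
  then have i: "i \<le> k" by simp
  note ah = is_chain_homs[OF C a ij] and bh = is_chain_homs[OF C b ij]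
  note ti = is_chain_trans_homs[OF \<tau> i] and tj = is_chain_trans_homs[OF \<tau> ij(2)]
  note n = is_chain_trans_natural[OF \<tau> ij]
  have p: "onar P (\<tau> j) \<cdot>\<^bsub>D\<^esub> onar P (a i j) = onar P (b i j) \<cdot>\<^bsub>D\<^esub> onar P (\<tau> i)"
    using functor_cmp[OF fP ah tj] functor_cmp[OF fP ti bh] n by simp
  have q: "onar Q (\<tau> j) \<cdot>\<^bsub>D\<^esub> onar Q (a i j) = onar Q (b i j) \<cdot>\<^bsub>D\<^esub> onar Q (\<tau> i)"
    using functor_cmp[OF fQ ah tj] functor_cmp[OF fQ ti bh] n by simp
  note oa = is_chain_obs[OF C a ij(2)] and ob = is_chain_obs[OF C b ij(2)]
  \<comment> \<open>The mixed square, with \<open>s i = 0\<close> but \<open>s j\<close> nonzero: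
    the \<open>P\<close>-square is followed by the naturality square of \<open>\<eta>\<close> at
    \<open>\<tau> j\<close>.\<close>
  have "onar Q (\<tau> j) \<cdot>\<^bsub>D\<^esub> (\<eta> (vtx C a j) \<cdot>\<^bsub>D\<^esub> onar P (a i j)) = (onar Q (\<tau> j) \<cdot>\<^bsub>D\<^esub> \<eta> (vtx C a j)) \<cdot>\<^bsub>D\<^esub> onar P (a i j)"
    by (rule category_assoc[OF catD functor_homs[OF fP ah] nat_homs[OF oa] functor_homs[OF fQ tj]])
  also have "\<dots> = (\<eta> (vtx C b j) \<cdot>\<^bsub>D\<^esub> onar P (\<tau> j)) \<cdot>\<^bsub>D\<^esub> onar P (a i j)"
    by (simp only: nat_square[OF tj])
  also have "\<dots> = \<eta> (vtx C b j) \<cdot>\<^bsub>D\<^esub> (onar P (\<tau> j) \<cdot>\<^bsub>D\<^esub> onar P (a i j))"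
    by (rule category_assoc[OF catD functor_homs[OF fP ah] functor_homs[OF fP tj] nat_homs[OF ob], symmetric])
  also have "\<dots> = (\<eta> (vtx C b j) \<cdot>\<^bsub>D\<^esub> onar P (b i j)) \<cdot>\<^bsub>D\<^esub> onar P (\<tau> i)"
    unfolding p by (rule category_assoc[OF catD functor_homs[OF fP ti] functor_homs[OF fP bh] nat_homs[OF ob]])
  finally have r: "onar Q (\<tau> j) \<cdot>\<^bsub>D\<^esub> (\<eta> (vtx C a j) \<cdot>\<^bsub>D\<^esub> onar P (a i j)) =
     (\<eta> (vtx C b j) \<cdot>\<^bsub>D\<^esub> onar P (b i j)) \<cdot>\<^bsub>D\<^esub> onar P (\<tau> i)" .
  show "?t j \<cdot>\<^bsub>D\<^esub> prism_chain k s a i j = prism_chain k s b i j \<cdot>\<^bsub>D\<^esub> ?t i"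
    using step_mono[OF s ij] ij i p q r by (auto simp: prism_chain_def)
qed simp

lemma column_morphism_prism:
  assumes s: "simplex_op k 1 s"
  shows "column_morphism C k D k (prism_chain k s) (prism_column k s)"
  unfolding column_morphism_def
proof (intro conjI allI impI)
  fix c assume c: "is_column C k c"
  then have ch: "is_chain C k (lchain c)" "is_chain C k (rchain c)" by (auto simp: is_column_iff)
  show "is_column D k (prism_column k s c)"
    using c prism_chain_is_chain(1)[OF s ch(1)] prism_chain_is_chain(1)[OF s ch(2)]
      prism_trans[OF s ch] prism_trans[OF s ch(2,1)] coloured_functorD(2)[OF P] coloured_functorD(2)[OF Q]
    unfolding is_column_iff prism_column_def by simp
  show "rightward (prism_column k s c) = rightward c" "lchain (prism_column k s c) = prism_chain k s (lchain c)"
    "rchain (prism_column k s c) = prism_chain k s (rchain c)"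
    by (simp_all add: prism_column_def)
  assume id: "is_id_column C k c"
  have "onar P (comps c i) = idt D (src D (onar P (comps c i))) \<and> onar Q (comps c i) = idt D (src D (onar Q (comps c i)))"
    if i: "i \<le> k" for i
  proof -
    obtain x where x: "x \<in> obs C" "comps c i = idt C x"
      using id i c is_chain_trans_homs[of C k "lchain c" "rchain c" "comps c" i]
        is_chain_trans_homs[of C k "rchain c" "lchain c" "comps c" i]
        is_chain_obs[OF C ch(1) i] is_chain_obs[OF C ch(2) i] homsD[of "comps c i" C]
      unfolding is_id_column_def is_column_iff by metis
    show ?thesis
      using x functor_idt[OF fP x(1)] functor_idt[OF fQ x(1)] homsD[OF category_idt[OF catD functor_ob[OF fP x(1)]]]
        homsD[OF category_idt[OF catD functor_ob[OF fQ x(1)]]] by simp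
  qed
  then show "is_id_column D k (prism_column k s c)"
    unfolding is_id_column_def prism_column_def by simp
next
  fix c d assume cd: "composable C k c d"
  have "onar P (comps d i \<cdot>\<^bsub>C\<^esub> comps c i) = onar P (comps d i) \<cdot>\<^bsub>D\<^esub> onar P (comps c i) \<and>
      onar Q (comps d i \<cdot>\<^bsub>C\<^esub> comps c i) = onar Q (comps d i) \<cdot>\<^bsub>D\<^esub> onar Q (comps c i)"
    if "rightward c" and i: "i \<le> k" for i
  proof -
    have "comps c i \<in> homs C (vtx C (lchain c) i) (vtx C (rchain c) i)" "comps d i \<in> homs C (vtx C (rchain c) i) (vtx C (rchain d) i)"
      using that cd by (auto simp: composable_def is_column_iff intro: is_chain_trans_homs[OF _ i])
    then show ?thesis using functor_cmp[OF fP] functor_cmp[OF fQ] by blast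
  qed
  moreover have "onar P (comps c i \<cdot>\<^bsub>C\<^esub> comps d i) = onar P (comps c i) \<cdot>\<^bsub>D\<^esub> onar P (comps d i) \<and>
      onar Q (comps c i \<cdot>\<^bsub>C\<^esub> comps d i) = onar Q (comps c i) \<cdot>\<^bsub>D\<^esub> onar Q (comps d i)"
    if "\<not> rightward c" and i: "i \<le> k" for i
  proof -
    have "comps c i \<in> homs C (vtx C (rchain c) i) (vtx C (lchain c) i)" "comps d i \<in> homs C (vtx C (rchain d) i) (vtx C (rchain c) i)"
      using that cd by (auto simp: composable_def is_column_iff intro: is_chain_trans_homs[OF _ i])
    then show ?thesis using functor_cmp[OF fP] functor_cmp[OF fQ] by blast
  qed
  ultimately show "prism_column k s (merge_columns C k c d) = merge_columns D k (prism_column k s c) (prism_column k s d)"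
    by (simp add: prism_column_def merge_columns_def fun_eq_iff)
qed

lemma prism_column_0: "prism_column k (\<lambda>_. 0) = map_column_fctr P k"
  by (simp add: prism_column_def map_column_fctr_def prism_chain_def fun_eq_iff)

lemma prism_column_1: "prism_column k (\<lambda>_. 1) = map_column_fctr Q k"
  by (simp add: prism_column_def map_column_fctr_def prism_chain_def fun_eq_iff)


text \<open>The prism over the constant chain at \<open>x\<close> is not a constant chain. The following columns, which
  point to the right if \<open>r\<close> holds, join it to the constant chains at \<open>P x\<close> and \<open>Q x\<close>; their
  components are identities and \<open>\<eta> x\<close>.\<close>

definition turn_column :: "bool \<Rightarrow> nat \<Rightarrow> (nat \<Rightarrow> nat) \<Rightarrow> 'o \<Rightarrow> 'n column" where
  "turn_column r k s x =
    (let a = const_chain D k (onob P x); b = prism_chain k s (const_chain C k x)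
     in Column r (if r then a else b) (if r then b else a)
       (\<lambda>i. if i \<le> k then (if s i = 0 then idt D (onob P x) else \<eta> x) else undefined))"

definition coturn_column :: "bool \<Rightarrow> nat \<Rightarrow> (nat \<Rightarrow> nat) \<Rightarrow> 'o \<Rightarrow> 'n column" where
  "coturn_column r k s x =
    (let a = prism_chain k s (const_chain C k x); b = const_chain D k (onob Q x)
     in Column r (if r then a else b) (if r then b else a)
       (\<lambda>i. if i \<le> k then (if s i = 0 then \<eta> x else idt D (onob Q x)) else undefined))"

lemma prism_const_eq:
  assumes x: "x \<in> obs C" and ij: "i \<le> j" "j \<le> k"
  shows "prism_chain k s (const_chain C k x) i j =
    (if s j = 0 then idt D (onob P x) else if s i = 0 then \<eta> x else idt D (onob Q x))"
  using ij functor_idt[OF fP x] functor_idt[OF fQ x] vtx_const_chain[OF C x ij(2)]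
    category_idt_right[OF catD nat_homs[OF x]]
  by (simp add: prism_chain_def const_chain_idt)

lemma is_column_turn:
  assumes x: "x \<in> obs C" and s: "simplex_op k 1 s"
  shows "is_column D k (turn_column r k s x)" "is_column D k (coturn_column r k s x)"
proof -
  note oP = functor_ob[OF fP x] and oQ = functor_ob[OF fQ x]
  note c = is_chain_const[OF C x, of k]
  note chains = is_chain_const[OF D oP, of k] is_chain_const[OF D oQ, of k] prism_chain_is_chain(1)[OF s c]
  have vP: "vtx D (const_chain D k (onob P x)) i = onob P x" and vQ: "vtx D (const_chain D k (onob Q x)) i = onob Q x"
    and vM: "vtx D (prism_chain k s (const_chain C k x)) i = (if s i = 0 then onob P x else onob Q x)" if "i \<le> k" for i
    using that prism_chain_is_chain(2)[OF s c that] vtx_const_chain[OF D oP that] vtx_const_chain[OF D oQ that]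
      vtx_const_chain[OF C x that] by (simp_all add: prism_vtx_def)
  note idP = category_idt[OF catD oP] and idQ = category_idt[OF catD oQ] and e = nat_homs[OF x]
  note ids = category_idt_left[OF catD e] category_idt_right[OF catD e] category_idt_left[OF catD idP]
    category_idt_left[OF catD idQ]
  have 1: "is_chain_trans D k (const_chain D k (onob P x)) (prism_chain k s (const_chain C k x))
      (\<lambda>i. if i \<le> k then (if s i = 0 then idt D (onob P x) else \<eta> x) else undefined)"
  proof (rule is_chain_transI)
    fix i j assume ij: "i \<le> j" "j \<le> k"
    then show "(if j \<le> k then (if s j = 0 then idt D (onob P x) else \<eta> x) else undefined) \<cdot>\<^bsub>D\<^esub> const_chain D k (onob P x) i j =
      prism_chain k s (const_chain C k x) i j \<cdot>\<^bsub>D\<^esub> (if i \<le> k then (if s i = 0 then idt D (onob P x) else \<eta> x) else undefined)"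
      using step_mono[OF s ij] by (auto simp: prism_const_eq[OF x ij] const_chain_idt ids)
  qed (use idP e in \<open>auto simp: vP vM\<close>)
  have 2: "is_chain_trans D k (prism_chain k s (const_chain C k x)) (const_chain D k (onob Q x))
      (\<lambda>i. if i \<le> k then (if s i = 0 then \<eta> x else idt D (onob Q x)) else undefined)"
  proof (rule is_chain_transI)
    fix i j assume ij: "i \<le> j" "j \<le> k"
    then show "(if j \<le> k then (if s j = 0 then \<eta> x else idt D (onob Q x)) else undefined) \<cdot>\<^bsub>D\<^esub> prism_chain k s (const_chain C k x) i j =
      const_chain D k (onob Q x) i j \<cdot>\<^bsub>D\<^esub> (if i \<le> k then (if s i = 0 then \<eta> x else idt D (onob Q x)) else undefined)"
      using step_mono[OF s ij] by (auto simp: prism_const_eq[OF x ij] const_chain_idt ids)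
  qed (use idQ e in \<open>auto simp: vQ vM\<close>)
  show "is_column D k (turn_column r k s x)" "is_column D k (coturn_column r k s x)"
    using 1 2 chains col[OF x] col_idt[OF D oP] col_idt[OF D oQ]
    by (auto simp: is_column_iff turn_column_def coturn_column_def Let_def)
qed

lemma turn_column_chains:
  "lchain (turn_column True k s x) = const_chain D k (onob P x)"
  "rchain (turn_column True k s x) = prism_chain k s (const_chain C k x)"
  "lchain (turn_column False k s x) = prism_chain k s (const_chain C k x)"
  "rchain (turn_column False k s x) = const_chain D k (onob P x)"
  "lchain (coturn_column True k s x) = prism_chain k s (const_chain C k x)"
  "rchain (coturn_column True k s x) = const_chain D k (onob Q x)"
  "lchain (coturn_column False k s x) = const_chain D k (onob Q x)"
  "rchain (coturn_column False k s x) = prism_chain k s (const_chain C k x)"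
  by (simp_all add: turn_column_def coturn_column_def Let_def)

lemma prism_chain_const:
  assumes "x \<in> obs C"
  shows "prism_chain k (\<lambda>_. 0) (const_chain C k x) = const_chain D k (onob P x)"
    "prism_chain k (\<lambda>_. 1) (const_chain C k x) = const_chain D k (onob Q x)"
  using functor_idt[OF fP assms] functor_idt[OF fQ assms]
  by (auto simp: prism_chain_def const_chain_def fun_eq_iff)

text \<open>In both cases the prism over the constant chain is itself constant, and all that remains
  is a column of copies of \<open>\<eta> x\<close>. Hence the same hammock occurs at both ends of
  the homotopy.\<close>

lemma turn_1_eq_coturn_0: "x \<in> obs C \<Longrightarrow> turn_column r k (\<lambda>_. 1) x = coturn_column r k (\<lambda>_. 0) x"
  by (simp add: turn_column_def coturn_column_def Let_def prism_chain_const[unfolded One_nat_def])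

lemma is_id_turn:
  assumes "x \<in> obs C"
  shows "is_id_column D k (turn_column r k (\<lambda>_. 0) x)" "is_id_column D k (coturn_column r k (\<lambda>_. 1) x)"
  using homsD[OF category_idt[OF catD functor_ob[OF fP assms]]] homsD[OF category_idt[OF catD functor_ob[OF fQ assms]]]
  by (simp_all add: is_id_column_def turn_column_def coturn_column_def Let_def)

lemma restrict_prism_chain:
  assumes \<alpha>: "simplex_op m n \<alpha>"
  shows "restrict_chain m \<alpha> (prism_chain n s a) = prism_chain m (s \<circ> \<alpha>) (restrict_chain m \<alpha> a)"
  using simplex_op_mono[OF \<alpha>] simplex_op_le[OF \<alpha>]
  by (intro ext) (simp add: restrict_chain_def prism_chain_def)

lemma restrict_prism_column:
  assumes \<alpha>: "simplex_op m n \<alpha>"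
  shows "restrict_column m \<alpha> (prism_column n s c) = prism_column m (s \<circ> \<alpha>) (restrict_column m \<alpha> c)"
  using simplex_op_le[OF \<alpha>]
  by (simp add: restrict_column_alt prism_column_def restrict_prism_chain[OF \<alpha>] fun_eq_iff)

lemma restrict_turn_column:
  assumes \<alpha>: "simplex_op m n \<alpha>"
  shows "restrict_column m \<alpha> (turn_column r n s x) = turn_column r m (s \<circ> \<alpha>) x"
    "restrict_column m \<alpha> (coturn_column r n s x) = coturn_column r m (s \<circ> \<alpha>) x"
  using simplex_op_le[OF \<alpha>]
  by (simp_all add: restrict_column_alt turn_column_def coturn_column_def Let_def restrict_prism_chain[OF \<alpha>]
      restrict_const_chain[OF \<alpha>] fun_eq_iff)

lemma prism_zigzag:
  assumes s: "simplex_op k 1 s" and h: "is_zigzag C k (const_chain C k x) h (const_chain C k y)"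
    and xy: "x \<in> obs C" "y \<in> obs C"
  shows "is_zigzag D k (const_chain D k (onob P x))
     (turn_column True k s x # map (prism_column k s) h @ [coturn_column True k s y]) (const_chain D k (onob Q y))"
  using is_zigzag_map[OF column_morphism_prism[OF s] h] is_column_turn[OF xy(1) s] is_column_turn[OF xy(2) s]
  by (auto simp: turn_column_chains is_zigzag_append)

text \<open>The outer columns repair the ends of the prism. At \<open>s = 0\<close> the first is an
  identity, leaving \<open>P h\<close> followed by \<open>\<eta> y\<close>; at \<open>s = 1\<close>
  the last is an identity, leaving \<open>\<eta> x\<close> followed by \<open>Q h\<close>. So this
  is a homotopy between the two sides of the naturality square.\<close>

definition hammock_prism :: "'o \<Rightarrow> 'o \<Rightarrow> nat \<Rightarrow> (nat \<Rightarrow> nat) \<Rightarrow> 'm column list \<Rightarrow> 'n column list" where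
  "hammock_prism x y k s h =
     reduce_zigzag D k (turn_column True k s x # map (prism_column k s) h @ [coturn_column True k s y])"

lemma simplicial_homotopy_hammock_prism:
  assumes xy: "x \<in> obs C" "y \<in> obs C"
  shows "simplicial_homotopy (hammocks C x y) (hammocks D (onob P x) (onob Q y)) (hammock_prism x y)"
  unfolding simplicial_homotopy_def
proof (intro conjI allI impI ballI)
  fix n s h assume "simplex_op n 1 s" "h \<in> simps (hammocks C x y) n"
  then show "hammock_prism x y n s h \<in> simps (hammocks D (onob P x) (onob Q y)) n"
    unfolding simps_hammocks hammock_prism_def
    using reduce_zigzag_in[OF D prism_zigzag[OF _ _ xy, of n s h]] by simp
next
  fix m n \<alpha> s h assume "simplex_op m n \<alpha> \<and> simplex_op n 1 s" "h \<in> simps (hammocks C x y) n"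
  then have \<alpha>: "simplex_op m n \<alpha>" and s: "simplex_op n 1 s"
    and h: "is_zigzag C n (const_chain C n x) h (const_chain C n y)" by (auto simp: simps_hammocks)
  have s\<alpha>: "simplex_op m 1 (s \<circ> \<alpha>)" by (rule simplex_op_comp[OF \<alpha> s])
  let ?h = "map (restrict_column m \<alpha>) h"
  have h': "is_zigzag C m (const_chain C m x) ?h (const_chain C m y)"
    by (rule restrict_zigzag[OF C \<alpha> h])
  let ?t = "[turn_column True m (s \<circ> \<alpha>) x]" and ?u = "[coturn_column True m (s \<circ> \<alpha>) y]"
  let ?M = "\<lambda>x. prism_chain m (s \<circ> \<alpha>) (const_chain C m x)"
  have t: "is_zigzag D m (const_chain D m (onob P x)) ?t (?M x)" "is_zigzag D m (?M y) ?u (const_chain D m (onob Q y))"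
    using is_column_turn[OF xy(1) s\<alpha>] is_column_turn[OF xy(2) s\<alpha>] by (auto simp: turn_column_chains)
  note r = reduce_zigzag_in(1)[OF C h']
  note m1 = is_zigzag_map[OF column_morphism_prism[OF s\<alpha>] r] and m2 = is_zigzag_map[OF column_morphism_prism[OF s\<alpha>] h']
  have tl: "is_zigzag D m (const_chain D m (onob P x)) (?t @ map (prism_column m (s \<circ> \<alpha>)) k) (?M y)"
    if "is_zigzag D m (?M x) (map (prism_column m (s \<circ> \<alpha>)) k) (?M y)" for k
    using t(1) that unfolding is_zigzag_append by blast
  have "hammock_prism x y m (s \<circ> \<alpha>) (sact (hammocks C x y) m n \<alpha> h) =
      reduce_zigzag D m ((?t @ map (prism_column m (s \<circ> \<alpha>)) (reduce_zigzag C m ?h)) @ ?u)"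
    by (simp add: hammock_prism_def sact_hammocks)
  \<comment> \<open>Reductions are inserted around the middle block and removed again afterwards; in
    this form the restricted hammock may be replaced by its unreduced version.\<close>
  also have "\<dots> = reduce_zigzag D m (reduce_zigzag D m (?t @ reduce_zigzag D m (map (prism_column m (s \<circ> \<alpha>)) (reduce_zigzag C m ?h))) @ ?u)"
    unfolding reduce_append_right[OF D m1] reduce_append_left[OF D tl[OF m1] t(2)] by (rule refl)
  also have "\<dots> = reduce_zigzag D m ((?t @ map (prism_column m (s \<circ> \<alpha>)) ?h) @ ?u)"
    unfolding reduce_map_reduce[OF C D column_morphism_prism[OF s\<alpha>] h']
      reduce_append_right[OF D m2] reduce_append_left[OF D tl[OF m2] t(2)] by (rule refl)
  also have "\<dots> = sact (hammocks D (onob P x) (onob Q y)) m n \<alpha> (hammock_prism x y n s h)"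
    unfolding sact_hammocks hammock_prism_def
      reduce_map_reduce[OF D D column_morphism_restrict[OF D \<alpha>] prism_zigzag[OF s h xy]]
    by (simp add: restrict_turn_column[OF \<alpha>] restrict_prism_column[OF \<alpha>] o_def)
  finally show "hammock_prism x y m (s \<circ> \<alpha>) (sact (hammocks C x y) m n \<alpha> h) =
      sact (hammocks D (onob P x) (onob Q y)) m n \<alpha> (hammock_prism x y n s h)" .
next
  fix n s s' h assume "simplex_op n 1 s \<and> (\<forall>i\<le>n. s i = s' i)"
  then have s: "s i = s' i" if "i \<le> n" for i using that by blast
  have "prism_chain n s = prism_chain n s'"
    by (intro ext) (simp add: prism_chain_def s)
  then have "prism_column n s = prism_column n s'" "turn_column True n s x = turn_column True n s' x"
    "coturn_column True n s y = coturn_column True n s' y"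
    by (auto simp: prism_column_def turn_column_def coturn_column_def Let_def s fun_eq_iff)
  then show "hammock_prism x y n s h = hammock_prism x y n s' h"
    by (simp add: hammock_prism_def)
qed

end

section \<open>The simplicial functor induced by a coloured functor\<close>

text \<open>With the identity transformation, the results on prisms become results on a single
  functor \<open>P\<close>.\<close>

lemma coloured_nat_trans_refl:
  fixes C :: "('o, 'm) ccat" and D :: "('p, 'n) ccat"
  assumes C: "coloured_category C" and D: "coloured_category D" and P: "coloured_functor C D P"
  shows "coloured_nat_trans C D P P (\<lambda>x. idt D (onob P x))"
proof
  note cat = coloured_categoryD[OF D] and f = coloured_functorD(1)[OF P]
  show "nat_trans C D P P (\<lambda>x. idt D (onob P x))"
    unfolding nat_trans_def
  proof (intro conjI ballI allI)
    show "idt D (onob P x) \<in> homs D (onob P x) (onob P x)" if "x \<in> obs C" for x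
      by (rule category_idt[OF cat functor_ob[OF f that]])
    show "idt D (onob P y) \<cdot>\<^bsub>D\<^esub> onar P h = onar P h \<cdot>\<^bsub>D\<^esub> idt D (onob P x)" if "h \<in> homs C x y" for x y h
      using category_idt_left[OF cat functor_homs[OF f that]] category_idt_right[OF cat functor_homs[OF f that]] by simp
  qed
  show "idt D (onob P x) \<in> col D" if "x \<in> obs C" for x
    by (rule col_idt[OF D functor_ob[OF f that]])
qed (fact C D P)+

text \<open>Applying \<open>P\<close> to a column is the prism operation with constant parameter 0;
  the effect on chains is kept abstract except on constant chains.\<close>

lemma column_morphism_fctr:
  fixes C :: "('o, 'm) ccat" and D :: "('p, 'n) ccat"
  assumes C: "coloured_category C" and D: "coloured_category D" and P: "coloured_functor C D P"
  shows "\<exists>\<psi>. column_morphism C k D k \<psi> (map_column_fctr P k) \<and> (\<forall>x\<in>obs C. \<psi> (const_chain C k x) = const_chain D k (onob P x))"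
proof -
  interpret coloured_nat_trans C D P P "\<lambda>x. idt D (onob P x)"
    by (rule coloured_nat_trans_refl[OF assms])
  have "simplex_op k 1 (\<lambda>_. 0)" by (rule simplex_op_const) simp
  from column_morphism_prism[OF this] show ?thesis
    unfolding prism_column_0 using prism_chain_const(1) by blast
qed

lemma map_column_fctr_zigzag:
  fixes C :: "('o, 'm) ccat" and D :: "('p, 'n) ccat"
  assumes "coloured_category C" "coloured_category D" "coloured_functor C D P" "x \<in> obs C" "y \<in> obs C"
    "is_zigzag C k (const_chain C k x) h (const_chain C k y)"
  shows "is_zigzag D k (const_chain D k (onob P x)) (map (map_column_fctr P k) h) (const_chain D k (onob P y))"
  using column_morphism_fctr[OF assms(1-3), of k] is_zigzag_map[OF _ assms(6)] assms(4,5) by metis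

lemma reduce_map_column_fctr:
  fixes C :: "('o, 'm) ccat" and D :: "('p, 'n) ccat"
  assumes "coloured_category C" "coloured_category D" "coloured_functor C D P"
    "is_zigzag C k a h b"
  shows "reduce_zigzag D k (map (map_column_fctr P k) (reduce_zigzag C k h)) = reduce_zigzag D k (map (map_column_fctr P k) h)"
  using column_morphism_fctr[OF assms(1-3), of k] reduce_map_reduce[OF assms(1,2) _ assms(4)] by metis


lemma restrict_map_column_fctr:
  assumes \<alpha>: "simplex_op m n \<alpha>"
  shows "restrict_column m \<alpha> (map_column_fctr P n c) = map_column_fctr P m (restrict_column m \<alpha> c)"
  using simplex_op_mono[OF \<alpha>] simplex_op_le[OF \<alpha>]
  by (simp add: restrict_column_def map_column_fctr_def fun_eq_iff)

lemma localisation_fctr_simps: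
  "sonob (localisation_fctr D F) = onob F"
  "sonmap (localisation_fctr D F) x y k h = reduce_zigzag D k (map (map_column_fctr F k) h)"
  by (simp_all add: localisation_fctr_def)

lemma premap_localisation:
  fixes C :: "('o, 'm) ccat" and D :: "('p, 'n) ccat"
  assumes C: "coloured_category C" and D: "coloured_category D" and F: "coloured_functor C D F"
  shows "premap (localisation C) (localisation D) (localisation_fctr D F)"
proof -
  have 1: "onob F x \<in> obs D" if "x \<in> obs C" for x
    by (rule functor_ob[OF coloured_functorD(1)[OF F] that])
  have 2: "sset_map (hammocks C x y) (hammocks D (onob F x) (onob F y)) (sonmap (localisation_fctr D F) x y)"
    if xy: "x \<in> obs C" "y \<in> obs C" for x y
    unfolding sset_map_def
  proof (intro conjI allI impI ballI)
    fix n h assume "h \<in> simps (hammocks C x y) n"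
    then have h: "is_zigzag C n (const_chain C n x) h (const_chain C n y)" by (simp add: simps_hammocks)
    note Fh = map_column_fctr_zigzag[OF C D F xy h]
    show "sonmap (localisation_fctr D F) x y n h \<in> simps (hammocks D (onob F x) (onob F y)) n"
      using reduce_zigzag_in[OF D Fh] by (simp add: simps_hammocks localisation_fctr_simps)
    fix m \<alpha> assume \<alpha>: "simplex_op m n \<alpha>"
    show "sonmap (localisation_fctr D F) x y m (sact (hammocks C x y) m n \<alpha> h) =
        sact (hammocks D (onob F x) (onob F y)) m n \<alpha> (sonmap (localisation_fctr D F) x y n h)"
      unfolding localisation_fctr_simps sact_hammocks
        reduce_map_column_fctr[OF C D F restrict_zigzag[OF C \<alpha> h]]
        reduce_map_reduce[OF D D column_morphism_restrict[OF D \<alpha>] Fh]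
      by (simp add: restrict_map_column_fctr[OF \<alpha>] o_def)
  qed
  show ?thesis
    unfolding premap_def localisation_simps(1,2) localisation_fctr_simps(1) using 1 2 by blast
qed

lemma simplicial_functor_localisation:
  fixes C :: "('o, 'm) ccat" and D :: "('p, 'n) ccat"
  assumes C: "coloured_category C" and D: "coloured_category D" and F: "coloured_functor C D F"
  shows "simplicial_functor (localisation C) (localisation D) (localisation_fctr D F)"
  unfolding simplicial_functor_def localisation_simps localisation_fctr_simps
proof (intro conjI ballI allI premap_localisation[OF assms])
  fix x y z k f g assume o: "x \<in> obs C" "y \<in> obs C" "z \<in> obs C"
    and "f \<in> simps (hammocks C x y) k" "g \<in> simps (hammocks C y z) k"
  then have fg: "is_zigzag C k (const_chain C k x) f (const_chain C k y)" "is_zigzag C k (const_chain C k y) g (const_chain C k z)"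
    by (auto simp: simps_hammocks)
  then have app: "is_zigzag C k (const_chain C k x) (f @ g) (const_chain C k z)"
    unfolding is_zigzag_append by blast
  show "reduce_zigzag D k (map (map_column_fctr F k) (reduce_zigzag C k (f @ g))) =
      reduce_zigzag D k (reduce_zigzag D k (map (map_column_fctr F k) f) @ reduce_zigzag D k (map (map_column_fctr F k) g))"
    unfolding reduce_map_column_fctr[OF C D F app]
      reduce_append_both[OF D map_column_fctr_zigzag[OF C D F o(1,2) fg(1)] map_column_fctr_zigzag[OF C D F o(2,3) fg(2)]]
    by simp
qed (simp add: reduce_zigzag_def)

section \<open>The components of a coloured transformation as invertible hammocks\<close>

context coloured_nat_trans
begin

lemma is_zigzag_turns:
  assumes x: "x \<in> obs C" and s: "simplex_op k 1 s"
  shows "is_zigzag D k (const_chain D k (onob P x)) [turn_column True k s x] (prism_chain k s (const_chain C k x))"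
    "is_zigzag D k (prism_chain k s (const_chain C k x)) [turn_column False k s x] (const_chain D k (onob P x))"
    "is_zigzag D k (prism_chain k s (const_chain C k x)) [coturn_column True k s x] (const_chain D k (onob Q x))"
    "is_zigzag D k (const_chain D k (onob Q x)) [coturn_column False k s x] (prism_chain k s (const_chain C k x))"
  using is_column_turn[OF x s] by (auto simp: turn_column_chains)

text \<open>The component \<open>\<eta> x\<close> as a vertex of the mapping space. It is reduced
  because the component may be an identity, and then the hammock is empty.\<close>

definition nat_hammock :: "'o \<Rightarrow> 'n column list" where
  "nat_hammock x = reduce_zigzag D 0 [turn_column True 0 (\<lambda>_. 1) x]"

definition conat_hammock :: "'o \<Rightarrow> 'n column list" where
  "conat_hammock x = reduce_zigzag D 0 [turn_column False 0 (\<lambda>_. 1) x]"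

lemma op1: "simplex_op k 1 (\<lambda>_. 1)" and op0: "simplex_op k 1 (\<lambda>_. 0)"
  by (rule simplex_op_const, simp)+

lemma nat_hammock_zigzags:
  assumes x: "x \<in> obs C"
  shows "is_zigzag D k (const_chain D k (onob P x)) [turn_column True k (\<lambda>_. 1) x] (const_chain D k (onob Q x))"
    "is_zigzag D k (const_chain D k (onob Q x)) [turn_column False k (\<lambda>_. 1) x] (const_chain D k (onob P x))"
  using is_zigzag_turns(1,2)[OF x op1, of k] unfolding prism_chain_const(2)[OF x] .

lemma degen_nat_hammock:
  assumes x: "x \<in> obs C"
  shows "degen (localisation D) a b k (nat_hammock x) = reduce_zigzag D k [turn_column True k (\<lambda>_. 1) x]"
proof -
  have op: "simplex_op k 0 (\<lambda>_. 0)" by (rule simplex_op_const) simp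
  show ?thesis
    unfolding degen_localisation nat_hammock_def
      reduce_map_reduce[OF D D column_morphism_restrict[OF D op] nat_hammock_zigzags(1)[OF x]]
    by (simp add: restrict_turn_column[OF op] o_def)
qed

lemma natural_nat_hammock:
  "natural_up_to_homotopy (localisation C) (localisation D) (localisation_fctr D P) (localisation_fctr D Q) nat_hammock"
  unfolding natural_up_to_homotopy_def localisation_simps localisation_fctr_simps
proof (intro conjI ballI)
  show "nat_hammock x \<in> simps (hammocks D (onob P x) (onob Q x)) 0" if "x \<in> obs C" for x
    unfolding simps_hammocks nat_hammock_def
    using reduce_zigzag_in[OF D nat_hammock_zigzags(1)[OF that]] by blast
  fix x y assume xy: "x \<in> obs C" "y \<in> obs C"
  interpret L: simplicial_category "localisation D"
    by (rule simplicial_category_localisation[OF D])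
  have in0: "nat_hammock x \<in> simps (hammocks D (onob P x) (onob Q x)) 0" if "x \<in> obs C" for x
    unfolding simps_hammocks nat_hammock_def
    using reduce_zigzag_in[OF D nat_hammock_zigzags(1)[OF that]] by blast
  note o = functor_ob[OF fP] functor_ob[OF fQ]
  have mP: "sset_map (hammocks C x y) (hammocks D (onob P x) (onob P y)) (\<lambda>k h. reduce_zigzag D k (map (map_column_fctr P k) h))"
    and mQ: "sset_map (hammocks C x y) (hammocks D (onob Q x) (onob Q y)) (\<lambda>k h. reduce_zigzag D k (map (map_column_fctr Q k) h))"
    using premap_localisation[OF C D P] premap_localisation[OF C D Q] xy
    by (simp_all add: premap_def localisation_simps localisation_fctr_simps localisation_fctr_def)
  show "homotopic_maps (hammocks C x y) (hammocks D (onob P x) (onob Q y))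
     (\<lambda>k h. reduce_zigzag D k (reduce_zigzag D k (map (map_column_fctr P k) h) @
        degen (localisation D) (onob P y) (onob Q y) k (nat_hammock y)))
     (\<lambda>k h. reduce_zigzag D k (degen (localisation D) (onob P x) (onob Q x) k (nat_hammock x) @
        reduce_zigzag D k (map (map_column_fctr Q k) h)))"
  proof (rule homotopic_maps_simplicial[OF sset_hammocks[OF C] sset_hammocks[OF D] simplicial_homotopy_hammock_prism[OF xy]])
    show "sset_map (hammocks C x y) (hammocks D (onob P x) (onob Q y))
     (\<lambda>k h. reduce_zigzag D k (reduce_zigzag D k (map (map_column_fctr P k) h) @
        degen (localisation D) (onob P y) (onob Q y) k (nat_hammock y)))"
      using sset_map_comp[OF mP L.sset_map_post[unfolded localisation_simps, OF o(1)[OF xy(1)] o(1)[OF xy(2)] o(2)[OF xy(2)] in0[OF xy(2)]]] .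
    show "sset_map (hammocks C x y) (hammocks D (onob P x) (onob Q y))
     (\<lambda>k h. reduce_zigzag D k (degen (localisation D) (onob P x) (onob Q x) k (nat_hammock x) @
        reduce_zigzag D k (map (map_column_fctr Q k) h)))"
      using sset_map_comp[OF mQ L.sset_map_pre[unfolded localisation_simps, OF o(1)[OF xy(1)] o(2)[OF xy(1)] o(2)[OF xy(2)] in0[OF xy(1)]]] .
  next
    fix k h assume "h \<in> simps (hammocks C x y) k"
    then have h: "is_zigzag C k (const_chain C k x) h (const_chain C k y)" by (simp add: simps_hammocks)
    have "hammock_prism x y k (\<lambda>_. 0) h = reduce_zigzag D k (map (map_column_fctr P k) h @ [turn_column True k (\<lambda>_. 1) y])"
      using add_column_id[OF is_id_turn(1)[OF xy(1)]]
      by (simp add: hammock_prism_def prism_column_0 turn_1_eq_coturn_0[OF xy(2)] reduce_zigzag_def del: One_nat_def)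
    then show "hammock_prism x y k (\<lambda>_. 0) h = reduce_zigzag D k (reduce_zigzag D k (map (map_column_fctr P k) h) @
        degen (localisation D) (onob P y) (onob Q y) k (nat_hammock y))"
      unfolding degen_nat_hammock[OF xy(2)]
        reduce_append_both[OF D map_column_fctr_zigzag[OF C D P xy h] nat_hammock_zigzags(1)[OF xy(2)]] .
    have "hammock_prism x y k (\<lambda>_. 1) h = reduce_zigzag D k ([turn_column True k (\<lambda>_. 1) x] @ map (map_column_fctr Q k) h)"
      using is_id_turn(2)[OF xy(2), of k True]
      by (simp add: hammock_prism_def prism_column_1 reduce_zigzag_def del: One_nat_def)
    then show "hammock_prism x y k (\<lambda>_. 1) h = reduce_zigzag D k (degen (localisation D) (onob P x) (onob Q x) k (nat_hammock x) @
        reduce_zigzag D k (map (map_column_fctr Q k) h))"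
      unfolding degen_nat_hammock[OF xy(1)]
        reduce_append_both[OF D nat_hammock_zigzags(1)[OF xy(1)] map_column_fctr_zigzag[OF C D Q xy h]] .
  qed
qed

lemma hammock_edge:
  assumes h: "is_zigzag D 1 (const_chain D 1 a) h (const_chain D 1 b)"
  shows "(reduce_zigzag D 0 (map (restrict_column 0 (\<lambda>_. 0)) h), reduce_zigzag D 0 (map (restrict_column 0 (\<lambda>_. 1)) h))
    \<in> edge_eq (hammocks D a b)"
proof -
  have e: "reduce_zigzag D 1 h \<in> simps (hammocks D a b) 1"
    unfolding simps_hammocks using reduce_zigzag_in[OF D h] by blast
  have op: "simplex_op 0 1 (\<lambda>_. c)" if "c \<le> 1" for c
    by (rule simplex_op_const[OF that])
  show ?thesis
    using edge_eq_edge[OF e] unfolding sact_hammocks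
      reduce_map_reduce[OF D D column_morphism_restrict[OF D op[of 0]] h, OF le0]
      reduce_map_reduce[OF D D column_morphism_restrict[OF D op[of 1]] h, OF le_refl] .
qed

text \<open>Going along \<open>\<eta> x\<close> and back along it is joined to the empty hammock by
  a hammock of width 1: one row consists of identities, the other is the round trip. The columns
  pointing left are legitimate because the components are coloured.\<close>

lemma inverse_nat_hammock:
  assumes x: "x \<in> obs C"
  shows "(reduce_zigzag D 0 (nat_hammock x @ conat_hammock x), []) \<in> edge_eq (hammocks D (onob P x) (onob P x))"
    "(reduce_zigzag D 0 (conat_hammock x @ nat_hammock x), []) \<in> edge_eq (hammocks D (onob Q x) (onob Q x))"
proof -
  \<comment> \<open>The edge parameter: \<open>turn_column\<close> has identities in row 0 and
    \<open>\<eta> x\<close> in row 1, while \<open>coturn_column\<close> has \<open>\<eta> x\<close>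
    in row 0 and identities in row 1.\<close>
  let ?i = "\<lambda>i::nat. if i = 0 then 0 else (1::nat)"
  have i: "simplex_op 1 1 ?i" by (rule simplex_opI) auto
  have op: "simplex_op 0 1 (\<lambda>_. c)" if "c \<le> 1" for c
    by (rule simplex_op_const[OF that])
  have r: "restrict_column 0 (\<lambda>_. c) (turn_column r 1 ?i x) = turn_column r 0 (\<lambda>_. ?i c) x"
    "restrict_column 0 (\<lambda>_. c) (coturn_column r 1 ?i x) = coturn_column r 0 (\<lambda>_. ?i c) x" if "c \<le> 1" for c r
    using restrict_turn_column[OF op[OF that], of r ?i x] by (simp_all add: o_def del: One_nat_def)
  note z = is_zigzag_turns[OF x i]
  have z1: "is_zigzag D 1 (const_chain D 1 (onob P x)) ([turn_column True 1 ?i x] @ [turn_column False 1 ?i x]) (const_chain D 1 (onob P x))"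
    using z(1,2) unfolding is_zigzag_append by blast
  have z2: "is_zigzag D 1 (const_chain D 1 (onob Q x)) ([coturn_column False 1 ?i x] @ [coturn_column True 1 ?i x]) (const_chain D 1 (onob Q x))"
    using z(4,3) unfolding is_zigzag_append by blast
  have red: "reduce_zigzag D 0 [a, b] = []" if "is_id_column D 0 a" "is_id_column D 0 b" for a b
    using that by (simp add: reduce_zigzag_def)
  have i01: "?i 0 = 0" "?i 1 = 1" by simp_all
  have e1: "([], reduce_zigzag D 0 ([turn_column True 0 (\<lambda>_. 1) x] @ [turn_column False 0 (\<lambda>_. 1) x])) \<in> edge_eq (hammocks D (onob P x) (onob P x))"
    using hammock_edge[OF z1] unfolding map_append list.map r(1)[OF le0] r(1)[OF order_refl] i01
    by (simp only: append.simps red[OF is_id_turn(1)[OF x] is_id_turn(1)[OF x]])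
  have e2: "(reduce_zigzag D 0 ([coturn_column False 0 (\<lambda>_. 0) x] @ [coturn_column True 0 (\<lambda>_. 0) x]), []) \<in> edge_eq (hammocks D (onob Q x) (onob Q x))"
    using hammock_edge[OF z2] unfolding map_append list.map r(2)[OF le0] r(2)[OF order_refl] i01
    by (simp only: append.simps red[OF is_id_turn(2)[OF x] is_id_turn(2)[OF x]])
  note n = nat_hammock_zigzags[OF x, of 0]
  show "(reduce_zigzag D 0 (nat_hammock x @ conat_hammock x), []) \<in> edge_eq (hammocks D (onob P x) (onob P x))"
    unfolding nat_hammock_def conat_hammock_def reduce_append_both[OF D n]
    by (rule edge_eq_sym[OF e1])
  show "(reduce_zigzag D 0 (conat_hammock x @ nat_hammock x), []) \<in> edge_eq (hammocks D (onob Q x) (onob Q x))"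
    unfolding nat_hammock_def conat_hammock_def reduce_append_both[OF D n(2,1)]
    using e2 unfolding turn_1_eq_coturn_0[OF x] .
qed

theorem homotopic_localisation:
  "homotopic_sfctrs (localisation C) (localisation D) (localisation_fctr D P) (localisation_fctr D Q)"
  unfolding homotopic_sfctrs_def
proof (intro conjI premap_localisation[OF C D P] premap_localisation[OF C D Q],
    rule exI[of _ nat_hammock], rule exI[of _ conat_hammock], intro conjI natural_nat_hammock)
  show "\<forall>x\<in>sobs (localisation C). conat_hammock x \<in> simps (smap (localisation D)
      (sonob (localisation_fctr D Q) x) (sonob (localisation_fctr D P) x)) 0"
    unfolding localisation_simps localisation_fctr_simps simps_hammocks conat_hammock_def
    using reduce_zigzag_in[OF D nat_hammock_zigzags(2)] by blast
qed (simp_all add: inverse_up_to_homotopy_def localisation_simps localisation_fctr_simps inverse_nat_hammock)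

end

section \<open>From homotopies of localised functors to equifunctors\<close>

text \<open>Localisation respects composites and identities of functors only on actual hammocks, not
  as an equality of functions; this turns such agreement into a homotopy with identity
  components.\<close>

lemma homotopic_sfctrs_eq:
  assumes S: "simplicial_category S" and T: "simplicial_category T" and P: "premap S T P"
    and ob: "sonob Q = sonob P"
    and eq: "\<And>x y k h. \<lbrakk>x \<in> sobs S; y \<in> sobs S; h \<in> simps (smap S x y) k\<rbrakk> \<Longrightarrow> sonmap Q x y k h = sonmap P x y k h"
  shows "homotopic_sfctrs S T P Q"
proof -
  interpret S: simplicial_category S by (rule S)
  interpret T: simplicial_category T by (rule T)
  have o: "x \<in> sobs S \<Longrightarrow> sonob P x \<in> sobs T" and m: "\<lbrakk>x \<in> sobs S; y \<in> sobs S\<rbrakk> \<Longrightarrow>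
      sset_map (smap S x y) (smap T (sonob P x) (sonob P y)) (sonmap P x y)" for x y
    using P by (auto simp: premap_def)
  have Q: "premap S T Q"
    unfolding premap_def ob
  proof (intro conjI ballI o)
    fix x y assume xy: "x \<in> sobs S" "y \<in> sobs S"
    have "homotopic_maps (smap S x y) (smap T (sonob P x) (sonob P y)) (sonmap P x y) (sonmap Q x y)"
      by (rule homotopic_maps_eq[OF S.hom_sset[OF xy] T.hom_sset[OF o[OF xy(1)] o[OF xy(2)]] m[OF xy]])
        (simp add: eq xy)
    then show "sset_map (smap S x y) (smap T (sonob P x) (sonob P y)) (sonmap Q x y)"
      by (simp add: homotopic_maps_def)
  qed
  have N: "natural_up_to_homotopy S T P Q (\<lambda>x. sidt T (sonob P x))"
    unfolding natural_up_to_homotopy_def ob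
  proof (intro conjI ballI)
    show "sidt T (sonob P x) \<in> T.hv (sonob P x) (sonob P x)" if "x \<in> sobs S" for x
      by (rule T.sidt_in[OF o[OF that]])
    fix x y assume xy: "x \<in> sobs S" "y \<in> sobs S"
    note oo = o[OF xy(1)] o[OF xy(2)]
    show "homotopic_maps (smap S x y) (smap T (sonob P x) (sonob P y))
        (\<lambda>k h. scmp T (sonob P x) (sonob P y) (sonob P y) k (degen T (sonob P y) (sonob P y) k (sidt T (sonob P y))) (sonmap P x y k h))
        (\<lambda>k h. scmp T (sonob P x) (sonob P x) (sonob P y) k (sonmap Q x y k h) (degen T (sonob P x) (sonob P x) k (sidt T (sonob P x))))"
      by (rule homotopic_maps_eq[OF S.hom_sset[OF xy] T.hom_sset[OF oo]
          sset_map_comp[OF m[OF xy] T.sset_map_post[OF oo(1,2,2) T.sidt_in[OF oo(2)]]]])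
        (simp add: eq xy T.scmp_ident_left[OF oo] T.scmp_ident_right[OF oo] sset_map_closed[OF m[OF xy]])
  qed
  have "scmp T (sonob P x) (sonob P x) (sonob P x) 0 (sidt T (sonob P x)) (sidt T (sonob P x)) = sidt T (sonob P x)"
    if "x \<in> sobs S" for x
    using T.scmp_ident_left[OF o[OF that] o[OF that] T.sidt_in[OF o[OF that]]]
      T.degen_0[OF o[OF that] o[OF that] T.sidt_in[OF o[OF that]]] by simp
  then have "inverse_up_to_homotopy S T P Q (\<lambda>x. sidt T (sonob P x)) (\<lambda>x. sidt T (sonob P x))"
    "inverse_up_to_homotopy S T Q P (\<lambda>x. sidt T (sonob P x)) (\<lambda>x. sidt T (sonob P x))"
    by (simp_all add: inverse_up_to_homotopy_def ob)
  then show ?thesis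
    unfolding homotopic_sfctrs_def
    by (intro conjI exI[of _ "\<lambda>x. sidt T (sonob P x)"] P Q N) (simp_all add: ob T.sidt_in[OF o])
qed

lemma coloured_functor_comp:
  "\<lbrakk>coloured_functor C D F; coloured_functor D E G\<rbrakk> \<Longrightarrow> coloured_functor C E (comp_fctr G F)"
  unfolding coloured_functor_def is_functor_def comp_fctr_def by simp blast

lemma coloured_functor_id: "coloured_functor C C id_fctr"
  by (simp add: coloured_functor_def is_functor_def id_fctr_def)

text \<open>The homotopies are given for localisations of composite functors, whereas
  \<open>scat_equivalenceI\<close> speaks of composites of localisations. The local facts
  \<open>comp\<close> and \<open>ident\<close> bridge the difference in both directions.\<close>

theorem equifunctorI:
  fixes C :: "('o, 'm) ccat" and D :: "('p, 'n) ccat"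
  assumes C: "coloured_category C" and D: "coloured_category D"
    and F: "coloured_functor C D F" and G: "coloured_functor D C G"
    and GF: "homotopic_sfctrs (localisation C) (localisation C) (localisation_fctr C (comp_fctr G F)) (localisation_fctr C id_fctr)"
    and FG: "homotopic_sfctrs (localisation D) (localisation D) (localisation_fctr D (comp_fctr F G)) (localisation_fctr D id_fctr)"
  shows "equifunctor C D F"
proof -
  have comp: "homotopic_sfctrs (localisation C) (localisation C)
      (comp_sfctr (localisation_fctr C G) (localisation_fctr D F)) (localisation_fctr C (comp_fctr G F))"
    if C: "coloured_category C" and D: "coloured_category D" and F: "coloured_functor C D F" and G: "coloured_functor D C G"
    for C :: "('a, 'b) ccat" and D :: "('c, 'd) ccat" and F G
  proof (rule homotopic_sfctrs_sym[OF simplicial_category_localisation[OF C] simplicial_category_localisation[OF C]],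
      rule homotopic_sfctrs_eq[OF simplicial_category_localisation[OF C] simplicial_category_localisation[OF C]
        premap_localisation[OF C C coloured_functor_comp[OF F G]]])
    show "sonob (comp_sfctr (localisation_fctr C G) (localisation_fctr D F)) = sonob (localisation_fctr C (comp_fctr G F))"
      by (simp add: comp_sfctr_def localisation_fctr_simps comp_fctr_def o_def)
    fix x y k h assume "x \<in> sobs (localisation C)" "y \<in> sobs (localisation C)" "h \<in> simps (smap (localisation C) x y) k"
    then have xy: "x \<in> obs C" "y \<in> obs C" and h: "is_zigzag C k (const_chain C k x) h (const_chain C k y)"
      by (simp_all add: localisation_simps simps_hammocks)
    have "map_column_fctr G k (map_column_fctr F k c) = map_column_fctr (comp_fctr G F) k c" for c
      by (simp add: map_column_fctr_def comp_fctr_def fun_eq_iff)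
    then show "sonmap (comp_sfctr (localisation_fctr C G) (localisation_fctr D F)) x y k h =
        sonmap (localisation_fctr C (comp_fctr G F)) x y k h"
      by (simp add: comp_sfctr_def localisation_fctr_simps o_def
        reduce_map_column_fctr[OF D C G map_column_fctr_zigzag[OF C D F xy h]])
  qed
  have ident: "homotopic_sfctrs (localisation C) (localisation C) (localisation_fctr C id_fctr) id_sfctr"
    if C: "coloured_category C" for C :: "('a, 'b) ccat"
  proof (rule homotopic_sfctrs_eq[OF simplicial_category_localisation[OF C] simplicial_category_localisation[OF C]
        premap_localisation[OF C C coloured_functor_id]])
    show "sonob id_sfctr = sonob (localisation_fctr C id_fctr)"
      by (simp add: id_sfctr_def localisation_fctr_simps id_fctr_def)
    fix x y k h assume "h \<in> simps (smap (localisation C) x y) k"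
    then have h: "is_zigzag C k (const_chain C k x) h (const_chain C k y)" "is_reduced C k h"
      by (simp_all add: localisation_simps simps_hammocks)
    have op: "simplex_op k k (\<lambda>i. i)" by (rule simplex_opI) auto
    \<comment> \<open>Applying the identity functor to a column is the same cutting-off as
      restricting along the identity operator.\<close>
    have "map_column_fctr (id_fctr :: ('a, 'b, 'a, 'b) fctr) k c = c" if "c \<in> set h" for c
      using restrict_column_ident[OF is_zigzag_columns[OF h(1) that]]
      unfolding map_column_fctr_def restrict_column_def id_fctr_def fctr.select_convs .
    then have "map (map_column_fctr (id_fctr :: ('a, 'b, 'a, 'b) fctr) k) h = h"
      by (rule map_idI)
    then show "sonmap id_sfctr x y k h = sonmap (localisation_fctr C id_fctr) x y k h"
      using reduce_zigzag_reduced[OF h(2)] by (simp add: id_sfctr_def localisation_fctr_simps)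
  qed
  note LC = simplicial_category_localisation[OF C] and LD = simplicial_category_localisation[OF D]
  note tC = homotopic_sfctrs_trans[OF LC LC] and tD = homotopic_sfctrs_trans[OF LD LD]
  have "scat_equivalence (localisation C) (localisation D) (localisation_fctr D F)"
    by (rule scat_equivalenceI[OF LC LD simplicial_functor_localisation[OF C D F] simplicial_functor_localisation[OF D C G]
          tC[OF tC[OF comp[OF C D F G] GF] ident[OF C]] tD[OF tD[OF comp[OF D C G F] FG] ident[OF D]]])
  then show ?thesis
    unfolding equifunctor_def using F by blast
qed

section \<open>Initial objects, coproducts and pushouts\<close>

lemma homs_op_cat: "homs (op_cat C) x y = homs C y x"
  by (auto simp: op_cat_def homs_def)

lemma op_cat_simps:
  "obs (op_cat C) = obs C" "g \<cdot>\<^bsub>op_cat C\<^esub> f = f \<cdot>\<^bsub>C\<^esub> g" "idt (op_cat C) = idt C"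
  by (simp_all add: op_cat_def)

text \<open>An initial object is a colimit of the empty diagram.\<close>

lemma initial_ex:
  assumes C: "category C" and lim: "has_colimits TYPE('s) C"
  shows "\<exists>z. is_initial C z"
proof -
  define J :: "('s, 's) cat" where "J = \<lparr>obs = {}, arrs = {}, src = id, tgt = id, idt = id, cmp = (\<lambda>g f. f)\<rparr>"
  have J: "obs J = {}" "homs J x y = {}" for x y
    by (auto simp: J_def homs_def)
  have "category J"
    unfolding category_def J by (simp add: J_def)
  moreover have "is_functor J (op_cat C) D" for D
    unfolding is_functor_def J by simp
  ultimately obtain z \<pi> where z: "is_limit J (op_cat C) undefined z \<pi>"
    using lim unfolding has_colimits_def has_limits_def by blast
  have cone: "is_cone J (op_cat C) undefined y \<rho> \<longleftrightarrow> y \<in> obs C" for y \<rho>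
    unfolding is_cone_def nat_trans_def J by (simp add: op_cat_simps)
  show ?thesis
    using z unfolding is_limit_def cone J homs_op_cat is_initial_def by (intro exI[of _ z]) blast
qed

lemma coproduct_ex:
  assumes C: "category C" and lim: "has_colimits TYPE('s) C" and inf: "infinite (UNIV :: 's set)"
    and a: "a \<in> obs C" and b: "b \<in> obs C"
  shows "\<exists>p. \<exists>i\<in>homs C a p. \<exists>j\<in>homs C b p. \<forall>y. \<forall>u\<in>homs C a y. \<forall>v\<in>homs C b y.
     \<exists>!h. h \<in> homs C p y \<and> h \<cdot>\<^bsub>C\<^esub> i = u \<and> h \<cdot>\<^bsub>C\<^esub> j = v"
proof -
  \<comment> \<open>Two distinct elements of the index universe serve as the objects of a discrete
    category whose colimit is the coproduct.\<close>
  obtain s t :: 's where st: "s \<noteq> t"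
    using inf by (metis finite.simps finite_subset subsetI insertCI)
  define J :: "('s, 's) cat" where "J = \<lparr>obs = {s, t}, arrs = {s, t}, src = id, tgt = id, idt = id, cmp = (\<lambda>g f. f)\<rparr>"
  define D where "D = \<lparr>onob = (\<lambda>r. if r = s then a else b), onar = (\<lambda>r. idt C (if r = s then a else b))\<rparr>"
  have J: "obs J = {s, t}" "homs J x y = (if x = y \<and> x \<in> {s, t} then {x} else {})" "idt J x = x" "g \<cdot>\<^bsub>J\<^esub> f = f" for x y g f
    by (auto simp: J_def homs_def)
  have "category J"
    unfolding category_def J by (simp add: J_def)
  have idC: "idt C a \<in> homs C a a" "idt C b \<in> homs C b b"
    using category_idt[OF C] a b by auto
  have idid: "idt C a \<cdot>\<^bsub>C\<^esub> idt C a = idt C a" "idt C b \<cdot>\<^bsub>C\<^esub> idt C b = idt C b"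
    using category_idt_left[OF C] idC by auto
  have "is_functor J (op_cat C) D"
    unfolding is_functor_def J op_cat_simps homs_op_cat
    using a b idC idid by (simp add: D_def split: if_splits)
  with \<open>category J\<close> obtain p \<pi> where p: "is_limit J (op_cat C) D p \<pi>"
    using lim unfolding has_colimits_def has_limits_def by blast
  have cone: "is_cone J (op_cat C) D y \<rho> \<longleftrightarrow> \<rho> s \<in> homs C a y \<and> \<rho> t \<in> homs C b y" for y \<rho>
  proof
    assume "is_cone J (op_cat C) D y \<rho>"
    then show "\<rho> s \<in> homs C a y \<and> \<rho> t \<in> homs C b y"
      using st unfolding is_cone_def nat_trans_def J homs_op_cat by (simp add: D_def const_fctr_def)
  next
    assume r: "\<rho> s \<in> homs C a y \<and> \<rho> t \<in> homs C b y"
    then have y: "y \<in> obs C" using category_obs(2)[OF C] by blast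
    have "\<rho> s \<cdot>\<^bsub>C\<^esub> idt C a = \<rho> s" "\<rho> t \<cdot>\<^bsub>C\<^esub> idt C b = \<rho> t" "idt C y \<cdot>\<^bsub>C\<^esub> \<rho> s = \<rho> s" "idt C y \<cdot>\<^bsub>C\<^esub> \<rho> t = \<rho> t"
      using r category_idt_left[OF C] category_idt_right[OF C] by blast+
    then show "is_cone J (op_cat C) D y \<rho>"
      using st r y unfolding is_cone_def nat_trans_def J homs_op_cat op_cat_simps
      by (simp add: D_def const_fctr_def op_cat_simps split: if_splits)
  qed
  have uni: "\<exists>!h. h \<in> homs C p y \<and> h \<cdot>\<^bsub>C\<^esub> \<pi> s = u \<and> h \<cdot>\<^bsub>C\<^esub> \<pi> t = v" if "u \<in> homs C a y" "v \<in> homs C b y" for y u v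
  proof -
    have "is_cone J (op_cat C) D y (\<lambda>r. if r = s then u else v)"
      unfolding cone using that st by simp
    then have "\<exists>!h. h \<in> homs (op_cat C) y p \<and> (\<forall>j\<in>obs J. \<pi> j \<cdot>\<^bsub>op_cat C\<^esub> h = (if j = s then u else v))"
      using p unfolding is_limit_def by blast
    then show ?thesis
      using st unfolding homs_op_cat op_cat_simps J by simp
  qed
  have "\<pi> s \<in> homs C a p" "\<pi> t \<in> homs C b p"
    using p unfolding is_limit_def cone by blast+
  with uni show ?thesis by blast
qed

lemma initial_arrow: "\<lbrakk>is_initial C z; x \<in> obs C\<rbrakk> \<Longrightarrow> \<exists>f. f \<in> homs C z x"
  unfolding is_initial_def by blast

lemma initial_unique: "\<lbrakk>category C; is_initial C z; f \<in> homs C z x; g \<in> homs C z x\<rbrakk> \<Longrightarrow> f = g"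
  using category_obs(2)[of C f z x] unfolding is_initial_def by blast

text \<open>An arrow between initial objects is invertible, so its pushout along \<open>g\<close> is
  the target of \<open>g\<close>. This makes the pushout products with arrows out of an initial
  object computable.\<close>

lemma is_pushout_initial:
  assumes C: "category C" and z: "is_initial C z" "is_initial C z'"
    and f: "f \<in> homs C z z'" and g: "g \<in> homs C z c" and i: "i \<in> homs C z' c"
  shows "is_pushout C f g c i (idt C c)"
proof -
  have c: "c \<in> obs C" by (rule category_obs(2)[OF C g])
  note idc = category_idt[OF C c]
  show ?thesis
    unfolding is_pushout_def
  proof (intro conjI allI ballI impI)
    show "f \<in> arrs C" "g \<in> arrs C" "src C f = src C g" "i \<in> homs C (tgt C f) c" "idt C c \<in> homs C (tgt C g) c"
      using f g i idc by (auto simp: homs_def)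
    show "i \<cdot>\<^bsub>C\<^esub> f = idt C c \<cdot>\<^bsub>C\<^esub> g"
      by (rule initial_unique[OF C z(1) category_cmp[OF C f i] category_cmp[OF C g idc]])
    fix q u v assume "u \<in> homs C (tgt C f) q" "v \<in> homs C (tgt C g) q"
    then have uv: "u \<in> homs C z' q" "v \<in> homs C c q" using f g by (auto simp: homs_def)
    show "\<exists>!h. h \<in> homs C c q \<and> h \<cdot>\<^bsub>C\<^esub> i = u \<and> h \<cdot>\<^bsub>C\<^esub> idt C c = v"
    proof (rule ex1I[of _ v])
      show "v \<in> homs C c q \<and> v \<cdot>\<^bsub>C\<^esub> i = u \<and> v \<cdot>\<^bsub>C\<^esub> idt C c = v"
        using uv(2) initial_unique[OF C z(2) category_cmp[OF C i uv(2)] uv(1)] category_idt_right[OF C uv(2)] by blast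
      show "h = v" if "h \<in> homs C c q \<and> h \<cdot>\<^bsub>C\<^esub> i = u \<and> h \<cdot>\<^bsub>C\<^esub> idt C c = v" for h
        using that category_idt_right[OF C, of h c q] by metis
    qed
  qed
qed

lemma is_pushout_sym: "is_pushout C f g p i j \<Longrightarrow> is_pushout C g f p j i"
  unfolding is_pushout_def
proof (elim conjE, intro conjI allI ballI impI)
  fix q u v
  assume H: "\<forall>q. \<forall>u\<in>homs C (tgt C f) q. \<forall>v\<in>homs C (tgt C g) q. u \<cdot>\<^bsub>C\<^esub> f = v \<cdot>\<^bsub>C\<^esub> g \<longrightarrow>
        (\<exists>!h. h \<in> homs C p q \<and> h \<cdot>\<^bsub>C\<^esub> i = u \<and> h \<cdot>\<^bsub>C\<^esub> j = v)"
    and uv: "u \<in> homs C (tgt C g) q" "v \<in> homs C (tgt C f) q" "u \<cdot>\<^bsub>C\<^esub> g = v \<cdot>\<^bsub>C\<^esub> f"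
  show "\<exists>!h. h \<in> homs C p q \<and> h \<cdot>\<^bsub>C\<^esub> j = u \<and> h \<cdot>\<^bsub>C\<^esub> i = v"
    unfolding conj_commute[of "_ \<cdot>\<^bsub>C\<^esub> j = u"] by (rule H[rule_format, OF uv(2,1) uv(3)[symmetric]])
qed simp_all

section \<open>Cofibrant objects of a model category\<close>

context
  fixes M :: "('o, 'm, 'z) mcat_scheme" and S :: "'s itself"
  assumes mc: "model_category TYPE('s) M"
begin

lemma model_cat: "category M" and model_colimits: "has_colimits TYPE('s) M"
  and model_wide: "wide_subcat M (weq M)" "wide_subcat M (cof M)"
  using mc unfolding model_category_def by blast+

lemma weq_arrs: "f \<in> weq M \<Longrightarrow> f \<in> arrs M" and cof_arrs: "f \<in> cof M \<Longrightarrow> f \<in> arrs M"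
  using model_wide by (auto simp: wide_subcat_def)

lemma weq_homs: "f \<in> weq M \<Longrightarrow> f \<in> homs M (src M f) (tgt M f)"
  by (simp add: homs_def weq_arrs)

lemma weq_idt: "x \<in> obs M \<Longrightarrow> idt M x \<in> weq M"
  using model_wide by (simp add: wide_subcat_def)

lemma two_of_three:
  assumes f: "f \<in> homs M x y" and g: "g \<in> homs M y z"
  shows "f \<in> weq M \<Longrightarrow> g \<in> weq M \<Longrightarrow> g \<cdot>\<^bsub>M\<^esub> f \<in> weq M"
    "f \<in> weq M \<Longrightarrow> g \<cdot>\<^bsub>M\<^esub> f \<in> weq M \<Longrightarrow> g \<in> weq M"
    "g \<in> weq M \<Longrightarrow> g \<cdot>\<^bsub>M\<^esub> f \<in> weq M \<Longrightarrow> f \<in> weq M"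
proof -
  have "\<forall>f\<in>arrs M. \<forall>g\<in>arrs M. src M g = tgt M f \<longrightarrow>
        (f \<in> weq M \<and> g \<in> weq M \<longrightarrow> g \<cdot>\<^bsub>M\<^esub> f \<in> weq M) \<and>
        (f \<in> weq M \<and> g \<cdot>\<^bsub>M\<^esub> f \<in> weq M \<longrightarrow> g \<in> weq M) \<and>
        (g \<in> weq M \<and> g \<cdot>\<^bsub>M\<^esub> f \<in> weq M \<longrightarrow> f \<in> weq M)"
    using mc unfolding model_category_def by blast
  moreover have "f \<in> arrs M" "g \<in> arrs M" "src M g = tgt M f"
    using f g by (auto simp: homs_def)
  ultimately show "f \<in> weq M \<Longrightarrow> g \<in> weq M \<Longrightarrow> g \<cdot>\<^bsub>M\<^esub> f \<in> weq M"
    "f \<in> weq M \<Longrightarrow> g \<cdot>\<^bsub>M\<^esub> f \<in> weq M \<Longrightarrow> g \<in> weq M"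
    "g \<in> weq M \<Longrightarrow> g \<cdot>\<^bsub>M\<^esub> f \<in> weq M \<Longrightarrow> f \<in> weq M"
    by blast+
qed

lemma cof_cmp: "\<lbrakk>f \<in> homs M x y; g \<in> homs M y z; f \<in> cof M; g \<in> cof M\<rbrakk> \<Longrightarrow> g \<cdot>\<^bsub>M\<^esub> f \<in> cof M"
  using model_wide by (auto simp: wide_subcat_def homs_def)

lemma has_llpI:
  assumes "i \<in> homs M a b" "p \<in> homs M x y"
    and "\<And>u v. \<lbrakk>u \<in> homs M a x; v \<in> homs M b y; p \<cdot>\<^bsub>M\<^esub> u = v \<cdot>\<^bsub>M\<^esub> i\<rbrakk> \<Longrightarrow>
       \<exists>h\<in>homs M b x. h \<cdot>\<^bsub>M\<^esub> i = u \<and> p \<cdot>\<^bsub>M\<^esub> h = v"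
  shows "has_llp M i p"
  unfolding has_llp_def is_square_def using assms by (auto simp: homs_def)

lemma has_llpD:
  assumes "has_llp M i p" "i \<in> homs M a b" "p \<in> homs M x y"
    "u \<in> homs M a x" "v \<in> homs M b y" "p \<cdot>\<^bsub>M\<^esub> u = v \<cdot>\<^bsub>M\<^esub> i"
  shows "\<exists>h\<in>homs M b x. h \<cdot>\<^bsub>M\<^esub> i = u \<and> p \<cdot>\<^bsub>M\<^esub> h = v"
proof -
  have "is_square M i p u v"
    unfolding is_square_def using assms by (auto simp: homs_def)
  then show ?thesis
    using assms(1,2,3) unfolding has_llp_def by (auto simp: homs_def)
qed

lemma cof_llp: "\<lbrakk>i \<in> cof M; p \<in> fib M; p \<in> weq M\<rbrakk> \<Longrightarrow> has_llp M i p"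
  using mc unfolding model_category_def by blast

lemma factorisation:
  obtains \<alpha> \<beta> \<theta> where
    "\<And>f. f \<in> arrs M \<Longrightarrow> \<alpha> f \<in> cof M \<and> \<beta> f \<in> fib M \<and> \<beta> f \<in> weq M \<and>
       \<alpha> f \<in> homs M (src M f) (src M (\<beta> f)) \<and> \<beta> f \<in> homs M (src M (\<beta> f)) (tgt M f) \<and> \<beta> f \<cdot>\<^bsub>M\<^esub> \<alpha> f = f"
    "\<And>f g u v. is_square M f g u v \<Longrightarrow> \<theta> f g u v \<in> homs M (src M (\<beta> f)) (src M (\<beta> g)) \<and>
       \<alpha> g \<cdot>\<^bsub>M\<^esub> u = \<theta> f g u v \<cdot>\<^bsub>M\<^esub> \<alpha> f \<and> \<beta> g \<cdot>\<^bsub>M\<^esub> \<theta> f g u v = v \<cdot>\<^bsub>M\<^esub> \<beta> f"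
    "\<And>f. f \<in> arrs M \<Longrightarrow> \<theta> f f (idt M (src M f)) (idt M (tgt M f)) = idt M (src M (\<beta> f))"
    "\<And>f g h u v u' v'. \<lbrakk>is_square M f g u v; is_square M g h u' v'\<rbrakk> \<Longrightarrow>
       \<theta> f h (u' \<cdot>\<^bsub>M\<^esub> u) (v' \<cdot>\<^bsub>M\<^esub> v) = \<theta> g h u' v' \<cdot>\<^bsub>M\<^esub> \<theta> f g u v"
proof -
  have "has_functorial_factorisation M (cof M) (fib M \<inter> weq M)"
    using mc unfolding model_category_def by blast
  then obtain \<alpha> \<beta> \<theta> where
     1: "\<forall>f\<in>arrs M. \<alpha> f \<in> cof M \<and> \<beta> f \<in> fib M \<inter> weq M \<and> src M (\<alpha> f) = src M f \<and> tgt M (\<beta> f) = tgt M f \<and>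
           tgt M (\<alpha> f) = src M (\<beta> f) \<and> \<beta> f \<cdot>\<^bsub>M\<^esub> \<alpha> f = f" and
     2: "\<forall>f g u v. is_square M f g u v \<longrightarrow>
           is_square M (\<alpha> f) (\<alpha> g) u (\<theta> f g u v) \<and> is_square M (\<beta> f) (\<beta> g) (\<theta> f g u v) v" and
     3: "\<forall>f\<in>arrs M. \<theta> f f (idt M (src M f)) (idt M (tgt M f)) = idt M (tgt M (\<alpha> f))" and
     4: "\<forall>f g h u v u' v'. is_square M f g u v \<and> is_square M g h u' v' \<longrightarrow>
           \<theta> f h (u' \<cdot>\<^bsub>M\<^esub> u) (v' \<cdot>\<^bsub>M\<^esub> v) = \<theta> g h u' v' \<cdot>\<^bsub>M\<^esub> \<theta> f g u v"
    unfolding has_functorial_factorisation_def by (elim exE conjE) blast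
  show thesis
  proof (rule that[of \<alpha> \<beta> \<theta>])
    show "\<alpha> f \<in> cof M \<and> \<beta> f \<in> fib M \<and> \<beta> f \<in> weq M \<and>
       \<alpha> f \<in> homs M (src M f) (src M (\<beta> f)) \<and> \<beta> f \<in> homs M (src M (\<beta> f)) (tgt M f) \<and> \<beta> f \<cdot>\<^bsub>M\<^esub> \<alpha> f = f"
      if "f \<in> arrs M" for f
      using bspec[OF 1 that] cof_arrs weq_arrs unfolding homs_def by auto
    show "\<theta> f g u v \<in> homs M (src M (\<beta> f)) (src M (\<beta> g)) \<and>
       \<alpha> g \<cdot>\<^bsub>M\<^esub> u = \<theta> f g u v \<cdot>\<^bsub>M\<^esub> \<alpha> f \<and> \<beta> g \<cdot>\<^bsub>M\<^esub> \<theta> f g u v = v \<cdot>\<^bsub>M\<^esub> \<beta> f"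
      if "is_square M f g u v" for f g u v
      using 2[rule_format, OF that] unfolding is_square_def by blast
    show "\<theta> f f (idt M (src M f)) (idt M (tgt M f)) = idt M (src M (\<beta> f))" if "f \<in> arrs M" for f
      using bspec[OF 3 that] bspec[OF 1 that] by metis
    show "\<theta> f h (u' \<cdot>\<^bsub>M\<^esub> u) (v' \<cdot>\<^bsub>M\<^esub> v) = \<theta> g h u' v' \<cdot>\<^bsub>M\<^esub> \<theta> f g u v"
      if "is_square M f g u v" "is_square M g h u' v'" for f g h u v u' v'
      using 4 that by blast
  qed
qed

lemma factorisation_ex:
  assumes "f \<in> homs M x y"
  shows "\<exists>m. \<exists>a\<in>homs M x m. \<exists>b\<in>homs M m y. a \<in> cof M \<and> b \<in> fib M \<and> b \<in> weq M \<and> b \<cdot>\<^bsub>M\<^esub> a = f"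
proof (rule factorisation)
  fix \<alpha> \<beta> :: "'m \<Rightarrow> 'm"
  have f: "f \<in> arrs M" "src M f = x" "tgt M f = y" using assms by (auto simp: homs_def)
  assume "\<And>f. f \<in> arrs M \<Longrightarrow> \<alpha> f \<in> cof M \<and> \<beta> f \<in> fib M \<and> \<beta> f \<in> weq M \<and>
       \<alpha> f \<in> homs M (src M f) (src M (\<beta> f)) \<and> \<beta> f \<in> homs M (src M (\<beta> f)) (tgt M f) \<and> \<beta> f \<cdot>\<^bsub>M\<^esub> \<alpha> f = f"
  from this[OF f(1)] show ?thesis unfolding f(2,3) by blast
qed

text \<open>Retract argument: lifting against the second half of its factorisation makes \<open>i\<close> a retract
  of the first half.\<close>

lemma cof_if_llp:
  assumes i: "i \<in> homs M a b" and llp: "\<And>p. p \<in> fib M \<Longrightarrow> p \<in> weq M \<Longrightarrow> has_llp M i p"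
  shows "i \<in> cof M"
proof -
  have st: "i \<in> arrs M" "src M i = a" "tgt M i = b" using i by (auto simp: homs_def)
  obtain m \<alpha> \<beta> where f: "\<alpha> \<in> cof M" "\<beta> \<in> fib M" "\<beta> \<in> weq M"
       "\<alpha> \<in> homs M a m" "\<beta> \<in> homs M m b" "\<beta> \<cdot>\<^bsub>M\<^esub> \<alpha> = i"
    using factorisation_ex[OF i] by blast
  have ob: "a \<in> obs M" "b \<in> obs M" using category_obs[OF model_cat i] by auto
  note ida = category_idt[OF model_cat ob(1)] and idb = category_idt[OF model_cat ob(2)]
  have "\<beta> \<cdot>\<^bsub>M\<^esub> \<alpha> = idt M b \<cdot>\<^bsub>M\<^esub> i"
    using f(6) category_idt_left[OF model_cat i] by simp
  from has_llpD[OF llp[OF f(2,3)] i f(5) f(4) idb this]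
  obtain h where h: "h \<in> homs M b (m)" "h \<cdot>\<^bsub>M\<^esub> i = \<alpha>" "\<beta> \<cdot>\<^bsub>M\<^esub> h = idt M b" by blast
  have "is_retract M i \<alpha>"
    unfolding is_retract_def
  proof (intro exI conjI)
    show "is_square M i \<alpha> (idt M a) h"
      unfolding is_square_def using st f(4) h ida category_idt_right[OF model_cat f(4)] by (auto simp: homs_def)
    show "is_square M \<alpha> i (idt M a) (\<beta>)"
      unfolding is_square_def using st f(4,5,6) ida category_idt_right[OF model_cat i] by (auto simp: homs_def)
    show "idt M a \<cdot>\<^bsub>M\<^esub> idt M a = idt M (src M i)" "\<beta> \<cdot>\<^bsub>M\<^esub> h = idt M (tgt M i)"
      using h(3) st category_idt_left[OF model_cat ida] by auto
  qed
  moreover have "\<forall>f g. is_retract M f g \<longrightarrow>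
        (g \<in> weq M \<longrightarrow> f \<in> weq M) \<and> (g \<in> cof M \<longrightarrow> f \<in> cof M) \<and> (g \<in> fib M \<longrightarrow> f \<in> fib M)"
    using mc unfolding model_category_def by blast
  ultimately show ?thesis using f(1) by blast
qed

lemma cofibrant_obs: "cofibrant M x \<Longrightarrow> x \<in> obs M"
  unfolding cofibrant_def using category_obs(2)[OF model_cat] by blast

lemma cofibrant_cof:
  assumes "cofibrant M x" "f \<in> homs M x y" "f \<in> cof M"
  shows "cofibrant M y"
  using assms cof_cmp[OF _ assms(2)] category_cmp[OF model_cat _ assms(2)] unfolding cofibrant_def by blast

text \<open>In a lifting problem for \<open>i\<close>, the lift on \<open>a\<close> is prescribed
  and a lift on \<open>b\<close> exists because \<open>b\<close> is cofibrant; the universal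
  property joins them to a lift on the coproduct.\<close>

lemma cof_coproduct_inclusion:
  assumes b: "cofibrant M b" and i: "i \<in> homs M a p" and j: "j \<in> homs M b p"
    and uni: "\<And>y u v. \<lbrakk>u \<in> homs M a y; v \<in> homs M b y\<rbrakk> \<Longrightarrow>
      \<exists>!h. h \<in> homs M p y \<and> h \<cdot>\<^bsub>M\<^esub> i = u \<and> h \<cdot>\<^bsub>M\<^esub> j = v"
  shows "i \<in> cof M"
proof (rule cof_if_llp[OF i])
  fix q assume q: "q \<in> fib M" "q \<in> weq M"
  obtain z e where z: "is_initial M z" "e \<in> homs M z b" "e \<in> cof M"
    using b unfolding cofibrant_def by blast
  note qh = weq_homs[OF q(2)]
  show "has_llp M i q"
  proof (rule has_llpI[OF i qh])
    fix u v assume u: "u \<in> homs M a (src M q)" and v: "v \<in> homs M p (tgt M q)" and sq: "q \<cdot>\<^bsub>M\<^esub> u = v \<cdot>\<^bsub>M\<^esub> i"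
    obtain w where w: "w \<in> homs M z (src M q)"
      using initial_arrow[OF z(1)] category_obs(1)[OF model_cat qh] by blast
    note vj = category_cmp[OF model_cat j v]
    have "q \<cdot>\<^bsub>M\<^esub> w = (v \<cdot>\<^bsub>M\<^esub> j) \<cdot>\<^bsub>M\<^esub> e"
      by (rule initial_unique[OF model_cat z(1) category_cmp[OF model_cat w qh] category_cmp[OF model_cat z(2) vj]])
    from has_llpD[OF cof_llp[OF z(3) q] z(2) qh w vj this]
    obtain k where k: "k \<in> homs M b (src M q)" "q \<cdot>\<^bsub>M\<^esub> k = v \<cdot>\<^bsub>M\<^esub> j" by blast
    obtain h where h: "h \<in> homs M p (src M q)" "h \<cdot>\<^bsub>M\<^esub> i = u" "h \<cdot>\<^bsub>M\<^esub> j = k"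
      using uni[OF u k(1)] by blast
    have "q \<cdot>\<^bsub>M\<^esub> h \<in> homs M p (tgt M q) \<and> (q \<cdot>\<^bsub>M\<^esub> h) \<cdot>\<^bsub>M\<^esub> i = v \<cdot>\<^bsub>M\<^esub> i \<and> (q \<cdot>\<^bsub>M\<^esub> h) \<cdot>\<^bsub>M\<^esub> j = v \<cdot>\<^bsub>M\<^esub> j"
      using category_cmp[OF model_cat h(1) qh] category_assoc[OF model_cat i h(1) qh]
        category_assoc[OF model_cat j h(1) qh] h(2,3) k(2) sq by simp
    then have "q \<cdot>\<^bsub>M\<^esub> h = v"
      using uni[OF category_cmp[OF model_cat i v] vj] v by blast
    then show "\<exists>h\<in>homs M p (src M q). h \<cdot>\<^bsub>M\<^esub> i = u \<and> q \<cdot>\<^bsub>M\<^esub> h = v"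
      using h by blast
  qed
qed

text \<open>A weak equivalence between cofibrant objects is written as a trivial cofibration
  followed by a retraction of another trivial cofibration. The functor controls both of these, and
  two out of three does the rest.\<close>

lemma ken_brown:
  assumes inf: "infinite (UNIV :: 's set)" and F: "is_functor M M F"
    and ac: "\<And>g. \<lbrakk>g \<in> cof M; g \<in> weq M; cofibrant M (src M g); cofibrant M (tgt M g)\<rbrakk> \<Longrightarrow> onar F g \<in> weq M"
    and f: "f \<in> weq M" and ca: "cofibrant M (src M f)" and cb: "cofibrant M (tgt M f)"
  shows "onar F f \<in> weq M"
proof -
  note cat = model_cat
  define a b where ab: "a = src M f" "b = tgt M f"
  have fh: "f \<in> homs M a b" using weq_homs[OF f] by (simp add: ab)
  have cab: "cofibrant M a" "cofibrant M b" using ca cb by (simp_all add: ab)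
  have ob: "a \<in> obs M" "b \<in> obs M" using cab by (auto intro: cofibrant_obs)
  obtain p i j where p12: "i \<in> homs M a p" "j \<in> homs M b p" and
    uni: "\<forall>y. \<forall>u\<in>homs M a y. \<forall>v\<in>homs M b y. \<exists>!h. h \<in> homs M p y \<and> h \<cdot>\<^bsub>M\<^esub> i = u \<and> h \<cdot>\<^bsub>M\<^esub> j = v"
    using coproduct_ex[OF cat model_colimits inf ob] by (elim exE bexE) (rule that)
  note p = p12 uni[rule_format]
  have i: "i \<in> cof M" by (rule cof_coproduct_inclusion[OF cab(2) p])
  have j: "j \<in> cof M"
  proof (rule cof_coproduct_inclusion[OF cab(1) p(2,1)])
    fix y u v assume "u \<in> homs M b y" "v \<in> homs M a y"
    from p(3)[OF this(2,1)] show "\<exists>!h. h \<in> homs M p y \<and> h \<cdot>\<^bsub>M\<^esub> j = u \<and> h \<cdot>\<^bsub>M\<^esub> i = v"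
      unfolding conj_commute[of "_ \<cdot>\<^bsub>M\<^esub> j = u"] .
  qed
  have cp: "cofibrant M p" by (rule cofibrant_cof[OF cab(1) p(1) i])
  note idb = category_idt[OF cat ob(2)]
  \<comment> \<open>The arrow from the coproduct of \<open>a\<close> and \<open>b\<close> to
    \<open>b\<close> with components \<open>f\<close> and the identity; it is factored as a
    cofibration followed by a trivial fibration.\<close>
  obtain h where h: "h \<in> homs M p b" "h \<cdot>\<^bsub>M\<^esub> i = f" "h \<cdot>\<^bsub>M\<^esub> j = idt M b"
    using p(3)[OF fh idb] by blast
  obtain c \<alpha> \<beta> where ff: "\<alpha> \<in> cof M" "\<beta> \<in> weq M"
       "\<alpha> \<in> homs M p c" "\<beta> \<in> homs M c b" "\<beta> \<cdot>\<^bsub>M\<^esub> \<alpha> = h"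
    using factorisation_ex[OF h(1)] by blast
  have cc: "cofibrant M c" by (rule cofibrant_cof[OF cp ff(3,1)])
  \<comment> \<open>The two restrictions of the cofibration: \<open>\<beta> k = f\<close>, and
    \<open>l\<close> is a section of \<open>\<beta>\<close>. Both are weak equivalences by two out
    of three, since \<open>\<beta>\<close> is one.\<close>
  define k l where kl: "k = \<alpha> \<cdot>\<^bsub>M\<^esub> i" "l = \<alpha> \<cdot>\<^bsub>M\<^esub> j"
  have kh: "k \<in> homs M a c" and lh: "l \<in> homs M b c"
    unfolding kl by (rule category_cmp[OF cat p(1) ff(3)], rule category_cmp[OF cat p(2) ff(3)])
  have kc: "k \<in> cof M" and lc: "l \<in> cof M"
    unfolding kl by (rule cof_cmp[OF p(1) ff(3) i ff(1)], rule cof_cmp[OF p(2) ff(3) j ff(1)])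
  have bk: "\<beta> \<cdot>\<^bsub>M\<^esub> k = f" and bl: "\<beta> \<cdot>\<^bsub>M\<^esub> l = idt M b"
    unfolding kl category_assoc[OF cat p(1) ff(3,4)] category_assoc[OF cat p(2) ff(3,4)] ff(5) by (rule h(2), rule h(3))
  have kw: "k \<in> weq M" using two_of_three(3)[OF kh ff(4) ff(2)] bk f by simp
  have lw: "l \<in> weq M" using two_of_three(3)[OF lh ff(4) ff(2)] bl weq_idt[OF ob(2)] by simp
  have Fk: "onar F k \<in> weq M" and Fl: "onar F l \<in> weq M"
    using ac[OF kc kw] ac[OF lc lw] kh lh cab cc by (auto simp: homs_def)
  have Fb: "onob F b \<in> obs M" by (rule functor_ob[OF F ob(2)])
  have "onar F \<beta> \<cdot>\<^bsub>M\<^esub> onar F l = idt M (onob F b)"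
    using functor_cmp[OF F lh ff(4)] bl functor_idt[OF F ob(2)] by simp
  then have "onar F \<beta> \<in> weq M"
    using two_of_three(2)[OF functor_homs[OF F lh] functor_homs[OF F ff(4)] Fl] weq_idt[OF Fb] by simp
  then show ?thesis
    using two_of_three(1)[OF functor_homs[OF F kh] functor_homs[OF F ff(4)] Fk]
      functor_cmp[OF F kh ff(4)] bk by simp
qed

end

section \<open>Monoidal model categories\<close>

lemma homs_prod_cat: "homs (prod_cat C D) (x, y) (x', y') = homs C x x' \<times> homs D y y'"
  by (auto simp: homs_def prod_cat_def)

lemma prod_cat_simps:
  "obs (prod_cat C D) = obs C \<times> obs D" "arrs (prod_cat C D) = arrs C \<times> arrs D"
  "idt (prod_cat C D) (x, y) = (idt C x, idt D y)" "(g, g') \<cdot>\<^bsub>prod_cat C D\<^esub> (f, f') = (g \<cdot>\<^bsub>C\<^esub> f, g' \<cdot>\<^bsub>D\<^esub> f')"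
  by (simp_all add: prod_cat_def)

locale monoidal_cat =
  fixes M :: "('o, 'm, 'z) mmcat_scheme"
  assumes mon: "monoidal_category M"
begin

lemma cat: "category M" and tensor_functor: "is_functor (prod_cat M M) M (ten M)"
  and strict: "strictly_associative M (ten M)" and unt_obs: "unt M \<in> obs M"
  using mon unfolding monoidal_category_def by blast+

lemma tob_obs: "\<lbrakk>x \<in> obs M; y \<in> obs M\<rbrakk> \<Longrightarrow> tob M x y \<in> obs M"
  by (rule functor_ob[OF tensor_functor]) (simp add: prod_cat_simps)

lemma tar_homs: "\<lbrakk>f \<in> homs M a b; g \<in> homs M c d\<rbrakk> \<Longrightarrow> tar M f g \<in> homs M (tob M a c) (tob M b d)"
  by (rule functor_homs[OF tensor_functor]) (simp add: homs_prod_cat)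

lemma tar_idt: "\<lbrakk>x \<in> obs M; y \<in> obs M\<rbrakk> \<Longrightarrow> tar M (idt M x) (idt M y) = idt M (tob M x y)"
  using functor_idt[OF tensor_functor, of "(x, y)"] by (simp add: prod_cat_simps)

lemma tar_cmp:
  assumes "f \<in> homs M a b" "f' \<in> homs M b c" "g \<in> homs M x y" "g' \<in> homs M y z"
  shows "tar M (f' \<cdot>\<^bsub>M\<^esub> f) (g' \<cdot>\<^bsub>M\<^esub> g) = tar M f' g' \<cdot>\<^bsub>M\<^esub> tar M f g"
  using functor_cmp[OF tensor_functor, of "(f, g)" "(a, x)" "(b, y)" "(f', g')" "(c, z)"] assms
  by (simp add: prod_cat_simps homs_prod_cat)

lemma tob_assoc: "\<lbrakk>x \<in> obs M; y \<in> obs M; z \<in> obs M\<rbrakk> \<Longrightarrow> tob M (tob M x y) z = tob M x (tob M y z)"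
  and tar_assoc: "\<lbrakk>f \<in> arrs M; g \<in> arrs M; h \<in> arrs M\<rbrakk> \<Longrightarrow> tar M (tar M f g) h = tar M f (tar M g h)"
  using strict unfolding strictly_associative_def by blast+

lemma tar_split:
  assumes "f \<in> homs M a b" "g \<in> homs M c d"
  shows "tar M f g = tar M (idt M b) g \<cdot>\<^bsub>M\<^esub> tar M f (idt M c)" "tar M f g = tar M f (idt M d) \<cdot>\<^bsub>M\<^esub> tar M (idt M a) g"
proof -
  note o = category_obs[OF cat assms(1)] category_obs[OF cat assms(2)]
  note i = category_idt[OF cat o(1)] category_idt[OF cat o(2)] category_idt[OF cat o(3)] category_idt[OF cat o(4)]
  note l = category_idt_left[OF cat assms(1)] category_idt_right[OF cat assms(1)]
     category_idt_left[OF cat assms(2)] category_idt_right[OF cat assms(2)]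
  show "tar M f g = tar M (idt M b) g \<cdot>\<^bsub>M\<^esub> tar M f (idt M c)"
    using tar_cmp[OF assms(1) i(2) i(3) assms(2)] by (simp add: l)
  show "tar M f g = tar M f (idt M d) \<cdot>\<^bsub>M\<^esub> tar M (idt M a) g"
    using tar_cmp[OF i(1) assms(1) assms(2) i(4)] by (simp add: l)
qed

lemma functor_tensor_left: "x \<in> obs M \<Longrightarrow> is_functor M M \<lparr>onob = tob M x, onar = tar M (idt M x)\<rparr>"
  unfolding is_functor_def fctr.select_convs
proof (intro conjI ballI allI)
  assume x: "x \<in> obs M"
  note i = category_idt[OF cat x]
  show "tob M x y \<in> obs M" "tar M (idt M x) (idt M y) = idt M (tob M x y)" if "y \<in> obs M" for y
    using x that by (rule tob_obs, rule tar_idt)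
  show "tar M (idt M x) f \<in> homs M (tob M x y) (tob M x z)" if "f \<in> homs M y z" for f y z
    by (rule tar_homs[OF i that])
  show "tar M (idt M x) (g \<cdot>\<^bsub>M\<^esub> f) = tar M (idt M x) g \<cdot>\<^bsub>M\<^esub> tar M (idt M x) f"
    if "f \<in> homs M y z" "g \<in> homs M z w" for f g y z w
    using tar_cmp[OF i i that] category_idt_left[OF cat i] by simp
qed

lemma functor_tensor_right: "x \<in> obs M \<Longrightarrow> is_functor M M \<lparr>onob = (\<lambda>y. tob M y x), onar = (\<lambda>f. tar M f (idt M x))\<rparr>"
  unfolding is_functor_def fctr.select_convs
proof (intro conjI ballI allI)
  assume x: "x \<in> obs M"
  note i = category_idt[OF cat x]
  show "tob M y x \<in> obs M" "tar M (idt M y) (idt M x) = idt M (tob M y x)" if "y \<in> obs M" for y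
    using that x by (rule tob_obs, rule tar_idt)
  show "tar M f (idt M x) \<in> homs M (tob M y x) (tob M z x)" if "f \<in> homs M y z" for f y z
    by (rule tar_homs[OF that i])
  show "tar M (g \<cdot>\<^bsub>M\<^esub> f) (idt M x) = tar M g (idt M x) \<cdot>\<^bsub>M\<^esub> tar M f (idt M x)"
    if "f \<in> homs M y z" "g \<in> homs M z w" for f g y z w
    using tar_cmp[OF that i i] category_idt_left[OF cat i] by simp
qed

lemma nat_lun:
  "nat_iso M M \<lparr>onob = tob M (unt M), onar = tar M (idt M (unt M))\<rparr> id_fctr (lun M)"
  and nat_run: "nat_iso M M \<lparr>onob = (\<lambda>x. tob M x (unt M)), onar = (\<lambda>f. tar M f (idt M (unt M)))\<rparr> id_fctr (run M)"
  and triangle: "\<lbrakk>x \<in> obs M; y \<in> obs M\<rbrakk> \<Longrightarrow> tar M (run M x) (idt M y) = tar M (idt M x) (lun M y)"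
  using mon unfolding monoidal_category_def by blast+

lemma lun_homs: "x \<in> obs M \<Longrightarrow> lun M x \<in> homs M (tob M (unt M) x) x"
  and lun_natural: "f \<in> homs M x y \<Longrightarrow> lun M y \<cdot>\<^bsub>M\<^esub> tar M (idt M (unt M)) f = f \<cdot>\<^bsub>M\<^esub> lun M x"
  using nat_lun unfolding nat_iso_def nat_trans_def id_fctr_def fctr.select_convs by blast+

lemma run_homs: "x \<in> obs M \<Longrightarrow> run M x \<in> homs M (tob M x (unt M)) x"
  and run_natural: "f \<in> homs M x y \<Longrightarrow> run M y \<cdot>\<^bsub>M\<^esub> tar M f (idt M (unt M)) = f \<cdot>\<^bsub>M\<^esub> run M x"
  using nat_run unfolding nat_iso_def nat_trans_def id_fctr_def fctr.select_convs by blast+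

text \<open>Tensoring with the unit is naturally isomorphic to the identity functor, hence
  faithful.\<close>

lemma lun_cancel:
  assumes x: "x \<in> obs M" and f: "f \<in> homs M a x" "g \<in> homs M a x"
    and eq: "tar M (idt M (unt M)) f = tar M (idt M (unt M)) g"
  shows "f = g"
proof -
  have a: "a \<in> obs M" by (rule category_obs(1)[OF cat f(1)])
  have "f \<cdot>\<^bsub>M\<^esub> lun M a = g \<cdot>\<^bsub>M\<^esub> lun M a"
    using lun_natural[OF f(1)] lun_natural[OF f(2)] eq by simp
  moreover have "iso_arr M (lun M a)"
    using nat_lun a unfolding nat_iso_def by blast
  then obtain k where k: "k \<in> homs M a (tob M (unt M) a)" "lun M a \<cdot>\<^bsub>M\<^esub> k = idt M a"
    using homsD[OF lun_homs[OF a]] unfolding iso_arr_def by auto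
  ultimately have "f \<cdot>\<^bsub>M\<^esub> (lun M a \<cdot>\<^bsub>M\<^esub> k) = g \<cdot>\<^bsub>M\<^esub> (lun M a \<cdot>\<^bsub>M\<^esub> k)"
    using category_assoc[OF cat k(1) lun_homs[OF a] f(1)] category_assoc[OF cat k(1) lun_homs[OF a] f(2)] by simp
  then show ?thesis
    using k(2) category_idt_right[OF cat f(1)] category_idt_right[OF cat f(2)] by simp
qed

lemma cancel_lun:
  assumes x: "x \<in> obs M" and f: "f \<in> homs M a (tob M (unt M) x)" "g \<in> homs M a (tob M (unt M) x)"
    and eq: "lun M x \<cdot>\<^bsub>M\<^esub> f = lun M x \<cdot>\<^bsub>M\<^esub> g"
  shows "f = g"
proof -
  have "iso_arr M (lun M x)"
    using nat_lun x unfolding nat_iso_def by blast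
  then obtain k where k: "k \<in> homs M x (tob M (unt M) x)" "k \<cdot>\<^bsub>M\<^esub> lun M x = idt M (tob M (unt M) x)"
    using homsD[OF lun_homs[OF x]] unfolding iso_arr_def by auto
  have "k \<cdot>\<^bsub>M\<^esub> (lun M x \<cdot>\<^bsub>M\<^esub> f) = k \<cdot>\<^bsub>M\<^esub> (lun M x \<cdot>\<^bsub>M\<^esub> g)" using eq by simp
  then show ?thesis
    using category_assoc[OF cat f(1) lun_homs[OF x] k(1)] category_assoc[OF cat f(2) lun_homs[OF x] k(1)]
      k(2) category_idt_left[OF cat f(1)] category_idt_left[OF cat f(2)] by simp
qed

text \<open>Kelly's argument: by the triangle identity, \<open>1 \<otimes> lun (I \<otimes> I)\<close> and \<open>1 \<otimes> (lun I \<otimes> 1)\<close> both equal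
  \<open>run I \<otimes> 1 \<otimes> 1\<close>.\<close>

lemma lun_unt: "tar M (lun M (unt M)) (idt M (unt M)) = tar M (idt M (unt M)) (lun M (unt M))"
proof -
  let ?I = "unt M" and ?l = "lun M (unt M)"
  let ?II = "tob M ?I ?I"
  have I: "?I \<in> obs M" and II: "?II \<in> obs M" by (auto intro: unt_obs tob_obs)
  note i = category_idt[OF cat I]
  have arr: "idt M ?I \<in> arrs M" "?l \<in> arrs M" "run M ?I \<in> arrs M"
    using i lun_homs[OF I] run_homs[OF I] by (auto simp: homs_def)
  have l1: "tar M ?l (idt M ?I) \<in> homs M (tob M ?I ?II) ?II"
    using tar_homs[OF lun_homs[OF I] i] tob_assoc[OF I I I] by simp
  have "tar M (idt M ?I) (tar M ?l (idt M ?I)) = tar M (run M ?I) (tar M (idt M ?I) (idt M ?I))"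
    using tar_assoc[OF arr(1,2,1)] triangle[OF I I] tar_assoc[OF arr(3,1,1)] by simp
  also have "\<dots> = tar M (idt M ?I) (lun M ?II)"
    using tar_idt[OF I I] triangle[OF I II] by simp
  finally have 1: "tar M ?l (idt M ?I) = lun M ?II"
    by (rule lun_cancel[OF II l1 lun_homs[OF II]])
  \<comment> \<open>The other half: naturality of \<open>lun\<close> at the arrow
    \<open>lun I\<close> itself, after which the invertible \<open>lun I\<close> is cancelled on the
    left.\<close>
  have "tar M (idt M ?I) ?l = lun M ?II"
    by (rule cancel_lun[OF I tar_homs[OF i lun_homs[OF I]] lun_homs[OF II] lun_natural[OF lun_homs[OF I]]])
  with 1 show ?thesis by simp
qed

end

section \<open>Tensor products of cofibrant objects and of weak equivalences\<close>

locale monoidal_model_cat =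
  fixes M :: "('o, 'm) mmcat" and S :: "'s itself"
  assumes inf: "infinite (UNIV :: 's set)" and mmc: "monoidal_model_category TYPE('s) M"
begin

lemma model: "model_category TYPE('s) M" and closed: "closed_monoidal M"
  and pushout_product: "\<lbrakk>f \<in> cof M; g \<in> cof M; is_pushout_product M f g h\<rbrakk> \<Longrightarrow>
        h \<in> cof M \<and> (f \<in> weq M \<or> g \<in> weq M \<longrightarrow> h \<in> weq M)"
  and unit_axiom: "\<lbrakk>q \<in> weq M; cofibrant M (src M q); tgt M q = unt M; cofibrant M x\<rbrakk> \<Longrightarrow>
        lun M x \<cdot>\<^bsub>M\<^esub> tar M q (idt M x) \<in> weq M \<and> run M x \<cdot>\<^bsub>M\<^esub> tar M (idt M x) q \<in> weq M"
  using mmc unfolding monoidal_model_category_def by blast+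

sublocale monoidal_cat M
  using closed by unfold_locales (simp add: closed_monoidal_def)

lemmas cofib_obs = cofibrant_obs[OF model] and weq_hom = weq_homs[OF model]

lemma inner_hom:
  assumes "x \<in> obs M" "w \<in> obs M"
  shows "\<exists>e\<in>obs M. \<exists>ev\<in>homs M (tob M e x) w. \<forall>y\<in>obs M. \<forall>f\<in>homs M (tob M y x) w.
           \<exists>!g. g \<in> homs M y e \<and> ev \<cdot>\<^bsub>M\<^esub> tar M g (idt M x) = f"
    "\<exists>e\<in>obs M. \<exists>ev\<in>homs M (tob M x e) w. \<forall>y\<in>obs M. \<forall>f\<in>homs M (tob M x y) w.
           \<exists>!g. g \<in> homs M y e \<and> ev \<cdot>\<^bsub>M\<^esub> tar M (idt M x) g = f"
proof -
  note c = bspec[OF bspec[OF closed[unfolded closed_monoidal_def, THEN conjunct2] assms(1)] assms(2)]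
  show "\<exists>e\<in>obs M. \<exists>ev\<in>homs M (tob M e x) w. \<forall>y\<in>obs M. \<forall>f\<in>homs M (tob M y x) w.
           \<exists>!g. g \<in> homs M y e \<and> ev \<cdot>\<^bsub>M\<^esub> tar M g (idt M x) = f"
    by (rule conjunct1[OF c])
  show "\<exists>e\<in>obs M. \<exists>ev\<in>homs M (tob M x e) w. \<forall>y\<in>obs M. \<forall>f\<in>homs M (tob M x y) w.
           \<exists>!g. g \<in> homs M y e \<and> ev \<cdot>\<^bsub>M\<^esub> tar M (idt M x) g = f"
    by (rule conjunct2[OF c])
qed

text \<open>Closedness makes tensoring with \<open>x\<close> a left adjoint: arrows out of the
  tensor product correspond to arrows out of \<open>z\<close> into an inner hom, of which there is
  exactly one.\<close>

lemma tensor_initial: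
  assumes z: "is_initial M z" and x: "x \<in> obs M"
  shows "is_initial M (tob M z x)" "is_initial M (tob M x z)"
proof -
  have zo: "z \<in> obs M" using z by (simp add: is_initial_def)
  note i = category_idt[OF cat x]
  have "\<exists>!f. f \<in> homs M (tob M z x) w" if w: "w \<in> obs M" for w
  proof -
    obtain e ev where e12: "e \<in> obs M" "ev \<in> homs M (tob M e x) w" and
      uni: "\<forall>y\<in>obs M. \<forall>f\<in>homs M (tob M y x) w. \<exists>!g. g \<in> homs M y e \<and> ev \<cdot>\<^bsub>M\<^esub> tar M g (idt M x) = f"
      using inner_hom(1)[OF x w] by (elim bexE) (rule that)
    note e = e12 uni[rule_format, OF zo]
    obtain g where g: "g \<in> homs M z e" using initial_arrow[OF z e(1)] by blast
    show ?thesis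
    proof (rule ex1I[of _ "ev \<cdot>\<^bsub>M\<^esub> tar M g (idt M x)"])
      show "ev \<cdot>\<^bsub>M\<^esub> tar M g (idt M x) \<in> homs M (tob M z x) w"
        by (rule category_cmp[OF cat tar_homs[OF g i] e(2)])
      fix f assume "f \<in> homs M (tob M z x) w"
      then obtain g' where "g' \<in> homs M z e" "ev \<cdot>\<^bsub>M\<^esub> tar M g' (idt M x) = f" using e(3) by blast
      then show "f = ev \<cdot>\<^bsub>M\<^esub> tar M g (idt M x)" using initial_unique[OF cat z g] by blast
    qed
  qed
  then show "is_initial M (tob M z x)"
    unfolding is_initial_def using tob_obs[OF zo x] by blast
  have "\<exists>!f. f \<in> homs M (tob M x z) w" if w: "w \<in> obs M" for w
  proof -
    obtain e ev where e12: "e \<in> obs M" "ev \<in> homs M (tob M x e) w" and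
      uni: "\<forall>y\<in>obs M. \<forall>f\<in>homs M (tob M x y) w. \<exists>!g. g \<in> homs M y e \<and> ev \<cdot>\<^bsub>M\<^esub> tar M (idt M x) g = f"
      using inner_hom(2)[OF x w] by (elim bexE) (rule that)
    note e = e12 uni[rule_format, OF zo]
    obtain g where g: "g \<in> homs M z e" using initial_arrow[OF z e(1)] by blast
    show ?thesis
    proof (rule ex1I[of _ "ev \<cdot>\<^bsub>M\<^esub> tar M (idt M x) g"])
      show "ev \<cdot>\<^bsub>M\<^esub> tar M (idt M x) g \<in> homs M (tob M x z) w"
        by (rule category_cmp[OF cat tar_homs[OF i g] e(2)])
      fix f assume "f \<in> homs M (tob M x z) w"
      then obtain g' where "g' \<in> homs M z e" "ev \<cdot>\<^bsub>M\<^esub> tar M (idt M x) g' = f" using e(3) by blast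
      then show "f = ev \<cdot>\<^bsub>M\<^esub> tar M (idt M x) g" using initial_unique[OF cat z g] by blast
    qed
  qed
  then show "is_initial M (tob M x z)"
    unfolding is_initial_def using tob_obs[OF x zo] by blast
qed

text \<open>The pushout product of \<open>g\<close> with the cofibration from the initial object to
  \<open>x\<close> is \<open>g\<close> tensored with \<open>x\<close>, because the corners
  containing the initial object are initial. The pushout product axiom then applies.\<close>

lemma tensor_cof:
  assumes x: "cofibrant M x" and g: "g \<in> cof M"
  shows "tar M (idt M x) g \<in> cof M \<and> (g \<in> weq M \<longrightarrow> tar M (idt M x) g \<in> weq M)"
    "tar M g (idt M x) \<in> cof M \<and> (g \<in> weq M \<longrightarrow> tar M g (idt M x) \<in> weq M)"
proof -
  obtain z e where z: "is_initial M z" and e: "e \<in> homs M z x" "e \<in> cof M"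
    using x unfolding cofibrant_def by blast
  define c d where cd: "c = src M g" "d = tgt M g"
  have gh: "g \<in> homs M c d" using cof_arrs[OF model g] by (simp add: cd homs_def)
  have est: "src M e = z" "tgt M e = x" using e(1) by (auto simp: homs_def)
  have o: "x \<in> obs M" "z \<in> obs M" "c \<in> obs M" "d \<in> obs M"
    using category_obs[OF cat e(1)] category_obs[OF cat gh] by auto
  note i = category_idt[OF cat o(1)] category_idt[OF cat o(2)] category_idt[OF cat o(3)] category_idt[OF cat o(4)]
  have "is_pushout_product M e g (tar M (idt M x) g)"
  proof -
    note z1 = tensor_initial(1)[OF z o(3)] and z2 = tensor_initial(1)[OF z o(4)]
    obtain k where k: "k \<in> homs M (tob M z d) (tob M x c)"
      using initial_arrow[OF z2 tob_obs[OF o(1,3)]] by blast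
    note a = tar_homs[OF i(1) gh]
    show ?thesis
      unfolding is_pushout_product_def est cd[symmetric]
    proof (intro exI conjI)
      show "is_pushout M (tar M (idt M z) g) (tar M e (idt M c)) (tob M x c) k (idt M (tob M x c))"
        by (rule is_pushout_initial[OF cat z1 z2 tar_homs[OF i(2) gh] tar_homs[OF e(1) i(3)] k])
      show "tar M (idt M x) g \<in> homs M (tob M x c) (tob M x d)" by (rule a)
      show "tar M (idt M x) g \<cdot>\<^bsub>M\<^esub> k = tar M e (idt M d)"
        by (rule initial_unique[OF cat z2 category_cmp[OF cat k a] tar_homs[OF e(1) i(4)]])
      show "tar M (idt M x) g \<cdot>\<^bsub>M\<^esub> idt M (tob M x c) = tar M (idt M x) g"
        by (rule category_idt_right[OF cat a])
    qed
  qed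
  from pushout_product[OF e(2) g this]
  show "tar M (idt M x) g \<in> cof M \<and> (g \<in> weq M \<longrightarrow> tar M (idt M x) g \<in> weq M)" by blast
  have "is_pushout_product M g e (tar M g (idt M x))"
  proof -
    note z1 = tensor_initial(2)[OF z o(3)] and z2 = tensor_initial(2)[OF z o(4)]
    obtain k where k: "k \<in> homs M (tob M d z) (tob M c x)"
      using initial_arrow[OF z2 tob_obs[OF o(3,1)]] by blast
    note a = tar_homs[OF gh i(1)]
    show ?thesis
      unfolding is_pushout_product_def est cd[symmetric]
    proof (intro exI conjI)
      show "is_pushout M (tar M (idt M c) e) (tar M g (idt M z)) (tob M c x) (idt M (tob M c x)) k"
        by (rule is_pushout_sym[OF is_pushout_initial[OF cat z1 z2 tar_homs[OF gh i(2)] tar_homs[OF i(3) e(1)] k]])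
      show "tar M g (idt M x) \<in> homs M (tob M c x) (tob M d x)" by (rule a)
      show "tar M g (idt M x) \<cdot>\<^bsub>M\<^esub> k = tar M (idt M d) e"
        by (rule initial_unique[OF cat z2 category_cmp[OF cat k a] tar_homs[OF i(4) e(1)]])
      show "tar M g (idt M x) \<cdot>\<^bsub>M\<^esub> idt M (tob M c x) = tar M g (idt M x)"
        by (rule category_idt_right[OF cat a])
    qed
  qed
  from pushout_product[OF g e(2) this]
  show "tar M g (idt M x) \<in> cof M \<and> (g \<in> weq M \<longrightarrow> tar M g (idt M x) \<in> weq M)" by blast
qed

lemma tensor_cofibrant:
  assumes x: "cofibrant M x" and y: "cofibrant M y"
  shows "cofibrant M (tob M x y)"
proof -
  obtain z e where z: "is_initial M z" and e: "e \<in> homs M z y" "e \<in> cof M"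
    using y unfolding cofibrant_def by blast
  note xo = cofib_obs[OF x]
  show ?thesis
    unfolding cofibrant_def
    using tensor_initial(2)[OF z xo] tar_homs[OF category_idt[OF cat xo] e(1)] tensor_cof(1)[OF x e(2)] by blast
qed

text \<open>\<open>f \<otimes> g\<close> is \<open>f \<otimes> 1\<close> followed by
  \<open>1 \<otimes> g\<close>, with cofibrant objects throughout. Tensoring with a cofibrant object
  preserves trivial cofibrations, so Ken Brown's lemma covers each factor.\<close>

lemma tensor_weq:
  assumes f: "f \<in> weq M" "cofibrant M (src M f)" "cofibrant M (tgt M f)"
    and g: "g \<in> weq M" "cofibrant M (src M g)" "cofibrant M (tgt M g)"
  shows "tar M f g \<in> weq M"
proof -
  note fh = weq_hom[OF f(1)] and gh = weq_hom[OF g(1)]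
  note i = category_idt[OF cat cofib_obs[OF f(3)]] category_idt[OF cat cofib_obs[OF g(2)]]
  have 1: "tar M (idt M (tgt M f)) g \<in> weq M"
    using ken_brown[OF model inf functor_tensor_left[OF cofib_obs[OF f(3)]] _ g] tensor_cof(1)[OF f(3)] by simp
  have 2: "tar M f (idt M (src M g)) \<in> weq M"
    using ken_brown[OF model inf functor_tensor_right[OF cofib_obs[OF g(2)]] _ f] tensor_cof(2)[OF g(2)] by simp
  show ?thesis
    unfolding tar_split(1)[OF fh gh]
    by (rule two_of_three(1)[OF model tar_homs[OF fh i(2)] tar_homs[OF i(1) gh] 2 1])
qed

end

section \<open>Products of coloured categories\<close>

lemma prod_ccat_simps:
  "obs (prod_ccat C D) = obs C \<times> obs D" "arrs (prod_ccat C D) = arrs C \<times> arrs D"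
  "src (prod_ccat C D) (f, f') = (src C f, src D f')" "tgt (prod_ccat C D) (f, f') = (tgt C f, tgt D f')"
  "idt (prod_ccat C D) (x, y) = (idt C x, idt D y)" "(g, g') \<cdot>\<^bsub>prod_ccat C D\<^esub> (f, f') = (g \<cdot>\<^bsub>C\<^esub> f, g' \<cdot>\<^bsub>D\<^esub> f')"
  "col (prod_ccat C D) = col C \<times> col D"
  by (simp_all add: prod_ccat_def prod_cat_def cat.defs ccat.defs)

lemma homs_prod_ccat: "homs (prod_ccat C D) (x, y) (x', y') = homs C x x' \<times> homs D y y'"
  by (auto simp: homs_def prod_ccat_simps)

lemma categoryI:
  assumes "\<And>f. f \<in> arrs C \<Longrightarrow> src C f \<in> obs C \<and> tgt C f \<in> obs C"
    and "\<And>x. x \<in> obs C \<Longrightarrow> idt C x \<in> homs C x x"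
    and "\<And>x y z f g. \<lbrakk>f \<in> homs C x y; g \<in> homs C y z\<rbrakk> \<Longrightarrow> g \<cdot>\<^bsub>C\<^esub> f \<in> homs C x z"
    and "\<And>x y f. f \<in> homs C x y \<Longrightarrow> f \<cdot>\<^bsub>C\<^esub> idt C x = f \<and> idt C y \<cdot>\<^bsub>C\<^esub> f = f"
    and "\<And>x y z w f g h. \<lbrakk>f \<in> homs C x y; g \<in> homs C y z; h \<in> homs C z w\<rbrakk> \<Longrightarrow>
       h \<cdot>\<^bsub>C\<^esub> (g \<cdot>\<^bsub>C\<^esub> f) = (h \<cdot>\<^bsub>C\<^esub> g) \<cdot>\<^bsub>C\<^esub> f"
  shows "category C"
  unfolding category_def by (intro conjI ballI allI) (simp_all add: assms)

lemma coloured_categoryI: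
  assumes "category C" "col C \<subseteq> arrs C" "\<And>x. x \<in> obs C \<Longrightarrow> idt C x \<in> col C"
    and "\<And>x y z f g. \<lbrakk>f \<in> col C; g \<in> col C; f \<in> homs C x y; g \<in> homs C y z\<rbrakk> \<Longrightarrow> g \<cdot>\<^bsub>C\<^esub> f \<in> col C"
  shows "coloured_category C"
  unfolding coloured_category_def wide_subcat_def
proof (intro conjI ballI impI assms(1,2,3))
  fix f g assume fg: "f \<in> col C" "g \<in> col C" "src C g = tgt C f"
  then show "g \<cdot>\<^bsub>C\<^esub> f \<in> col C"
    using assms(2) by (intro assms(4)[of f g "src C f" "tgt C f" "tgt C g"] homsI) auto
qed

lemma is_functorI:
  assumes "\<And>x. x \<in> obs C \<Longrightarrow> onob F x \<in> obs D"
    and "\<And>x. x \<in> obs C \<Longrightarrow> onar F (idt C x) = idt D (onob F x)"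
    and "\<And>x y f. f \<in> homs C x y \<Longrightarrow> onar F f \<in> homs D (onob F x) (onob F y)"
    and "\<And>x y z f g. \<lbrakk>f \<in> homs C x y; g \<in> homs C y z\<rbrakk> \<Longrightarrow> onar F (g \<cdot>\<^bsub>C\<^esub> f) = onar F g \<cdot>\<^bsub>D\<^esub> onar F f"
  shows "is_functor C D F"
  unfolding is_functor_def by (intro conjI ballI allI) (blast intro: assms)+

lemma nat_transI:
  assumes "\<And>x. x \<in> obs C \<Longrightarrow> \<eta> x \<in> homs D (onob F x) (onob G x)"
    and "\<And>x y f. f \<in> homs C x y \<Longrightarrow> \<eta> y \<cdot>\<^bsub>D\<^esub> onar F f = onar G f \<cdot>\<^bsub>D\<^esub> \<eta> x"
  shows "nat_trans C D F G \<eta>"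
  unfolding nat_trans_def using assms by blast

lemma coloured_category_prod:
  assumes C: "coloured_category C" and D: "coloured_category D"
  shows "coloured_category (prod_ccat C D)"
proof -
  note c = coloured_categoryD[OF C] and d = coloured_categoryD[OF D]
  have "category (prod_ccat C D)"
  proof (rule categoryI)
    fix f assume "f \<in> arrs (prod_ccat C D)"
    then obtain g h where f: "f = (g, h)" "g \<in> homs C (src C g) (tgt C g)" "h \<in> homs D (src D h) (tgt D h)"
      by (auto simp: prod_ccat_simps homs_def)
    then show "src (prod_ccat C D) f \<in> obs (prod_ccat C D) \<and> tgt (prod_ccat C D) f \<in> obs (prod_ccat C D)"
      using category_obs[OF c f(2)] category_obs[OF d f(3)] by (simp add: prod_ccat_simps)
  qed (auto simp: prod_ccat_simps homs_prod_ccat category_idt[OF c] category_idt[OF d] category_idt_left[OF c]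
      category_idt_left[OF d] category_idt_right[OF c] category_idt_right[OF d]
      intro: category_cmp[OF c] category_cmp[OF d] category_assoc[OF c] category_assoc[OF d])
  then show ?thesis
    by (rule coloured_categoryI)
      (auto simp: prod_ccat_simps homs_prod_ccat col_arrs[OF C] col_arrs[OF D] col_idt[OF C] col_idt[OF D]
        intro: col_cmp[OF C] col_cmp[OF D])
qed

lemma prod_fctr_simps:
  "onob (prod_fctr F G) (x, y) = (onob F x, onob G y)" "onar (prod_fctr F G) (f, g) = (onar F f, onar G g)"
  by (simp_all add: prod_fctr_def)

lemma coloured_functorI:
  "\<lbrakk>is_functor C D F; \<And>f. f \<in> col C \<Longrightarrow> onar F f \<in> col D\<rbrakk> \<Longrightarrow> coloured_functor C D F"
  by (simp add: coloured_functor_def)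

lemma coloured_functor_prod:
  assumes F: "coloured_functor C D F" and G: "coloured_functor C' D' G"
  shows "coloured_functor (prod_ccat C C') (prod_ccat D D') (prod_fctr F G)"
proof (rule coloured_functorI)
  note f = coloured_functorD(1)[OF F] and g = coloured_functorD(1)[OF G]
  show "is_functor (prod_ccat C C') (prod_ccat D D') (prod_fctr F G)"
    by (rule is_functorI)
      (auto simp: prod_ccat_simps homs_prod_ccat prod_fctr_simps functor_idt[OF f] functor_idt[OF g]
        functor_cmp[OF f] functor_cmp[OF g] intro: functor_ob[OF f] functor_ob[OF g] functor_homs[OF f] functor_homs[OF g])
qed (auto simp: prod_ccat_simps prod_fctr_simps coloured_functorD(2)[OF F] coloured_functorD(2)[OF G])

lemma coloured_nat_trans_prod:
  assumes "coloured_nat_trans C D P Q \<eta>" and "coloured_nat_trans C' D' P' Q' \<theta>"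
  shows "coloured_nat_trans (prod_ccat C C') (prod_ccat D D') (prod_fctr P P') (prod_fctr Q Q') (\<lambda>(x, y). (\<eta> x, \<theta> y))"
proof -
  interpret A: coloured_nat_trans C D P Q \<eta> by fact
  interpret B: coloured_nat_trans C' D' P' Q' \<theta> by fact
  show ?thesis
  proof
    show "nat_trans (prod_ccat C C') (prod_ccat D D') (prod_fctr P P') (prod_fctr Q Q') (\<lambda>(x, y). (\<eta> x, \<theta> y))"
      by (rule nat_transI)
        (auto simp: prod_ccat_simps homs_prod_ccat prod_fctr_simps A.nat_homs B.nat_homs A.nat_square B.nat_square)
  qed (auto intro: coloured_category_prod coloured_functor_prod A.C A.D A.P A.Q B.C B.D B.P B.Q
      simp: prod_ccat_simps A.col B.col)
qed

lemma coloured_nat_trans_post: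
  assumes "coloured_nat_trans C D P Q \<eta>" and E: "coloured_category E" and G: "coloured_functor D E G"
  shows "coloured_nat_trans C E (comp_fctr G P) (comp_fctr G Q) (\<lambda>x. onar G (\<eta> x))"
proof -
  interpret A: coloured_nat_trans C D P Q \<eta> by fact
  note g = coloured_functorD(1)[OF G]
  show ?thesis
  proof
    show "nat_trans C E (comp_fctr G P) (comp_fctr G Q) (\<lambda>x. onar G (\<eta> x))"
    proof (rule nat_transI)
      show "onar G (\<eta> x) \<in> homs E (onob (comp_fctr G P) x) (onob (comp_fctr G Q) x)" if "x \<in> obs C" for x
        using functor_homs[OF g A.nat_homs[OF that]] by (simp add: comp_fctr_def)
      fix x y f assume f: "f \<in> homs C x y"
      note xy = category_obs[OF coloured_categoryD[OF A.C] f]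
      show "onar G (\<eta> y) \<cdot>\<^bsub>E\<^esub> onar (comp_fctr G P) f = onar (comp_fctr G Q) f \<cdot>\<^bsub>E\<^esub> onar G (\<eta> x)"
        using functor_cmp[OF g functor_homs[OF A.fP f] A.nat_homs[OF xy(2)]]
          functor_cmp[OF g A.nat_homs[OF xy(1)] functor_homs[OF A.fQ f]] A.nat_square[OF f]
        by (simp add: comp_fctr_def)
    qed
  qed (auto intro: E A.C coloured_functor_comp[OF A.P G] coloured_functor_comp[OF A.Q G] coloured_functorD(2)[OF G] A.col)
qed

lemma coloured_nat_trans_pre:
  assumes "coloured_nat_trans C D P Q \<eta>" and B: "coloured_category B" and H: "coloured_functor B C H"
  shows "coloured_nat_trans B D (comp_fctr P H) (comp_fctr Q H) (\<lambda>x. \<eta> (onob H x))"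
proof -
  interpret A: coloured_nat_trans C D P Q \<eta> by fact
  note h = coloured_functorD(1)[OF H]
  show ?thesis
  proof
    show "nat_trans B D (comp_fctr P H) (comp_fctr Q H) (\<lambda>x. \<eta> (onob H x))"
      by (rule nat_transI)
        (simp_all add: comp_fctr_def A.nat_homs[OF functor_ob[OF h]] A.nat_square[OF functor_homs[OF h]])
  qed (auto intro: B A.D coloured_functor_comp[OF H A.P] coloured_functor_comp[OF H A.Q] A.col functor_ob[OF h])
qed

section \<open>Contractions and the equifunctors they produce\<close>

text \<open>The section \<open>i\<close> of \<open>pr\<close> is an inverse of \<open>F\<close> up
  to homotopy: \<open>i F\<close> is connected to \<open>i pr\<close> and so to the identity, and
  \<open>F i\<close> is connected to \<open>pr i\<close>, the identity. Contractibility of weak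
  units and both multiplication conditions are instances.\<close>

lemma equifunctor_if_projection:
  fixes B :: "('p, 'n) ccat" and A :: "('o, 'm) ccat"
  assumes B: "coloured_category B" and A: "coloured_category A"
    and i: "coloured_functor A B i" and pi: "comp_fctr pr i = id_fctr"
    and ip: "homotopic_sfctrs (localisation B) (localisation B) (localisation_fctr B (comp_fctr i pr)) (localisation_fctr B id_fctr)"
    and nt: "coloured_nat_trans B A F pr \<eta>"
  shows "equifunctor B A F"
proof -
  interpret N: coloured_nat_trans B A F pr \<eta> by fact
  interpret X: coloured_nat_trans B B "comp_fctr i F" "comp_fctr i pr" "\<lambda>x. onar i (\<eta> x)"
    by (rule coloured_nat_trans_post[OF nt B i])
  interpret Y: coloured_nat_trans A A "comp_fctr F i" "comp_fctr pr i" "\<lambda>x. \<eta> (onob i x)"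
    by (rule coloured_nat_trans_pre[OF nt A i])
  show ?thesis
  proof (rule equifunctorI[OF B A N.P i])
    show "homotopic_sfctrs (localisation B) (localisation B) (localisation_fctr B (comp_fctr i F)) (localisation_fctr B id_fctr)"
      using homotopic_sfctrs_trans[OF simplicial_category_localisation[OF B] simplicial_category_localisation[OF B]
          X.homotopic_localisation ip] .
    show "homotopic_sfctrs (localisation A) (localisation A) (localisation_fctr A (comp_fctr F i)) (localisation_fctr A id_fctr)"
      using Y.homotopic_localisation unfolding pi .
  qed
qed

text \<open>The two transformations point into \<open>P\<close> from either side; after localisation
  the second leg can be reversed.\<close>

lemma homotopic_localisation_span:
  assumes a: "coloured_nat_trans B B id_fctr P a" and b: "coloured_nat_trans B B Q P b"
  shows "homotopic_sfctrs (localisation B) (localisation B) (localisation_fctr B Q) (localisation_fctr B id_fctr)"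
proof -
  interpret a: coloured_nat_trans B B id_fctr P a by fact
  interpret b: coloured_nat_trans B B Q P b by fact
  note L = simplicial_category_localisation[OF a.C]
  show ?thesis
    by (rule homotopic_sfctrs_trans[OF L L b.homotopic_localisation
          homotopic_sfctrs_sym[OF L L a.homotopic_localisation]])
qed

lemma prod_fctr_id: "prod_fctr id_fctr id_fctr = id_fctr"
  by (simp add: prod_fctr_def id_fctr_def map_prod_def fun_eq_iff)

lemma coloured_functor_const:
  assumes "coloured_category D" "q \<in> obs D" shows "coloured_functor C D (const_fctr D q)"
proof (rule coloured_functorI)
  note d = coloured_categoryD[OF assms(1)]
  note i = category_idt[OF d assms(2)]
  show "is_functor C D (const_fctr D q)"
    by (rule is_functorI) (simp_all add: const_fctr_def assms(2) i category_idt_left[OF d i])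
qed (simp add: const_fctr_def col_idt[OF assms])

text \<open>Contractibility is kept in the form of explicit transformations, since these can be
  multiplied with the identity of \<open>A\<close> and so contract a whole product onto the slice at
  \<open>q\<close>.\<close>

locale unit_contraction =
  fixes U :: "('u, 'v) ccat" and q :: 'u and P :: "('u, 'v, 'u, 'v) fctr" and a b :: "'u \<Rightarrow> 'v"
  assumes q: "q \<in> obs U" and a: "coloured_nat_trans U U id_fctr P a"
    and b: "coloured_nat_trans U U (const_fctr U q) P b"
begin

lemma U: "coloured_category U"
  using a by (simp add: coloured_nat_trans_def)

text \<open>The functor to the terminal category plays the parts of both \<open>F\<close> and
  \<open>pr\<close> in \<open>equifunctor_if_projection\<close>, with the identity transformation
  between them.\<close>

lemma contractible: "contractible_ccat U"
  unfolding contractible_ccat_def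
proof (rule equifunctor_if_projection[where i = "const_fctr U q" and pr = to_terminal])
  have T: "coloured_category terminal_ccat"
    unfolding coloured_category_def category_def wide_subcat_def homs_def terminal_ccat_def by simp
  show "coloured_category terminal_ccat" by (rule T)
  have "coloured_functor U terminal_ccat to_terminal"
    unfolding coloured_functor_def is_functor_def homs_def to_terminal_def terminal_ccat_def by simp
  then show "coloured_nat_trans U terminal_ccat to_terminal to_terminal
      (\<lambda>x. idt terminal_ccat (onob (to_terminal :: ('u, 'v, unit, unit) fctr) x))"
    by (rule coloured_nat_trans_refl[OF U T])
  show "coloured_functor terminal_ccat U (const_fctr U q)"
    by (rule coloured_functor_const[OF U q])
  show "comp_fctr to_terminal (const_fctr U q) = id_fctr"
    by (simp add: comp_fctr_def to_terminal_def const_fctr_def id_fctr_def fun_eq_iff)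
  have "comp_fctr (const_fctr U q) to_terminal = (const_fctr U q :: ('u, 'v, 'u, 'v) fctr)"
    by (simp add: comp_fctr_def to_terminal_def const_fctr_def fun_eq_iff)
  then show "homotopic_sfctrs (localisation U) (localisation U)
      (localisation_fctr U (comp_fctr (const_fctr U q) to_terminal)) (localisation_fctr U id_fctr)"
    using homotopic_localisation_span[OF a b] by simp
qed (rule U)

lemma equifunctor_left:
  fixes A :: "('o, 'm) ccat"
  assumes A: "coloured_category A"
    and nt: "coloured_nat_trans (prod_ccat U A) A F \<lparr>onob = snd, onar = snd\<rparr> \<eta>"
  shows "equifunctor (prod_ccat U A) A F"
proof (rule equifunctor_if_projection[OF coloured_category_prod[OF U A] A _ _ _ nt])
  let ?i = "\<lparr>onob = (\<lambda>x. (q, x)), onar = (\<lambda>f. (idt U q, f))\<rparr>"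
  note iq = category_idt[OF coloured_categoryD[OF U] q]
  show "coloured_functor A (prod_ccat U A) ?i"
  proof (rule coloured_functorI)
    show "is_functor A (prod_ccat U A) ?i"
      by (rule is_functorI) (simp_all add: prod_ccat_simps homs_prod_ccat q iq category_idt_left[OF coloured_categoryD[OF U] iq])
  qed (simp add: prod_ccat_simps col_idt[OF U q])
  show "comp_fctr \<lparr>onob = snd, onar = snd\<rparr> ?i = id_fctr"
    by (simp add: comp_fctr_def id_fctr_def fun_eq_iff)
  \<comment> \<open>The contraction of \<open>U\<close> times the identity transformation of
    \<open>A\<close> connects the functor that replaces the weak unit by \<open>q\<close> with the
    identity of the product.\<close>
  note r = coloured_nat_trans_refl[OF A A coloured_functor_id]
  have "comp_fctr ?i \<lparr>onob = snd, onar = snd\<rparr> =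
      (prod_fctr (const_fctr U q) id_fctr :: ('u \<times> 'o, 'v \<times> 'm, 'u \<times> 'o, 'v \<times> 'm) fctr)"
    by (simp add: comp_fctr_def prod_fctr_def const_fctr_def id_fctr_def fun_eq_iff)
  then show "homotopic_sfctrs (localisation (prod_ccat U A)) (localisation (prod_ccat U A))
      (localisation_fctr (prod_ccat U A) (comp_fctr ?i \<lparr>onob = snd, onar = snd\<rparr>)) (localisation_fctr (prod_ccat U A) id_fctr)"
    using homotopic_localisation_span[OF coloured_nat_trans_prod[OF a r, unfolded prod_fctr_id] coloured_nat_trans_prod[OF b r]]
    by simp
qed

lemma equifunctor_right:
  fixes A :: "('o, 'm) ccat"
  assumes A: "coloured_category A"
    and nt: "coloured_nat_trans (prod_ccat A U) A F \<lparr>onob = fst, onar = fst\<rparr> \<eta>"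
  shows "equifunctor (prod_ccat A U) A F"
proof (rule equifunctor_if_projection[OF coloured_category_prod[OF A U] A _ _ _ nt])
  let ?i = "\<lparr>onob = (\<lambda>x. (x, q)), onar = (\<lambda>f. (f, idt U q))\<rparr>"
  note iq = category_idt[OF coloured_categoryD[OF U] q]
  show "coloured_functor A (prod_ccat A U) ?i"
  proof (rule coloured_functorI)
    show "is_functor A (prod_ccat A U) ?i"
      by (rule is_functorI) (simp_all add: prod_ccat_simps homs_prod_ccat q iq category_idt_left[OF coloured_categoryD[OF U] iq])
  qed (simp add: prod_ccat_simps col_idt[OF U q])
  show "comp_fctr \<lparr>onob = fst, onar = fst\<rparr> ?i = id_fctr"
    by (simp add: comp_fctr_def id_fctr_def fun_eq_iff)
  note r = coloured_nat_trans_refl[OF A A coloured_functor_id]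
  have "comp_fctr ?i \<lparr>onob = fst, onar = fst\<rparr> =
      (prod_fctr id_fctr (const_fctr U q) :: ('o \<times> 'u, 'm \<times> 'v, 'o \<times> 'u, 'm \<times> 'v) fctr)"
    by (simp add: comp_fctr_def prod_fctr_def const_fctr_def id_fctr_def fun_eq_iff)
  then show "homotopic_sfctrs (localisation (prod_ccat A U)) (localisation (prod_ccat A U))
      (localisation_fctr (prod_ccat A U) (comp_fctr ?i \<lparr>onob = fst, onar = fst\<rparr>)) (localisation_fctr (prod_ccat A U) id_fctr)"
    using homotopic_localisation_span[OF coloured_nat_trans_prod[OF r a, unfolded prod_fctr_id] coloured_nat_trans_prod[OF r b]]
    by simp
qed

end

section \<open>Cofibrant objects and weak units\<close>

context monoidal_model_cat
begin

abbreviation A where "A \<equiv> cofibrant_ccat M"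
abbreviation U where "U \<equiv> weak_units M"

lemma cofibrant_ccat_simps:
  "obs A = {x \<in> obs M. cofibrant M x}" "arrs A = {f \<in> arrs M. cofibrant M (src M f) \<and> cofibrant M (tgt M f)}"
  "src A = src M" "tgt A = tgt M" "idt A = idt M" "g \<cdot>\<^bsub>A\<^esub> f = g \<cdot>\<^bsub>M\<^esub> f"
  "col A = {f \<in> weq M. cofibrant M (src M f) \<and> cofibrant M (tgt M f)}"
  by (simp_all add: cofibrant_ccat_def)

lemma homs_cofibrant_ccat: "f \<in> homs A x y \<longleftrightarrow> f \<in> homs M x y \<and> cofibrant M x \<and> cofibrant M y"
  by (auto simp: homs_def cofibrant_ccat_simps)

lemma coloured_category_cofibrant: "coloured_category A"
proof (rule coloured_categoryI)
  show "category A"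
    by (rule categoryI)
      (auto simp: homs_cofibrant_ccat cofibrant_ccat_simps cofib_obs category_idt[OF cat] category_idt_left[OF cat]
        category_idt_right[OF cat] intro: category_cmp[OF cat] category_assoc[OF cat])
  show "col A \<subseteq> arrs A"
    using weq_arrs[OF model] by (auto simp: cofibrant_ccat_simps)
  show "idt A x \<in> col A" if "x \<in> obs A" for x
    using that weq_idt[OF model] homsD[OF category_idt[OF cat]] by (auto simp: cofibrant_ccat_simps)
  fix x y z f g assume "f \<in> col A" "g \<in> col A" "f \<in> homs A x y" "g \<in> homs A y z"
  then show "g \<cdot>\<^bsub>A\<^esub> f \<in> col A"
    using two_of_three(1)[OF model, of f x y g z] homsD[OF category_cmp[OF cat, of f x y g z]]
    by (auto simp: cofibrant_ccat_simps homs_cofibrant_ccat)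
qed

lemma coloured_functor_tensor: "coloured_functor (prod_ccat A A) A (ten M)"
proof (rule coloured_functorI)
  show "is_functor (prod_ccat A A) A (ten M)"
  proof (rule is_functorI)
    fix x assume "x \<in> obs (prod_ccat A A)"
    then obtain y z where x: "x = (y, z)" "cofibrant M y" "cofibrant M z" "y \<in> obs M" "z \<in> obs M"
      by (auto simp: prod_ccat_simps cofibrant_ccat_simps)
    show "onob (ten M) x \<in> obs A"
      using x tensor_cofibrant tob_obs by (simp add: cofibrant_ccat_simps)
    show "onar (ten M) (idt (prod_ccat A A) x) = idt A (onob (ten M) x)"
      using x tar_idt by (simp add: cofibrant_ccat_simps prod_ccat_simps)
  next
    fix x y f assume "f \<in> homs (prod_ccat A A) x y"
    then show "onar (ten M) f \<in> homs A (onob (ten M) x) (onob (ten M) y)"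
      by (cases x; cases y; cases f) (auto simp: homs_prod_ccat homs_cofibrant_ccat tar_homs tensor_cofibrant)
  next
    fix x y z f g assume "f \<in> homs (prod_ccat A A) x y" "g \<in> homs (prod_ccat A A) y z"
    then show "onar (ten M) (g \<cdot>\<^bsub>prod_ccat A A\<^esub> f) = onar (ten M) g \<cdot>\<^bsub>A\<^esub> onar (ten M) f"
      by (cases x; cases y; cases z; cases f; cases g)
        (auto simp: homs_prod_ccat homs_cofibrant_ccat prod_ccat_simps cofibrant_ccat_simps intro: tar_cmp)
  qed
  fix f assume "f \<in> col (prod_ccat A A)"
  then obtain g h where f: "f = (g, h)" "g \<in> weq M" "cofibrant M (src M g)" "cofibrant M (tgt M g)"
      "h \<in> weq M" "cofibrant M (src M h)" "cofibrant M (tgt M h)"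
    by (auto simp: prod_ccat_simps cofibrant_ccat_simps)
  show "onar (ten M) f \<in> col A"
    using tensor_weq[OF f(2-7)] homsD[OF tar_homs[OF weq_hom[OF f(2)] weq_hom[OF f(5)]]]
      tensor_cofibrant[OF f(3,6)] tensor_cofibrant[OF f(4,7)] f(1)
    by (simp add: cofibrant_ccat_simps)
qed

lemma semimonoid_cofibrant: "semimonoid_ccat A (ten M)"
  unfolding semimonoid_ccat_def strictly_associative_def
  using coloured_category_cofibrant coloured_functor_tensor tob_assoc tar_assoc by (simp add: cofibrant_ccat_simps)

section \<open>Weak units and their multiplication\<close>

definition weak_unit :: "'m \<Rightarrow> bool" where
  "weak_unit p \<longleftrightarrow> p \<in> weq M \<and> cofibrant M (src M p) \<and> tgt M p = unt M"

lemma weak_unitD: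
  assumes "weak_unit p"
  shows "p \<in> weq M" "cofibrant M (src M p)" "tgt M p = unt M" "p \<in> homs M (src M p) (unt M)" "src M p \<in> obs M"
  using assms weq_hom[of p] cofib_obs by (auto simp: weak_unit_def)

lemma weak_units_simps:
  "obs U = {p. weak_unit p}" "idt U p = (p, idt M (src M p), p)"
  "src U (p', w, p) = p'" "tgt U (p', w, p) = p"
  "(p1, v, p) \<cdot>\<^bsub>U\<^esub> (p'', w, p2) = (p'', v \<cdot>\<^bsub>M\<^esub> w, p)" "col U = arrs U"
  "(p', w, p) \<in> arrs U \<longleftrightarrow> weak_unit p' \<and> weak_unit p \<and> w \<in> weq M \<and> w \<in> homs M (src M p') (src M p) \<and> p \<cdot>\<^bsub>M\<^esub> w = p'"
  by (auto simp: weak_units_def Let_def weak_unit_def)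

lemma homs_weak_units:
  "f \<in> homs U p' p \<longleftrightarrow> (\<exists>w. f = (p', w, p) \<and> weak_unit p' \<and> weak_unit p \<and> w \<in> weq M \<and>
     w \<in> homs M (src M p') (src M p) \<and> p \<cdot>\<^bsub>M\<^esub> w = p')"
  by (cases f) (auto simp: homs_def weak_units_simps)

text \<open>Arrows over \<open>I\<close> between weak units are weak equivalences by two out of
  three, so in constructing arrows of \<open>U\<close> only the triangle has to be checked.\<close>

lemma weak_unit_arrI:
  assumes "weak_unit p'" "weak_unit p" "w \<in> homs M (src M p') (src M p)" "p \<cdot>\<^bsub>M\<^esub> w = p'"
  shows "(p', w, p) \<in> homs U p' p"
  using assms two_of_three(3)[OF model assms(3) weak_unitD(4)[OF assms(2)]] weak_unitD(1)
  by (auto simp: homs_weak_units)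

lemma coloured_category_weak_units: "coloured_category U"
proof (rule coloured_categoryI)
  show "category U"
  proof (rule categoryI)
    fix f assume "f \<in> arrs U"
    then show "src U f \<in> obs U \<and> tgt U f \<in> obs U"
      by (cases f) (simp add: weak_units_simps)
  next
    fix p assume "p \<in> obs U"
    then have p: "weak_unit p" by (simp add: weak_units_simps)
    show "idt U p \<in> homs U p p"
      unfolding weak_units_simps
      by (rule weak_unit_arrI[OF p p category_idt[OF cat weak_unitD(5)[OF p]] category_idt_right[OF cat weak_unitD(4)[OF p]]])
  next
    fix p1 p2 p3 f g assume "f \<in> homs U p1 p2" "g \<in> homs U p2 p3"
    then obtain w v where w: "f = (p1, w, p2)" "weak_unit p1" "w \<in> homs M (src M p1) (src M p2)" "p2 \<cdot>\<^bsub>M\<^esub> w = p1"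
      and v: "g = (p2, v, p3)" "weak_unit p3" "v \<in> homs M (src M p2) (src M p3)" "p3 \<cdot>\<^bsub>M\<^esub> v = p2"
      by (auto simp: homs_weak_units)
    show "g \<cdot>\<^bsub>U\<^esub> f \<in> homs U p1 p3"
      unfolding w(1) v(1) weak_units_simps
      using category_assoc[OF cat w(3) v(3) weak_unitD(4)[OF v(2)]] w(4) v(4)
      by (intro weak_unit_arrI w(2) v(2) category_cmp[OF cat w(3) v(3)]) simp
  qed (auto simp: homs_weak_units weak_units_simps category_idt_left[OF cat] category_idt_right[OF cat]
      intro: category_assoc[OF cat])
  then show "idt U x \<in> col U" if "x \<in> obs U" for x
    using category_idt[OF _ that] unfolding weak_units_simps(6) by (blast dest: homsD)
  show "g \<cdot>\<^bsub>U\<^esub> f \<in> col U" if "f \<in> homs U x y" "g \<in> homs U y z" for x y z f g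
    using category_cmp[OF \<open>category U\<close> that] unfolding weak_units_simps(6) by (blast dest: homsD)
qed (simp add: weak_units_simps)


text \<open>The delicate point is the weak equivalence: the unit need not be cofibrant, so
  \<open>p \<otimes> q\<close> is not covered by \<open>tensor_weq\<close>. The unit axiom is used
  in its place.\<close>

lemma weak_unit_tensor:
  assumes p: "weak_unit p" and q: "weak_unit q"
  shows "weak_unit (weak_unit_tensor M p q)" "src M (weak_unit_tensor M p q) = tob M (src M p) (src M q)"
    "weak_unit_tensor M p q \<in> homs M (tob M (src M p) (src M q)) (unt M)"
proof -
  note ph = weak_unitD(4)[OF p] and qh = weak_unitD(4)[OF q]
  note l = lun_homs[OF unt_obs]
  note i = category_idt[OF cat unt_obs] and iq = category_idt[OF cat weak_unitD(5)[OF q]]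
  have h: "weak_unit_tensor M p q \<in> homs M (tob M (src M p) (src M q)) (unt M)"
    unfolding weak_unit_tensor_def by (rule category_cmp[OF cat tar_homs[OF ph qh] l])
  note lq = lun_homs[OF weak_unitD(5)[OF q]]
  have 1: "lun M (src M q) \<cdot>\<^bsub>M\<^esub> tar M p (idt M (src M q)) \<in> homs M (tob M (src M p) (src M q)) (src M q)"
    by (rule category_cmp[OF cat tar_homs[OF ph iq] lq])
  \<comment> \<open>By naturality of \<open>lun\<close>, the product of \<open>p\<close> and
    \<open>q\<close> factors through the source of \<open>q\<close>: first the arrow of the unit
    axiom, then \<open>q\<close>. Both are weak equivalences.\<close>
  have "q \<cdot>\<^bsub>M\<^esub> (lun M (src M q) \<cdot>\<^bsub>M\<^esub> tar M p (idt M (src M q))) =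
      lun M (unt M) \<cdot>\<^bsub>M\<^esub> (tar M (idt M (unt M)) q \<cdot>\<^bsub>M\<^esub> tar M p (idt M (src M q)))"
    using category_assoc[OF cat tar_homs[OF ph iq] lq qh] category_assoc[OF cat tar_homs[OF ph iq] tar_homs[OF i qh] l]
      lun_natural[OF qh] by simp
  also have "\<dots> = weak_unit_tensor M p q"
    unfolding weak_unit_tensor_def tar_split(1)[OF ph qh] by (rule refl)
  finally have "weak_unit_tensor M p q \<in> weq M"
    using two_of_three(1)[OF model 1 qh _ weak_unitD(1)[OF q]]
      unit_axiom[OF weak_unitD(1-3)[OF p] weak_unitD(2)[OF q]] by simp
  then show "weak_unit (weak_unit_tensor M p q)"
    unfolding weak_unit_def using homsD[OF h] tensor_cofibrant[OF weak_unitD(2)[OF p] weak_unitD(2)[OF q]] by simp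
  show "src M (weak_unit_tensor M p q) = tob M (src M p) (src M q)" using homsD[OF h] by simp
  show "weak_unit_tensor M p q \<in> homs M (tob M (src M p) (src M q)) (unt M)" by (rule h)
qed

text \<open>Both sides end in \<open>lun I\<close> and begin with
  \<open>p \<otimes> q \<otimes> r\<close>. The arrows in between are
  \<open>lun I \<otimes> 1\<close> and \<open>1 \<otimes> lun I\<close>, which agree by
  \<open>lun_unt\<close>.\<close>

lemma weak_unit_tensor_assoc:
  assumes p: "weak_unit p" and q: "weak_unit q" and r: "weak_unit r"
  shows "weak_unit_tensor M (weak_unit_tensor M p q) r = weak_unit_tensor M p (weak_unit_tensor M q r)"
proof -
  note ph = weak_unitD(4)[OF p] and qh = weak_unitD(4)[OF q] and rh = weak_unitD(4)[OF r]
  note l = lun_homs[OF unt_obs] and i = category_idt[OF cat unt_obs]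
  have "tar M (lun M (unt M) \<cdot>\<^bsub>M\<^esub> tar M p q) r = tar M (lun M (unt M)) (idt M (unt M)) \<cdot>\<^bsub>M\<^esub> tar M (tar M p q) r"
    using tar_cmp[OF tar_homs[OF ph qh] l rh i] category_idt_left[OF cat rh] by simp
  moreover have "tar M p (lun M (unt M) \<cdot>\<^bsub>M\<^esub> tar M q r) = tar M (idt M (unt M)) (lun M (unt M)) \<cdot>\<^bsub>M\<^esub> tar M p (tar M q r)"
    using tar_cmp[OF ph i tar_homs[OF qh rh] l] category_idt_left[OF cat ph] by simp
  ultimately show ?thesis
    using lun_unt tar_assoc[of p q r] homsD[OF ph] homsD[OF qh] homsD[OF rh]
    by (simp add: weak_unit_tensor_def)
qed

lemma weak_units_mult_simps:
  "onob (weak_units_mult M) (p, q) = weak_unit_tensor M p q"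
  "onar (weak_units_mult M) ((p', w, p), (q', v, q)) = (weak_unit_tensor M p' q', tar M w v, weak_unit_tensor M p q)"
  by (simp_all add: weak_units_mult_def)

lemma weak_units_mult_homs:
  assumes "f \<in> homs U p' p" "g \<in> homs U q' q"
  shows "onar (weak_units_mult M) (f, g) \<in> homs U (weak_unit_tensor M p' q') (weak_unit_tensor M p q)"
proof -
  obtain w v where w: "f = (p', w, p)" "weak_unit p'" "weak_unit p" "w \<in> homs M (src M p') (src M p)" "p \<cdot>\<^bsub>M\<^esub> w = p'"
    and v: "g = (q', v, q)" "weak_unit q'" "weak_unit q" "v \<in> homs M (src M q') (src M q)" "q \<cdot>\<^bsub>M\<^esub> v = q'"
    using assms by (auto simp: homs_weak_units)
  note ph = weak_unitD(4)[OF w(3)] and qh = weak_unitD(4)[OF v(3)]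
  show ?thesis
    unfolding w(1) v(1) weak_units_mult_simps
  proof (rule weak_unit_arrI)
    show "weak_unit_tensor M p q \<cdot>\<^bsub>M\<^esub> tar M w v = weak_unit_tensor M p' q'"
      using category_assoc[OF cat tar_homs[OF w(4) v(4)] tar_homs[OF ph qh] lun_homs[OF unt_obs]]
        tar_cmp[OF w(4) ph v(4) qh] w(5) v(5)
      by (simp add: weak_unit_tensor_def)
  qed (simp_all add: weak_unit_tensor w v tar_homs)
qed

lemma semimonoid_weak_units: "semimonoid_ccat U (weak_units_mult M)"
  unfolding semimonoid_ccat_def
proof (intro conjI coloured_category_weak_units coloured_functorI is_functorI)
  fix x assume "x \<in> obs (prod_ccat U U)"
  then obtain p q where x: "x = (p, q)" "weak_unit p" "weak_unit q"
    by (auto simp: prod_ccat_simps weak_units_simps)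
  show "onob (weak_units_mult M) x \<in> obs U"
    unfolding x(1) weak_units_mult_simps using weak_unit_tensor(1)[OF x(2,3)] by (simp add: weak_units_simps)
  show "onar (weak_units_mult M) (idt (prod_ccat U U) x) = idt U (onob (weak_units_mult M) x)"
    unfolding x(1) prod_ccat_simps weak_units_simps weak_units_mult_simps weak_unit_tensor(2)[OF x(2,3)]
      tar_idt[OF weak_unitD(5)[OF x(2)] weak_unitD(5)[OF x(3)]] by (rule refl)
next
  fix x y f assume "f \<in> homs (prod_ccat U U) x y"
  then show "onar (weak_units_mult M) f \<in> homs U (onob (weak_units_mult M) x) (onob (weak_units_mult M) y)"
    using weak_units_mult_homs
    by (cases x; cases y; cases f) (simp only: homs_prod_ccat mem_Times_iff fst_conv snd_conv weak_units_mult_simps(1))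
next
  fix x y z f g assume "f \<in> homs (prod_ccat U U) x y" "g \<in> homs (prod_ccat U U) y z"
  then show "onar (weak_units_mult M) (g \<cdot>\<^bsub>prod_ccat U U\<^esub> f) = onar (weak_units_mult M) g \<cdot>\<^bsub>U\<^esub> onar (weak_units_mult M) f"
    by (cases x; cases y; cases z; cases f; cases g)
      (auto simp: homs_prod_ccat prod_ccat_simps homs_weak_units weak_units_simps weak_units_mult_simps intro: tar_cmp)
next
  fix f assume "f \<in> col (prod_ccat U U)"
  then obtain g h where f: "f = (g, h)" "g \<in> homs U (src U g) (tgt U g)" "h \<in> homs U (src U h) (tgt U h)"
    by (auto simp: prod_ccat_simps weak_units_simps(6) homs_def)
  show "onar (weak_units_mult M) f \<in> col U"
    unfolding f(1) weak_units_simps(6) using homsD[OF weak_units_mult_homs[OF f(2,3)]] by blast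
next
  show "strictly_associative U (weak_units_mult M)"
    unfolding strictly_associative_def
  proof (intro conjI ballI)
    fix p q r assume "p \<in> obs U" "q \<in> obs U" "r \<in> obs U"
    then show "onob (weak_units_mult M) (onob (weak_units_mult M) (p, q), r) =
        onob (weak_units_mult M) (p, onob (weak_units_mult M) (q, r))"
      using weak_unit_tensor_assoc by (simp add: weak_units_simps weak_units_mult_simps)
  next
    fix f g h assume fgh: "f \<in> arrs U" "g \<in> arrs U" "h \<in> arrs U"
    obtain p' w p q' v q r' u r where e: "f = (p', w, p)" "g = (q', v, q)" "h = (r', u, r)"
      by (cases f; cases g; cases h) blast
    show "onar (weak_units_mult M) (onar (weak_units_mult M) (f, g), h) =
        onar (weak_units_mult M) (f, onar (weak_units_mult M) (g, h))"
      using fgh unfolding e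
      by (simp add: weak_units_simps weak_units_mult_simps weak_unit_tensor_assoc tar_assoc weq_arrs[OF model])
  qed
qed

lemma weak_units_forget_simps:
  "onob (weak_units_forget M) p = src M p" "onar (weak_units_forget M) (p', w, p) = w"
  by (simp_all add: weak_units_forget_def)

lemma coloured_functor_forget: "coloured_functor U A (weak_units_forget M)"
proof (rule coloured_functorI)
  show "is_functor U A (weak_units_forget M)"
    by (rule is_functorI)
      (auto simp: weak_units_simps weak_units_forget_simps cofibrant_ccat_simps homs_weak_units homs_cofibrant_ccat weak_unitD(2,5))
  fix f assume "f \<in> col U"
  then show "onar (weak_units_forget M) f \<in> col A"
    using weak_unitD(2) by (cases f) (auto simp: weak_units_simps weak_units_forget_simps cofibrant_ccat_simps homs_def)
qed

lemma semimonoid_hom_forget: "semimonoid_hom U (weak_units_mult M) A (ten M) (weak_units_forget M)"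
  unfolding semimonoid_hom_def
proof (intro conjI ballI coloured_functor_forget)
  show "onob (weak_units_forget M) (onob (weak_units_mult M) (p, q)) =
      onob (ten M) (onob (weak_units_forget M) p, onob (weak_units_forget M) q)" if "p \<in> obs U" "q \<in> obs U" for p q
    using that by (simp add: weak_units_simps weak_units_mult_simps weak_units_forget_simps weak_unit_tensor)
  show "onar (weak_units_forget M) (onar (weak_units_mult M) (f, g)) =
      onar (ten M) (onar (weak_units_forget M) f, onar (weak_units_forget M) g)" for f g
    by (cases f; cases g) (simp add: weak_units_mult_simps weak_units_forget_simps)
qed

text \<open>The functor \<open>P\<close> replaces a weak unit by the trivial fibration of its functorial
  factorisation; \<open>q\<close> is the cofibrant replacement of the unit.\<close>

lemma weak_units_contraction: "\<exists>q P a b. unit_contraction U q P a b"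
proof (rule factorisation[OF model])
  fix \<alpha> \<beta> \<theta>
  assume F: "\<And>f. f \<in> arrs M \<Longrightarrow> \<alpha> f \<in> cof M \<and> \<beta> f \<in> fib M \<and> \<beta> f \<in> weq M \<and>
       \<alpha> f \<in> homs M (src M f) (src M (\<beta> f)) \<and> \<beta> f \<in> homs M (src M (\<beta> f)) (tgt M f) \<and> \<beta> f \<cdot>\<^bsub>M\<^esub> \<alpha> f = f"
    and T: "\<And>f g u v. is_square M f g u v \<Longrightarrow> \<theta> f g u v \<in> homs M (src M (\<beta> f)) (src M (\<beta> g)) \<and>
       \<alpha> g \<cdot>\<^bsub>M\<^esub> u = \<theta> f g u v \<cdot>\<^bsub>M\<^esub> \<alpha> f \<and> \<beta> g \<cdot>\<^bsub>M\<^esub> \<theta> f g u v = v \<cdot>\<^bsub>M\<^esub> \<beta> f"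
    and Ti: "\<And>f. f \<in> arrs M \<Longrightarrow> \<theta> f f (idt M (src M f)) (idt M (tgt M f)) = idt M (src M (\<beta> f))"
    and Tc: "\<And>f g h u v u' v'. \<lbrakk>is_square M f g u v; is_square M g h u' v'\<rbrakk> \<Longrightarrow>
       \<theta> f h (u' \<cdot>\<^bsub>M\<^esub> u) (v' \<cdot>\<^bsub>M\<^esub> v) = \<theta> g h u' v' \<cdot>\<^bsub>M\<^esub> \<theta> f g u v"
  obtain z where z: "is_initial M z"
    using initial_ex[OF cat model_colimits[OF model]] by blast
  obtain e where e: "e \<in> homs M z (unt M)"
    using initial_arrow[OF z unt_obs] by blast
  let ?I = "unt M"
  note i = category_idt[OF cat unt_obs]
  have i2: "idt M ?I \<cdot>\<^bsub>M\<^esub> idt M ?I = idt M ?I" by (rule category_idt_left[OF cat i])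
  \<comment> \<open>An arrow over \<open>I\<close> is a square with the identity of \<open>I\<close>
    on its target side, the form to which the functoriality \<open>\<theta>\<close> applies.\<close>
  have sq: "is_square M f g u (idt M ?I)" if "f \<in> homs M x ?I" "g \<in> homs M y ?I" "u \<in> homs M x y" "g \<cdot>\<^bsub>M\<^esub> u = f" for f g u x y
    unfolding is_square_def using that i category_idt_left[OF cat that(1)] by (auto simp: homs_def)
  have over: "\<alpha> f \<in> cof M" "\<alpha> f \<in> homs M x (src M (\<beta> f))" "\<beta> f \<in> homs M (src M (\<beta> f)) ?I" "\<beta> f \<cdot>\<^bsub>M\<^esub> \<alpha> f = f" "\<beta> f \<in> weq M"
    if "f \<in> homs M x ?I" for f x
    using F[of f] homsD[OF that] by auto
  have wb: "weak_unit (\<beta> f)" if "f \<in> homs M x ?I" "cofibrant M x" for f x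
    unfolding weak_unit_def using over[OF that(1)] cofibrant_cof[OF model that(2) over(2)[OF that(1)] over(1)[OF that(1)]]
    by (auto simp: homs_def)
  have tu: "(\<beta> f, \<theta> f g u (idt M ?I), \<beta> g) \<in> homs U (\<beta> f) (\<beta> g)"
    if "f \<in> homs M x ?I" "g \<in> homs M y ?I" "cofibrant M x" "cofibrant M y" "u \<in> homs M x y" "g \<cdot>\<^bsub>M\<^esub> u = f" for f g u x y
    using T[OF sq[OF that(1,2,5,6)]] category_idt_left[OF cat over(3)[OF that(1)]]
    by (intro weak_unit_arrI wb[OF that(1,3)] wb[OF that(2,4)]) auto
  have cz: "cofibrant M z"
  proof -
    have zo: "z \<in> obs M" using z by (simp add: is_initial_def)
    moreover have "idt M z \<in> cof M"
      using model_wide(2)[OF model] zo by (simp add: wide_subcat_def)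
    ultimately show ?thesis
      unfolding cofibrant_def using z category_idt[OF cat zo] by blast
  qed
  \<comment> \<open>\<open>e\<close> goes from the initial object to \<open>I\<close>, so its first
    factor is a cofibration out of an initial object and the source of \<open>\<beta> e\<close> is
    cofibrant.\<close>
  define q where "q = \<beta> e"
  define P where "P = \<lparr>onob = \<beta>, onar = (\<lambda>(p', w, p). (\<beta> p', \<theta> p' p w (idt M ?I), \<beta> p))\<rparr>"
  define a where "a p = (p, \<alpha> p, \<beta> p)" for p
  \<comment> \<open>The unique arrow from the initial object to the source of \<open>p\<close>
    exhibits \<open>e\<close> as an object over \<open>I\<close> mapping to \<open>p\<close>;
    functoriality of the factorisation turns it into the component \<open>b p\<close> from
    \<open>q\<close> to \<open>P p\<close>.\<close>
  define u where "u p = (THE f. f \<in> homs M z (src M p))" for p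
  define b where "b p = (q, \<theta> e p (u p) (idt M ?I), \<beta> p)" for p
  have u: "u p \<in> homs M z (src M p)" if "weak_unit p" for p
    unfolding u_def by (rule theI') (rule z[unfolded is_initial_def, THEN conjunct2, rule_format, OF weak_unitD(5)[OF that]])
  have pu: "p \<cdot>\<^bsub>M\<^esub> u p = e" if "weak_unit p" for p
    by (rule initial_unique[OF cat z category_cmp[OF cat u[OF that] weak_unitD(4)[OF that]] e])
  have P: "coloured_functor U U P"
  proof (rule coloured_functorI)
    show "is_functor U U P"
    proof (rule is_functorI)
      fix p assume "p \<in> obs U"
      then have p: "weak_unit p" by (simp add: weak_units_simps)
      show "onob P p \<in> obs U"
        using wb[OF weak_unitD(4,2)[OF p]] by (simp add: P_def weak_units_simps)
      show "onar P (idt U p) = idt U (onob P p)"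
        using Ti[OF weq_arrs[OF model weak_unitD(1)[OF p]]] weak_unitD(3)[OF p] by (simp add: P_def weak_units_simps)
    next
      fix x y f assume "f \<in> homs U x y"
      then show "onar P f \<in> homs U (onob P x) (onob P y)"
        using tu[OF weak_unitD(4) weak_unitD(4) weak_unitD(2) weak_unitD(2)] by (auto simp: homs_weak_units[of f] P_def)
    next
      fix p1 p2 p3 f g assume "f \<in> homs U p1 p2" "g \<in> homs U p2 p3"
      then obtain w v where w: "f = (p1, w, p2)" "weak_unit p1" "w \<in> homs M (src M p1) (src M p2)" "p2 \<cdot>\<^bsub>M\<^esub> w = p1"
        and v: "g = (p2, v, p3)" "weak_unit p3" "v \<in> homs M (src M p2) (src M p3)" "p3 \<cdot>\<^bsub>M\<^esub> v = p2" and p2: "weak_unit p2"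
        by (auto simp: homs_weak_units)
      have "\<theta> p1 p3 (v \<cdot>\<^bsub>M\<^esub> w) (idt M ?I) = \<theta> p2 p3 v (idt M ?I) \<cdot>\<^bsub>M\<^esub> \<theta> p1 p2 w (idt M ?I)"
        using Tc[OF sq[OF weak_unitD(4)[OF w(2)] weak_unitD(4)[OF p2] w(3,4)] sq[OF weak_unitD(4)[OF p2] weak_unitD(4)[OF v(2)] v(3,4)]]
        by (simp add: i2)
      then show "onar P (g \<cdot>\<^bsub>U\<^esub> f) = onar P g \<cdot>\<^bsub>U\<^esub> onar P f"
        unfolding w(1) v(1) by (simp add: P_def weak_units_simps)
    qed
    then show "onar P f \<in> col U" if "f \<in> col U" for f
      using functor_homs[of U U P f "src U f" "tgt U f"] that unfolding weak_units_simps(6) by (blast intro: homsI dest: homsD)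
  qed
  have "coloured_nat_trans U U id_fctr P a"
  proof
    show "nat_trans U U id_fctr P a"
    proof (rule nat_transI)
      show "a p \<in> homs U (onob id_fctr p) (onob P p)" if "p \<in> obs U" for p
      proof -
        have p: "weak_unit p" using that by (simp add: weak_units_simps)
        note o = over[OF weak_unitD(4)[OF p]]
        show ?thesis
          unfolding a_def P_def id_fctr_def fctr.select_convs
          by (rule weak_unit_arrI[OF p wb[OF weak_unitD(4,2)[OF p]] o(2,4)])
      qed
      fix x y f assume "f \<in> homs U x y"
      then obtain w where w: "f = (x, w, y)" "weak_unit x" "weak_unit y" "w \<in> homs M (src M x) (src M y)" "y \<cdot>\<^bsub>M\<^esub> w = x"
        by (auto simp: homs_weak_units)
      show "a y \<cdot>\<^bsub>U\<^esub> onar id_fctr f = onar P f \<cdot>\<^bsub>U\<^esub> a x"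
        using T[OF sq[OF weak_unitD(4)[OF w(2)] weak_unitD(4)[OF w(3)] w(4,5)]]
        by (simp add: w(1) a_def P_def id_fctr_def weak_units_simps)
    qed
    then show "a x \<in> col U" if "x \<in> obs U" for x
      using that unfolding nat_trans_def weak_units_simps(6) by (blast dest: homsD)
  qed (auto intro: coloured_category_weak_units coloured_functor_id P)
  moreover have q: "q \<in> obs U"
    using wb[OF e cz] by (simp add: q_def weak_units_simps)
  moreover have "coloured_nat_trans U U (const_fctr U q) P b"
  proof
    show "nat_trans U U (const_fctr U q) P b"
    proof (rule nat_transI)
      show "b p \<in> homs U (onob (const_fctr U q) p) (onob P p)" if "p \<in> obs U" for p
      proof -
        have p: "weak_unit p" using that by (simp add: weak_units_simps)
        show ?thesis
          using tu[OF e weak_unitD(4)[OF p] cz weak_unitD(2)[OF p] u[OF p] pu[OF p]]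
          by (simp add: b_def P_def const_fctr_def q_def)
      qed
      fix x y f assume "f \<in> homs U x y"
      then obtain w where w: "f = (x, w, y)" "weak_unit x" "weak_unit y" "w \<in> homs M (src M x) (src M y)" "y \<cdot>\<^bsub>M\<^esub> w = x"
        by (auto simp: homs_weak_units)
      \<comment> \<open>By initiality the arrows \<open>u\<close> are compatible with
        \<open>w\<close> on the nose, so functoriality of \<open>\<theta>\<close> gives naturality
        of \<open>b\<close>.\<close>
      have wu: "w \<cdot>\<^bsub>M\<^esub> u x = u y"
        by (rule initial_unique[OF cat z category_cmp[OF cat u[OF w(2)] w(4)] u[OF w(3)]])
      note sx = sq[OF e weak_unitD(4)[OF w(2)] u[OF w(2)] pu[OF w(2)]]
      note sy = sq[OF e weak_unitD(4)[OF w(3)] u[OF w(3)] pu[OF w(3)]]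
      have "\<theta> e y (u y) (idt M ?I) = \<theta> x y w (idt M ?I) \<cdot>\<^bsub>M\<^esub> \<theta> e x (u x) (idt M ?I)"
        using Tc[OF sx sq[OF weak_unitD(4)[OF w(2)] weak_unitD(4)[OF w(3)] w(4,5)]] by (simp add: i2 wu)
      moreover have "\<theta> e y (u y) (idt M ?I) \<cdot>\<^bsub>M\<^esub> idt M (src M q) = \<theta> e y (u y) (idt M ?I)"
        using category_idt_right[OF cat conjunct1[OF T[OF sy]]] by (simp add: q_def)
      ultimately show "b y \<cdot>\<^bsub>U\<^esub> onar (const_fctr U q) f = onar P f \<cdot>\<^bsub>U\<^esub> b x"
        by (simp add: w(1) b_def P_def const_fctr_def weak_units_simps)
    qed
    then show "b x \<in> col U" if "x \<in> obs U" for x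
      using that unfolding nat_trans_def weak_units_simps(6) by (blast dest: homsD)
  qed (auto intro: coloured_category_weak_units coloured_functor_const[OF coloured_category_weak_units q] P)
  ultimately show ?thesis
    unfolding unit_contraction_def by blast
qed

text \<open>The components are the composites of the unit axiom, which makes them coloured.
  Naturality holds in both variables: the triangle over \<open>I\<close> absorbs \<open>w\<close>,
  and naturality of \<open>lun\<close> moves \<open>g\<close> across.\<close>

lemma left_unit_nat_trans:
  "coloured_nat_trans (prod_ccat U A) A (comp_fctr (ten M) (prod_fctr (weak_units_forget M) id_fctr))
     \<lparr>onob = snd, onar = snd\<rparr> (\<lambda>(p, x). lun M x \<cdot>\<^bsub>M\<^esub> tar M p (idt M x))" (is "coloured_nat_trans ?B A ?F ?pr ?\<eta>")
proof
  show "coloured_category ?B" "coloured_category A"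
    by (intro coloured_category_prod coloured_category_weak_units coloured_category_cofibrant)+
  show "coloured_functor ?B A ?F"
    by (intro coloured_functor_comp[OF coloured_functor_prod coloured_functor_tensor] coloured_functor_forget coloured_functor_id)
  show "coloured_functor ?B A ?pr"
    unfolding coloured_functor_def is_functor_def by (auto simp: prod_ccat_simps homs_prod_ccat)
  have \<eta>: "?\<eta> x \<in> homs A (onob ?F x) (onob ?pr x) \<and> ?\<eta> x \<in> col A" if x: "x \<in> obs ?B" for x
  proof -
    obtain p y where p: "x = (p, y)" "weak_unit p" "cofibrant M y" "y \<in> obs M"
      using x by (auto simp: prod_ccat_simps weak_units_simps cofibrant_ccat_simps)
    have "lun M y \<cdot>\<^bsub>M\<^esub> tar M p (idt M y) \<in> homs M (tob M (src M p) y) y"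
      by (rule category_cmp[OF cat tar_homs[OF weak_unitD(4)[OF p(2)] category_idt[OF cat p(4)]] lun_homs[OF p(4)]])
    then show ?thesis
      using p(1,3) tensor_cofibrant[OF weak_unitD(2)[OF p(2)] p(3)] unit_axiom[OF weak_unitD(1-3)[OF p(2)] p(3)]
      by (auto simp: homs_cofibrant_ccat cofibrant_ccat_simps comp_fctr_def prod_fctr_simps weak_units_forget_simps
          id_fctr_def dest: homsD)
  qed
  then show "?\<eta> x \<in> col A" if "x \<in> obs ?B" for x using that by blast
  show "nat_trans ?B A ?F ?pr ?\<eta>"
  proof (rule nat_transI)
    show "?\<eta> x \<in> homs A (onob ?F x) (onob ?pr x)" if "x \<in> obs ?B" for x using \<eta>[OF that] by blast
    fix x y f assume f: "f \<in> homs ?B x y"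
    obtain p' x' p y' where e: "x = (p', x')" "y = (p, y')" by (cases x; cases y)
    obtain w g where w: "f = ((p', w, p), g)" "weak_unit p'" "weak_unit p" "w \<in> homs M (src M p') (src M p)" "p \<cdot>\<^bsub>M\<^esub> w = p'"
      and g: "g \<in> homs M x' y'"
      using f unfolding e by (cases f) (auto simp: homs_prod_ccat homs_weak_units homs_cofibrant_ccat)
    note o = category_obs[OF cat g]
    note ph = weak_unitD(4)[OF w(3)] and ph' = weak_unitD(4)[OF w(2)]
    note ix = category_idt[OF cat o(1)] and iy = category_idt[OF cat o(2)] and i = category_idt[OF cat unt_obs]
    have "(lun M y' \<cdot>\<^bsub>M\<^esub> tar M p (idt M y')) \<cdot>\<^bsub>M\<^esub> tar M w g = lun M y' \<cdot>\<^bsub>M\<^esub> tar M p' g"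
      using category_assoc[OF cat tar_homs[OF w(4) g] tar_homs[OF ph iy] lun_homs[OF o(2)]]
        tar_cmp[OF w(4) ph g iy] category_idt_left[OF cat g] w(5) by simp
    also have "\<dots> = (lun M y' \<cdot>\<^bsub>M\<^esub> tar M (idt M (unt M)) g) \<cdot>\<^bsub>M\<^esub> tar M p' (idt M x')"
      unfolding tar_split(1)[OF ph' g] by (rule category_assoc[OF cat tar_homs[OF ph' ix] tar_homs[OF i g] lun_homs[OF o(2)]])
    also have "\<dots> = g \<cdot>\<^bsub>M\<^esub> (lun M x' \<cdot>\<^bsub>M\<^esub> tar M p' (idt M x'))"
      unfolding lun_natural[OF g] by (rule category_assoc[OF cat tar_homs[OF ph' ix] lun_homs[OF o(1)] g, symmetric])
    finally show "?\<eta> y \<cdot>\<^bsub>A\<^esub> onar ?F f = onar ?pr f \<cdot>\<^bsub>A\<^esub> ?\<eta> x"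
      by (simp add: e w(1) cofibrant_ccat_simps comp_fctr_def prod_fctr_simps weak_units_forget_simps id_fctr_def)
  qed
qed

text \<open>The mirror image. Here \<open>p\<close> acts first and \<open>g\<close> second, so the
  other splitting of a tensor product of arrows is used, together with naturality of
  \<open>run\<close>.\<close>

lemma right_unit_nat_trans:
  "coloured_nat_trans (prod_ccat A U) A (comp_fctr (ten M) (prod_fctr id_fctr (weak_units_forget M)))
     \<lparr>onob = fst, onar = fst\<rparr> (\<lambda>(x, p). run M x \<cdot>\<^bsub>M\<^esub> tar M (idt M x) p)" (is "coloured_nat_trans ?B A ?F ?pr ?\<eta>")
proof
  show "coloured_category ?B" "coloured_category A"
    by (intro coloured_category_prod coloured_category_weak_units coloured_category_cofibrant)+
  show "coloured_functor ?B A ?F"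
    by (intro coloured_functor_comp[OF coloured_functor_prod coloured_functor_tensor] coloured_functor_forget coloured_functor_id)
  show "coloured_functor ?B A ?pr"
    unfolding coloured_functor_def is_functor_def by (auto simp: prod_ccat_simps homs_prod_ccat)
  have \<eta>: "?\<eta> x \<in> homs A (onob ?F x) (onob ?pr x) \<and> ?\<eta> x \<in> col A" if x: "x \<in> obs ?B" for x
  proof -
    obtain p y where p: "x = (y, p)" "weak_unit p" "cofibrant M y" "y \<in> obs M"
      using x by (auto simp: prod_ccat_simps weak_units_simps cofibrant_ccat_simps)
    have "run M y \<cdot>\<^bsub>M\<^esub> tar M (idt M y) p \<in> homs M (tob M y (src M p)) y"
      by (rule category_cmp[OF cat tar_homs[OF category_idt[OF cat p(4)] weak_unitD(4)[OF p(2)]] run_homs[OF p(4)]])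
    then show ?thesis
      using p(1,3) tensor_cofibrant[OF p(3) weak_unitD(2)[OF p(2)]] unit_axiom[OF weak_unitD(1-3)[OF p(2)] p(3)]
      by (auto simp: homs_cofibrant_ccat cofibrant_ccat_simps comp_fctr_def prod_fctr_simps weak_units_forget_simps
          id_fctr_def dest: homsD)
  qed
  then show "?\<eta> x \<in> col A" if "x \<in> obs ?B" for x using that by blast
  show "nat_trans ?B A ?F ?pr ?\<eta>"
  proof (rule nat_transI)
    show "?\<eta> x \<in> homs A (onob ?F x) (onob ?pr x)" if "x \<in> obs ?B" for x using \<eta>[OF that] by blast
    fix x y f assume f: "f \<in> homs ?B x y"
    obtain p' x' p y' where e: "x = (x', p')" "y = (y', p)" by (cases x; cases y)
    obtain w g where w: "f = (g, (p', w, p))" "weak_unit p'" "weak_unit p" "w \<in> homs M (src M p') (src M p)" "p \<cdot>\<^bsub>M\<^esub> w = p'"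
      and g: "g \<in> homs M x' y'"
      using f unfolding e by (cases f) (auto simp: homs_prod_ccat homs_weak_units homs_cofibrant_ccat)
    note o = category_obs[OF cat g]
    note ph = weak_unitD(4)[OF w(3)] and ph' = weak_unitD(4)[OF w(2)]
    note ix = category_idt[OF cat o(1)] and iy = category_idt[OF cat o(2)] and i = category_idt[OF cat unt_obs]
    have "(run M y' \<cdot>\<^bsub>M\<^esub> tar M (idt M y') p) \<cdot>\<^bsub>M\<^esub> tar M g w = run M y' \<cdot>\<^bsub>M\<^esub> tar M g p'"
      using category_assoc[OF cat tar_homs[OF g w(4)] tar_homs[OF iy ph] run_homs[OF o(2)]]
        tar_cmp[OF g iy w(4) ph] category_idt_left[OF cat g] w(5) by simp
    also have "\<dots> = (run M y' \<cdot>\<^bsub>M\<^esub> tar M g (idt M (unt M))) \<cdot>\<^bsub>M\<^esub> tar M (idt M x') p'"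
      unfolding tar_split(2)[OF g ph'] by (rule category_assoc[OF cat tar_homs[OF ix ph'] tar_homs[OF g i] run_homs[OF o(2)]])
    also have "\<dots> = g \<cdot>\<^bsub>M\<^esub> (run M x' \<cdot>\<^bsub>M\<^esub> tar M (idt M x') p')"
      unfolding run_natural[OF g] by (rule category_assoc[OF cat tar_homs[OF ix ph'] run_homs[OF o(1)] g, symmetric])
    finally show "?\<eta> y \<cdot>\<^bsub>A\<^esub> onar ?F f = onar ?pr f \<cdot>\<^bsub>A\<^esub> ?\<eta> x"
      by (simp add: e w(1) cofibrant_ccat_simps comp_fctr_def prod_fctr_simps weak_units_forget_simps id_fctr_def)
  qed
qed

lemma fair_monoid_cofibrant: "fair_monoid A (ten M) U (weak_units_mult M) (weak_units_forget M)"
proof -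
  obtain q P a b where "unit_contraction U q P a b"
    using weak_units_contraction by blast
  then interpret unit_contraction U q P a b .
  show ?thesis
    unfolding fair_monoid_def
    by (intro conjI semimonoid_cofibrant semimonoid_weak_units semimonoid_hom_forget contractible
        equifunctor_left[OF coloured_category_cofibrant left_unit_nat_trans]
        equifunctor_right[OF coloured_category_cofibrant right_unit_nat_trans])
qed

end

theorem lemma8p8:
  fixes M :: "('o, 'm) mmcat"
  assumes "infinite (UNIV :: 's set)"
    and "monoidal_model_category TYPE('s) M"
  shows "fair_monoid (cofibrant_ccat M) (ten M)
           (weak_units M) (weak_units_mult M) (weak_units_forget M)"
  by (rule monoidal_model_cat.fair_monoid_cofibrant[OF monoidal_model_cat.intro[OF assms]])

end
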